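(* Let $b\in L^1_\alpha(\mathbb B_n,\mathcal L(\ell^2))$. The associated Toeplitz operator $T_b$ is compact on $A^2_\alpha(\mathbb B_n,\ell^2)$ if the following four conditions are satisfied. (i) $b\in BMO^1_\alpha(\mathbb B_n,\mathcal L(\ell^2))$ and $\widetilde b\in L^\infty(\mathbb B_n,\mathcal L(\ell^2))$. (ii) $\lim_{d\to\infty}\big\|\widetilde{\|b_{(d)}(\cdot)\|_{\mathcal L(\ell^2)}}\big\|_{L^\infty(\mathbb B_n,\mathbb C)}=0$. (iii) $\lim_{d\to\infty}\big\|\widetilde{\|(b^\star)_{(d)}(\cdot)\|_{\mathcal L(\ell^2)}}\big\|_{L^\infty(\mathbb B_n,\mathbb C)}=0$, where $b^\star(w)=(b(w))^\star$. (iv) For every positive integer $d$, $$\sup_{e\in\mathbb C^d,\ \|e\|_{\mathbb C^d}=1}\ \lim_{z\to\partial\mathbb B_n}\|T_{b^{[d]}}(k^\alpha_z e)\|_{A^2_\alpha(\mathbb B_n,\mathbb C^d)}=0.$$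
   Context: Fix an integer $n\ge 1$ and a real $\alpha>-1$. $\mathbb B_n$ is the open unit ball of $\mathbb C^n$, $\langle z,w\rangle=\sum_k z_k\overline{w_k}$, and $d\nu_\alpha(z)=c_\alpha(1-|z|^2)^\alpha d\nu(z)$, where $\nu$ is Lebesgue measure and $c_\alpha$ is the constant making $\nu_\alpha$ a probability measure on $\mathbb B_n$. For a complex Banach space $E$ and $1\le p<\infty$, $L^p_\alpha(\mathbb B_n,E)$ is the Bochner–Lebesgue space of measurable $f:\mathbb B_n\to E$ with $\|f\|^p=\int_{\mathbb B_n}\|f(z)\|_E^p\,d\nu_\alpha(z)<\infty$; $L^\infty(\mathbb B_n,E)$ is the space of essentially bounded measurable functions; $A^p_\alpha(\mathbb B_n,E)$ is the subspace of holomorphic functions in $L^p_\alpha(\mathbb B_n,E)$; $H^\infty(\mathbb B_n,E)$ is the space of bounded holomorphic functions, which is dense in $A^2_\alpha(\mathbb B_n,E)$. $\mathcal L(E,F)$ denotes bounded linear operators and $\mathcal L(E)=\mathcal L(E,E)$. Kernels: $K^\alpha_z(w)=(1-\langle w,z\rangle)^{-(n+1+\alpha)}$, $k^\alpha_z(w)=(1-|z|^2)^{(n+1+\alpha)/2}(1-\langle w,z\rangle)^{-(n+1+\alpha)}$. For $a\in\mathbb B_n\setminus\{0\}$, $\varphi_a(z)=\dfrac{a-P_a(z)-\sqrt{1-|a|^2}\,Q_a(z)}{1-\langle z,a\rangle}$ with $P_a(z)=\frac{\langle z,a\rangle}{|a|^2}a$, $Q_a=I-P_a$; $\varphi_0(z)=-z$.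 For $b\in L^1_\alpha(\mathbb B_n,E)$ the Berezin transform is $\widetilde b(z)=\int_{\mathbb B_n}|k^\alpha_z(w)|^2b(w)\,d\nu_\alpha(w)$ (applied to a scalar function such as $w\mapsto\|b(w)\|$ with $E=\mathbb C$), and $b\in BMO^1_\alpha(\mathbb B_n,E)$ if $\|b\|_{BMO^1_\alpha(\mathbb B_n,E)}:=\sup_{z\in\mathbb B_n}\|b\circ\varphi_z-\widetilde b(z)\|_{L^1_\alpha(\mathbb B_n,E)}<\infty$. For $b\in L^1_\alpha(\mathbb B_n,\mathcal L(E,F))$ the Toeplitz operator $T_b$ is densely defined on $A^2_\alpha(\mathbb B_n,E)$ by $T_bf(z)=\int_{\mathbb B_n}b(w)(f(w))\overline{K^\alpha_z(w)}\,d\nu_\alpha(w)$, $f\in H^\infty(\mathbb B_n,E)$. It is known that if $b\in BMO^1_\alpha(\mathbb B_n,\mathcal L(E,F))$ and $\widetilde b\in L^\infty(\mathbb B_n,\mathcal L(E,F))$, then $T_b$ extends to a bounded operator $A^2_\alpha(\mathbb B_n,E)\to A^2_\alpha(\mathbb B_n,F)$, still denoted $T_b$. Fix an orthonormal basis $\{e_j\}_{j\ge1}$ of $\ell^2$. For $b:\mathbb B_n\to\mathcal L(\ell^2)$ and a positive integer $d$, $b_{(d)}:\mathbb B_n\to\mathcal L(\ell^2)$ is defined by $b_{(d)}(w)(e_i)=0$ if $1\le i\le d$ and $b_{(d)}(w)(e_i)=b(w)(e_i)$ if $i\ge d+1$. $(b(w))^\star$ is the Hilbert space adjoint of $b(w)$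 in $\mathcal L(\ell^2)$. The compression $b^{[d]}:\mathbb B_n\to\mathcal L(\mathbb C^d)$ is defined by $\langle b^{[d]}(w)e_k,e_j\rangle_{\mathbb C^d}=\langle b(w)e_k,e_j\rangle_{\ell^2}$ for $1\le k,j\le d$, where the standard basis vectors of $\mathbb C^d$ are identified with $e_1,\dots,e_d$; $T_{b^{[d]}}$ is the corresponding Toeplitz operator on $A^2_\alpha(\mathbb B_n,\mathbb C^d)$. For a vector $e$, $k^\alpha_z e$ denotes $w\mapsto k^\alpha_z(w)e$. *)

theory Defs
  imports "HOL-Analysis.Analysis" "HOL-Probability.Essential_Supremum"
begin

section \<open>Complex normed spaces and complex-linear operators\<close>

class complex_normed_space = real_normed_vector +
  fixes scaleC :: "complex \<Rightarrow> 'a \<Rightarrow> 'a" (infixr "*\<^sub>C" 75)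
  assumes scaleC_add_right: "a *\<^sub>C (x + y) = a *\<^sub>C x + a *\<^sub>C y"
    and scaleC_add_left: "(a + b) *\<^sub>C x = a *\<^sub>C x + b *\<^sub>C x"
    and scaleC_scaleC: "a *\<^sub>C (b *\<^sub>C x) = (a * b) *\<^sub>C x"
    and scaleC_of_real: "complex_of_real r *\<^sub>C x = r *\<^sub>R x"
    and norm_scaleC: "norm (a *\<^sub>C x) = cmod a * norm x"

text \<open>The operator norm of a complex-linear map does not depend on whether it is
  computed over the reals or over the complex numbers, so the bounded complex-linear operators
  form a closed subspace of the library's Banach space of bounded real-linear maps.\<close>

definition bounded_clinear_ops :: "('a::complex_normed_space \<Rightarrow>\<^sub>L 'b::complex_normed_space) set"
  where "bounded_clinear_ops =
    {A. \<forall>c x. blinfun_apply A (c *\<^sub>C x) = c *\<^sub>C blinfun_apply A x}"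


section \<open>The space of square-summable sequences\<close>

typedef ell2 = "{x :: nat \<Rightarrow> complex. summable (\<lambda>i. (cmod (x i))\<^sup>2)}"
  morphisms coord Abs_ell2
  by (rule exI[of _ "\<lambda>_. 0"]) simp

setup_lifting type_definition_ell2

lemma sq_summable_add:
  assumes "summable (\<lambda>i. (cmod (x i))\<^sup>2)" "summable (\<lambda>i. (cmod (y i))\<^sup>2)"
  shows "summable (\<lambda>i. (cmod (x i + y i))\<^sup>2)"
proof (rule summable_comparison_test')
  show "summable (\<lambda>i. 2 * (cmod (x i))\<^sup>2 + 2 * (cmod (y i))\<^sup>2)"
    using assms by (intro summable_add summable_mult)
  fix i :: nat
  have "(cmod (x i + y i))\<^sup>2 \<le> (cmod (x i) + cmod (y i))\<^sup>2"
    by (intro power_mono norm_triangle_ineq) auto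
  also have "\<dots> \<le> 2 * (cmod (x i))\<^sup>2 + 2 * (cmod (y i))\<^sup>2"
    using sum_squares_bound[of "cmod (x i)" "cmod (y i)"] by (simp add: power2_sum)
  finally show "norm ((cmod (x i + y i))\<^sup>2) \<le> 2 * (cmod (x i))\<^sup>2 + 2 * (cmod (y i))\<^sup>2"
    by simp
qed

lemma sq_summable_mult:
  assumes "summable (\<lambda>i. (cmod (x i))\<^sup>2)"
  shows "summable (\<lambda>i. (cmod (c * x i))\<^sup>2)"
  using summable_mult[OF assms, of "(cmod c)\<^sup>2"] by (simp add: norm_mult power_mult_distrib)

lemma sq_summable_prod:
  assumes "summable (\<lambda>i. (cmod (x i))\<^sup>2)" "summable (\<lambda>i. (cmod (y i))\<^sup>2)"
  shows "summable (\<lambda>i. x i * cnj (y i))"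
proof (rule summable_comparison_test')
  show "summable (\<lambda>i. (cmod (x i))\<^sup>2 + (cmod (y i))\<^sup>2)"
    using assms by (rule summable_add)
  fix i :: nat
  have "0 \<le> cmod (x i) * cmod (y i)" by simp
  moreover have "2 * (cmod (x i) * cmod (y i)) \<le> (cmod (x i))\<^sup>2 + (cmod (y i))\<^sup>2"
    using sum_squares_bound[of "cmod (x i)" "cmod (y i)"] by (simp add: mult.assoc)
  ultimately have "cmod (x i) * cmod (y i) \<le> (cmod (x i))\<^sup>2 + (cmod (y i))\<^sup>2"
    by linarith
  then show "norm (x i * cnj (y i)) \<le> (cmod (x i))\<^sup>2 + (cmod (y i))\<^sup>2"
    by (simp add: norm_mult)
qed

lemma coord_sq_summable: "summable (\<lambda>i. (cmod (coord x i))\<^sup>2)"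
  using coord[of x] by simp

definition cinner :: "ell2 \<Rightarrow> ell2 \<Rightarrow> complex"
  where "cinner x y = (\<Sum>i. coord x i * cnj (coord y i))"

lemma cinner_summable: "summable (\<lambda>i. coord x i * cnj (coord y i))"
  by (intro sq_summable_prod coord_sq_summable)

instantiation ell2 :: real_inner
begin

lift_definition zero_ell2 :: ell2 is "\<lambda>_. 0" by simp
lift_definition plus_ell2 :: "ell2 \<Rightarrow> ell2 \<Rightarrow> ell2" is "\<lambda>x y i. x i + y i"
  by (rule sq_summable_add)
lift_definition uminus_ell2 :: "ell2 \<Rightarrow> ell2" is "\<lambda>x i. - x i" by simp
definition minus_ell2 :: "ell2 \<Rightarrow> ell2 \<Rightarrow> ell2" where "minus_ell2 x y = x + - y"
lift_definition scaleR_ell2 :: "real \<Rightarrow> ell2 \<Rightarrow> ell2" is "\<lambda>r x i. complex_of_real r * x i"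
  by (rule sq_summable_mult)
definition inner_ell2 :: "ell2 \<Rightarrow> ell2 \<Rightarrow> real" where "inner_ell2 x y = Re (cinner x y)"
definition norm_ell2 :: "ell2 \<Rightarrow> real" where "norm_ell2 x = sqrt (inner x x)"
definition sgn_ell2 :: "ell2 \<Rightarrow> ell2" where "sgn_ell2 x = scaleR (inverse (norm x)) x"
definition dist_ell2 :: "ell2 \<Rightarrow> ell2 \<Rightarrow> real" where "dist_ell2 x y = norm (x - y)"
definition uniformity_ell2 :: "(ell2 \<times> ell2) filter"
  where "uniformity_ell2 = (INF e\<in>{0<..}. principal {(x, y). dist x y < e})"
definition open_ell2 :: "ell2 set \<Rightarrow> bool"
  where "open_ell2 U \<longleftrightarrow> (\<forall>x\<in>U. eventually (\<lambda>(x', y). x' = x \<longrightarrow> y \<in> U) uniformity)"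

lemma cinner_self: "cinner x x = complex_of_real (\<Sum>i. (cmod (coord x i))\<^sup>2)"
proof -
  have "cinner x x = (\<Sum>i. complex_of_real ((cmod (coord x i))\<^sup>2))"
    unfolding cinner_def complex_norm_square ..
  then show ?thesis by (simp add: suminf_of_real coord_sq_summable)
qed

instance
proof
  fix x y z :: ell2 and r s :: real
  show "x + y + z = x + (y + z)" by transfer (simp add: add.assoc)
  show "x + y = y + x" by transfer (simp add: add.commute)
  show "0 + x = x" by transfer simp
  show "- x + x = 0" by transfer simp
  show "x - y = x + - y" by (simp add: minus_ell2_def)
  show "r *\<^sub>R (x + y) = r *\<^sub>R x + r *\<^sub>R y" by transfer (simp add: algebra_simps)
  show "(r + s) *\<^sub>R x = r *\<^sub>R x + s *\<^sub>R x" by transfer (simp add: algebra_simps)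
  show "r *\<^sub>R s *\<^sub>R x = (r * s) *\<^sub>R x" by transfer (simp add: algebra_simps)
  show "1 *\<^sub>R x = x" by transfer simp
  show "sgn x = scaleR (inverse (norm x)) x" by (simp add: sgn_ell2_def)
  show "dist x y = norm (x - y)" by (simp add: dist_ell2_def)
  show "(uniformity :: (ell2 \<times> ell2) filter) = (INF e\<in>{0<..}. principal {(x, y). dist x y < e})"
    by (simp add: uniformity_ell2_def)
  show "open U \<longleftrightarrow> (\<forall>x\<in>U. eventually (\<lambda>(x', y). x' = x \<longrightarrow> y \<in> U) uniformity)"
    for U :: "ell2 set" by (simp add: open_ell2_def)
  show "norm x = sqrt (inner x x)" by (simp add: norm_ell2_def)
  have "cinner y x = cnj (cinner x y)"
    using sums_cnj[THEN iffD2, OF summable_sums[OF cinner_summable[of x y]]]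
    unfolding cinner_def by (simp add: sums_iff mult.commute)
  then show "inner x y = inner y x" by (simp add: inner_ell2_def)
  have "cinner (x + y) z = cinner x z + cinner y z"
    unfolding cinner_def
    by (simp add: suminf_add[OF cinner_summable cinner_summable] plus_ell2.rep_eq algebra_simps)
  then show "inner (x + y) z = inner x z + inner y z" by (simp add: inner_ell2_def)
  have "cinner (r *\<^sub>R x) y = complex_of_real r * cinner x y"
    unfolding cinner_def
    by (simp add: suminf_mult[OF cinner_summable, symmetric] scaleR_ell2.rep_eq algebra_simps)
  then show "inner (r *\<^sub>R x) y = r * inner x y" by (simp add: inner_ell2_def)
  show "0 \<le> inner x x"
    by (simp add: inner_ell2_def cinner_self suminf_nonneg[OF coord_sq_summable])
  have "inner x x = 0 \<longleftrightarrow> (\<forall>i. coord x i = 0)"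
    by (simp add: inner_ell2_def cinner_self suminf_eq_zero_iff[OF coord_sq_summable])
  also have "\<dots> \<longleftrightarrow> x = 0" by transfer auto
  finally show "inner x x = 0 \<longleftrightarrow> x = 0" .
qed

end

lemma norm_ell2_eq: "norm (x :: ell2) = sqrt (\<Sum>i. (cmod (coord x i))\<^sup>2)"
  by (simp add: norm_ell2_def inner_ell2_def cinner_self)

instantiation ell2 :: complex_normed_space
begin

lift_definition scaleC_ell2 :: "complex \<Rightarrow> ell2 \<Rightarrow> ell2" is "\<lambda>c x i. c * x i"
  by (rule sq_summable_mult)

instance
proof
  fix x y :: ell2 and a b :: complex and r :: real
  show "a *\<^sub>C (x + y) = a *\<^sub>C x + a *\<^sub>C y" by transfer (simp add: algebra_simps)
  show "(a + b) *\<^sub>C x = a *\<^sub>C x + b *\<^sub>C x" by transfer (simp add: algebra_simps)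
  show "a *\<^sub>C b *\<^sub>C x = (a * b) *\<^sub>C x" by transfer (simp add: algebra_simps)
  show "complex_of_real r *\<^sub>C x = r *\<^sub>R x" by transfer simp
  show "norm (a *\<^sub>C x) = cmod a * norm x"
    by (simp add: norm_ell2_eq scaleC_ell2.rep_eq norm_mult power_mult_distrib
        suminf_mult[OF coord_sq_summable] real_sqrt_mult)
qed

end

lemma partial_norm_ell2: "(\<Sum>i<N. (cmod (coord x i))\<^sup>2) \<le> (norm x)\<^sup>2"
  by (simp add: norm_ell2_eq suminf_nonneg[OF coord_sq_summable]
      sum_le_suminf[OF coord_sq_summable])

lemma ell2_boundedI:
  assumes "\<And>N. (\<Sum>i<N. (cmod (f i))\<^sup>2) \<le> C\<^sup>2" "C \<ge> 0"
  shows "coord (Abs_ell2 f) = f" "norm (Abs_ell2 f) \<le> C"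
proof -
  have s: "summable (\<lambda>i. (cmod (f i))\<^sup>2)"
    using assms(1) by (intro summableI_nonneg_bounded) auto
  then show 1: "coord (Abs_ell2 f) = f" by (intro Abs_ell2_inverse) simp
  show "norm (Abs_ell2 f) \<le> C"
    unfolding norm_ell2_eq 1
    by (intro real_le_lsqrt suminf_le_const[OF s] assms)
qed

lemma coord_diff: "coord (x - y) i = coord x i - coord y i"
  unfolding minus_ell2_def plus_ell2.rep_eq uminus_ell2.rep_eq by simp

lemma norm_coord_le: "cmod (coord x i) \<le> norm x"
proof -
  have "(cmod (coord x i))\<^sup>2 \<le> (\<Sum>j<Suc i. (cmod (coord x j))\<^sup>2)"
    by (simp add: sum_nonneg)
  also have "\<dots> \<le> (norm x)\<^sup>2" by (rule partial_norm_ell2)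
  finally show ?thesis by (rule power2_le_imp_le) simp
qed

instance ell2 :: banach
proof
  fix X :: "nat \<Rightarrow> ell2" assume X: "Cauchy X"
  have "Cauchy (\<lambda>n. coord (X n) i)" for i
  proof (rule metric_CauchyI)
    fix e :: real assume "e > 0"
    then obtain M where M: "\<And>m n. m \<ge> M \<Longrightarrow> n \<ge> M \<Longrightarrow> dist (X m) (X n) < e"
      using metric_CauchyD[OF X] by blast
    show "\<exists>M. \<forall>m\<ge>M. \<forall>n\<ge>M. dist (coord (X m) i) (coord (X n) i) < e"
    proof (intro exI[of _ M] allI impI)
      fix m n assume "m \<ge> M" "n \<ge> M"
      then show "dist (coord (X m) i) (coord (X n) i) < e"
        using M[of m n] norm_coord_le[of "X m - X n" i] by (simp add: dist_norm coord_diff)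
    qed
  qed
  then have "\<forall>i. \<exists>l. (\<lambda>n. coord (X n) i) \<longlonglongrightarrow> l"
    by (simp add: Cauchy_convergent convergentD)
  then obtain L where L: "\<And>i. (\<lambda>n. coord (X n) i) \<longlonglongrightarrow> L i" by metis
  have est: "\<exists>M. \<forall>m\<ge>M. \<exists>y. coord y = (\<lambda>i. coord (X m) i - L i) \<and> norm y \<le> e"
    if "e > 0" for e :: real
  proof -
    obtain M where M: "\<And>m n. m \<ge> M \<Longrightarrow> n \<ge> M \<Longrightarrow> dist (X m) (X n) < e"
      using metric_CauchyD[OF X \<open>e > 0\<close>] by blast
    have "(\<Sum>i<N. (cmod (coord (X m) i - L i))\<^sup>2) \<le> e\<^sup>2" if "m \<ge> M" for m N
    proof (rule LIMSEQ_le_const2)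
      show "(\<lambda>n. \<Sum>i<N. (cmod (coord (X m) i - coord (X n) i))\<^sup>2)
          \<longlonglongrightarrow> (\<Sum>i<N. (cmod (coord (X m) i - L i))\<^sup>2)"
        by (intro tendsto_intros L)
      have "(\<Sum>i<N. (cmod (coord (X m) i - coord (X n) i))\<^sup>2) \<le> e\<^sup>2" if "n \<ge> M" for n
      proof -
        have "(\<Sum>i<N. (cmod (coord (X m) i - coord (X n) i))\<^sup>2) \<le> (norm (X m - X n))\<^sup>2"
          using partial_norm_ell2[of "X m - X n" N] by (simp add: coord_diff)
        also have "\<dots> \<le> e\<^sup>2"
          using M[OF \<open>m \<ge> M\<close> \<open>n \<ge> M\<close>] by (intro power_mono) (auto simp: dist_norm)
        finally show ?thesis .
      qed
      then show "\<exists>K. \<forall>n\<ge>K. (\<Sum>i<N. (cmod (coord (X m) i - coord (X n) i))\<^sup>2) \<le> e\<^sup>2"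
        by blast
    qed
    then have "\<forall>m\<ge>M. coord (Abs_ell2 (\<lambda>i. coord (X m) i - L i)) = (\<lambda>i. coord (X m) i - L i)
        \<and> norm (Abs_ell2 (\<lambda>i. coord (X m) i - L i)) \<le> e"
      using ell2_boundedI[of "\<lambda>i. coord (X _) i - L i" e] \<open>e > 0\<close> by auto
    then show ?thesis by blast
  qed
  obtain M y where y: "coord y = (\<lambda>i. coord (X M) i - L i)"
    using est[of 1] by auto
  define l where "l = X M - y"
  have l: "coord l = L" unfolding l_def by (auto simp: coord_diff y)
  have "X \<longlonglongrightarrow> l"
  proof (rule LIMSEQ_I)
    fix e :: real assume "e > 0"
    then obtain K where K:
      "\<And>m. m \<ge> K \<Longrightarrow> \<exists>y. coord y = (\<lambda>i. coord (X m) i - L i) \<and> norm y \<le> e / 2"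
      using est[of "e / 2"] by auto
    have "norm (X m - l) < e" if "m \<ge> K" for m
    proof -
      obtain y where y: "coord y = (\<lambda>i. coord (X m) i - L i)" "norm y \<le> e / 2"
        using K[OF \<open>m \<ge> K\<close>] by blast
      have "X m - l = y"
        by (rule coord_inject[THEN iffD1]) (auto simp: coord_diff y l)
      then show ?thesis using y \<open>e > 0\<close> by simp
    qed
    then show "\<exists>K. \<forall>m\<ge>K. norm (X m - l) < e" by blast
  qed
  then show "convergent X" by (rule convergentI)
qed

definition unit_vec :: "nat \<Rightarrow> ell2"
  where "unit_vec j = Abs_ell2 (\<lambda>i. if i = j then 1 else 0)"

text \<open>\<open>\<complex>\<^sup>d\<close>, with \<open>d\<close> a variable, is realised as the sequences supported on the first \<open>d\<close>
  coordinates; the norm inherited from \<^typ>\<open>ell2\<close> is the Euclidean one and the standard basis is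
  \<^term>\<open>unit_vec 0\<close>, \dots, \<^term>\<open>unit_vec (d - 1)\<close>.\<close>

definition complex_space :: "nat \<Rightarrow> ell2 set"
  where "complex_space d = {x. \<forall>i\<ge>d. coord x i = 0}"

definition orthonormal_basis :: "(nat \<Rightarrow> ell2) \<Rightarrow> bool"
  where "orthonormal_basis e \<longleftrightarrow>
    (\<forall>i j. cinner (e i) (e j) = (if i = j then 1 else 0)) \<and>
    (\<forall>x. (\<lambda>i. cinner x (e i) *\<^sub>C e i) sums x)"

lemma cinner_add_left: "cinner (x + y) z = cinner x z + cinner y z"
  unfolding cinner_def
  by (simp add: suminf_add[OF cinner_summable cinner_summable] plus_ell2.rep_eq algebra_simps)

lemma cinner_scaleC_left: "cinner (c *\<^sub>C x) y = c * cinner x y"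
  unfolding cinner_def scaleC_ell2.rep_eq
  by (simp add: suminf_mult[OF cinner_summable] mult.assoc)

lemma cinner_commute: "cinner y x = cnj (cinner x y)"
  using sums_cnj[THEN iffD2, OF summable_sums[OF cinner_summable[of x y]]]
  unfolding cinner_def by (simp add: sums_iff mult.commute)

lemma cinner_norm_le: "cmod (cinner x y) \<le> norm x * norm y"
proof (cases "cinner x y = 0")
  case False
  define c where "c = cnj (cinner x y) / cmod (cinner x y)"
  have c: "cmod c = 1" using False by (simp add: c_def norm_divide)
  have "cinner (c *\<^sub>C x) y = complex_of_real (cmod (cinner x y))"
    using False by (simp add: cinner_scaleC_left c_def complex_norm_square[symmetric] power2_eq_square
        mult.commute)
  then have "cmod (cinner x y) = inner (c *\<^sub>C x) y" by (simp add: inner_ell2_def)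
  also have "\<dots> \<le> norm (c *\<^sub>C x) * norm y" by (rule norm_cauchy_schwarz)
  finally show ?thesis by (simp add: norm_scaleC c)
qed simp

lemma bounded_linear_cinner_left: "bounded_linear (\<lambda>x. cinner x y)"
proof (rule bounded_linear_intro)
  show "cinner (r *\<^sub>R x) y = r *\<^sub>R cinner x y" for r x
    using cinner_scaleC_left[of "complex_of_real r" x y]
    by (simp add: scaleC_of_real scaleR_conv_of_real)
  show "norm (cinner x y) \<le> norm x * norm y" for x by (rule cinner_norm_le)
qed (rule cinner_add_left)

lemma bounded_linear_scaleC_left: "bounded_linear (\<lambda>c. c *\<^sub>C (x :: 'a::complex_normed_space))"
proof (rule bounded_linear_intro)
  show "(r *\<^sub>R c) *\<^sub>C x = r *\<^sub>R c *\<^sub>C x" for r c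
    by (simp add: scaleC_of_real[symmetric] scaleC_scaleC scaleR_conv_of_real)
  show "norm (c *\<^sub>C x) \<le> norm c * norm x" for c by (simp add: norm_scaleC)
qed (rule scaleC_add_left)

lemma scaleC_sum_right:
  "c *\<^sub>C (\<Sum>i\<in>I. f i) = (\<Sum>i\<in>I. c *\<^sub>C (f i :: 'a::complex_normed_space))"
proof -
  have "c *\<^sub>C (0::'a) = 0" using scaleC_of_real[of 0 "0::'a"] norm_scaleC[of c "0::'a"] by simp
  then show ?thesis by (induction I rule: infinite_finite_induct) (simp_all add: scaleC_add_right)
qed

lemma scaleC_diff_right: "c *\<^sub>C (x - y) = c *\<^sub>C x - c *\<^sub>C (y :: 'a::complex_normed_space)"
  by (metis add_diff_cancel_right' diff_add_cancel scaleC_add_right)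

lemma coord_unit_vec: "coord (unit_vec j) = (\<lambda>i. if i = j then 1 else 0)"
proof -
  have "summable (\<lambda>i. (cmod (if i = j then 1 else 0))\<^sup>2)"
    by (rule summable_finite[of "{j}"]) auto
  then show ?thesis unfolding unit_vec_def by (subst Abs_ell2_inverse) auto
qed

lemma cinner_unit_vec: "cinner x (unit_vec j) = coord x j"
proof -
  have "cinner x (unit_vec j) = (\<Sum>i\<in>{j}. coord x i * cnj (coord (unit_vec j) i))"
    unfolding cinner_def by (rule suminf_finite) (auto simp: coord_unit_vec)
  then show ?thesis by (simp add: coord_unit_vec)
qed

lemma coord_sum: "coord (\<Sum>i\<in>I. f i) k = (\<Sum>i\<in>I. coord (f i) k)"
  by (induction I rule: infinite_finite_induct) (simp_all add: zero_ell2.rep_eq plus_ell2.rep_eq)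

lemma orthonormal_basis_unit_vec: "orthonormal_basis unit_vec"
  unfolding orthonormal_basis_def
proof (intro conjI allI)
  show "cinner (unit_vec i) (unit_vec j) = (if i = j then 1 else 0)" for i j
    by (simp add: cinner_unit_vec coord_unit_vec)
  fix x
  define S where "S n = (\<Sum>i<n. cinner x (unit_vec i) *\<^sub>C unit_vec i)" for n
  have S: "coord (S n) k = (if k < n then coord x k else 0)" for n k
    by (simp add: S_def coord_sum scaleC_ell2.rep_eq coord_unit_vec cinner_unit_vec
        if_distrib[of "\<lambda>u. _ * u"] cong: if_cong)
  have eq: "(norm (S n - x))\<^sup>2 = (\<Sum>k. (cmod (coord x (k + n)))\<^sup>2)" for n
  proof -
    have "(norm (S n - x))\<^sup>2 = (\<Sum>k. (cmod (coord (S n - x) k))\<^sup>2)"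
      by (simp add: norm_ell2_eq suminf_nonneg[OF coord_sq_summable])
    also have "\<dots> = (\<Sum>k. (cmod (coord (S n - x) (k + n)))\<^sup>2)
        + (\<Sum>k<n. (cmod (coord (S n - x) k))\<^sup>2)"
      by (rule suminf_split_initial_segment[OF coord_sq_summable])
    finally show ?thesis by (simp add: coord_diff S)
  qed
  have "(\<lambda>n. \<Sum>k. (cmod (coord x (k + n)))\<^sup>2) \<longlonglongrightarrow> 0"
    by (rule suminf_exist_split2[OF coord_sq_summable])
  then have "(\<lambda>n. sqrt ((norm (S n - x))\<^sup>2)) \<longlonglongrightarrow> sqrt 0"
    unfolding eq by (rule tendsto_real_sqrt)
  then have "(\<lambda>n. norm (S n - x)) \<longlonglongrightarrow> 0" by simp
  then have "S \<longlonglongrightarrow> x" by (simp add: LIM_zero_iff tendsto_norm_zero_iff)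
  then show "(\<lambda>i. cinner x (unit_vec i) *\<^sub>C unit_vec i) sums x"
    by (simp add: sums_def S_def[abs_def])
qed

lemma bounded_clinear_opsI:
  assumes "bounded_linear f" "\<And>c x. f (c *\<^sub>C x) = c *\<^sub>C f x"
  shows "Blinfun f \<in> bounded_clinear_ops" "blinfun_apply (Blinfun f) = f"
  using assms by (simp_all add: bounded_clinear_ops_def bounded_linear_Blinfun_apply)

lemma bounded_clinear_ops_eqI:
  assumes "orthonormal_basis e" "A \<in> bounded_clinear_ops" "B \<in> bounded_clinear_ops"
    and "\<And>i. blinfun_apply A (e i) = blinfun_apply B (e i)"
  shows "A = B"
proof (rule blinfun_eqI)
  fix x
  have s: "(\<lambda>i. cinner x (e i) *\<^sub>C e i) sums x"
    using assms(1) by (simp add: orthonormal_basis_def)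
  have "(\<lambda>i. cinner x (e i) *\<^sub>C blinfun_apply C (e i)) sums blinfun_apply C x"
    if "C \<in> bounded_clinear_ops" for C :: "ell2 \<Rightarrow>\<^sub>L 'a"
    using bounded_linear.sums[OF blinfun.bounded_linear_right s, of C] that
    by (simp add: bounded_clinear_ops_def)
  from this[OF assms(2)] this[OF assms(3)] show "blinfun_apply A x = blinfun_apply B x"
    unfolding assms(4) by (rule sums_unique2)
qed

text \<open>In the following three definitions the operator is described by its characterising
  equations, which have exactly one solution (see the lemmas that follow them).  Basis vectors are
  numbered from \<open>0\<close>.\<close>

definition hilbert_adjoint :: "(ell2 \<Rightarrow>\<^sub>L ell2) \<Rightarrow> (ell2 \<Rightarrow>\<^sub>L ell2)"
  where "hilbert_adjoint A = (THE B. B \<in> bounded_clinear_ops \<and>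
    (\<forall>x y. cinner (blinfun_apply A x) y = cinner x (blinfun_apply B y)))"

definition tail_op :: "(nat \<Rightarrow> ell2) \<Rightarrow> nat \<Rightarrow> (ell2 \<Rightarrow>\<^sub>L ell2) \<Rightarrow> (ell2 \<Rightarrow>\<^sub>L ell2)"
  where "tail_op e d A = (THE B. B \<in> bounded_clinear_ops \<and>
    (\<forall>i. blinfun_apply B (e i) = (if i < d then 0 else blinfun_apply A (e i))))"

text \<open>The compression is an operator on \<^term>\<open>complex_space d\<close>, extended by \<open>0\<close> to the orthogonal
  complement.\<close>

definition compression :: "(nat \<Rightarrow> ell2) \<Rightarrow> nat \<Rightarrow> (ell2 \<Rightarrow>\<^sub>L ell2) \<Rightarrow> (ell2 \<Rightarrow>\<^sub>L ell2)"
  where "compression e d A = (THE B. B \<in> bounded_clinear_ops \<and>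
    (\<forall>k j. cinner (blinfun_apply B (unit_vec k)) (unit_vec j) =
      (if k < d \<and> j < d then cinner (blinfun_apply A (e k)) (e j) else 0)))"

lemma tail_op_unique:
  assumes e: "orthonormal_basis e" and A: "A \<in> bounded_clinear_ops"
  shows "\<exists>!B. B \<in> bounded_clinear_ops \<and>
    (\<forall>i. blinfun_apply B (e i) = (if i < d then 0 else blinfun_apply A (e i)))"
proof (rule ex_ex1I)
  define f where "f x = blinfun_apply A (x - (\<Sum>i<d. cinner x (e i) *\<^sub>C e i))" for x
  have lin: "bounded_linear f"
    unfolding f_def
    by (intro bounded_linear_compose[OF blinfun.bounded_linear_right] bounded_linear_sub
        bounded_linear_sum bounded_linear_ident
        bounded_linear_compose[OF bounded_linear_scaleC_left bounded_linear_cinner_left])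
  have "f (c *\<^sub>C x) = blinfun_apply A (c *\<^sub>C (x - (\<Sum>i<d. cinner x (e i) *\<^sub>C e i)))" for c x
    by (simp add: f_def cinner_scaleC_left scaleC_scaleC scaleC_sum_right scaleC_diff_right)
  then have clin: "f (c *\<^sub>C x) = c *\<^sub>C f x" for c x
    using A by (simp add: bounded_clinear_ops_def f_def)
  have z: "0 *\<^sub>C x = 0" "1 *\<^sub>C x = x" for x :: ell2
    using scaleC_of_real[of 0 x] scaleC_of_real[of 1 x] by simp_all
  have "cinner (e i) (e j) *\<^sub>C e j = (if j = i then e i else 0)" for i j
    using e by (simp add: orthonormal_basis_def z)
  then have "f (e i) = (if i < d then 0 else blinfun_apply A (e i))" for i
    by (simp add: f_def blinfun.zero_right)
  then show "\<exists>B. B \<in> bounded_clinear_ops \<and>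
      (\<forall>i. blinfun_apply B (e i) = (if i < d then 0 else blinfun_apply A (e i)))"
    using bounded_clinear_opsI[OF lin clin] by (intro exI[of _ "Blinfun f"]) simp
next
  show "B = B'" if
    "B \<in> bounded_clinear_ops \<and>
      (\<forall>i. blinfun_apply B (e i) = (if i < d then 0 else blinfun_apply A (e i)))"
    "B' \<in> bounded_clinear_ops \<and>
      (\<forall>i. blinfun_apply B' (e i) = (if i < d then 0 else blinfun_apply A (e i)))" for B B'
    using that by (intro bounded_clinear_ops_eqI[OF e]) auto
qed

lemma compression_unique:
  "\<exists>!B. B \<in> bounded_clinear_ops \<and>
    (\<forall>k j. cinner (blinfun_apply B (unit_vec k)) (unit_vec j) =
      (if k < d \<and> j < d then cinner (blinfun_apply A (e k)) (e j) else 0))"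
proof (rule ex_ex1I)
  define m where "m k j = cinner (blinfun_apply A (e k)) (e j)" for k j
  define v where "v k = (\<Sum>j<d. m k j *\<^sub>C unit_vec j)" for k
  define f where "f x = (\<Sum>k<d. cinner x (unit_vec k) *\<^sub>C v k)" for x
  have lin: "bounded_linear f"
    unfolding f_def
    by (intro bounded_linear_sum
        bounded_linear_compose[OF bounded_linear_scaleC_left bounded_linear_cinner_left])
  have clin: "f (c *\<^sub>C x) = c *\<^sub>C f x" for c x
    by (simp add: f_def cinner_scaleC_left scaleC_scaleC scaleC_sum_right)
  have v: "coord (v k) j = (if j < d then m k j else 0)" for k j
    by (simp add: v_def coord_sum scaleC_ell2.rep_eq coord_unit_vec
        if_distrib[of "\<lambda>u. _ * u"] cong: if_cong)
  have "coord (f (unit_vec k)) j = (if k < d \<and> j < d then m k j else 0)" for k j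
    by (simp add: f_def coord_sum scaleC_ell2.rep_eq cinner_unit_vec coord_unit_vec v
        if_distrib[of "\<lambda>u. u * _"] cong: if_cong)
  then show "\<exists>B. B \<in> bounded_clinear_ops \<and>
    (\<forall>k j. cinner (blinfun_apply B (unit_vec k)) (unit_vec j) =
      (if k < d \<and> j < d then cinner (blinfun_apply A (e k)) (e j) else 0))"
    using bounded_clinear_opsI[OF lin clin]
    by (intro exI[of _ "Blinfun f"]) (simp add: cinner_unit_vec m_def)
next
  show "B = B'" if
    "B \<in> bounded_clinear_ops \<and> (\<forall>k j. cinner (blinfun_apply B (unit_vec k)) (unit_vec j) =
      (if k < d \<and> j < d then cinner (blinfun_apply A (e k)) (e j) else 0))"
    "B' \<in> bounded_clinear_ops \<and> (\<forall>k j. cinner (blinfun_apply B' (unit_vec k)) (unit_vec j) =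
      (if k < d \<and> j < d then cinner (blinfun_apply A (e k)) (e j) else 0))" for B B'
    using that
    by (intro bounded_clinear_ops_eqI[OF orthonormal_basis_unit_vec])
      (auto simp: cinner_unit_vec coord_inject[symmetric] fun_eq_iff)
qed

lemma hilbert_adjoint_unique:
  assumes A: "A \<in> bounded_clinear_ops"
  shows "\<exists>!B. B \<in> bounded_clinear_ops \<and>
    (\<forall>x y. cinner (blinfun_apply A x) y = cinner x (blinfun_apply B y))"
proof (rule ex_ex1I)
  define c where "c y j = cnj (cinner (blinfun_apply A (unit_vec j)) y)" for y j
  define B where "B y = Abs_ell2 (c y)" for y
  have Asum: "cinner (blinfun_apply A (\<Sum>j<N. a j *\<^sub>C unit_vec j)) y = (\<Sum>j<N. a j * cnj (c y j))"
    for N a y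
  proof -
    interpret bounded_linear "\<lambda>x. cinner x y" by (rule bounded_linear_cinner_left)
    show ?thesis
      using A by (simp add: blinfun.sum_right bounded_clinear_ops_def sum cinner_scaleC_left c_def)
  qed
  have bound: "(\<Sum>j<N. (cmod (c y j))\<^sup>2) \<le> (norm A * norm y)\<^sup>2" for N y
  proof -
    define s where "s = (\<Sum>j<N. (cmod (c y j))\<^sup>2)"
    define u where "u = (\<Sum>j<N. c y j *\<^sub>C unit_vec j)"
    have s0: "s \<ge> 0" by (simp add: s_def sum_nonneg)
    have u: "coord u k = (if k < N then c y k else 0)" for k
      by (simp add: u_def coord_sum scaleC_ell2.rep_eq coord_unit_vec
          if_distrib[of "\<lambda>u. _ * u"] cong: if_cong)
    have "(\<Sum>k. (cmod (coord u k))\<^sup>2) = (\<Sum>k<N. (cmod (coord u k))\<^sup>2)"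
      by (rule suminf_finite) (auto simp: u)
    then have nu: "norm u = sqrt s" by (simp add: norm_ell2_eq u s_def)
    have "complex_of_real s = cinner (blinfun_apply A u) y"
      unfolding u_def Asum by (simp only: s_def of_real_sum complex_norm_square)
    then have "s = cmod (cinner (blinfun_apply A u) y)"
      using s0 by (metis abs_of_nonneg norm_of_real)
    also have "\<dots> \<le> norm (blinfun_apply A u) * norm y" by (rule cinner_norm_le)
    also have "\<dots> \<le> norm A * norm u * norm y"
      by (intro mult_right_mono norm_blinfun) simp
    finally have "sqrt s * sqrt s \<le> sqrt s * (norm A * norm y)"
      using s0 by (simp add: nu mult.commute mult.left_commute)
    then have "sqrt s \<le> norm A * norm y"
      using s0 by (cases "s = 0") (simp, metis mult_le_cancel_left_pos order_le_less real_sqrt_gt_zero)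
    then have "(sqrt s)\<^sup>2 \<le> (norm A * norm y)\<^sup>2" using s0 by (intro power_mono) auto
    then show ?thesis using s0 by (simp add: s_def)
  qed
  have cB: "coord (B y) = c y" and nB: "norm (B y) \<le> norm A * norm y" for y
    unfolding B_def by (rule ell2_boundedI[OF bound], simp)+
  have Beq: "cinner (blinfun_apply A x) y = cinner x (B y)" for x y
  proof -
    have "(\<lambda>i. cinner x (unit_vec i) *\<^sub>C unit_vec i) sums x"
      using orthonormal_basis_unit_vec by (simp add: orthonormal_basis_def)
    then have "(\<lambda>N. \<Sum>i<N. coord x i *\<^sub>C unit_vec i) \<longlonglongrightarrow> x"
      by (simp add: sums_def cinner_unit_vec)
    then have "(\<lambda>N. cinner (blinfun_apply A (\<Sum>i<N. coord x i *\<^sub>C unit_vec i)) y)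
        \<longlonglongrightarrow> cinner (blinfun_apply A x) y"
      by (intro bounded_linear.tendsto[OF bounded_linear_cinner_left]
          bounded_linear.tendsto[OF blinfun.bounded_linear_right])
    then have "(\<lambda>j. coord x j * cnj (c y j)) sums cinner (blinfun_apply A x) y"
      by (simp add: sums_def Asum)
    then show ?thesis unfolding cinner_def[of x "B y"] cB by (rule sums_unique)
  qed
  have Badd: "B (y + z) = B y + B z" and Bscale: "B (r *\<^sub>C y) = r *\<^sub>C B y" for y z r
  proof -
    show "B (y + z) = B y + B z"
      unfolding coord_inject[symmetric] plus_ell2.rep_eq cB c_def
      by (rule ext) (subst (1 2 3) cinner_commute, simp add: cinner_add_left)
    show "B (r *\<^sub>C y) = r *\<^sub>C B y"
      unfolding coord_inject[symmetric] scaleC_ell2.rep_eq cB c_def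
      by (rule ext) (subst (1 2) cinner_commute, simp add: cinner_scaleC_left)
  qed
  have lin: "bounded_linear B"
  proof (rule bounded_linear_intro)
    show "B (r *\<^sub>R y) = r *\<^sub>R B y" for r y
      using Bscale[of "complex_of_real r" y] by (simp add: scaleC_of_real)
    show "norm (B y) \<le> norm y * norm A" for y using nB[of y] by (simp add: mult.commute)
  qed (rule Badd)
  show "\<exists>B. B \<in> bounded_clinear_ops \<and>
      (\<forall>x y. cinner (blinfun_apply A x) y = cinner x (blinfun_apply B y))"
    using bounded_clinear_opsI[OF lin Bscale] Beq by (intro exI[of _ "Blinfun B"]) simp
next
  fix B B'
  assume "B \<in> bounded_clinear_ops \<and>
      (\<forall>x y. cinner (blinfun_apply A x) y = cinner x (blinfun_apply B y))"
    "B' \<in> bounded_clinear_ops \<and>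
      (\<forall>x y. cinner (blinfun_apply A x) y = cinner x (blinfun_apply B' y))"
  then have "cinner (unit_vec j) (blinfun_apply B y) = cinner (unit_vec j) (blinfun_apply B' y)"
    for j y by metis
  then have "coord (blinfun_apply B y) j = coord (blinfun_apply B' y) j" for j y
    by (metis cinner_commute cinner_unit_vec)
  then show "B = B'" by (intro blinfun_eqI) (auto simp: coord_inject[symmetric])
qed


section \<open>Strong measurability and the Bochner integral\<close>

text \<open>The library's Bochner integral requires a second countable target space, which
  \<^typ>\<open>ell2 \<Rightarrow>\<^sub>L ell2\<close> is not.  The definition below is the library's one with Borel measurability
  replaced by strong measurability.\<close>

definition strongly_measurable :: "'a measure \<Rightarrow> ('a \<Rightarrow> 'b::real_normed_vector) \<Rightarrow> bool"
  where "strongly_measurable M f \<longleftrightarrow>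
    (\<exists>s. (\<forall>i::nat. simple_function M (s i)) \<and> (AE x in M. (\<lambda>i. s i x) \<longlonglongrightarrow> f x))"

definition has_bochner_int :: "'a measure \<Rightarrow> ('a \<Rightarrow> 'b::real_normed_vector) \<Rightarrow> 'b \<Rightarrow> bool"
  where "has_bochner_int M f I \<longleftrightarrow> strongly_measurable M f \<and>
    (\<exists>s. (\<forall>i::nat. Bochner_Integration.simple_bochner_integrable M (s i)) \<and>
      (\<lambda>i. \<integral>\<^sup>+x. ennreal (norm (f x - s i x)) \<partial>M) \<longlonglongrightarrow> 0 \<and>
      (\<lambda>i. Bochner_Integration.simple_bochner_integral M (s i)) \<longlonglongrightarrow> I)"

definition bochner_int :: "'a measure \<Rightarrow> ('a \<Rightarrow> 'b::real_normed_vector) \<Rightarrow> 'b"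
  where "bochner_int M f = (THE I. has_bochner_int M f I)"


section \<open>The ball, its weighted measures and function spaces\<close>

definition hprod :: "complex ^ 'n::finite \<Rightarrow> complex ^ 'n \<Rightarrow> complex"
  where "hprod z w = (\<Sum>k\<in>UNIV. z $ k * cnj (w $ k))"

definition weight_const :: "'n::finite itself \<Rightarrow> real \<Rightarrow> real"
  where "weight_const _ \<alpha> =
    1 / (LINT z|lebesgue_on (ball (0 :: complex ^ 'n) 1). (1 - (norm z)\<^sup>2) powr \<alpha>)"

definition nu :: "real \<Rightarrow> (complex ^ 'n::finite) measure"
  where "nu \<alpha> = density (lebesgue_on (ball 0 1))
    (\<lambda>z. ennreal (weight_const TYPE('n) \<alpha> * (1 - (norm z)\<^sup>2) powr \<alpha>))"

definition Lp_norm :: "real \<Rightarrow> real \<Rightarrow> (complex ^ 'n::finite \<Rightarrow> 'e::real_normed_vector) \<Rightarrow> ennreal"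
  where "Lp_norm \<alpha> p f =
    (let I = (\<integral>\<^sup>+z. ennreal (norm (f z) powr p) \<partial>nu \<alpha>)
     in if I = \<infinity> then \<infinity> else ennreal (enn2real I powr (1 / p)))"

definition Lp_space :: "real \<Rightarrow> real \<Rightarrow> (complex ^ 'n::finite \<Rightarrow> 'e::real_normed_vector) set"
  where "Lp_space \<alpha> p = {f. strongly_measurable (nu \<alpha>) f \<and> Lp_norm \<alpha> p f < \<infinity>}"

text \<open>For every \<open>\<alpha>\<close> the measure \<^term>\<open>nu \<alpha>\<close> has the same null sets on the ball as Lebesgue
  measure, so the essential supremum does not depend on \<open>\<alpha>\<close>.\<close>

definition Linf_norm :: "real \<Rightarrow> (complex ^ 'n::finite \<Rightarrow> 'e::real_normed_vector) \<Rightarrow> ennreal"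
  where "Linf_norm \<alpha> f = esssup (nu \<alpha>) (\<lambda>z. ennreal (norm (f z)))"

definition Linf_space :: "real \<Rightarrow> (complex ^ 'n::finite \<Rightarrow> 'e::real_normed_vector) set"
  where "Linf_space \<alpha> = {f. strongly_measurable (nu \<alpha>) f \<and> Linf_norm \<alpha> f < \<infinity>}"

definition holomorphic_ball :: "(complex ^ 'n::finite \<Rightarrow> 'e::complex_normed_space) \<Rightarrow> bool"
  where "holomorphic_ball f \<longleftrightarrow>
    (\<forall>z\<in>ball 0 1. \<exists>D. (f has_derivative D) (at z) \<and> (\<forall>c v. D (c *s v) = c *\<^sub>C D v))"

definition Ap_space :: "real \<Rightarrow> real \<Rightarrow> (complex ^ 'n::finite \<Rightarrow> 'e::complex_normed_space) set"
  where "Ap_space \<alpha> p = {f \<in> Lp_space \<alpha> p. holomorphic_ball f}"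

definition Hinf_space :: "(complex ^ 'n::finite \<Rightarrow> 'e::complex_normed_space) set"
  where "Hinf_space = {f. holomorphic_ball f \<and> bounded (f ` ball 0 1)}"


section \<open>Kernels, automorphisms, Berezin transform and BMO\<close>

text \<open>The bases of the complex powers have positive real part, so the principal branch is the
  holomorphic one.\<close>

definition bergman_kernel :: "real \<Rightarrow> complex ^ 'n::finite \<Rightarrow> complex ^ 'n \<Rightarrow> complex"
  where "bergman_kernel \<alpha> z w =
    (1 - hprod w z) powr complex_of_real (- (real CARD('n) + 1 + \<alpha>))"

definition normalized_kernel :: "real \<Rightarrow> complex ^ 'n::finite \<Rightarrow> complex ^ 'n \<Rightarrow> complex"
  where "normalized_kernel \<alpha> z w =
    complex_of_real ((1 - (norm z)\<^sup>2) powr ((real CARD('n) + 1 + \<alpha>) / 2)) *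
    (1 - hprod w z) powr complex_of_real (- (real CARD('n) + 1 + \<alpha>))"

definition ball_proj :: "complex ^ 'n::finite \<Rightarrow> complex ^ 'n \<Rightarrow> complex ^ 'n"
  where "ball_proj a z = (hprod z a / complex_of_real ((norm a)\<^sup>2)) *s a"

definition ball_involution :: "complex ^ 'n::finite \<Rightarrow> complex ^ 'n \<Rightarrow> complex ^ 'n"
  where "ball_involution a z =
    (if a = 0 then - z
     else (1 / (1 - hprod z a)) *s
       (a - ball_proj a z - sqrt (1 - (norm a)\<^sup>2) *\<^sub>R (z - ball_proj a z)))"

definition berezin ::
  "real \<Rightarrow> (complex ^ 'n::finite \<Rightarrow> 'e::real_normed_vector) \<Rightarrow> complex ^ 'n \<Rightarrow> 'e"
  where "berezin \<alpha> b z = bochner_int (nu \<alpha>) (\<lambda>w. (cmod (normalized_kernel \<alpha> z w))\<^sup>2 *\<^sub>R b w)"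

definition BMO1_norm :: "real \<Rightarrow> (complex ^ 'n::finite \<Rightarrow> 'e::real_normed_vector) \<Rightarrow> ennreal"
  where "BMO1_norm \<alpha> b =
    (SUP z\<in>ball 0 1. Lp_norm \<alpha> 1 (\<lambda>w. b (ball_involution z w) - berezin \<alpha> b z))"

definition BMO1_space :: "real \<Rightarrow> (complex ^ 'n::finite \<Rightarrow> 'e::real_normed_vector) set"
  where "BMO1_space \<alpha> = {b \<in> Lp_space \<alpha> 1. BMO1_norm \<alpha> b < \<infinity>}"


section \<open>Toeplitz operators\<close>

definition toeplitz ::
  "real \<Rightarrow> (complex ^ 'n::finite \<Rightarrow> 'e::complex_normed_space \<Rightarrow>\<^sub>L 'f::complex_normed_space) \<Rightarrow>
   (complex ^ 'n \<Rightarrow> 'e) \<Rightarrow> complex ^ 'n \<Rightarrow> 'f"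
  where "toeplitz \<alpha> b f z =
    bochner_int (nu \<alpha>) (\<lambda>w. cnj (bergman_kernel \<alpha> z w) *\<^sub>C blinfun_apply (b w) (f w))"

text \<open>Functions on the ball are represented by functions on the whole space whose values off the
  ball are irrelevant; hence all identities are required on the ball only.\<close>

definition bounded_operator_A2 ::
  "real \<Rightarrow> ((complex ^ 'n::finite \<Rightarrow> 'e::complex_normed_space) \<Rightarrow>
     (complex ^ 'n \<Rightarrow> 'f::complex_normed_space)) \<Rightarrow> bool"
  where "bounded_operator_A2 \<alpha> T \<longleftrightarrow>
    (\<forall>f\<in>Ap_space \<alpha> 2. T f \<in> Ap_space \<alpha> 2) \<and>
    (\<forall>f\<in>Ap_space \<alpha> 2. \<forall>g\<in>Ap_space \<alpha> 2. \<forall>z\<in>ball 0 1. T (\<lambda>w. f w + g w) z = T f z + T g z) \<and>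
    (\<forall>c. \<forall>f\<in>Ap_space \<alpha> 2. \<forall>z\<in>ball 0 1. T (\<lambda>w. c *\<^sub>C f w) z = c *\<^sub>C T f z) \<and>
    (\<exists>C::real. \<forall>f\<in>Ap_space \<alpha> 2. Lp_norm \<alpha> 2 (T f) \<le> ennreal C * Lp_norm \<alpha> 2 f)"

definition toeplitz_extension ::
  "real \<Rightarrow> (complex ^ 'n::finite \<Rightarrow> 'e::complex_normed_space \<Rightarrow>\<^sub>L 'f::complex_normed_space) \<Rightarrow>
   ((complex ^ 'n \<Rightarrow> 'e) \<Rightarrow> (complex ^ 'n \<Rightarrow> 'f)) \<Rightarrow> bool"
  where "toeplitz_extension \<alpha> b T \<longleftrightarrow> bounded_operator_A2 \<alpha> T \<and>
    (\<forall>f\<in>Hinf_space. \<forall>z\<in>ball 0 1. T f z = toeplitz \<alpha> b f z)"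

definition compact_operator_A2 ::
  "real \<Rightarrow> ((complex ^ 'n::finite \<Rightarrow> 'e::complex_normed_space) \<Rightarrow>
     (complex ^ 'n \<Rightarrow> 'f::complex_normed_space)) \<Rightarrow> bool"
  where "compact_operator_A2 \<alpha> T \<longleftrightarrow> bounded_operator_A2 \<alpha> T \<and>
    (\<forall>f :: nat \<Rightarrow> complex ^ 'n \<Rightarrow> 'e.
      (\<forall>k. f k \<in> Ap_space \<alpha> 2) \<and> (\<exists>C::real. \<forall>k. Lp_norm \<alpha> 2 (f k) \<le> ennreal C) \<longrightarrow>
      (\<exists>r g. strict_mono r \<and> g \<in> Ap_space \<alpha> 2 \<and>
        (\<lambda>k. Lp_norm \<alpha> 2 (\<lambda>z. T (f (r k)) z - g z)) \<longlonglongrightarrow> 0))"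

text \<open>The filter of \<open>z\<close> in the unit ball approaching the unit sphere.\<close>

definition to_sphere :: "(complex ^ 'n::finite) filter"
  where "to_sphere = filtercomap norm (at_left 1)"

end

theory Submission
  imports Defs "HOL-Complex_Analysis.Complex_Analysis"
begin

text \<open>The bound on the Berezin transform makes \<open>\<parallel>b\<parallel> d\<nu>\<close> a Carleson measure with respect to the Berezin
  transform, and such symbols give Toeplitz operators whose norm is controlled by the bound.
  Hence (ii) and (iii) reduce compactness to the finitely many scalar entries of a compression.
  The integral kernel of a scalar entry is dominated by a Schur kernel, with a small constant near
  the sphere: far from the diagonal because a better power dominates it, near the diagonal by (iv).
  Along a subsequence converging pointwise on the ball the inner part converges in norm
  and the outer part is uniformly small.\<close>

section \<open>The involutions of the ball\<close>

text \<open>Every operator bound has to be linear in the Carleson bound, since (ii) and (iii) make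
  only that bound small. Linearity comes from inserting the reproducing formula for f and exchanging
  integrals: the weight then meets only |K_z K_w|, and as K_z K_w is holomorphic, the weight can be
  traded for its bound. What remains is \<open>Qker\<close>, that is |1 - <w,z>|^(-N) (1 -
  |phi_z(w)|^2)^(-d) with N = n + 1 + \<alpha>; the power d > 0 absorbs the logarithmic growth of
  the integral of |K_z K_w| and is still small enough for the Schur test. Condition (iv) gives
  smallness in L2 only. Evaluation of a holomorphic function turns it into a pointwise bound, which
  compares well with \<open>Qker\<close> only while 1 - |phi_z(w)|^2 stays away from 0; this forces
  the two regimes. Bounded sets of the sequence space are not relatively compact, so subsequences
  converge only coordinatewise along the basis, which is enough once finitely many entries are left.
  The extension is the integral operator itself: its integral converges for every function of the
  Bergman space.\<close>

lemma hprod_add_left: "hprod (x + y) z = hprod x z + hprod y z"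
  by (simp add: hprod_def sum.distrib algebra_simps)
lemma hprod_add_right: "hprod z (x + y) = hprod z x + hprod z y"
  by (simp add: hprod_def sum.distrib algebra_simps)
lemma hprod_diff_left: "hprod (x - y) z = hprod x z - hprod y z"
  by (simp add: hprod_def sum_subtractf algebra_simps)
lemma hprod_diff_right: "hprod z (x - y) = hprod z x - hprod z y"
  by (simp add: hprod_def sum_subtractf algebra_simps)
lemma hprod_minus_left: "hprod (- x) z = - hprod x z"
  by (simp add: hprod_def sum_negf)
lemma hprod_minus_right: "hprod z (- x) = - hprod z x"
  by (simp add: hprod_def sum_negf)
lemma hprod_scale_left: "hprod (c *s x) z = c * hprod x z"
  by (simp add: hprod_def sum_distrib_left algebra_simps)
lemma hprod_scale_right: "hprod z (c *s x) = cnj c * hprod z x"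
  by (simp add: hprod_def sum_distrib_left algebra_simps)
lemma hprod_zero [simp]: "hprod 0 z = 0" "hprod z 0 = 0"
  by (simp_all add: hprod_def)
lemma cnj_hprod: "cnj (hprod z w) = hprod w z"
  by (simp add: hprod_def algebra_simps)
lemma hprod_self: "hprod z z = complex_of_real ((norm z)\<^sup>2)"
  unfolding hprod_def norm_vec_def L2_set_def
  by (simp add: sum_nonneg complex_norm_square[symmetric] del: of_real_power)
lemma scaleR_vec_eq: "r *\<^sub>R z = complex_of_real r *s (z :: complex^'n::finite)"
  by (simp add: vec_eq_iff) (simp add: scaleR_conv_of_real)
lemma norm_vscale: "norm (c *s z) = cmod c * norm (z :: complex^'n::finite)"
  by (simp add: norm_vec_def norm_mult L2_set_right_distrib)

lemma hprod_norm_le: "cmod (hprod z w) \<le> norm z * norm w"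
proof -
  have "cmod (hprod z w) \<le> (\<Sum>k\<in>UNIV. \<bar>cmod (z $ k)\<bar> * \<bar>cmod (w $ k)\<bar>)"
    unfolding hprod_def by (rule order_trans[OF norm_sum]) (simp add: norm_mult)
  also have "\<dots> \<le> norm z * norm w"
    unfolding norm_vec_def by (rule L2_set_mult_ineq)
  finally show ?thesis .
qed

lemmas hprod_simps = hprod_add_left hprod_add_right hprod_diff_left hprod_diff_right
  hprod_minus_left hprod_minus_right hprod_scale_left hprod_scale_right

lemma hprod_in_ball:
  assumes "norm z \<le> 1" "norm w < 1"
  shows "cmod (hprod z w) < 1" "cmod (hprod w z) < 1"
proof -
  have "norm z * norm w \<le> 1 * norm w" using assms by (intro mult_right_mono) auto
  then show "cmod (hprod z w) < 1" using hprod_norm_le[of z w] assms by simp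
  then show "cmod (hprod w z) < 1" by (metis cnj_hprod complex_mod_cnj)
qed

lemma one_minus_hprod_nz:
  assumes "norm z \<le> 1" "norm w < 1"
  shows "1 - hprod z w \<noteq> 0" "1 - hprod w z \<noteq> 0"
  using hprod_in_ball[OF assms] by auto

definition srt :: "complex^'n::finite \<Rightarrow> complex"
  where "srt a = complex_of_real (sqrt (1 - (norm a)\<^sup>2))"

lemma norm_sq_less_one: "norm a < 1 \<Longrightarrow> (norm a)\<^sup>2 < (1::real)"
  by (simp add: abs_square_less_1)

lemma srt_sq: assumes "norm a < 1" shows "srt a * srt a = 1 - hprod a a"
proof -
  have "(norm a)\<^sup>2 \<le> 1" using norm_sq_less_one[OF assms] by simp
  then show ?thesis unfolding srt_def hprod_self of_real_mult[symmetric] by simp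
qed

lemma srt_nz: assumes "norm a < 1" shows "srt a \<noteq> 0" "1 + srt a \<noteq> 0"
proof -
  have "sqrt (1 - (norm a)\<^sup>2) > 0" using norm_sq_less_one[OF assms] by simp
  then have "sqrt (1 - (norm a)\<^sup>2) \<noteq> 0" "1 + sqrt (1 - (norm a)\<^sup>2) \<noteq> 0" by linarith+
  then show "srt a \<noteq> 0" "1 + srt a \<noteq> 0" unfolding srt_def complex_eq_iff by simp_all
qed

lemma cnj_srt [simp]: "cnj (srt a) = srt a" by (simp add: srt_def)

text \<open>As \<open>srt a * srt a\<close> is 1 - |a|^2, the factor (1 - srt a)/|a|^2 in front of
  the vector a becomes 1/(1 + srt a). The singularity at a = 0 is gone, so one formula covers both
  cases of the definition; it is the form used for all later algebra, measurability and
  differentiation.\<close>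

lemma ball_involution_eq:
  assumes "norm a < 1"
  shows "ball_involution a z =
    (1 / (1 - hprod z a)) *s (a - srt a *s z - (hprod z a / (1 + srt a)) *s a)"
proof (cases "a = 0")
  case True
  then show ?thesis by (simp add: ball_involution_def srt_def)
next
  case False
  define A where "A = hprod a a"
  have A: "A \<noteq> 0" using False by (simp add: A_def hprod_self)
  have s: "srt a * srt a = 1 - A" using srt_sq[OF assms] by (simp add: A_def)
  have "hprod z a / A * (1 - srt a) = hprod z a / (1 + srt a)"
    using A s srt_nz[OF assms]
    by (simp add: field_simps) (simp add: distrib_right[symmetric] mult.assoc[symmetric])
  then have eq: "hprod z a / (1 + srt a) = hprod z a / A - srt a * (hprod z a / A)"
    by (simp only: right_diff_distrib mult_1_right mult.commute[of _ "srt a"])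
  have sc: "sqrt (1 - (norm a)\<^sup>2) *\<^sub>R x = srt a * x" for x :: complex
    by (simp add: scaleR_conv_of_real srt_def)
  have "complex_of_real ((norm a)\<^sup>2) = A" by (simp add: A_def hprod_self)
  then show ?thesis unfolding ball_involution_def ball_proj_def eq if_not_P[OF False]
    by (simp add: vec_eq_iff sc algebra_simps diff_divide_distrib add_divide_distrib)
qed

text \<open>The basic identity of the Moebius group of the ball: the diagonal case gives 1 -
  |phi_a(z)|^2, the case w = 0 gives the behaviour of 1 - <z,a>, and both drive every change of
  variables in kernel integrals. It is polynomial in p, q, r, S and t = 1/(1 + S) once the
  denominators are cleared, subject to A = 1 - S^2.\<close>

lemma hprod_ball_involution:
  assumes a: "norm a < 1" and z: "1 - hprod z a \<noteq> 0" and w: "1 - hprod w a \<noteq> 0"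
  shows "1 - hprod (ball_involution a z) (ball_involution a w) =
    (1 - hprod a a) * (1 - hprod z w) / ((1 - hprod z a) * (1 - hprod a w))"
proof -
  define A p q p' S r where "A = hprod a a" and "p = hprod z a" and "q = hprod a w"
    and "p' = hprod w a" and "S = srt a" and "r = hprod z w"
  have cp: "cnj p' = q" by (simp add: p'_def q_def cnj_hprod)
  have cS: "cnj S = S" by (simp add: S_def)
  have S: "A = 1 - S * S" using srt_sq[OF a] by (simp add: A_def S_def)
  have nz: "1 + S \<noteq> 0" "1 - p \<noteq> 0" "1 - q \<noteq> 0"
    using srt_nz[OF a] z w cp by (auto simp: S_def p_def p'_def)
  define t where "t = 1 / (1 + S)"
  have t: "p / (1 + S) = p * t" "q / (1 + S) = q * t" "p' / (1 + S) = p' * t" "t * (1 + S) = 1"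
    using nz by (simp_all add: t_def)
  have ct: "cnj t = t" by (simp add: t_def cS)
  have tA: "t * A = 1 - S"
    using nz(1) unfolding S t_def by (simp add: field_simps)
  \<comment> \<open>Grouped so that only \<open>t * (1 + S) = 1\<close> and
    \<open>t * A = 1 - S\<close> are left to apply; the summand with \<open>S + t * A - 1\<close>
    then vanishes.\<close>
  have "hprod (a - S *s z - (p / (1 + S)) *s a) (a - S *s w - (p' / (1 + S)) *s a)
      = A - S * q - q * (t * A) - S * p + S * S * r + p * q * (t * (1 + S)) + p * q * t * (S + t * A - 1)
        - p * (t * A)"
    by (simp add: t hprod_simps cp cS ct A_def[symmetric] p_def[symmetric] q_def[symmetric]
      r_def[symmetric] algebra_simps)
  also have "\<dots> = (1 - p) * (1 - q) - S * S * (1 - r)"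
    unfolding tA t(4) unfolding S by (simp add: algebra_simps)
  finally have eq: "hprod (a - S *s z - (p / (1 + S)) *s a) (a - S *s w - (p' / (1 + S)) *s a)
     = (1 - p) * (1 - q) - S * S * (1 - r)" .
  have "hprod (ball_involution a z) (ball_involution a w)
      = (1 / (1 - p)) * (1 / (1 - q)) * ((1 - p) * (1 - q) - S * S * (1 - r))"
    unfolding ball_involution_eq[OF a] S_def[symmetric] p_def[symmetric] p'_def[symmetric]
    by (simp only: hprod_scale_left hprod_scale_right eq complex_cnj_divide complex_cnj_diff
      complex_cnj_one cp mult.assoc mult.left_commute)
  moreover have "1 - A = S * S" using S by simp
  ultimately show ?thesis
    using nz unfolding A_def[symmetric] p_def[symmetric] q_def[symmetric] r_def[symmetric]
    by (simp add: divide_simps) (simp add: algebra_simps)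
qed

lemma ball_involution_0 [simp]: assumes "norm a < 1" shows "ball_involution a 0 = a"
  using assms by (simp add: ball_involution_eq)

lemma hprod_ball_involution_self:
  assumes a: "norm a < 1" and z: "1 - hprod z a \<noteq> 0"
  shows "1 - hprod (ball_involution a z) a = (1 - hprod a a) / (1 - hprod z a)"
  using hprod_ball_involution[OF a z, of 0] a by simp

text \<open>The second application needs <phi_a(z),a>, which
  \<open>hprod_ball_involution_self\<close> supplies; the remaining identity is checked coordinate
  by coordinate.\<close>

lemma ball_involution_involution:
  assumes a: "norm a < 1" and z: "1 - hprod z a \<noteq> 0"
  shows "ball_involution a (ball_involution a z) = z"
proof -
  define A p S f where "A = hprod a a" and "p = hprod z a" and "S = srt a"
    and "f = ball_involution a z"
  have S: "A = 1 - S * S" using srt_sq[OF a] by (simp add: A_def S_def)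
  have nz: "1 + S \<noteq> 0" "1 - p \<noteq> 0" "S \<noteq> 0"
    using srt_nz[OF a] z by (auto simp: S_def p_def)
  have h: "1 - hprod f a = S * S / (1 - p)"
    using hprod_ball_involution_self[OF a z] S by (simp add: f_def p_def A_def[symmetric])
  then have hf: "hprod f a = 1 - S * S / (1 - p)" by (simp add: algebra_simps)
  define t where "t = 1 / (1 + S)"
  have t: "p / (1 + S) = p * t" "hprod f a / (1 + S) = hprod f a * t" "t * (1 + S) = 1"
    using nz by (simp_all add: t_def)
  have f: "(1 - p) * f $ i = a $ i - S * z $ i - p * t * a $ i" for i
    unfolding f_def ball_involution_eq[OF a] using nz
    by (simp add: S_def[symmetric] p_def[symmetric] t) (simp add: right_diff_distrib)
  have hf': "(1 - p) * hprod f a = 1 - p - S * S"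
    unfolding hf using nz by (simp add: field_simps)
  have "ball_involution a f $ i = z $ i" for i
  proof -
    have "(1 - p) * (a $ i - S * f $ i - hprod f a * t * a $ i)
      = (1 - p) * a $ i - S * ((1 - p) * f $ i) - ((1 - p) * hprod f a) * t * a $ i"
      by (simp add: algebra_simps)
    also have "\<dots> = S * S * z $ i + a $ i * (1 - p - S + p * (t * (1 + S)) - (1 - S) * (t * (1 + S)))"
      unfolding f hf' by (simp add: algebra_simps)
    also have "\<dots> = S * S * z $ i" unfolding t(3) by simp
    finally have "(a $ i - S * f $ i - hprod f a * t * a $ i) = S * S * z $ i / (1 - p)"
      using nz by (simp add: field_simps)
    then show ?thesis
      unfolding ball_involution_eq[OF a] S_def[symmetric] h using nz
      by (simp add: t del: vector_ssub_ldistrib)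
  qed
  then show ?thesis by (simp add: f_def vec_eq_iff)
qed

lemma ball_involution_norm:
  assumes a: "norm a < 1" and z: "norm z < 1"
  shows "1 - (norm (ball_involution a z))\<^sup>2
    = (1 - (norm a)\<^sup>2) * (1 - (norm z)\<^sup>2) / (cmod (1 - hprod z a))\<^sup>2"
proof -
  have nz: "1 - hprod z a \<noteq> 0" using one_minus_hprod_nz[of z a] a z by simp
  have "1 - hprod a z = cnj (1 - hprod z a)" by (simp add: cnj_hprod)
  then have "complex_of_real (1 - (norm (ball_involution a z))\<^sup>2)
    = complex_of_real ((1 - (norm a)\<^sup>2) * (1 - (norm z)\<^sup>2) / (cmod (1 - hprod z a))\<^sup>2)"
    using hprod_ball_involution[OF a nz nz] complex_norm_square[of "1 - hprod z a"]
    by (simp add: hprod_self del: complex_cnj_diff)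
  then show ?thesis by (simp only: of_real_eq_iff)
qed

lemma ball_involution_in_ball:
  assumes a: "norm a < 1" and z: "norm z < 1"
  shows "norm (ball_involution a z) < 1"
proof -
  have "cmod (1 - hprod z a) > 0" using one_minus_hprod_nz[of z a] a z by simp
  then have "1 - (norm (ball_involution a z))\<^sup>2 > 0"
    unfolding ball_involution_norm[OF a z]
    using a z by (intro divide_pos_pos mult_pos_pos) (auto simp: abs_square_less_1)
  then show ?thesis by (simp add: abs_square_less_1)
qed

section \<open>Real determinants and change of variables under a differentiable involution\<close>

definition euclid_coords :: "('m::finite \<Rightarrow> 'a::euclidean_space) \<Rightarrow> 'a \<Rightarrow> real ^ 'm"
  where "euclid_coords E x = (\<chi> j. x \<bullet> E j)"

definition euclid_point :: "('m::finite \<Rightarrow> 'a::euclidean_space) \<Rightarrow> real ^ 'm \<Rightarrow> 'a"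
  where "euclid_point E y = (\<Sum>j\<in>UNIV. (y $ j) *\<^sub>R E j)"

text \<open>The determinant of L as a real-linear map. The enumeration E of the real basis moves L
  to \<open>real ^ 'm\<close>, where determinants and the measure of differentiable images are
  available; \<open>lborel_euclid_coords\<close> says that this move preserves Lebesgue
  measure.\<close>

definition real_det :: "('m::{finite,wellorder} \<Rightarrow> 'a::euclidean_space) \<Rightarrow> ('a \<Rightarrow> 'a) \<Rightarrow> real"
  where "real_det E L = det (matrix (\<lambda>y. euclid_coords E (L (euclid_point E y))))"

context
  fixes E :: "'m::{finite,wellorder} \<Rightarrow> 'a::euclidean_space"
  assumes E: "bij_betw E UNIV Basis"
begin

lemma E_inner: "E i \<bullet> E j = (if i = j then 1 else 0)"
proof -
  have "E i \<in> Basis" "E j \<in> Basis" "E i = E j \<longleftrightarrow> i = j"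
    using E by (auto simp: bij_betw_def inj_on_def)
  then show ?thesis by (simp add: inner_Basis)
qed

lemma euclid_point_coords: "euclid_point E (euclid_coords E x) = x"
proof -
  have "euclid_point E (euclid_coords E x) = (\<Sum>j\<in>UNIV. (x \<bullet> E j) *\<^sub>R E j)"
    by (simp add: euclid_point_def euclid_coords_def)
  also have "\<dots> = (\<Sum>b\<in>Basis. (x \<bullet> b) *\<^sub>R b)"
    by (rule sum.reindex_bij_betw[OF E])
  finally show ?thesis by (simp add: euclidean_representation)
qed

lemma euclid_coords_point: "euclid_coords E (euclid_point E y) = y"
  by (simp add: vec_eq_iff euclid_coords_def euclid_point_def inner_sum_left E_inner
    if_distrib[of "\<lambda>u. _ * u"] cong: if_cong)

lemma linear_euclid_coords: "linear (euclid_coords E)"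
  by (intro linearI) (simp_all add: euclid_coords_def vec_eq_iff inner_add_left)

lemma linear_euclid_point: "linear (euclid_point E)"
  by (intro linearI) (simp_all add: euclid_point_def scaleR_add_left sum.distrib scaleR_sum_right)

lemma euclid_coords_inner: "euclid_coords E x \<bullet> euclid_coords E y = x \<bullet> y"
proof -
  have "euclid_coords E x \<bullet> euclid_coords E y = (\<Sum>j\<in>UNIV. (x \<bullet> E j) * (y \<bullet> E j))"
    by (simp add: inner_vec_def euclid_coords_def)
  also have "\<dots> = (\<Sum>b\<in>Basis. (x \<bullet> b) * (y \<bullet> b))"
    by (rule sum.reindex_bij_betw[OF E])
  finally show ?thesis by (simp only: euclidean_inner[of x y, symmetric])
qed

lemma real_det_compose:
  assumes "linear L" "linear M"
  shows "real_det E (\<lambda>x. L (M x)) = real_det E L * real_det E M"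
proof -
  let ?l = "\<lambda>L y. euclid_coords E (L (euclid_point E y))"
  have lin: "linear (?l L)" if "linear L" for L
    using linear_compose[OF linear_compose[OF linear_euclid_point that] linear_euclid_coords]
    by (simp add: o_def)
  have "matrix (?l L \<circ> ?l M) = matrix (?l L) ** matrix (?l M)"
    by (rule matrix_compose) (auto intro: lin assms)
  moreover have "?l L \<circ> ?l M = ?l (\<lambda>x. L (M x))"
    by (auto simp: euclid_point_coords)
  ultimately show ?thesis by (simp add: real_det_def det_mul)
qed

lemma real_det_id: "real_det E (\<lambda>x. x) = 1"
  using det_I by (simp add: real_det_def euclid_coords_point matrix_id_mat_1[unfolded id_def])

lemma real_det_isometry:
  assumes L: "linear L" "\<And>x. norm (L x) = norm x"
  shows "\<bar>real_det E L\<bar> = 1"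
proof -
  let ?l = "\<lambda>y. euclid_coords E (L (euclid_point E y))"
  have "linear ?l"
    using linear_compose[OF linear_compose[OF linear_euclid_point L(1)] linear_euclid_coords]
    by (simp add: o_def)
  moreover have "norm (?l y) = norm y" for y
  proof -
    have n: "norm (euclid_coords E x) = norm x" for x
      by (simp add: norm_eq_sqrt_inner euclid_coords_inner)
    show ?thesis using n[of "euclid_point E y"] by (simp add: n L euclid_coords_point)
  qed
  ultimately have "orthogonal_transformation ?l" by (simp add: orthogonal_transformation)
  then show ?thesis unfolding real_det_def by (rule orthogonal_transformation_det)
qed

lemma real_det_diag:
  assumes "\<And>j. L (E j) = d j *\<^sub>R E j"
  shows "real_det E L = (\<Prod>j\<in>UNIV. d j)"
proof -
  have "euclid_point E (axis j 1) = E j" for j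
  proof -
    have "axis j 1 = euclid_coords E (E j)"
      by (auto simp: vec_eq_iff axis_def euclid_coords_def E_inner)
    then show ?thesis by (simp add: euclid_point_coords)
  qed
  then have "matrix (\<lambda>y. euclid_coords E (L (euclid_point E y))) = (\<chi> i j. if i = j then d j else 0)"
    by (simp add: matrix_def vec_eq_iff assms euclid_coords_def E_inner)
  then show ?thesis unfolding real_det_def by (subst det_diagonal) auto
qed

lemma lborel_euclid_coords: "distr lborel borel (euclid_coords E) = (lborel :: (real ^ 'm::_) measure)"
proof (rule lborel_eqI[symmetric])
  have cont: "continuous_on UNIV (euclid_coords E)"
    by (simp add: linear_continuous_on linear_euclid_coords linear_linear)
  show "sets (distr lborel borel (euclid_coords E)) = sets borel" by simp
  fix l u :: "real ^ 'm::_" assume lu: "\<And>b. b \<in> Basis \<Longrightarrow> l \<bullet> b \<le> u \<bullet> b"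
  have lu': "l $ j \<le> u $ j" for j using lu[of "axis j 1"] by (simp add: inner_axis)
  have B: "Basis = range E" using E by (simp add: bij_betw_def)
  have pE: "euclid_point E y \<bullet> E j = y $ j" for y j
    using arg_cong[OF euclid_coords_point[of y], of "\<lambda>v. v $ j"] by (simp add: euclid_coords_def)
  have "euclid_coords E -` box l u = box (euclid_point E l) (euclid_point E u)"
    using mem_box_cart(1)[of "euclid_coords E _" l u]
    by (auto simp: mem_box(1)[of _ "euclid_point E l"] B pE euclid_coords_def)
  then have "emeasure (distr lborel borel (euclid_coords E)) (box l u)
     = emeasure lborel (box (euclid_point E l) (euclid_point E u))"
    using cont by (simp add: emeasure_distr borel_measurable_continuous_onI)
  also have "\<dots> = ennreal (\<Prod>b\<in>Basis. (euclid_point E u - euclid_point E l) \<bullet> b)"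
    by (subst emeasure_lborel_box) (auto simp: B pE lu')
  also have "(\<Prod>b\<in>Basis. (euclid_point E u - euclid_point E l) \<bullet> b)
      = (\<Prod>j\<in>UNIV. (euclid_point E u - euclid_point E l) \<bullet> E j)"
    by (rule prod.reindex_bij_betw[OF E, symmetric])
  also have "\<dots> = (\<Prod>b\<in>Basis. (u - l) \<bullet> b)"
    by (simp add: inner_diff_left pE Basis_vec_def axis_eq_axis inner_axis
       prod.reindex[where h="\<lambda>j. axis j 1", simplified] inj_on_def UNION_singleton_eq_range)
  finally show "emeasure (distr lborel borel (euclid_coords E)) (box l u)
      = ennreal (\<Prod>b\<in>Basis. (u - l) \<bullet> b)" .
qed

text \<open>Because \<phi> is its own inverse on B, the image of a set S inside B is the part of B
  that \<phi> maps into S. The formula for the measure of an injective differentiable image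
  therefore gives the density of the push-forward of Lebesgue measure on B directly, with the
  Jacobian at the point itself rather than at its preimage.\<close>

lemma nn_integral_involution:
  fixes \<phi> :: "'a \<Rightarrow> 'a" and J :: "'a \<Rightarrow> real"
  assumes B: "open B" "bounded B"
    and der: "\<And>x. x \<in> B \<Longrightarrow> (\<phi> has_derivative \<phi>' x) (at x)"
    and inv: "\<And>x. x \<in> B \<Longrightarrow> \<phi> x \<in> B \<and> \<phi> (\<phi> x) = x"
    and J: "\<And>x. x \<in> B \<Longrightarrow> \<bar>real_det E (\<phi>' x)\<bar> = J x" "J \<in> borel_measurable borel"
    and G: "G \<in> borel_measurable borel"
  shows "(\<integral>\<^sup>+x. indicator B x * G (\<phi> x) \<partial>lborel) = (\<integral>\<^sup>+x. indicator B x * (G x * ennreal (J x)) \<partial>lborel)"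
proof -
  let ?h = "euclid_coords E" and ?g = "euclid_point E"
  have contg: "continuous_on UNIV ?g" and conth: "continuous_on UNIV ?h"
    by (simp_all add: linear_continuous_on linear_euclid_coords linear_euclid_point linear_linear)
  have mh[measurable]: "?h \<in> borel_measurable borel" and mg[measurable]: "?g \<in> borel_measurable borel"
    using contg conth by (auto intro: borel_measurable_continuous_onI)
  have [measurable]: "B \<in> sets borel" using B by simp
  have contphi: "continuous_on B \<phi>"
    using der by (auto intro!: continuous_at_imp_continuous_on has_derivative_continuous)
  have [measurable]: "(\<lambda>x. indicator B x *\<^sub>R \<phi> x) \<in> borel_measurable borel"
    using borel_measurable_continuous_on_indicator[OF _ contphi] by simp
  have vimB: "B \<inter> \<phi> -` S \<in> sets borel" if "S \<in> sets borel" for S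
  proof -
    have "(\<lambda>x. indicator B x *\<^sub>R \<phi> x) -` S \<inter> B \<in> sets borel"
      using measurable_sets_borel[of "\<lambda>x. indicator B x *\<^sub>R \<phi> x" borel S] that by simp
    also have "(\<lambda>x. indicator B x *\<^sub>R \<phi> x) -` S \<inter> B = B \<inter> \<phi> -` S" by auto
    finally show ?thesis .
  qed
  have key: "emeasure lborel (B \<inter> \<phi> -` S) = (\<integral>\<^sup>+x. ennreal (J x) * indicator S x \<partial>lborel)"
    if S: "S \<in> sets borel" "S \<subseteq> B" for S
  proof -
    define S' where "S' = ?g -` S"
    define f where "f y = ?h (\<phi> (?g y))" for y
    have S'b: "S' \<in> sets borel" using measurable_sets_borel[OF mg S(1)] by (simp add: S'_def)
    have eq: "f ` S' = ?g -` (B \<inter> \<phi> -` S)"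
    proof (intro set_eqI iffI)
      fix x assume "x \<in> f ` S'"
      then obtain y where "y \<in> S'" "x = f y" by blast
      then show "x \<in> ?g -` (B \<inter> \<phi> -` S)"
        using S(2) inv[of "?g y"] by (auto simp: S'_def f_def euclid_point_coords)
    next
      fix y assume "y \<in> ?g -` (B \<inter> \<phi> -` S)"
      then have y: "?g y \<in> B" "\<phi> (?g y) \<in> S" by auto
      then have "y = f (?h (\<phi> (?g y)))" "?h (\<phi> (?g y)) \<in> S'"
        using inv by (auto simp: f_def S'_def euclid_point_coords euclid_coords_point)
      then show "y \<in> f ` S'" by blast
    qed
    have mB: "B \<inter> \<phi> -` S \<in> sets borel" by (rule vimB[OF S(1)])
    have "?g -` (B \<inter> \<phi> -` S) \<in> sets borel" using measurable_sets_borel[OF mg mB] by simp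
    moreover have "bounded (?g -` (B \<inter> \<phi> -` S))"
    proof -
      have "?g -` (B \<inter> \<phi> -` S) \<subseteq> ?h ` B" 
        by (metis (no_types, lifting) IntD1 euclid_coords_point imageI subsetI vimageD)
      then show ?thesis
        using bounded_linear_image[OF B(2), of ?h] linear_euclid_coords bounded_subset
        by (auto simp: linear_linear)
    qed
    ultimately have fm: "f ` S' \<in> lmeasurable" unfolding eq
      by (intro bounded_set_imp_lmeasurable) (auto intro: sets_completionI_sets)
    have d: "(f has_derivative (\<lambda>y. ?h (\<phi>' (?g x) (?g y)))) (at x within S')" if "x \<in> S'" for x
    proof -
      have "?g x \<in> B" using that S by (auto simp: S'_def)
      then show ?thesis unfolding f_def
        by (intro has_derivative_compose[OF _ linear_imp_has_derivative[OF linear_euclid_coords]]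
          has_derivative_compose[OF linear_imp_has_derivative[OF linear_euclid_point] der])
    qed
    have inj: "inj_on f S'"
    proof (rule inj_onI)
      fix x y assume xy: "x \<in> S'" "y \<in> S'" "f x = f y"
      then have "\<phi> (?g x) = \<phi> (?g y)" unfolding f_def by (metis euclid_point_coords)
      then have "?g x = ?g y" using inv xy S by (metis S'_def subsetD vimageD)
      then show "x = y" by (metis euclid_coords_point)
    qed
    have "((\<lambda>x. \<bar>det (matrix (\<lambda>y. ?h (\<phi>' (?g x) (?g y))))\<bar>) has_integral measure lebesgue (f ` S')) S'"
      using has_measure_differentiable_image[OF _ d inj, of "measure lebesgue (f ` S')"] fm S'b by auto
    then have "((\<lambda>x. J (?g x)) has_integral measure lebesgue (f ` S')) S'"
      using J(1) S(2) unfolding real_det_def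
      by (subst (asm) has_integral_cong) (auto simp: S'_def)
    then have "((\<lambda>x. if x \<in> S' then J (?g x) else 0) has_integral measure lebesgue (f ` S')) UNIV"
      by (simp add: has_integral_restrict_UNIV)
    moreover have "(\<lambda>x. if x \<in> S' then J (?g x) else 0) \<in> borel_measurable borel"
      using J(2) S'b by measurable
    moreover have "0 \<le> (if x \<in> S' then J (?g x) else 0)" for x
      using J(1)[of "?g x"] S(2) by (auto simp: S'_def)
    ultimately have "(\<integral>\<^sup>+x. ennreal (if x \<in> S' then J (?g x) else 0) \<partial>lborel) = measure lebesgue (f ` S')"
      by (intro nn_integral_has_integral_lborel) auto
    also have "\<dots> = emeasure lebesgue (f ` S')"
      by (rule emeasure_eq_ennreal_measure[OF fmeasurableD2[OF fm], symmetric])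
    also have "\<dots> = emeasure lborel (?g -` (B \<inter> \<phi> -` S))"
      unfolding eq using \<open>?g -` (B \<inter> \<phi> -` S) \<in> sets borel\<close> by (simp add: emeasure_completion)
    also have "\<dots> = emeasure (distr lborel borel ?h) (?g -` (B \<inter> \<phi> -` S))"
      by (simp add: lborel_euclid_coords)
    also have "\<dots> = emeasure lborel (?h -` (?g -` (B \<inter> \<phi> -` S)))"
      using \<open>?g -` (B \<inter> \<phi> -` S) \<in> sets borel\<close> by (subst emeasure_distr) auto
    also have "?h -` (?g -` (B \<inter> \<phi> -` S)) = B \<inter> \<phi> -` S"
      by (auto simp: euclid_point_coords)
    finally have 1: "(\<integral>\<^sup>+x. ennreal (if x \<in> S' then J (?g x) else 0) \<partial>lborel) = emeasure lborel (B \<inter> \<phi> -` S)" .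
    have [measurable]: "J \<in> borel_measurable borel" "S' \<in> sets borel" by fact+
    have "(\<lambda>x. ennreal (if x \<in> S' then J (?g x) else 0)) \<in> borel_measurable borel" by measurable
    moreover have "(\<integral>\<^sup>+x. ennreal (if x \<in> S' then J (?g x) else 0) \<partial>lborel)
      = (\<integral>\<^sup>+x. ennreal (if x \<in> S' then J (?g x) else 0) \<partial>distr lborel borel ?h)"
      by (simp add: lborel_euclid_coords)
    moreover have "(\<integral>\<^sup>+x. ennreal (if ?h x \<in> S' then J (?g (?h x)) else 0) \<partial>lborel)
        = (\<integral>\<^sup>+x. ennreal (J x) * indicator S x \<partial>lborel)"
      by (auto simp: S'_def euclid_point_coords indicator_def intro!: nn_integral_cong)
    ultimately show ?thesis using 1 by (simp add: nn_integral_distr)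
  qed
  \<comment> \<open>\<phi> is only known to be continuous on B; the cut-off by the indicator makes
    it Borel on the whole space without changing it where the measure lives.\<close>
  define M where "M = distr (density lborel (indicator B)) borel (\<lambda>x. indicator B x *\<^sub>R \<phi> x)"
  have "M = density lborel (\<lambda>x. ennreal (J x) * indicator B x)"
  proof (rule measure_eqI)
    show "sets M = sets (density lborel (\<lambda>x. ennreal (J x) * indicator B x))" by (simp add: M_def)
    fix S assume "S \<in> sets M"
    then have S[measurable]: "S \<in> sets borel" by (simp add: M_def)
    have "emeasure M S = emeasure (density lborel (indicator B)) ((\<lambda>x. indicator B x *\<^sub>R \<phi> x) -` S)"
      unfolding M_def by (subst emeasure_distr) auto
    also have "\<dots> = (\<integral>\<^sup>+x. indicator B x * indicator ((\<lambda>x. indicator B x *\<^sub>R \<phi> x) -` S) x \<partial>lborel)"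
      using measurable_sets_borel[of "\<lambda>x. indicator B x *\<^sub>R \<phi> x" borel S]
      by (intro emeasure_density) auto
    also have "\<dots> = (\<integral>\<^sup>+x. indicator (B \<inter> \<phi> -` (S \<inter> B)) x \<partial>lborel)"
      using inv by (intro nn_integral_cong) (auto simp: indicator_def)
    also have "\<dots> = emeasure lborel (B \<inter> \<phi> -` (S \<inter> B))"
      using vimB[of "S \<inter> B"] by simp
    also have "\<dots> = (\<integral>\<^sup>+x. ennreal (J x) * indicator (S \<inter> B) x \<partial>lborel)"
      by (rule key) auto
    also have "\<dots> = emeasure (density lborel (\<lambda>x. ennreal (J x) * indicator B x)) S"
      using J(2) by (subst emeasure_density) (auto intro!: nn_integral_cong simp: indicator_def)
    finally show "emeasure M S = emeasure (density lborel (\<lambda>x. ennreal (J x) * indicator B x)) S" .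
  qed
  then have "(\<integral>\<^sup>+x. G x \<partial>M) = (\<integral>\<^sup>+x. G x \<partial>density lborel (\<lambda>x. ennreal (J x) * indicator B x))" by simp
  also have "\<dots> = (\<integral>\<^sup>+x. indicator B x * (G x * ennreal (J x)) \<partial>lborel)"
    using J(2) G by (subst nn_integral_density) (auto intro!: nn_integral_cong simp: ac_simps)
  also have "(\<integral>\<^sup>+x. G x \<partial>M) = (\<integral>\<^sup>+x. indicator B x * G (indicator B x *\<^sub>R \<phi> x) \<partial>lborel)"
    unfolding M_def using G by (simp add: nn_integral_distr nn_integral_density)
  also have "\<dots> = (\<integral>\<^sup>+x. indicator B x * G (\<phi> x) \<partial>lborel)"
    by (intro nn_integral_cong) (auto simp: indicator_def)
  finally show ?thesis by simp
qed

end

section \<open>Jacobians of the ball involutions\<close>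

definition rank_one_pert :: "complex^'n::finite \<Rightarrow> complex^'n \<Rightarrow> complex^'n \<Rightarrow> complex^'n"
  where "rank_one_pert \<psi> a v = v - hprod v a *s \<psi>"

lemma bounded_linear_vscale_right: "bounded_linear (\<lambda>v. c *s (v :: complex^'n::finite))"
  by (rule bounded_linear_intro[of _ "cmod c"])
    (simp_all add: vec_eq_iff algebra_simps norm_vscale)

lemma bounded_linear_hprod_left: "bounded_linear (\<lambda>z. hprod z a)"
  by (rule bounded_linear_intro[of _ "norm a"])
    (simp_all add: hprod_add_left scaleR_vec_eq hprod_scale_left scaleR_conv_of_real hprod_norm_le)

lemma bounded_linear_vscale_left: "bounded_linear (\<lambda>c. c *s (v :: complex^'n::finite))"
  by (rule bounded_linear_intro[of _ "norm v"])
    (simp_all add: vec_eq_iff algebra_simps norm_vscale)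

lemma linear_rank_one_pert: "linear (rank_one_pert \<psi> a)"
  unfolding rank_one_pert_def
  by (intro bounded_linear.linear bounded_linear_sub bounded_linear_ident
    bounded_linear_compose[OF bounded_linear_vscale_left bounded_linear_hprod_left])

text \<open>With one of the two vectors fixed these maps are closed under composition, and the
  quantity 1 - <psi,a> is multiplicative. This is how determinants of general perturbations are
  reduced to transvections and coordinate scalings.\<close>

lemma rank_one_pert_compose:
  "rank_one_pert \<psi> a (rank_one_pert \<psi>' a v) = rank_one_pert (\<psi>' + (1 - hprod \<psi>' a) *s \<psi>) a v"
  "rank_one_pert \<psi> a (rank_one_pert \<psi> a' v) = rank_one_pert \<psi> (a + cnj (1 - hprod \<psi> a) *s a') v"
  by (simp_all add: rank_one_pert_def vec_eq_iff hprod_simps algebra_simps)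

lemma rank_one_pert_zero: "rank_one_pert 0 a = (\<lambda>v. v)" "rank_one_pert \<psi> 0 = (\<lambda>v. v)"
  by (simp_all add: rank_one_pert_def fun_eq_iff)

lemma norm_vec_sq: "(norm v)\<^sup>2 = (\<Sum>i\<in>UNIV. (cmod ((v :: complex^'n::finite) $ i))\<^sup>2)"
  by (simp add: norm_vec_def L2_set_def sum_nonneg)

context
  fixes E :: "'m::{finite,wellorder} \<Rightarrow> complex ^ 'n::finite"
  assumes E: "bij_betw E UNIV Basis"
begin

lemma CARD_E: "CARD('m) = 2 * CARD('n)"
proof -
  have "CARD('m) = DIM(complex ^ 'n)" using bij_betw_same_card[OF E] by simp
  then show ?thesis by simp
qed

text \<open>A transvection is the product of two involutions.\<close>

lemma real_det_transvection:
  assumes 0: "hprod \<psi> a = 0"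
  shows "\<bar>real_det E (rank_one_pert \<psi> a)\<bar> = 1"
proof (cases "a = 0")
  case True
  then show ?thesis using real_det_id[OF E] by (simp add: rank_one_pert_zero)
next
  case False
  define A where "A = hprod a a"
  have A: "A \<noteq> 0" using False by (simp add: A_def hprod_self)
  \<comment> \<open>A perturbation whose vector pairs with a to 2 is its own inverse, so its
    determinant is 1 or -1. Both \<rho> and \<psi> + \<rho> have pairing 2, and they differ by the
    transvection.\<close>
  define \<rho> where "\<rho> = (2 / A) *s a"
  have \<rho>: "hprod \<rho> a = 2" using A by (simp add: \<rho>_def hprod_scale_left A_def)
  have sq: "\<bar>real_det E (rank_one_pert \<xi> a)\<bar> = 1" if "hprod \<xi> a = 2" for \<xi>
  proof -
    have "real_det E (\<lambda>v. rank_one_pert \<xi> a (rank_one_pert \<xi> a v)) = 1"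
      using real_det_id[OF E] by (simp add: rank_one_pert_compose(1) that rank_one_pert_zero)
    then have "(real_det E (rank_one_pert \<xi> a))\<^sup>2 = 1"
      by (simp add: real_det_compose[OF E linear_rank_one_pert linear_rank_one_pert] power2_eq_square)
    then show ?thesis by (simp add: power2_eq_1_iff) (metis abs_1 abs_minus_cancel)
  qed
  have "rank_one_pert \<rho> a (rank_one_pert \<psi> a v) = rank_one_pert (\<psi> + \<rho>) a v" for v
    by (simp add: rank_one_pert_compose(1) 0)
  then have "real_det E (rank_one_pert \<rho> a) * real_det E (rank_one_pert \<psi> a)
      = real_det E (rank_one_pert (\<psi> + \<rho>) a)"
    by (simp add: real_det_compose[OF E linear_rank_one_pert linear_rank_one_pert, symmetric])
  then have "\<bar>real_det E (rank_one_pert \<rho> a)\<bar> * \<bar>real_det E (rank_one_pert \<psi> a)\<bar>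
      = \<bar>real_det E (rank_one_pert (\<psi> + \<rho>) a)\<bar>" by (simp add: abs_mult[symmetric])
  then show ?thesis using sq[of \<rho>] sq[of "\<psi> + \<rho>"] \<rho> 0 by (simp add: hprod_add_left)
qed

text \<open>Polar form of c: the unimodular factor is an isometry, and the modulus acts diagonally
  on the real basis, scaling exactly the two vectors \<open>axis k 1\<close> and
  \<open>axis k \<i>\<close>; hence the square.\<close>

lemma real_det_coordinate_scale:
  fixes k :: 'n and c :: complex
  assumes c: "c \<noteq> 0"
  defines "L \<equiv> \<lambda>c (v :: complex^'n). (\<chi> i. if i = k then c * v $ i else v $ i)"
  shows "\<bar>real_det E (L c)\<bar> = (cmod c)\<^sup>2"
proof -
  have lin: "linear (L c)" for c
    by (intro linearI) (auto simp: L_def vec_eq_iff algebra_simps)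
  define u where "u = c / cmod c"
  have u: "cmod u = 1" using c by (simp add: u_def norm_divide)
  have "norm (L u v) = norm v" for v
  proof -
    have "(norm (L u v))\<^sup>2 = (norm v)\<^sup>2" unfolding norm_vec_sq
      by (intro sum.cong refl) (simp add: L_def norm_mult u)
    then show ?thesis by simp
  qed
  then have 1: "\<bar>real_det E (L u)\<bar> = 1" by (rule real_det_isometry[OF E lin])
  define d where "d j = (if E j $ k = 0 then 1 else cmod c)" for j
  have EB: "E j \<in> Basis" for j using E by (auto simp: bij_betw_def)
  have "L (cmod c) (E j) = d j *\<^sub>R E j" for j
  proof -
    obtain i b where ib: "E j = axis i b" "b \<noteq> 0"
      using EB[of j] nonzero_Basis unfolding Basis_vec_def by blast
    show ?thesis
      by (cases "i = k") (simp_all add: ib L_def vec_eq_iff d_def axis_def scaleR_conv_of_real[where 'a=complex])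
  qed
  then have "real_det E (L (cmod c)) = (\<Prod>j\<in>UNIV. d j)" by (rule real_det_diag[OF E])
  also have "\<dots> = (\<Prod>b\<in>(Basis :: (complex^'n) set). if b $ k = 0 then 1 else cmod c)"
    unfolding d_def
    by (rule prod.reindex_bij_betw[OF E, of "\<lambda>b. if b $ k = 0 then 1 else cmod c"])
  also have "\<dots> = (\<Prod>b\<in>{b\<in>(Basis :: (complex^'n) set). b $ k \<noteq> 0}. cmod c)"
    by (subst prod.inter_filter) (auto intro!: prod.cong)
  also have "{b\<in>(Basis :: (complex^'n) set). b $ k \<noteq> 0} = {axis k 1, axis k \<i>}"
  proof -
    have "axis x v $ k = (if x = k then v else 0)" for x and v :: complex by (simp add: axis_def)
    then show ?thesis by (auto simp: Basis_vec_def Basis_complex_def split: if_splits)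
  qed
  also have "(\<Prod>b\<in>{axis k 1, axis k \<i>}. cmod c) = (cmod c)\<^sup>2"
    by (simp add: axis_eq_axis power2_eq_square)
  finally have 2: "real_det E (L (cmod c)) = (cmod c)\<^sup>2" .
  have "L c = (\<lambda>v. L u (L (cmod c) v))"
    using c by (auto simp: L_def fun_eq_iff vec_eq_iff u_def)
  then have "real_det E (L c) = real_det E (L u) * real_det E (L (cmod c))"
    by (simp add: real_det_compose[OF E lin lin, symmetric])
  then show ?thesis using 1 2 by (simp add: abs_mult)
qed

lemma real_det_scale: "\<bar>real_det E (\<lambda>v. c *s v)\<bar> = cmod c ^ (2 * CARD('n))"
proof -
  define u where "u = (if c = 0 then 1 else c / cmod c)"
  have u: "cmod u = 1" by (simp add: u_def norm_divide)
  have lin: "linear (\<lambda>v. c *s (v::complex^'n))" for c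
    by (rule bounded_linear.linear[OF bounded_linear_vscale_right])
  have 1: "\<bar>real_det E (\<lambda>v. u *s v)\<bar> = 1"
    by (rule real_det_isometry[OF E lin]) (simp add: norm_vscale u)
  have "real_det E (\<lambda>v. complex_of_real (cmod c) *s v) = (\<Prod>j\<in>(UNIV::'m set). cmod c)"
    by (rule real_det_diag[OF E]) (simp add: scaleR_vec_eq)
  then have 2: "real_det E (\<lambda>v. complex_of_real (cmod c) *s v) = cmod c ^ (2 * CARD('n))"
    by (simp add: CARD_E)
  have "(\<lambda>v. c *s v) = (\<lambda>v::complex^'n. u *s (complex_of_real (cmod c) *s v))"
    by (auto simp: fun_eq_iff vec_eq_iff u_def)
  then have "real_det E (\<lambda>v. c *s v) = real_det E (\<lambda>v. u *s v) * real_det E (\<lambda>v. complex_of_real (cmod c) *s v)"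
    by (simp add: real_det_compose[OF E lin lin, symmetric])
  then show ?thesis using 1 2 by (simp add: abs_mult)
qed

text \<open>The complex determinant of v - <v,a> psi is 1 - <psi,a>, and the real determinant is its
  squared modulus. Here transvections move first \<psi> and then a onto one coordinate axis with the
  pairing unchanged, until only a scaling of coordinate k is left.\<close>

lemma real_det_rank_one_pert:
  assumes c: "1 - hprod \<psi> a \<noteq> 0"
  shows "\<bar>real_det E (rank_one_pert \<psi> a)\<bar> = (cmod (1 - hprod \<psi> a))\<^sup>2"
proof (cases "a = 0")
  case True
  then show ?thesis using real_det_id[OF E] by (simp add: rank_one_pert_zero)
next
  case False
  then obtain k where k: "a $ k \<noteq> 0" by (auto simp: vec_eq_iff)
  define t where "t = hprod \<psi> a"
  \<comment> \<open>Vectors on axis k with the same pairing t, at an index where a does not vanish.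
    The corrections \<open>\<psi>0\<close> and \<open>a0\<close> below have pairing 0 and are scaled
    so that the composition rule returns \<psi> and a.\<close>
  define \<psi>1 where "\<psi>1 = axis k (t / cnj (a $ k))"
  define a1 where "a1 = axis k (a $ k)"
  have h1: "hprod \<psi>1 a = t" "hprod \<psi>1 a1 = t"
    using k by (simp_all add: \<psi>1_def a1_def hprod_def axis_def if_distrib[of "\<lambda>u. u * _"]
      if_distrib[of cnj] cong: if_cong)
  have c': "1 - t \<noteq> 0" using c by (simp add: t_def)
  define \<psi>0 where "\<psi>0 = (1 / (1 - t)) *s (\<psi> - \<psi>1)"
  define a0 where "a0 = (1 / cnj (1 - t)) *s (a - a1)"
  have c'': "cnj (1 - t) \<noteq> 0" using c' by (metis complex_cnj_zero_iff)
  have 0: "hprod \<psi>0 a = 0" "hprod \<psi>1 a0 = 0"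
    by (simp_all add: \<psi>0_def a0_def hprod_simps h1 t_def[symmetric])
  have "rank_one_pert \<psi> a v = rank_one_pert \<psi>0 a (rank_one_pert \<psi>1 a v)" for v
  proof -
    have "\<psi>1 + (1 - t) *s \<psi>0 = \<psi>"
      using c' by (simp add: \<psi>0_def vector_smult_assoc del: vector_ssub_ldistrib)
    then show ?thesis unfolding rank_one_pert_compose(1) h1 by simp
  qed
  then have "rank_one_pert \<psi> a = (\<lambda>v. rank_one_pert \<psi>0 a (rank_one_pert \<psi>1 a v))" by blast
  then have "\<bar>real_det E (rank_one_pert \<psi> a)\<bar> = \<bar>real_det E (rank_one_pert \<psi>1 a)\<bar>"
    by (simp add: real_det_compose[OF E linear_rank_one_pert linear_rank_one_pert] abs_mult
      real_det_transvection 0)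
  also have "rank_one_pert \<psi>1 a v = rank_one_pert \<psi>1 a1 (rank_one_pert \<psi>1 a0 v)" for v
  proof -
    have "a1 + cnj (1 - t) *s a0 = a"
      using c'' unfolding a0_def by (simp add: vector_smult_assoc del: vector_ssub_ldistrib complex_cnj_diff)
    then show ?thesis unfolding rank_one_pert_compose(2) h1 by simp
  qed
  then have "rank_one_pert \<psi>1 a = (\<lambda>v. rank_one_pert \<psi>1 a1 (rank_one_pert \<psi>1 a0 v))" by blast
  then have "\<bar>real_det E (rank_one_pert \<psi>1 a)\<bar> = \<bar>real_det E (rank_one_pert \<psi>1 a1)\<bar>"
    by (simp add: real_det_compose[OF E linear_rank_one_pert linear_rank_one_pert] abs_mult
      real_det_transvection 0)
  also have "rank_one_pert \<psi>1 a1 = (\<lambda>v. \<chi> i. if i = k then (1 - t) * v $ i else v $ i)"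
    using k by (auto simp: rank_one_pert_def fun_eq_iff vec_eq_iff a1_def \<psi>1_def hprod_def axis_def
      if_distrib[of "\<lambda>u. _ * u"] if_distrib[of cnj] algebra_simps cong: if_cong)
  finally show ?thesis using real_det_coordinate_scale[OF c'] by (simp add: t_def)
qed

end

text \<open>Differentiating the denominator in \<open>ball_involution_eq\<close> reproduces phi_a(z)
  itself; collecting the terms leaves a scalar times a rank one perturbation of the identity, the
  form in which the determinant is known.\<close>

definition involution_deriv :: "complex^'n::finite \<Rightarrow> complex^'n \<Rightarrow> complex^'n \<Rightarrow> complex^'n"
  where "involution_deriv a z v = (- srt a / (1 - hprod z a)) *s
    rank_one_pert ((1 / srt a) *s (ball_involution a z - (1 / (1 + srt a)) *s a)) a v"

lemma involution_deriv_scale: "involution_deriv a z (c *s v) = c *s involution_deriv a z v"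
proof -
  have "rank_one_pert \<psi> a (c *s v) = c *s rank_one_pert \<psi> a v" for \<psi>
    by (simp add: rank_one_pert_def hprod_scale_left vec_eq_iff algebra_simps)
  then show ?thesis by (simp only: involution_deriv_def vector_smult_assoc mult.commute)
qed

lemma has_derivative_ball_involution:
  assumes a: "norm a < 1" and z: "norm z < 1"
  shows "(ball_involution a has_derivative involution_deriv a z) (at z)"
proof -
  interpret bs: bounded_bilinear "\<lambda>c (v :: complex^'n). c *s v"
  proof
    show "\<exists>K. \<forall>a (b::complex^'n). norm (a *s b) \<le> norm a * norm b * K"
      by (intro exI[of _ 1]) (simp add: norm_vscale)
  qed (simp_all add: vec_eq_iff algebra_simps)
  have nz: "1 - hprod z a \<noteq> 0" using one_minus_hprod_nz[of z a] a z by simp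
  define S where "S = srt a"
  have S: "S \<noteq> 0" "1 + S \<noteq> 0" using srt_nz[OF a] by (auto simp: S_def)
  have h: "((\<lambda>z. hprod z a) has_derivative (\<lambda>v. hprod v a)) (at z)"
    by (rule bounded_linear_imp_has_derivative[OF bounded_linear_hprod_left])
  have "((\<lambda>z. (1 / (1 - hprod z a)) *s (a - S *s z - (hprod z a / (1 + S)) *s a)) has_derivative
    (\<lambda>v. (1 / (1 - hprod z a)) *s (- (S *s v) - (hprod v a / (1 + S)) *s a)
       + (hprod v a / (1 - hprod z a)\<^sup>2) *s (a - S *s z - (hprod z a / (1 + S)) *s a))) (at z)"
  proof (rule bs.FDERIV)
    show "((\<lambda>z. 1 / (1 - hprod z a)) has_derivative (\<lambda>v. hprod v a / (1 - hprod z a)\<^sup>2)) (at z)"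
      using nz by (auto intro!: derivative_eq_intros h simp: power2_eq_square)
    have "((\<lambda>z. (1 / (1 + S)) * hprod z a) has_derivative (\<lambda>v. (1 / (1 + S)) * hprod v a)) (at z)"
      by (intro has_derivative_mult_right h)
    then have "((\<lambda>z. (1 / (1 + S) * hprod z a) *s a) has_derivative
        (\<lambda>v. (1 / (1 + S) * hprod v a) *s a)) (at z)"
      by (rule bounded_linear.has_derivative[OF bounded_linear_vscale_left])
    from has_derivative_diff[OF has_derivative_diff[OF has_derivative_const
        bounded_linear_imp_has_derivative[OF bounded_linear_vscale_right]] this]
    show "((\<lambda>z. a - S *s z - (hprod z a / (1 + S)) *s a) has_derivative
      (\<lambda>v. - (S *s v) - (hprod v a / (1 + S)) *s a)) (at z)"
      by simp
  qed
  moreover have "(\<lambda>v. (1 / (1 - hprod z a)) *s (- (S *s v) - (hprod v a / (1 + S)) *s a)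
       + (hprod v a / (1 - hprod z a)\<^sup>2) *s (a - S *s z - (hprod z a / (1 + S)) *s a)) = involution_deriv a z"
    using nz S unfolding involution_deriv_def rank_one_pert_def ball_involution_eq[OF a] S_def[symmetric]
    by (auto simp: fun_eq_iff vec_eq_iff power2_eq_square divide_simps) (auto simp: algebra_simps)
  moreover have "ball_involution a = (\<lambda>z. (1 / (1 - hprod z a)) *s (a - S *s z - (hprod z a / (1 + S)) *s a))"
    using ball_involution_eq[OF a] by (auto simp: S_def)
  ultimately show ?thesis by simp
qed

text \<open>The scalar factor contributes the n-th power of |S/(1 - <z,a>)|^2, and the perturbation,
  for which 1 - <psi,a> = S/(1 - <z,a>), contributes one more such factor; hence the exponent n +
  1.\<close>

lemma real_det_involution_deriv:
  fixes E :: "'m::{finite,wellorder} \<Rightarrow> complex ^ 'n::finite"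
  assumes E: "bij_betw E UNIV Basis" and a: "norm a < 1" and z: "norm z < 1"
  shows "\<bar>real_det E (involution_deriv a z)\<bar> = ((1 - (norm a)\<^sup>2) / (cmod (1 - hprod z a))\<^sup>2) ^ (CARD('n) + 1)"
proof -
  have nz: "1 - hprod z a \<noteq> 0" using one_minus_hprod_nz[of z a] a z by simp
  define S where "S = srt a"
  have S: "S \<noteq> 0" "1 + S \<noteq> 0" using srt_nz[OF a] by (auto simp: S_def)
  have SS: "hprod a a = 1 - S * S" using srt_sq[OF a] by (simp add: S_def)
  define \<psi> where "\<psi> = (1 / S) *s (ball_involution a z - (1 / (1 + S)) *s a)"
  have "hprod (ball_involution a z) a = 1 - S * S / (1 - hprod z a)"
    using hprod_ball_involution_self[OF a nz] SS by (simp add: algebra_simps)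
  then have "hprod \<psi> a = (1 / S) * (1 - S * S / (1 - hprod z a) - (1 / (1 + S)) * (1 - S * S))"
    unfolding \<psi>_def hprod_scale_left hprod_diff_left SS by simp
  also have "(1 / (1 + S)) * (1 - S * S) = 1 - S" using S by (simp add: field_simps)
  also have "1 - S * S / (1 - hprod z a) - (1 - S) = S * (1 - S / (1 - hprod z a))"
    by (simp add: algebra_simps)
  finally have \<psi>: "1 - hprod \<psi> a = S / (1 - hprod z a)" using S by simp
  have lin: "linear (\<lambda>v. c *s (v::complex^'n))" for c
    by (rule bounded_linear.linear[OF bounded_linear_vscale_right])
  have "involution_deriv a z = (\<lambda>v. (- S / (1 - hprod z a)) *s rank_one_pert \<psi> a v)"
    by (auto simp: involution_deriv_def \<psi>_def S_def)
  then have "\<bar>real_det E (involution_deriv a z)\<bar>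
     = cmod (- S / (1 - hprod z a)) ^ (2 * CARD('n)) * (cmod (1 - hprod \<psi> a))\<^sup>2"
    using real_det_rank_one_pert[OF E, of \<psi> a] \<psi> S nz
    by (simp only: real_det_compose[OF E lin linear_rank_one_pert] real_det_scale[OF E] abs_mult)
      simp
  also have "\<dots> = ((cmod S / cmod (1 - hprod z a))\<^sup>2) ^ (CARD('n) + 1)"
    unfolding \<psi>
    by (simp only: norm_minus_cancel minus_divide_left[symmetric] norm_divide power_mult power_add
      power_one_right)
  also have "(cmod S / cmod (1 - hprod z a))\<^sup>2 = (1 - (norm a)\<^sup>2) / (cmod (1 - hprod z a))\<^sup>2"
    using norm_sq_less_one[OF a] by (simp add: S_def srt_def power_divide)
  finally show ?thesis .
qed

text \<open>The index type \<open>'n bit0\<close> is finite and well-ordered with 2 * CARD('n)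
  elements, the real dimension of the space.\<close>

lemma ex_basis_enum: "\<exists>E :: 'n bit0 \<Rightarrow> complex ^ 'n::finite. bij_betw E UNIV Basis"
  by (rule finite_same_card_bij) simp_all

lemma nn_integral_ball_involution:
  fixes a :: "complex ^ 'n::finite" and G :: "complex ^ 'n \<Rightarrow> ennreal"
  assumes a: "norm a < 1" and G: "G \<in> borel_measurable borel"
  shows "(\<integral>\<^sup>+x. indicator (ball 0 1) x * G (ball_involution a x) \<partial>lborel) =
    (\<integral>\<^sup>+x. indicator (ball 0 1) x *
       (G x * ennreal (((1 - (norm a)\<^sup>2) / (cmod (1 - hprod x a))\<^sup>2) ^ (CARD('n) + 1))) \<partial>lborel)"
proof -
  obtain E :: "'n bit0 \<Rightarrow> complex ^ 'n" where E: "bij_betw E UNIV Basis" using ex_basis_enum by blast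
  show ?thesis
  proof (rule nn_integral_involution[OF E, where \<phi>' = "involution_deriv a"])
    show "x \<in> ball 0 1 \<Longrightarrow> (ball_involution a has_derivative involution_deriv a x) (at x)" for x
      using has_derivative_ball_involution[OF a] by simp
    show "x \<in> ball 0 1 \<Longrightarrow> ball_involution a x \<in> ball 0 1 \<and> ball_involution a (ball_involution a x) = x" for x
      using ball_involution_in_ball[OF a] ball_involution_involution[OF a] one_minus_hprod_nz[of x a] a by simp
    show "x \<in> ball 0 1 \<Longrightarrow> \<bar>real_det E (involution_deriv a x)\<bar>
      = ((1 - (norm a)\<^sup>2) / (cmod (1 - hprod x a))\<^sup>2) ^ (CARD('n) + 1)" for x
      using real_det_involution_deriv[OF E a] by simp
    have [measurable]: "(\<lambda>x. hprod x a) \<in> borel_measurable borel"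
      by (intro borel_measurable_continuous_onI linear_continuous_on bounded_linear_hprod_left)
    show "(\<lambda>x. ((1 - (norm a)\<^sup>2) / (cmod (1 - hprod x a))\<^sup>2) ^ (CARD('n) + 1)) \<in> borel_measurable borel"
      by measurable
  qed (use G in auto)
qed

section \<open>The weighted probability measures on the ball\<close>

lemma dyadic_bracket:
  fixes x :: real
  assumes "0 < x" "x \<le> 1"
  shows "\<exists>k. (1/2) ^ Suc k < x \<and> x \<le> (1/2) ^ k"
proof -
  obtain n where n: "(1/2::real) ^ n < x"
    using real_arch_pow_inv[OF assms(1), of "1/2"] by auto
  define m where "m = (LEAST n. (1/2::real) ^ n < x)"
  have m: "(1/2) ^ m < x" unfolding m_def by (rule LeastI[of _ n]) (rule n)
  have "m \<noteq> 0" using m assms by (cases m) auto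
  then obtain k where k: "m = Suc k" by (cases m) auto
  have "\<not> (1/2) ^ k < x" using not_less_Least[of k "\<lambda>n. (1/2::real) ^ n < x"] k by (simp add: m_def)
  then show ?thesis using m k by (intro exI[of _ k]) auto
qed

lemma ennreal_le_suminf: "f k \<le> (\<Sum>k. f k :: ennreal)"
  using sum_le_suminf[of f "{k}"] by (simp add: summableI)

lemma measurable_hprod_left [measurable]: "(\<lambda>z. hprod z a) \<in> borel_measurable borel"
  by (intro borel_measurable_continuous_onI linear_continuous_on bounded_linear_hprod_left)

lemma nn_integral_lebesgue_on:
  assumes "S \<in> sets borel"
  shows "nn_integral (lebesgue_on S) f = (\<integral>\<^sup>+x. indicator S x * f x \<partial>lborel)"
proof -
  have "nn_integral (lebesgue_on S) f = (\<integral>\<^sup>+x. f x * indicator S x \<partial>lebesgue)"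
    using assms by (intro nn_integral_restrict_space) simp
  then show ?thesis by (simp add: nn_integral_completion mult.commute)
qed

lemma emeasure_shell:
  fixes k :: nat
  shows "emeasure lborel {x :: 'a::euclidean_space. norm x < 1 \<and> 1 - norm x \<le> (1/2) ^ k}
    \<le> ennreal (unit_ball_vol DIM('a) * DIM('a) * (1/2) ^ k)"
proof -
  define r where "r = 1 - (1/2::real) ^ k"
  have r: "0 \<le> r" "r \<le> 1" by (auto simp: r_def power_le_one)
  have "{x :: 'a. norm x < 1 \<and> 1 - norm x \<le> (1/2) ^ k} = ball 0 1 - ball 0 r"
    by (auto simp: r_def)
  then have "emeasure lborel {x :: 'a. norm x < 1 \<and> 1 - norm x \<le> (1/2) ^ k}
     = emeasure lborel (ball (0::'a) 1) - emeasure lborel (ball (0::'a) r)"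
    using r by (simp add: emeasure_Diff ball_subset_ball_iff emeasure_ball)
  also have "\<dots> = ennreal (unit_ball_vol DIM('a) * (1 - r ^ DIM('a)))"
    using r by (simp add: emeasure_ball ennreal_minus algebra_simps)
  also have "\<dots> \<le> ennreal (unit_ball_vol DIM('a) * (DIM('a) * (1/2) ^ k))"
  proof (intro ennreal_leI mult_left_mono)
    have "1 + real DIM('a) * (- ((1/2) ^ k)) \<le> (1 + (- ((1/2) ^ k))) ^ DIM('a)"
      by (rule Bernoulli_inequality) (simp add: power_le_one)
    then show "1 - r ^ DIM('a) \<le> real DIM('a) * (1/2) ^ k" by (simp add: r_def)
  qed simp
  finally show ?thesis by (simp add: mult.assoc)
qed

lemma one_minus_norm_sq_pos: "norm z < 1 \<Longrightarrow> 0 < 1 - (norm z)\<^sup>2"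
  by (simp add: abs_square_less_1)

lemma one_minus_norm_sq_ge: "norm z < 1 \<Longrightarrow> 1 - norm z \<le> 1 - (norm z)\<^sup>2"
  by (simp add: power2_eq_square mult_left_le)

text \<open>The delicate case is t < 0. On the layer 2^(-(k+1)) < 1 - |x| <= 2^(-k) the weight is at
  most 2^(-(k+1)t), and the shell 1 - |x| <= 2^(-k) has volume of order 2^(-k) by Bernoulli's
  inequality; the resulting geometric series has ratio 2^(-(1+t)), which is below 1 exactly because
  t > -1.\<close>

lemma ball_weight_finite:
  fixes t :: real
  assumes t: "t > -1"
  shows "(\<integral>\<^sup>+x. indicator (ball (0::'a::euclidean_space) 1) x * ennreal ((1 - (norm x)\<^sup>2) powr t) \<partial>lborel) < \<infinity>"
proof -
  have base: "(\<integral>\<^sup>+x. indicator (ball (0::'a) 1) x \<partial>lborel) < \<infinity>"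
    by (simp add: emeasure_ball)
  show ?thesis
  proof (cases "t \<ge> 0")
    case True
    have "(\<integral>\<^sup>+x. indicator (ball (0::'a) 1) x * ennreal ((1 - (norm x)\<^sup>2) powr t) \<partial>lborel)
       \<le> (\<integral>\<^sup>+x. indicator (ball (0::'a) 1) x \<partial>lborel)"
    proof (intro nn_integral_mono)
      fix x :: 'a
      have "(1 - (norm x)\<^sup>2) powr t \<le> 1" if "norm x < 1"
        using True one_minus_norm_sq_pos[OF that] by (intro powr_le1) auto
      then show "indicator (ball (0::'a) 1) x * ennreal ((1 - (norm x)\<^sup>2) powr t) \<le> indicator (ball 0 1) x"
        by (auto simp: indicator_def ennreal_le_1)
    qed
    then show ?thesis using base by (rule le_less_trans)
  next
    case False
    define V where "V = unit_ball_vol DIM('a) * DIM('a)"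
    have V: "V \<ge> 0" by (simp add: V_def)
    define S where "S k = {x :: 'a. norm x < 1 \<and> 1 - norm x \<le> (1/2) ^ k}" for k :: nat
    have [measurable]: "S k \<in> sets borel" for k unfolding S_def by measurable
    have "(\<integral>\<^sup>+x. indicator (ball (0::'a) 1) x * ennreal ((1 - (norm x)\<^sup>2) powr t) \<partial>lborel)
       \<le> (\<integral>\<^sup>+x. (\<Sum>k. ennreal (((1/2) ^ Suc k) powr t) * indicator (S k) x) \<partial>lborel)"
    proof (intro nn_integral_mono)
      fix x :: 'a
      show "indicator (ball (0::'a) 1) x * ennreal ((1 - (norm x)\<^sup>2) powr t)
        \<le> (\<Sum>k. ennreal (((1/2) ^ Suc k) powr t) * indicator (S k) x)"
      proof (cases "norm x < 1")
        case True
        then obtain k where k: "(1/2) ^ Suc k < 1 - norm x" "1 - norm x \<le> (1/2) ^ k"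
          using dyadic_bracket[of "1 - norm x"] by auto
        have "(1 - (norm x)\<^sup>2) powr t \<le> ((1/2) ^ Suc k) powr t"
          using False one_minus_norm_sq_ge[OF True] k by (intro powr_mono2') auto
        then have "indicator (ball (0::'a) 1) x * ennreal ((1 - (norm x)\<^sup>2) powr t)
          \<le> ennreal (((1/2) ^ Suc k) powr t) * indicator (S k) x"
          using True k by (auto simp: S_def ennreal_leI)
        also have "\<dots> \<le> (\<Sum>k. ennreal (((1/2) ^ Suc k) powr t) * indicator (S k) x)"
          by (rule ennreal_le_suminf)
        finally show ?thesis .
      qed simp
    qed
    also have "\<dots> = (\<Sum>k. ennreal (((1/2) ^ Suc k) powr t) * emeasure lborel (S k))"
      by (subst nn_integral_suminf) (auto simp: nn_integral_cmult)
    also have "\<dots> \<le> (\<Sum>k. ennreal ((V * (1/2) powr t) * ((1/2) powr (1 + t)) ^ k))"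
    proof (intro suminf_le summableI)
      fix k
      have "ennreal (((1/2) ^ Suc k) powr t) * emeasure lborel (S k)
         \<le> ennreal (((1/2) ^ Suc k) powr t) * ennreal (V * (1/2) ^ k)"
        unfolding S_def V_def by (intro mult_left_mono emeasure_shell) simp
      also have "\<dots> = ennreal (((1/2) ^ Suc k) powr t * (V * (1/2) ^ k))"
        using V by (simp add: ennreal_mult)
      also have "((1/2) ^ Suc k) powr t * (V * (1/2) ^ k) = (V * (1/2) powr t) * ((1/2) powr (1 + t)) ^ k"
      proof -
        define q :: real where "q = 1/2"
        have q: "q > 0" by (simp add: q_def)
        have "(q ^ Suc k) powr t * q ^ k = q powr (real (Suc k) * t) * q powr real k"
          using q by (simp only: powr_realpow[symmetric] powr_powr)
        also have "\<dots> = q powr t * q powr ((1 + t) * real k)"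
          by (simp add: powr_add[symmetric] algebra_simps)
        also have "q powr ((1 + t) * real k) = (q powr (1 + t)) ^ k"
          using q by (simp add: powr_realpow[symmetric] powr_powr)
        finally show ?thesis by (simp add: q_def)
      qed
      finally show "ennreal (((1/2) ^ Suc k) powr t) * emeasure lborel (S k)
         \<le> ennreal ((V * (1/2) powr t) * ((1/2) powr (1 + t)) ^ k)" .
    qed
    also have "\<dots> < \<infinity>"
    proof -
      have "(1/2::real) powr (1 + t) < 1" using t powr_less_mono'[of "1/2::real" 0 "1 + t"] by simp
      then have "summable (\<lambda>k. (V * (1/2) powr t) * ((1/2) powr (1 + t)) ^ k)"
        by (intro summable_mult summable_geometric) auto
      then show ?thesis using V by (subst suminf_ennreal2) auto
    qed
    finally show ?thesis .
  qed
qed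

lemma measurable_weight [measurable]: "(\<lambda>z::complex^'n::finite. (1 - (norm z)\<^sup>2) powr t) \<in> borel_measurable borel"
  by measurable

lemma ball_measurable [measurable]: "ball (c::'a::metric_space) r \<in> sets borel"
  by simp

lemma ball_weight_integral:
  fixes t :: real
  assumes t: "t > -1"
  defines "I \<equiv> LINT z|lebesgue_on (ball (0 :: complex ^ 'n::finite) 1). (1 - (norm z)\<^sup>2) powr t"
  shows "(\<integral>\<^sup>+x. indicator (ball (0::complex^'n) 1) x * ennreal ((1 - (norm x)\<^sup>2) powr t) \<partial>lborel) = ennreal I"
    and "I > 0"
proof -
  let ?M = "lebesgue_on (ball (0 :: complex ^ 'n) 1)"
  have m: "(\<lambda>z. (1 - (norm z)\<^sup>2) powr t) \<in> borel_measurable ?M"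
    by (intro measurable_restrict_space1 measurable_completion) simp
  have nn: "(\<integral>\<^sup>+x. ennreal ((1 - (norm x)\<^sup>2) powr t) \<partial>?M)
    = (\<integral>\<^sup>+x. indicator (ball (0::complex^'n) 1) x * ennreal ((1 - (norm x)\<^sup>2) powr t) \<partial>lborel)"
    by (rule nn_integral_lebesgue_on) simp
  have "integrable ?M (\<lambda>z. (1 - (norm z)\<^sup>2) powr t)"
    using m ball_weight_finite[OF t, where 'a="complex^'n"] nn by (intro integrableI_nonneg) auto
  then have "(\<integral>\<^sup>+x. ennreal ((1 - (norm x)\<^sup>2) powr t) \<partial>?M) = ennreal I"
    unfolding I_def by (intro nn_integral_eq_integral) auto
  then show 1: "(\<integral>\<^sup>+x. indicator (ball (0::complex^'n) 1) x * ennreal ((1 - (norm x)\<^sup>2) powr t) \<partial>lborel) = ennreal I"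
    using nn by simp
  have m2: "(\<lambda>x. indicator (ball (0::complex^'n) 1) x * ennreal ((1 - (norm x)\<^sup>2) powr t))
      \<in> borel_measurable borel"
    by measurable
  then have m2': "(\<lambda>x. indicator (ball (0::complex^'n) 1) x * ennreal ((1 - (norm x)\<^sup>2) powr t))
      \<in> borel_measurable lborel"
    by (subst measurable_cong_sets[OF sets_lborel refl])
  have "(\<integral>\<^sup>+x. indicator (ball (0::complex^'n) 1) x * ennreal ((1 - (norm x)\<^sup>2) powr t) \<partial>lborel) \<noteq> 0"
  proof
    assume "(\<integral>\<^sup>+x. indicator (ball (0::complex^'n) 1) x * ennreal ((1 - (norm x)\<^sup>2) powr t) \<partial>lborel) = 0"
    then have "AE x in lborel. indicator (ball (0::complex^'n) 1) x * ennreal ((1 - (norm x)\<^sup>2) powr t) = 0"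
      using m2' by (subst (asm) nn_integral_0_iff_AE)
    then have "AE x in lborel. x \<notin> ball (0::complex^'n) 1"
      by eventually_elim (auto simp: indicator_def abs_square_less_1 split: if_splits dest: one_minus_norm_sq_pos)
    then have "emeasure lborel (ball (0::complex^'n) 1) = 0"
      using AE_iff_null_sets[of "ball (0::complex^'n) 1" lborel] by auto
    then show False using unit_ball_vol_pos[of "real CARD('n) * 2"] by (simp add: emeasure_ball)
  qed
  then show "I > 0" unfolding 1 by (simp add: ennreal_eq_0_iff)
qed

lemma weight_const_pos: assumes "t > -1" shows "weight_const TYPE('n::finite) t > 0"
  using ball_weight_integral(2)[OF assms, where 'n='n] by (simp add: weight_const_def)

lemma space_nu [simp]: "space (nu t) = ball (0::complex^'n::finite) 1"
  by (simp add: nu_def)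

lemma sets_nu: "sets (nu t) = sets (lebesgue_on (ball (0::complex^'n::finite) 1))"
  by (simp add: nu_def)

lemma measurable_nu_borel [measurable (raw)]: "f \<in> measurable borel N \<Longrightarrow> f \<in> measurable (nu t) N"
  unfolding measurable_cong_sets[OF sets_nu refl]
  by (intro measurable_restrict_space1 measurable_completion) simp

lemma nu_density_measurable:
  "(\<lambda>z. ennreal (weight_const TYPE('n) t * (1 - (norm z)\<^sup>2) powr t))
     \<in> borel_measurable (lebesgue_on (ball (0::complex^'n::finite) 1))"
  by (intro measurable_restrict_space1 measurable_completion) simp

lemma nn_integral_nu:
  assumes "f \<in> borel_measurable (nu t)"
  shows "(\<integral>\<^sup>+x. f x \<partial>nu t) = (\<integral>\<^sup>+x. indicator (ball (0::complex^'n::finite) 1) x *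
     (ennreal (weight_const TYPE('n) t * (1 - (norm x)\<^sup>2) powr t) * f x) \<partial>lborel)"
proof -
  have f: "f \<in> borel_measurable (lebesgue_on (ball (0::complex^'n::finite) 1))"
    using assms by (subst (asm) measurable_cong_sets[OF sets_nu refl])
  show ?thesis unfolding nu_def
    by (subst nn_integral_density[OF nu_density_measurable f]) (simp add: nn_integral_lebesgue_on)
qed

lemma emeasure_nu_space: assumes "t > -1" shows "emeasure (nu t) (ball (0::complex^'n::finite) 1) = 1"
proof -
  let ?I = "LINT z|lebesgue_on (ball (0 :: complex ^ 'n::finite) 1). (1 - (norm z)\<^sup>2) powr t"
  have "emeasure (nu t) (ball (0::complex^'n::finite) 1) = (\<integral>\<^sup>+x. 1 \<partial>(nu t :: (complex^'n) measure))" by simp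
  also have "\<dots> = (\<integral>\<^sup>+x. ennreal (weight_const TYPE('n) t) * (indicator (ball (0::complex^'n::finite) 1) x *
     ennreal ((1 - (norm x)\<^sup>2) powr t)) \<partial>lborel)"
    using weight_const_pos[OF assms, where 'n='n] 
    by (subst nn_integral_nu) (auto intro!: nn_integral_cong simp: ennreal_mult ac_simps)
  also have "\<dots> = ennreal (weight_const TYPE('n) t) * ennreal ?I"
    by (simp add: nn_integral_cmult ball_weight_integral(1)[OF assms])
  also have "\<dots> = ennreal (weight_const TYPE('n) t * ?I)"
    using weight_const_pos[OF assms, where 'n='n] ball_weight_integral(2)[OF assms, where 'n='n]
    by (simp add: ennreal_mult)
  also have "weight_const TYPE('n) t * ?I = 1"
    using ball_weight_integral(2)[OF assms, where 'n='n] by (simp add: weight_const_def)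
  finally show ?thesis by simp
qed

lemma finite_measure_nu: assumes "t > -1" shows "finite_measure (nu t :: (complex^'n::finite) measure)"
  by (rule finite_measureI) (simp add: emeasure_nu_space[OF assms])

lemma AE_nu_iff:
  assumes "t > -1"
  shows "(AE z in nu t. P z) \<longleftrightarrow> (AE z in lebesgue_on (ball (0::complex^'n::finite) 1). P z)"
proof -
  have "(AE z in nu t. P z) \<longleftrightarrow> (AE z in lebesgue_on (ball (0::complex^'n) 1).
     0 < ennreal (weight_const TYPE('n) t * (1 - (norm z)\<^sup>2) powr t) \<longrightarrow> P z)"
    unfolding nu_def by (rule AE_density[OF nu_density_measurable])
  also have "\<dots> \<longleftrightarrow> (AE z in lebesgue_on (ball (0::complex^'n) 1). P z)"
    using weight_const_pos[OF assms, where 'n='n]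
    by (intro AE_cong) (auto simp: abs_square_less_1 dest!: one_minus_norm_sq_pos)
  finally show ?thesis .
qed

text \<open>Completeness makes almost everywhere limits of measurable functions measurable. On it
  rests the passage from strong measurability, the notion in the definitions of spaces and
  integrals, to Borel measurability of norms and of ell2-valued functions.\<close>

lemma complete_nu:
  assumes t: "t > -1" shows "complete_measure (nu t :: (complex^'n::finite) measure)"
proof
  fix A B assume AB: "A \<subseteq> B" "B \<in> null_sets (nu t :: (complex^'n::finite) measure)"
  let ?b = "ball (0::complex^'n) 1"
  have "AE z in nu t. z \<notin> B" using AB(2) by (rule AE_not_in)
  then have "AE z in lebesgue_on ?b. z \<notin> B" by (simp add: AE_nu_iff[OF t])
  then have ae: "AE z in lebesgue. z \<in> ?b \<longrightarrow> z \<notin> B"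
    by (subst (asm) AE_restrict_space_iff) auto
  have "B \<in> sets (nu t)" using AB by auto
  then have B: "B \<subseteq> ?b" "B \<in> sets lebesgue"
    using sets.sets_into_space[of B "nu t"] unfolding sets_nu
    by (auto simp: sets_restrict_space_iff)
  have "AE z in lebesgue. z \<notin> B"
    using ae by eventually_elim (use B(1) in auto)
  then have "B \<in> null_sets lebesgue" using B by (auto simp: AE_iff_null_sets)
  then have "A \<in> null_sets lebesgue"
    using AB(1) completion.complete2 by blast
  then show "A \<in> sets (nu t)" using AB(1) B unfolding sets_nu
    by (auto simp: sets_restrict_space_iff null_setsD2)
qed

lemma continuous_on_hprod: "continuous_on UNIV (\<lambda>x::(complex^'n::finite) \<times> (complex^'n). hprod (fst x) (snd x))"
  unfolding hprod_def by (intro continuous_intros)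

lemma measurable_hprod [measurable (raw)]:
  assumes "f \<in> borel_measurable M" "g \<in> borel_measurable M"
  shows "(\<lambda>x. hprod (f x) (g x)) \<in> borel_measurable M"
  using assms continuous_on_hprod by (rule borel_measurable_continuous_Pair)

lemma bounded_bilinear_vscale: "bounded_bilinear (\<lambda>c (v :: complex^'n::finite). c *s v)"
proof
  show "\<exists>K. \<forall>a (b::complex^'n). norm (a *s b) \<le> norm a * norm b * K"
    by (intro exI[of _ 1]) (simp add: norm_vscale)
qed (simp_all add: vec_eq_iff algebra_simps)

lemma measurable_vscale [measurable (raw)]:
  fixes g :: "'a \<Rightarrow> complex^'n::finite"
  assumes "f \<in> borel_measurable M" "g \<in> borel_measurable M"
  shows "(\<lambda>x. f x *s g x) \<in> borel_measurable M"
  using assms by (rule borel_measurable_continuous_Pair)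
    (intro bounded_bilinear.continuous_on[OF bounded_bilinear_vscale] continuous_intros)

lemma measurable_ball_involution [measurable]:
  assumes "norm a < 1" shows "ball_involution a \<in> borel_measurable borel"
proof -
  have "(\<lambda>z. (1 / (1 - hprod z a)) *s (a - srt a *s z - (hprod z a / (1 + srt a)) *s a))
      \<in> borel_measurable borel" by measurable
  then show ?thesis by (simp only: ball_involution_eq[OF assms, abs_def])
qed

section \<open>Moebius and rotation invariance of the measures\<close>

definition kernel_exp :: "'n::finite itself \<Rightarrow> real \<Rightarrow> real"
  where "kernel_exp _ t = real CARD('n) + 1 + t"

text \<open>On the ball this is |k_a(z)|^2, see \<open>kernel_sq_eq\<close>. Written as a real power
  of the quotient that also occurs in the Jacobian of phi_a, it is at once the Berezin kernel and
  the density of the image of the measure under phi_a.\<close>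

definition kernel_sq :: "real \<Rightarrow> complex^'n::finite \<Rightarrow> complex^'n \<Rightarrow> real"
  where "kernel_sq t a z = ((1 - (norm a)\<^sup>2) / (cmod (1 - hprod z a))\<^sup>2) powr kernel_exp TYPE('n) t"

lemma cmod_one_minus_hprod_swap: "cmod (1 - hprod w z) = cmod (1 - hprod z w)"
  by (metis cnj_hprod complex_cnj_diff complex_cnj_one complex_mod_cnj)

lemma cmod_one_minus_hprod_pos: 
  assumes "norm z < 1" "norm w < 1" shows "0 < cmod (1 - hprod z w)"
  using one_minus_hprod_nz[of z w] assms by simp

lemma kernel_sq_nonneg [simp]: "kernel_sq t a z \<ge> 0" by (simp add: kernel_sq_def)

lemma measurable_kernel_sq [measurable (raw)]:
  assumes [measurable]: "f \<in> borel_measurable M" "g \<in> borel_measurable M"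
  shows "(\<lambda>x. kernel_sq t (f x) (g x)) \<in> borel_measurable M"
  unfolding kernel_sq_def by measurable

lemma measurable_nu_id: "(\<lambda>x. x) \<in> measurable (nu t) borel"
  by (rule measurable_nu_borel) simp

lemma nn_integral_nu_borel:
  fixes f :: "complex^'n::finite \<Rightarrow> ennreal"
  assumes "f \<in> borel_measurable borel"
  shows "(\<integral>\<^sup>+x. f x \<partial>nu t) = (\<integral>\<^sup>+x. indicator (ball (0::complex^'n::finite) 1) x *
     (ennreal (weight_const TYPE('n) t * (1 - (norm x)\<^sup>2) powr t) * f x) \<partial>lborel)"
  by (rule nn_integral_nu) (use assms in measurable)

text \<open>With J = (1-|a|^2)/|1-<x,a>|^2 the Jacobian is J^(n+1), and the weight changes by J^t
  because 1-|phi_a(x)|^2 = J (1-|x|^2); the product of the two is \<open>kernel_sq\<close>.\<close>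

lemma nn_integral_nu_involution:
  fixes a :: "complex^'n::finite" and G :: "complex^'n \<Rightarrow> ennreal"
  assumes t: "t > -1" and a: "norm a < 1" and G[measurable]: "G \<in> borel_measurable borel"
  shows "(\<integral>\<^sup>+x. G (ball_involution a x) \<partial>nu t) = (\<integral>\<^sup>+x. G x * ennreal (kernel_sq t a x) \<partial>nu t)"
proof -
  note measurable_ball_involution[OF a, measurable]
  define W where "W = weight_const TYPE('n) t"
  have W: "W > 0" unfolding W_def by (rule weight_const_pos[OF t])
  \<comment> \<open>This is 1 - |phi_a(y)|^2 written out, so it is Borel on the whole space. At y =
    phi_a(x) it takes the value 1 - |x|^2, which makes the integrand a function of phi_a(x).\<close>
  define wt where "wt y = (1 - (norm a)\<^sup>2) * (1 - (norm y)\<^sup>2) / (cmod (1 - hprod y a))\<^sup>2" for y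
  have [measurable]: "wt \<in> borel_measurable borel" unfolding wt_def by measurable
  define H where "H y = ennreal (W * wt y powr t) * G y" for y
  have H[measurable]: "H \<in> borel_measurable borel" unfolding H_def by measurable
  have "(\<integral>\<^sup>+x. G (ball_involution a x) \<partial>nu t) = (\<integral>\<^sup>+x. indicator (ball (0::complex^'n) 1) x *
     (ennreal (W * (1 - (norm x)\<^sup>2) powr t) * G (ball_involution a x)) \<partial>lborel)"
    unfolding W_def by (rule nn_integral_nu_borel) measurable
  also have "\<dots> = (\<integral>\<^sup>+x. indicator (ball (0::complex^'n) 1) x * H (ball_involution a x) \<partial>lborel)"
  proof (intro nn_integral_cong)
    fix x :: "complex^'n"
    have "wt (ball_involution a x) = 1 - (norm x)\<^sup>2" if "norm x < 1"
      using ball_involution_norm[OF a ball_involution_in_ball[OF a that]]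
        ball_involution_involution[OF a, of x] one_minus_hprod_nz[of x a] a that
      by (simp add: wt_def)
    then show "indicator (ball 0 1) x * (ennreal (W * (1 - (norm x)\<^sup>2) powr t) * G (ball_involution a x))
        = indicator (ball 0 1) x * H (ball_involution a x)"
      by (auto simp: H_def indicator_def)
  qed
  also have "\<dots> = (\<integral>\<^sup>+x. indicator (ball 0 1) x *
       (H x * ennreal (((1 - (norm a)\<^sup>2) / (cmod (1 - hprod x a))\<^sup>2) ^ (CARD('n) + 1))) \<partial>lborel)"
    by (rule nn_integral_ball_involution[OF a H])
  also have "\<dots> = (\<integral>\<^sup>+x. indicator (ball (0::complex^'n) 1) x *
     (ennreal (W * (1 - (norm x)\<^sup>2) powr t) * (G x * ennreal (kernel_sq t a x))) \<partial>lborel)"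
  proof (intro nn_integral_cong)
    fix x :: "complex^'n"
    have "ennreal (W * wt x powr t) * G x *
       ennreal (((1 - (norm a)\<^sup>2) / (cmod (1 - hprod x a))\<^sup>2) ^ (CARD('n) + 1))
      = ennreal (W * (1 - (norm x)\<^sup>2) powr t) * (G x * ennreal (kernel_sq t a x))" if x: "norm x < 1"
    proof -
      define J where "J = (1 - (norm a)\<^sup>2) / (cmod (1 - hprod x a))\<^sup>2"
      have J: "J > 0" unfolding J_def
        using one_minus_norm_sq_pos[OF a] cmod_one_minus_hprod_pos[OF x a] by (intro divide_pos_pos) auto
      have px: "1 - (norm x)\<^sup>2 > 0" by (rule one_minus_norm_sq_pos[OF x])
      have "wt x = J * (1 - (norm x)\<^sup>2)" by (simp add: wt_def J_def)
      then have "W * wt x powr t * J ^ (CARD('n) + 1) = W * (1 - (norm x)\<^sup>2) powr t * (J powr t * J ^ (CARD('n) + 1))"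
        using J px by (simp add: powr_mult)
      also have "J powr t * J ^ (CARD('n) + 1) = kernel_sq t a x"
        using J unfolding kernel_sq_def J_def[symmetric] kernel_exp_def
        by (simp add: powr_realpow[symmetric] powr_add[symmetric] algebra_simps del: power_Suc)
      finally have eq: "W * wt x powr t * J ^ (CARD('n) + 1) = W * (1 - (norm x)\<^sup>2) powr t * kernel_sq t a x" .
      have "ennreal (W * wt x powr t) * G x * ennreal (J ^ (CARD('n) + 1))
        = G x * ennreal (W * wt x powr t * J ^ (CARD('n) + 1))"
        using W J by (simp add: ennreal_mult ac_simps)
      also have "\<dots> = ennreal (W * (1 - (norm x)\<^sup>2) powr t) * (G x * ennreal (kernel_sq t a x))"
        unfolding eq using W by (simp add: ennreal_mult ac_simps)
      finally show ?thesis by (simp add: J_def)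
    qed
    then show "indicator (ball 0 1) x *
       (H x * ennreal (((1 - (norm a)\<^sup>2) / (cmod (1 - hprod x a))\<^sup>2) ^ (CARD('n) + 1)))
      = indicator (ball (0::complex^'n) 1) x *
     (ennreal (W * (1 - (norm x)\<^sup>2) powr t) * (G x * ennreal (kernel_sq t a x)))"
      by (auto simp: H_def indicator_def)
  qed
  also have "\<dots> = (\<integral>\<^sup>+x. G x * ennreal (kernel_sq t a x) \<partial>nu t)"
    unfolding W_def by (rule nn_integral_nu_borel[symmetric]) measurable
  finally show ?thesis .
qed

lemma kernel_sq_integral:
  assumes "t > -1" "norm (a :: complex^'n::finite) < 1"
  shows "(\<integral>\<^sup>+x. ennreal (kernel_sq t a x) \<partial>nu t) = 1"
  using nn_integral_nu_involution[OF assms, of "\<lambda>_. 1"] emeasure_nu_space[OF assms(1), where 'n='n] by simp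

text \<open>Multiplication by u is in general no involution, but it is the composite of two
  conjugate-linear isometries that are: coordinatewise conjugation, and conjugation followed by
  multiplication by u. The change of variables for involutions is applied to each.\<close>

lemma nn_integral_nu_rotation:
  fixes G :: "complex^'n::finite \<Rightarrow> ennreal"
  assumes t: "t > -1" and u: "cmod u = 1" and G[measurable]: "G \<in> borel_measurable borel"
  shows "(\<integral>\<^sup>+x. G (u *s x) \<partial>nu t) = (\<integral>\<^sup>+x. G x \<partial>nu t)"
proof -
  define R where "R u x = (\<chi> i. u * cnj (x $ i))" for u and x :: "complex^'n"
  have lin: "linear (R u)" for u
    by (intro linearI) (simp_all add: R_def vec_eq_iff algebra_simps)
  have nR: "norm (R u x) = norm x" if "cmod u = 1" for u x
    using that by (simp add: R_def norm_vec_def norm_mult)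
  have [measurable]: "R u \<in> borel_measurable borel" for u
    by (simp add: borel_measurable_continuous_onI linear_continuous_on linear_linear lin)
  obtain E :: "'n bit0 \<Rightarrow> complex ^ 'n" where E: "bij_betw E UNIV Basis" using ex_basis_enum by blast
  have R: "(\<integral>\<^sup>+x. G (R u x) \<partial>nu t) = (\<integral>\<^sup>+x. G x \<partial>nu t)"
    if u: "cmod u = 1" and [measurable]: "G \<in> borel_measurable borel" for u and G :: "complex^'n \<Rightarrow> ennreal"
  proof -
    define H where "H y = ennreal (weight_const TYPE('n) t * (1 - (norm y)\<^sup>2) powr t) * G y" for y
    have [measurable]: "H \<in> borel_measurable borel" unfolding H_def by measurable
    have "(\<integral>\<^sup>+x. indicator (ball 0 1) x * H (R u x) \<partial>lborel)
       = (\<integral>\<^sup>+x. indicator (ball 0 1) x * (H x * ennreal 1) \<partial>lborel)"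
    proof (rule nn_integral_involution[OF E, where \<phi>' = "\<lambda>_. R u"])
      show "(R u has_derivative R u) (at x)" for x by (rule linear_imp_has_derivative[OF lin])
      have "u * cnj u = 1" using u complex_norm_square[of u] by simp
      then have "R u (R u x) = x" for x by (simp add: R_def vec_eq_iff mult.assoc[symmetric])
      then show "x \<in> ball 0 1 \<Longrightarrow> R u x \<in> ball 0 1 \<and> R u (R u x) = x" for x by (simp add: nR u)
      show "\<bar>real_det E (R u)\<bar> = 1" by (rule real_det_isometry[OF E lin nR[OF u]])
    qed auto
    then show ?thesis
      by (simp add: nn_integral_nu_borel H_def nR u)
  qed
  have "R u (R 1 x) = u *s x" for x by (simp add: R_def vec_eq_iff)
  then have "(\<integral>\<^sup>+x. G (u *s x) \<partial>nu t) = (\<integral>\<^sup>+x. G (R u (R 1 x)) \<partial>nu t)" by simp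
  also have "\<dots> = (\<integral>\<^sup>+x. G (R u x) \<partial>nu t)" by (rule R) auto
  also have "\<dots> = (\<integral>\<^sup>+x. G x \<partial>nu t)" by (rule R) (auto simp: u)
  finally show ?thesis .
qed

lemma integral_nu_rotation:
  fixes F :: "complex^'n::finite \<Rightarrow> complex"
  assumes t: "t > -1" and u: "cmod u = 1" and F[measurable]: "F \<in> borel_measurable borel"
  shows "(LINT x|nu t. F (u *s x)) = (LINT x|nu t. F x)"
proof -
  note measurable_nu_id[measurable]
  have "distr (nu t) borel (\<lambda>x. u *s x) = distr (nu t) borel (\<lambda>x::complex^'n. x)"
  proof (rule measure_eqI)
    fix A assume "A \<in> sets (distr (nu t) borel (\<lambda>x::complex^'n. u *s x))"
    then have [measurable]: "A \<in> sets borel" by simp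
    have "emeasure (distr (nu t) borel f) A = (\<integral>\<^sup>+x. indicator A (f x) \<partial>nu t)" 
      if "f \<in> measurable (nu t) borel" for f :: "complex^'n \<Rightarrow> complex^'n"
    proof -
      have "emeasure (distr (nu t) borel f) A = (\<integral>\<^sup>+x. indicator A x \<partial>distr (nu t) borel f)"
        by (rule nn_integral_indicator[symmetric]) simp
      also have "\<dots> = (\<integral>\<^sup>+x. indicator A (f x) \<partial>nu t)" by (rule nn_integral_distr[OF that]) simp
      finally show ?thesis .
    qed
    from this[of "\<lambda>x. u *s x"] this[OF measurable_nu_id]
    show "emeasure (distr (nu t) borel (\<lambda>x. u *s x)) A = emeasure (distr (nu t) borel (\<lambda>x::complex^'n. x)) A"
      by (simp add: nn_integral_nu_rotation[OF t u])
  qed simp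
  then have "(LINT x|distr (nu t) borel (\<lambda>x. u *s x). F x) = (LINT x|distr (nu t) borel (\<lambda>x. x). F x)" by simp
  then show ?thesis by (simp add: integral_distr)
qed

section \<open>Mean value property of holomorphic functions and its consequences\<close>

definition scalar_holo :: "(complex^'n::finite \<Rightarrow> complex) \<Rightarrow> bool"
  where "scalar_holo F \<longleftrightarrow>
    (\<forall>z\<in>ball 0 1. \<exists>D. (F has_derivative D) (at z) \<and> (\<forall>c v. D (c *s v) = c * D v))"

lemma scalar_holo_continuous: "scalar_holo F \<Longrightarrow> continuous_on (ball 0 1) F"
  unfolding scalar_holo_def by (meson continuous_at_imp_continuous_on has_derivative_continuous)

lemma scalar_holo_cut_measurable:
  assumes "scalar_holo F" shows "(\<lambda>x. indicator (ball 0 1) x *\<^sub>R F x) \<in> borel_measurable borel"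
  using borel_measurable_continuous_on_indicator[OF _ scalar_holo_continuous[OF assms]] by simp

lemma scalar_holo_measurable:
  assumes "scalar_holo F" shows "F \<in> borel_measurable (nu t)"
proof -
  have "(\<lambda>x. indicator (ball 0 1) x *\<^sub>R F x) \<in> borel_measurable (nu t)"
    using scalar_holo_cut_measurable[OF assms] by (rule measurable_nu_borel)
  then show ?thesis by (rule measurable_cong[THEN iffD1, rotated]) auto
qed

text \<open>On the complex line through z the function l -> F(l z) is holomorphic near the closed
  unit disc, since |z| < 1; Cauchy's formula over the unit circle gives F(0) as the average.\<close>

lemma scalar_holo_disc:
  assumes F: "scalar_holo F" and z: "norm z < 1"
  shows "((\<lambda>x. F (exp (2 * of_real pi * \<i> * of_real x) *s z)) has_integral F 0) {0..1}"
proof -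
  define g where "g l = F (l *s z)" for l :: complex
  define S where "S = {l :: complex. norm (l *s z) < 1}"
  have "open S" unfolding S_def
    by (intro open_Collect_less continuous_intros linear_continuous_on bounded_linear_vscale_left)
  have hol: "g holomorphic_on S"
  proof (unfold holomorphic_on_def field_differentiable_def, intro ballI)
    fix l assume "l \<in> S"
    then have "l *s z \<in> ball 0 1" by (simp add: S_def)
    then obtain D where D: "(F has_derivative D) (at (l *s z))" "\<And>c v. D (c *s v) = c * D v"
      using F unfolding scalar_holo_def by blast
    have "(g has_derivative (\<lambda>h. D (h *s z))) (at l within S)"
      unfolding g_def
      by (rule has_derivative_compose[OF bounded_linear_imp_has_derivative[OF bounded_linear_vscale_left] D(1)])
    then have "(g has_field_derivative D z) (at l within S)"
      by (simp add: has_field_derivative_def D(2) mult_commute_abs)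
    then show "\<exists>f'. (g has_field_derivative f') (at l within S)" by blast
  qed
  have sub: "cball 0 1 \<subseteq> S"
  proof
    fix l :: complex assume "l \<in> cball 0 1"
    then have "cmod l * norm z \<le> 1 * norm z" by (intro mult_right_mono) auto
    then show "l \<in> S" using z by (simp add: S_def norm_vscale)
  qed
  have "((\<lambda>u. g u / (u - 0)) has_contour_integral (2 * of_real pi * \<i> * g 0)) (circlepath 0 1)"
  proof (rule Cauchy_integral_circlepath)
    show "continuous_on (cball 0 1) g" using hol sub holomorphic_on_imp_continuous_on holomorphic_on_subset by blast
    show "g holomorphic_on ball 0 1" using hol sub by (meson ball_subset_cball holomorphic_on_subset order_trans)
  qed simp
  then have "((\<lambda>x. g (circlepath 0 1 x) / circlepath 0 1 x *
     vector_derivative (circlepath 0 1) (at x within {0..1})) has_integral (2 * of_real pi * \<i> * g 0)) {0..1}"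
    by (simp add: has_contour_integral_def)
  then have "((\<lambda>x. (2 * of_real pi * \<i>) * g (exp (2 * of_real pi * \<i> * of_real x))) has_integral (2 * of_real pi * \<i> * g 0)) {0..1}"
    by (rule has_integral_eq[rotated])
      (simp add: vector_derivative_circlepath01, simp add: circlepath)
  then have "((\<lambda>x. (1 / (2 * of_real pi * \<i>)) * ((2 * of_real pi * \<i>) * g (exp (2 * of_real pi * \<i> * of_real x))))
     has_integral (1 / (2 * of_real pi * \<i>)) * (2 * of_real pi * \<i> * g 0)) {0..1}"
    by (rule has_integral_mult_right)
  then show ?thesis by (simp add: g_def)
qed

text \<open>The double integral of F(e^(2 pi i x) z) over z and over x in [0,1] is computed in both
  orders: the integral over x is F(0) on every slice, and the integral over z is independent of x by
  rotation invariance.\<close>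

lemma mean_value_property:
  fixes F :: "complex^'n::finite \<Rightarrow> complex"
  assumes t: "t > -1" and F: "scalar_holo F" and int: "integrable (nu t) F"
  shows "F 0 = (LINT z|nu t. F z)"
proof -
  let ?N = "nu t :: (complex^'n) measure" and ?L = "lebesgue_on {0..1::real}"
  \<comment> \<open>Holomorphy is known on the ball only; the cut-off version is Borel on the whole
    space, which gives joint measurability with the rotation parameter.\<close>
  define F' where "F' x = indicator (ball 0 1) x *\<^sub>R F x" for x
  have [measurable]: "F' \<in> borel_measurable borel"
    unfolding F'_def by (rule scalar_holo_cut_measurable[OF F])
  define e where "e x = exp (2 * of_real pi * \<i> * of_real x)" for x :: real
  have e: "cmod (e x) = 1" for x by (simp add: e_def)
  have ce: "continuous_on A e" for A unfolding e_def by (intro continuous_intros)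
  have [measurable]: "e \<in> borel_measurable borel" using ce by (rule borel_measurable_continuous_onI)
  let ?L = "restrict_space lborel {0..1::real}"
  interpret N: finite_measure ?N by (rule finite_measure_nu[OF t])
  interpret L: finite_measure ?L by (rule finite_measureI) (simp add: space_restrict_space emeasure_restrict_space)
  interpret P: pair_sigma_finite ?N ?L ..
  note measurable_nu_id[measurable]
  have idL: "(\<lambda>x. x) \<in> measurable ?L borel" by (rule measurable_restrict_space1) simp
  note idL[measurable]
  have sL: "emeasure ?L (space ?L) = 1" by (simp add: space_restrict_space emeasure_restrict_space)
  have int': "integrable ?N F'"
    using int by (rule Bochner_Integration.integrable_cong[THEN iffD1, rotated -1]) (auto simp: F'_def)
  have m: "(\<lambda>(z, x). F' (e x *s z)) \<in> borel_measurable (?N \<Otimes>\<^sub>M ?L)"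
    by measurable
  have "(\<integral>\<^sup>+p. ennreal (norm (case p of (z, x) \<Rightarrow> F' (e x *s z))) \<partial>(?N \<Otimes>\<^sub>M ?L))
     = (\<integral>\<^sup>+x. \<integral>\<^sup>+z. ennreal (norm (F' (e x *s z))) \<partial>?N \<partial>?L)"
    by (subst P.nn_integral_snd[symmetric]) auto
  also have "\<dots> = (\<integral>\<^sup>+x. \<integral>\<^sup>+z. ennreal (norm (F' z)) \<partial>?N \<partial>?L)"
    by (intro nn_integral_cong nn_integral_nu_rotation[OF t e, of "\<lambda>z. ennreal (norm (F' z))"]) measurable
  also have "\<dots> < \<infinity>"
    using int' sL by (simp add: integrable_iff_bounded)
  finally have ip: "integrable (?N \<Otimes>\<^sub>M ?L) (\<lambda>(z, x). F' (e x *s z))"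
    using m by (intro integrableI_bounded) auto
  have inner: "(LINT x|?L. F' (e x *s z)) = F 0" if z: "z \<in> space ?N" for z
  proof -
    have nz: "norm (e x *s z) < 1" for x using z e by (simp add: norm_vscale)
    have "continuous_on {0..1} (\<lambda>x. F (e x *s z))"
      by (rule continuous_on_compose2[OF scalar_holo_continuous[OF F]])
       (use nz in \<open>auto intro!: continuous_on_compose2[OF linear_continuous_on[OF bounded_linear_vscale_left] ce]\<close>)
    then have si: "set_integrable lborel {0..1} (\<lambda>x. F (e x *s z))" by (rule borel_integrable_atLeastAtMost')
    have "(LINT x|?L. F' (e x *s z)) = (LINT x:{0..1}|lborel. F' (e x *s z))"
      by (subst integral_restrict_space) (auto simp: set_lebesgue_integral_def)
    also have "\<dots> = (LINT x:{0..1}|lborel. F (e x *s z))"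
      using nz by (simp add: F'_def)
    also have "\<dots> = integral {0..1} (\<lambda>x. F (e x *s z))" by (rule set_borel_integral_eq_integral(2)[OF si])
    also have "\<dots> = F 0"
      using scalar_holo_disc[OF F, of z] z by (simp add: integral_unique e_def)
    finally show ?thesis .
  qed
  have "(LINT z|?N. LINT x|?L. F' (e x *s z)) = (LINT x|?L. LINT z|?N. F' (e x *s z))"
    by (rule P.Fubini_integral[OF ip, symmetric])
  also have "\<dots> = (LINT x|?L. LINT z|?N. F' z)"
    by (intro Bochner_Integration.integral_cong refl integral_nu_rotation[OF t e]) simp
  also have "\<dots> = (LINT z|?N. F' z)" using sL by (simp add: measure_def)
  also have "\<dots> = (LINT z|?N. F z)" by (intro Bochner_Integration.integral_cong) (auto simp: F'_def)
  also have "(LINT z|?N. LINT x|?L. F' (e x *s z)) = (LINT z|?N. F 0)"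
    by (intro Bochner_Integration.integral_cong refl inner)
  also have "\<dots> = F 0" using emeasure_nu_space[OF t, where 'n='n] by (simp add: measure_def)
  finally show ?thesis .
qed

lemma scalar_holo_const [intro]: "scalar_holo (\<lambda>_. c)"
  unfolding scalar_holo_def by (auto intro!: exI[of _ "\<lambda>_. 0"])

lemma scalar_holo_mult [intro]:
  assumes "scalar_holo F" "scalar_holo G" shows "scalar_holo (\<lambda>z. F z * G z)"
  unfolding scalar_holo_def
proof
  fix z :: "complex^'a" assume z: "z \<in> ball 0 1"
  obtain D where D: "(F has_derivative D) (at z)" "\<And>c v. D (c *s v) = c * D v"
    using assms(1) z unfolding scalar_holo_def by blast
  obtain E where E: "(G has_derivative E) (at z)" "\<And>c v. E (c *s v) = c * E v"
    using assms(2) z unfolding scalar_holo_def by blast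
  show "\<exists>D. ((\<lambda>z. F z * G z) has_derivative D) (at z) \<and> (\<forall>c v. D (c *s v) = c * D v)"
    by (intro exI[of _ "\<lambda>v. F z * E v + D v * G z"] conjI has_derivative_mult D(1) E(1))
      (simp add: D(2) E(2) algebra_simps)
qed

lemma scalar_holo_one_minus_hprod: "scalar_holo (\<lambda>z. 1 - hprod z a)"
  unfolding scalar_holo_def
proof (intro ballI exI[of _ "\<lambda>v. - hprod v a"] conjI allI)
  show "((\<lambda>z. 1 - hprod z a) has_derivative (\<lambda>v. - hprod v a)) (at z)" for z
    using has_derivative_diff[OF has_derivative_const
        bounded_linear_imp_has_derivative[OF bounded_linear_hprod_left]] by simp
qed (simp add: hprod_scale_left)

lemma scalar_holo_involution:
  assumes F: "scalar_holo F" and a: "norm a < 1"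
  shows "scalar_holo (\<lambda>z. F (ball_involution a z))"
  unfolding scalar_holo_def
proof
  fix z :: "complex^'a" assume z: "z \<in> ball 0 1"
  then have "ball_involution a z \<in> ball 0 1" using ball_involution_in_ball[OF a] by simp
  then obtain D where D: "(F has_derivative D) (at (ball_involution a z))" "\<And>c v. D (c *s v) = c * D v"
    using F unfolding scalar_holo_def by blast
  show "\<exists>D. ((\<lambda>z. F (ball_involution a z)) has_derivative D) (at z) \<and> (\<forall>c v. D (c *s v) = c * D v)"
    using has_derivative_compose[OF has_derivative_ball_involution[OF a] D(1)] z
    by (intro exI[of _ "\<lambda>v. D (involution_deriv a z v)"] conjI)
      (simp_all add: D(2) involution_deriv_scale)
qed

lemma one_minus_hprod_Re_pos:
  assumes "norm z < 1" "norm w < 1" shows "0 < Re (1 - hprod z w)"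
  using hprod_in_ball(1)[of z w] assms complex_Re_le_cmod[of "hprod z w"] by simp

lemma one_minus_hprod_slit:
  assumes "norm z < 1" "norm w < 1" shows "1 - hprod z w \<notin> \<real>\<^sub>\<le>\<^sub>0"
  using one_minus_hprod_Re_pos[OF assms] by (auto simp: complex_nonpos_Reals_iff)

lemma scalar_holo_kernel:
  assumes a: "norm a < 1"
  shows "scalar_holo (\<lambda>z. (1 - hprod z a) powr s)"
  unfolding scalar_holo_def
proof
  fix z :: "complex^'a" assume z: "z \<in> ball 0 1"
  have "((\<lambda>u. u powr s) has_field_derivative s * (1 - hprod z a) powr (s - 1)) (at (1 - hprod z a))"
    using one_minus_hprod_slit[of z a] z a by (intro has_field_derivative_powr) auto
  then have d: "((\<lambda>u. u powr s) has_derivative (\<lambda>h. s * (1 - hprod z a) powr (s - 1) * h)) (at (1 - hprod z a))"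
    by (simp add: has_field_derivative_def)
  obtain D where D: "((\<lambda>z. 1 - hprod z a) has_derivative D) (at z)" "\<And>c v. D (c *s v) = c * D v"
    using scalar_holo_one_minus_hprod[of a] z unfolding scalar_holo_def by blast
  show "\<exists>D. ((\<lambda>z. (1 - hprod z a) powr s) has_derivative D) (at z) \<and> (\<forall>c v. D (c *s v) = c * D v)"
    using has_derivative_compose[OF D(1) d]
    by (intro exI[of _ "\<lambda>v. s * (1 - hprod z a) powr (s - 1) * D v"] conjI) (simp_all add: D(2))
qed

lemma cmod_powr_of_real: "cmod (z powr complex_of_real r) = cmod z powr r"
  by (simp add: norm_powr_real_powr')

text \<open>The mean value property of F composed with phi_u, at 0, transported by the change of
  variables. When the integral of the composite is infinite the bound is trivial.\<close>

lemma holo_submean: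
  fixes F :: "complex^'n::finite \<Rightarrow> complex"
  assumes t: "t > -1" and F: "scalar_holo F" and u: "norm u < 1"
  shows "ennreal (cmod (F u)) \<le> (\<integral>\<^sup>+z. ennreal (cmod (F z)) * ennreal (kernel_sq t u z) \<partial>nu t)"
proof -
  define F' where "F' x = indicator (ball 0 1) x *\<^sub>R F x" for x
  have [measurable]: "F' \<in> borel_measurable borel"
    unfolding F'_def by (rule scalar_holo_cut_measurable[OF F])
  define H where "H z = F (ball_involution u z)" for z
  have H: "scalar_holo H" unfolding H_def by (rule scalar_holo_involution[OF F u])
  have [measurable]: "H \<in> borel_measurable (nu t)" by (rule scalar_holo_measurable[OF H])
  have "(\<integral>\<^sup>+z. ennreal (cmod (F z)) * ennreal (kernel_sq t u z) \<partial>nu t)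
     = (\<integral>\<^sup>+z. ennreal (cmod (F' z)) * ennreal (kernel_sq t u z) \<partial>nu t)"
    by (intro nn_integral_cong) (simp add: F'_def)
  also have "\<dots> = (\<integral>\<^sup>+z. ennreal (cmod (F' (ball_involution u z))) \<partial>nu t)"
    by (rule nn_integral_nu_involution[OF t u, symmetric]) measurable
  also have "\<dots> = (\<integral>\<^sup>+z. ennreal (cmod (H z)) \<partial>nu t)"
    using ball_involution_in_ball[OF u] by (intro nn_integral_cong) (simp add: F'_def H_def)
  finally have eq: "(\<integral>\<^sup>+z. ennreal (cmod (F z)) * ennreal (kernel_sq t u z) \<partial>nu t)
     = (\<integral>\<^sup>+z. ennreal (cmod (H z)) \<partial>nu t)" .
  show ?thesis
  proof (cases "(\<integral>\<^sup>+z. ennreal (cmod (H z)) \<partial>nu t) < \<infinity>")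
    case True
    then have i: "integrable (nu t) H" by (intro integrableI_bounded) auto
    have "F u = H 0" using u by (simp add: H_def)
    also have "\<dots> = (LINT z|nu t. H z)" by (rule mean_value_property[OF t H i])
    finally show ?thesis unfolding eq using integral_norm_bound_ennreal[OF i] by simp
  next
    case False
    then have "(\<integral>\<^sup>+z. ennreal (cmod (H z)) \<partial>nu t) = top" by (simp add: less_top[symmetric])
    then show ?thesis unfolding eq by simp
  qed
qed

lemma nn_integral_nu_change:
  fixes f :: "complex^'n::finite \<Rightarrow> ennreal"
  assumes s: "s > -1" and t: "t > -1" and f: "f \<in> borel_measurable (nu t)"
  shows "(\<integral>\<^sup>+x. f x \<partial>nu t) = (\<integral>\<^sup>+x. ennreal (weight_const TYPE('n) t / weight_const TYPE('n) s
    * (1 - (norm x)\<^sup>2) powr (t - s)) * f x \<partial>nu s)"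
proof -
  have W: "weight_const TYPE('n) t > 0" "weight_const TYPE('n) s > 0" 
    using weight_const_pos s t by blast+
  have fs[measurable]: "f \<in> borel_measurable (nu s)"
    using f unfolding measurable_cong_sets[OF sets_nu refl] .
  have [measurable]: "(\<lambda>x::complex^'n. ennreal (weight_const TYPE('n) t / weight_const TYPE('n) s
    * (1 - (norm x)\<^sup>2) powr (t - s))) \<in> borel_measurable (nu s)"
    by (rule measurable_nu_borel) measurable
  have "(\<integral>\<^sup>+x. f x \<partial>nu t) = (\<integral>\<^sup>+x. indicator (ball (0::complex^'n) 1) x *
     (ennreal (weight_const TYPE('n) t * (1 - (norm x)\<^sup>2) powr t) * f x) \<partial>lborel)"
    by (rule nn_integral_nu[OF f])
  also have "\<dots> = (\<integral>\<^sup>+x. indicator (ball (0::complex^'n) 1) x *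
     (ennreal (weight_const TYPE('n) s * (1 - (norm x)\<^sup>2) powr s) * 
       (ennreal (weight_const TYPE('n) t / weight_const TYPE('n) s
    * (1 - (norm x)\<^sup>2) powr (t - s)) * f x)) \<partial>lborel)"
  proof (intro nn_integral_cong)
    fix x :: "complex^'n"
    have "ennreal (weight_const TYPE('n) t * (1 - (norm x)\<^sup>2) powr t) =
      ennreal (weight_const TYPE('n) s * (1 - (norm x)\<^sup>2) powr s) * 
       ennreal (weight_const TYPE('n) t / weight_const TYPE('n) s * (1 - (norm x)\<^sup>2) powr (t - s))"
      if "norm x < 1"
      using W one_minus_norm_sq_pos[OF that]
      by (subst ennreal_mult[symmetric]) (simp_all add: powr_diff)
    then show "indicator (ball 0 1) x * (ennreal (weight_const TYPE('n) t * (1 - (norm x)\<^sup>2) powr t) * f x)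
      = indicator (ball 0 1) x * (ennreal (weight_const TYPE('n) s * (1 - (norm x)\<^sup>2) powr s) * 
       (ennreal (weight_const TYPE('n) t / weight_const TYPE('n) s * (1 - (norm x)\<^sup>2) powr (t - s)) * f x))"
      by (auto simp: indicator_def mult.assoc)
  qed
  also have "\<dots> = (\<integral>\<^sup>+x. ennreal (weight_const TYPE('n) t / weight_const TYPE('n) s
    * (1 - (norm x)\<^sup>2) powr (t - s)) * f x \<partial>nu s)"
    by (rule nn_integral_nu[symmetric]) measurable
  finally show ?thesis .
qed

section \<open>Kernel estimates: pointwise bounds, Forelli-Rudin integrals and the Schur
  test\<close>

lemma one_minus_norm_le_cmod:
  assumes "norm z < 1" "norm w < 1"
  shows "1 - norm z \<le> cmod (1 - hprod z w)"
proof -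
  have "cmod (hprod z w) \<le> norm z * norm w" by (rule hprod_norm_le)
  also have "\<dots> \<le> norm z" using assms by (simp add: mult_left_le)
  finally show ?thesis using norm_triangle_ineq2[of 1 "hprod z w"] by simp
qed

lemma one_minus_norm_sq_le_cmod:
  assumes "norm z < 1" "norm w < 1"
  shows "1 - (norm z)\<^sup>2 \<le> 2 * cmod (1 - hprod z w)"
proof -
  have "1 - (norm z)\<^sup>2 = (1 - norm z) * (1 + norm z)" by (simp add: power2_eq_square algebra_simps)
  also have "\<dots> \<le> (1 - norm z) * 2" using assms by (intro mult_left_mono) auto
  finally show ?thesis using one_minus_norm_le_cmod[OF assms] by simp
qed

lemma kernel_exp_pos: "t > -1 \<Longrightarrow> kernel_exp TYPE('n::finite) t > 1"
proof -
  assume "t > -1"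
  moreover have "real CARD('n) \<ge> 1" by (simp add: Suc_leI)
  ultimately show ?thesis unfolding kernel_exp_def by linarith
qed

text \<open>Compared with \<open>holo_submean\<close> the arguments of the kernel are exchanged: the
  variable of integration z now sits in the slot of the base point. Tonelli will need this form, as
  integrating in u against a weight then produces its Berezin transform at z. The exchange is paid
  for by a sub-mean value inequality with a heavier weight.\<close>

lemma holo_bound:
  fixes \<alpha> :: real
  assumes \<alpha>: "\<alpha> > -1"
  shows "\<exists>C>0. \<forall>F u. scalar_holo F \<and> norm (u :: complex^'n::finite) < 1 \<longrightarrow>
    ennreal (cmod (F u)) \<le> ennreal C * (\<integral>\<^sup>+z. ennreal (cmod (F z)) * ennreal (kernel_sq \<alpha> z u) \<partial>nu \<alpha>)"
proof -
  define N where "N = kernel_exp TYPE('n) \<alpha>"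
  have N: "N > 1" unfolding N_def by (rule kernel_exp_pos[OF \<alpha>])
  \<comment> \<open>For this weight the kernel exponent doubles to 2N, and the density relative to
    \<open>nu \<alpha>\<close> is a multiple of (1-|z|^2)^N, the numerator of
    \<open>kernel_sq \<alpha> z u\<close>. The powers of 1-|u|^2 are absorbed by 1-|u|^2 <=
    2|1-<u,z>|.\<close>
  define \<beta> where "\<beta> = N + \<alpha>"
  have \<beta>: "\<beta> > -1" using \<alpha> N by (simp add: \<beta>_def)
  have N\<beta>: "kernel_exp TYPE('n) \<beta> = 2 * N" by (simp add: N_def \<beta>_def kernel_exp_def)
  define R where "R = weight_const TYPE('n) \<beta> / weight_const TYPE('n) \<alpha>"
  have R: "R > 0" unfolding R_def using weight_const_pos \<alpha> \<beta> by (metis divide_pos_pos)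
  have "ennreal (cmod (F u)) \<le> ennreal (R * 2 powr (2 * N)) * (\<integral>\<^sup>+z. ennreal (cmod (F z)) * ennreal (kernel_sq \<alpha> z u) \<partial>nu \<alpha>)"
    if F: "scalar_holo F" and u: "norm (u :: complex^'n) < 1" for F u
  proof -
    have [measurable]: "F \<in> borel_measurable (nu t)" for t by (rule scalar_holo_measurable[OF F])
    have km[measurable]: "(\<lambda>z. kernel_sq t u z) \<in> borel_measurable (nu s)"
       "(\<lambda>z. kernel_sq t z u) \<in> borel_measurable (nu s)" for t s
      by (rule measurable_nu_borel, measurable)+
    have "ennreal (cmod (F u)) \<le> (\<integral>\<^sup>+z. ennreal (cmod (F z)) * ennreal (kernel_sq \<beta> u z) \<partial>nu \<beta>)"
      by (rule holo_submean[OF \<beta> F u])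
    also have "\<dots> = (\<integral>\<^sup>+z. ennreal (R * (1 - (norm z)\<^sup>2) powr (\<beta> - \<alpha>)) * (ennreal (cmod (F z)) * ennreal (kernel_sq \<beta> u z)) \<partial>nu \<alpha>)"
      unfolding R_def by (rule nn_integral_nu_change[OF \<alpha> \<beta>]) measurable
    also have "\<dots> \<le> (\<integral>\<^sup>+z. ennreal (R * 2 powr (2 * N)) * (ennreal (cmod (F z)) * ennreal (kernel_sq \<alpha> z u)) \<partial>nu \<alpha>)"
    proof (intro nn_integral_mono)
      fix z :: "complex^'n" assume "z \<in> space (nu \<alpha>)"
      then have z: "norm z < 1" by simp
      define m where "m = cmod (1 - hprod z u)"
      have m: "m > 0" unfolding m_def by (rule cmod_one_minus_hprod_pos[OF z u])
      have mu: "cmod (1 - hprod u z) = m" unfolding m_def by (rule cmod_one_minus_hprod_swap)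
      have pu: "1 - (norm u)\<^sup>2 > 0" and pz: "1 - (norm z)\<^sup>2 > 0"
        using one_minus_norm_sq_pos u z by blast+
      have "(1 - (norm u)\<^sup>2) / m\<^sup>2 \<le> 2 / m"
        using one_minus_norm_sq_le_cmod[OF u z] m unfolding mu
        by (simp add: power2_eq_square divide_simps)
      then have "((1 - (norm u)\<^sup>2) / m\<^sup>2) powr (2 * N) \<le> (2 / m) powr (2 * N)"
        using N pu m by (intro powr_mono2) auto
      also have "\<dots> = 2 powr (2 * N) * (1 / m\<^sup>2) powr N"
        using m by (simp add: powr_divide powr_powr power2_eq_square powr_mult powr_add[symmetric])
      finally have "(1 - (norm z)\<^sup>2) powr N * ((1 - (norm u)\<^sup>2) / m\<^sup>2) powr (2 * N)
        \<le> (1 - (norm z)\<^sup>2) powr N * (2 powr (2 * N) * (1 / m\<^sup>2) powr N)"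
        by (intro mult_left_mono) auto
      also have "\<dots> = 2 powr (2 * N) * kernel_sq \<alpha> z u"
        using pz m unfolding kernel_sq_def N_def[symmetric] mu by (simp add: powr_divide)
      finally have **: "(1 - (norm z)\<^sup>2) powr N * ((1 - (norm u)\<^sup>2) / m\<^sup>2) powr (2 * N)
        \<le> 2 powr (2 * N) * kernel_sq \<alpha> z u" .
      have kb: "kernel_sq \<beta> u z = ((1 - (norm u)\<^sup>2) / m\<^sup>2) powr (2 * N)"
        by (simp only: kernel_sq_def N\<beta> m_def)
      have e: "\<beta> - \<alpha> = N" by (simp add: \<beta>_def)
      have *: "R * (1 - (norm z)\<^sup>2) powr (\<beta> - \<alpha>) * kernel_sq \<beta> u z \<le> R * 2 powr (2 * N) * kernel_sq \<alpha> z u"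
        using mult_left_mono[OF **, of R] R unfolding kb e by (simp add: mult.assoc)
      have "ennreal (R * (1 - (norm z)\<^sup>2) powr (\<beta> - \<alpha>)) * (ennreal (cmod (F z)) * ennreal (kernel_sq \<beta> u z))
         = ennreal (cmod (F z)) * ennreal (R * (1 - (norm z)\<^sup>2) powr (\<beta> - \<alpha>) * kernel_sq \<beta> u z)"
        using R by (simp add: ennreal_mult ac_simps)
      also have "\<dots> \<le> ennreal (cmod (F z)) * ennreal (R * 2 powr (2 * N) * kernel_sq \<alpha> z u)"
        using * by (intro mult_left_mono ennreal_leI) auto
      also have "\<dots> = ennreal (R * 2 powr (2 * N)) * (ennreal (cmod (F z)) * ennreal (kernel_sq \<alpha> z u))"
        using R by (simp add: ennreal_mult ac_simps)
      finally show "ennreal (R * (1 - (norm z)\<^sup>2) powr (\<beta> - \<alpha>)) * (ennreal (cmod (F z)) * ennreal (kernel_sq \<beta> u z))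
        \<le> ennreal (R * 2 powr (2 * N)) * (ennreal (cmod (F z)) * ennreal (kernel_sq \<alpha> z u))" .
    qed
    also have "\<dots> = ennreal (R * 2 powr (2 * N)) * (\<integral>\<^sup>+z. ennreal (cmod (F z)) * ennreal (kernel_sq \<alpha> z u) \<partial>nu \<alpha>)"
      by (rule nn_integral_cmult) measurable
    finally show ?thesis .
  qed
  then show ?thesis using R by (intro exI[of _ "R * 2 powr (2 * N)"]) auto
qed

text \<open>A dyadic decomposition replaces the usual power series proof of the
  Forelli--Rudin estimates: \<open>\<integral>kernel_sq t z\<^sub>k d\<nu>\<^sub>t = 1\<close> at the contracted points
  \<open>z\<^sub>k = (1 - 2\<^sup>-\<^sup>k) z\<close> controls the part of the ball where \<open>\<bar>1 - \<langle>w,z\<rangle>\<bar>\<close> is about \<open>2\<^sup>-\<^sup>k\<close>.\<close>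

lemma forelli_rudin_bounded:
  assumes t: "t > -1" and c: "0 < c" "c \<le> kernel_exp TYPE('n::finite) t"
  shows "\<exists>C\<ge>0. \<forall>z::complex^'n. norm z < 1 \<longrightarrow>
    (\<integral>\<^sup>+w. ennreal (cmod (1 - hprod w z) powr (c - kernel_exp TYPE('n) t)) \<partial>nu t) \<le> ennreal C"
proof -
  define N where "N = kernel_exp TYPE('n) t"
  have N: "N > 1" unfolding N_def by (rule kernel_exp_pos[OF t])
  define q where "q = (1/2::real) powr c"
  have q: "0 < q" "q < 1" using c powr_less_mono'[of "1/2::real" 0 c] by (auto simp: q_def)
  define C where "C = 9 powr N * (1 / (1 - q))"
  have C: "C \<ge> 0" using q by (simp add: C_def)
  have "(\<integral>\<^sup>+w. ennreal (cmod (1 - hprod w z) powr (c - N)) \<partial>nu t) \<le> ennreal C" if z: "norm (z::complex^'n) < 1" for z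
  proof -
    define r where "r k = (1/2::real) ^ k" for k
    have r: "0 < r k" "r k \<le> 1" for k by (auto simp: r_def power_le_one)
    define zz where "zz k = complex_of_real (1 - r k) *s z" for k
    have nzz: "norm (zz k) \<le> 1 - r k" for k
    proof -
      have "norm (zz k) = (1 - r k) * norm z" using r(2)[of k] by (simp only: zz_def norm_vscale norm_of_real)
      then show ?thesis using z r[of k] by (simp add: mult_left_le)
    qed
    have nzz1: "norm (zz k) < 1" for k using nzz[of k] r[of k] by simp
    have [measurable]: "(\<lambda>w. kernel_sq t a w) \<in> borel_measurable (nu t)" for a :: "complex^'n"
      by (rule measurable_nu_borel) measurable
    have "(\<integral>\<^sup>+w. ennreal (cmod (1 - hprod w z) powr (c - N)) \<partial>nu t)
      \<le> (\<integral>\<^sup>+w. (\<Sum>k. ennreal (9 powr N * q ^ k) * ennreal (kernel_sq t (zz k) w)) \<partial>nu t)"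
    proof (intro nn_integral_mono)
      fix w :: "complex^'n" assume "w \<in> space (nu t)"
      then have w: "norm w < 1" by simp
      define m where "m = cmod (1 - hprod w z)"
      have m: "m > 0" unfolding m_def by (rule cmod_one_minus_hprod_pos[OF w z])
      have hp: "cmod (hprod w z) < 1" using hprod_in_ball[of w z] w z by simp
      then have "m \<le> 2" using norm_triangle_ineq4[of 1 "hprod w z"] by (simp add: m_def)
      \<comment> \<open>Half of m is bracketed because m itself can exceed 1; the outcome is r k < m
        <= 2 * r k.\<close>
      then obtain k where k: "r (Suc k) < m / 2" "m / 2 \<le> r k"
        using dyadic_bracket[of "m / 2"] m by (auto simp: r_def)
      have k1: "r k < m" using k(1) by (simp add: r_def)
      define mk where "mk = cmod (1 - hprod w (zz k))"
      have mk0: "mk > 0" unfolding mk_def by (rule cmod_one_minus_hprod_pos[OF w nzz1])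
      have "hprod w (zz k) = complex_of_real (1 - r k) * hprod w z"
        by (simp only: zz_def hprod_scale_right complex_cnj_complex_of_real)
      then have "1 - hprod w (zz k) = (1 - hprod w z) + r k * hprod w z"
        by (simp add: algebra_simps)
      then have "mk \<le> m + cmod (r k * hprod w z)" unfolding mk_def m_def by (metis norm_triangle_ineq)
      also have "cmod (r k * hprod w z) \<le> r k"
        using r[of k] hp by (simp add: norm_mult mult_left_le)
      finally have mk: "mk \<le> 3 * r k" using k(2) by simp
      \<comment> \<open>Since 1 - |zz k|^2 >= r k and mk <= 3 * r k, the kernel at the contracted
        point is at least (9 * r k)^(-N). The factor left over is (r k)^c = q^k, which sums because
        c > 0.\<close>
      have "1 / (9 * r k) = r k / (3 * r k)\<^sup>2" using r(1)[of k] by (simp add: power2_eq_square)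
      also have "\<dots> \<le> r k / mk\<^sup>2"
        using mk mk0 r(1)[of k] by (intro divide_left_mono power_mono) auto
      also have "\<dots> \<le> (1 - (norm (zz k))\<^sup>2) / mk\<^sup>2"
        using one_minus_norm_sq_ge[OF nzz1[of k]] nzz[of k] by (intro divide_right_mono) auto
      finally have "(1 / (9 * r k)) powr N \<le> kernel_sq t (zz k) w"
        unfolding kernel_sq_def N_def[symmetric] mk_def[symmetric]
        using N r(1)[of k] by (intro powr_mono2) auto
      then have 1: "r k powr (-N) \<le> 9 powr N * kernel_sq t (zz k) w"
        using r(1)[of k] by (simp add: powr_divide powr_mult powr_minus_divide divide_simps mult_ac)
      have "m powr (c - N) \<le> r k powr (c - N)"
        using c k1 r(1)[of k] by (intro powr_mono2') (auto simp: N_def)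
      also have "\<dots> = r k powr c * r k powr (-N)" by (simp add: powr_add[symmetric])
      also have "r k powr c = q ^ k"
        by (simp add: r_def q_def powr_realpow[symmetric] powr_powr mult.commute)
      also have "q ^ k * r k powr (-N) \<le> q ^ k * (9 powr N * kernel_sq t (zz k) w)"
        using 1 q by (intro mult_left_mono) auto
      finally have "ennreal (m powr (c - N)) \<le> ennreal (9 powr N * q ^ k * kernel_sq t (zz k) w)"
        by (intro ennreal_leI) (simp add: mult_ac)
      also have "\<dots> = ennreal (9 powr N * q ^ k) * ennreal (kernel_sq t (zz k) w)"
        using q by (simp add: ennreal_mult)
      also have "\<dots> \<le> (\<Sum>k. ennreal (9 powr N * q ^ k) * ennreal (kernel_sq t (zz k) w))"
        by (rule ennreal_le_suminf)
      finally show "ennreal (cmod (1 - hprod w z) powr (c - N))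
         \<le> (\<Sum>k. ennreal (9 powr N * q ^ k) * ennreal (kernel_sq t (zz k) w))"
        by (simp add: m_def)
    qed
    also have "\<dots> = (\<Sum>k. ennreal (9 powr N * q ^ k))"
      by (subst nn_integral_suminf) (auto simp: nn_integral_cmult kernel_sq_integral[OF t nzz1])
    also have "\<dots> = ennreal C"
      unfolding C_def using q
      by (subst suminf_ennreal2) (auto simp: suminf_mult suminf_geometric intro!: summable_mult summable_geometric)
    finally show ?thesis .
  qed
  then show ?thesis using C unfolding N_def by blast
qed

text \<open>The involution phi_z turns |1 - <w,z>| into (1-|z|^2)/|1 - <w,z>|; together with the
  density \<open>kernel_sq\<close> this exchanges the exponents -c - N and c - N at the price of
  (1-|z|^2)^(-c), and the bounded case finishes.\<close>

lemma forelli_rudin: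
  assumes t: "t > -1" and c: "0 < c" "c \<le> kernel_exp TYPE('n::finite) t"
  shows "\<exists>C\<ge>0. \<forall>z::complex^'n. norm z < 1 \<longrightarrow>
    (\<integral>\<^sup>+w. ennreal (cmod (1 - hprod w z) powr (- c - kernel_exp TYPE('n) t)) \<partial>nu t)
      \<le> ennreal (C * (1 - (norm z)\<^sup>2) powr (- c))"
proof -
  define N where "N = kernel_exp TYPE('n) t"
  obtain C where C: "C \<ge> 0" "\<And>z::complex^'n. norm z < 1 \<Longrightarrow>
    (\<integral>\<^sup>+w. ennreal (cmod (1 - hprod w z) powr (c - N)) \<partial>nu t) \<le> ennreal C"
    using forelli_rudin_bounded[OF t c] unfolding N_def by blast
  have "(\<integral>\<^sup>+w. ennreal (cmod (1 - hprod w z) powr (- c - N)) \<partial>nu t) \<le> ennreal (C * (1 - (norm z)\<^sup>2) powr (- c))"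
    if z: "norm (z::complex^'n) < 1" for z
  proof -
    define s where "s = 1 - (norm z)\<^sup>2"
    have s: "s > 0" unfolding s_def by (rule one_minus_norm_sq_pos[OF z])
    \<comment> \<open>The integrand divided by the density \<open>kernel_sq t z\<close>, so that the
      change of variables can be read from right to left.\<close>
    define G where "G w = ennreal (cmod (1 - hprod w z) powr (N - c) * s powr (-N))" for w
    have [measurable]: "G \<in> borel_measurable borel" unfolding G_def by measurable
    have "(\<integral>\<^sup>+w. ennreal (cmod (1 - hprod w z) powr (- c - N)) \<partial>nu t)
      = (\<integral>\<^sup>+w. G w * ennreal (kernel_sq t z w) \<partial>nu t)"
    proof (intro nn_integral_cong)
      fix w :: "complex^'n" assume "w \<in> space (nu t)"
      then have m: "cmod (1 - hprod w z) > 0" using cmod_one_minus_hprod_pos z by simp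
      define m where "m = cmod (1 - hprod w z)"
      have "m powr (N - c) * s powr (-N) * (s / m\<^sup>2) powr N = m powr (- c - N)"
      proof -
        have "(m\<^sup>2) powr N = m powr (2 * N)" using m by (simp add: m_def powr_powr[symmetric] powr_numeral)
        then have "m powr (N - c) * s powr (-N) * (s / m\<^sup>2) powr N
           = m powr (N - c) * (s powr (-N) * s powr N) * m powr (- (2 * N))"
          using s by (simp add: powr_divide powr_minus_divide)
        also have "\<dots> = m powr (N - c + - (2 * N))"
          using s m unfolding powr_add by (simp add: powr_add[symmetric] m_def)
        also have "N - c + - (2 * N) = - c - N" by simp
        finally show ?thesis .
      qed
      then show "ennreal (cmod (1 - hprod w z) powr (- c - N)) = G w * ennreal (kernel_sq t z w)"
        unfolding G_def kernel_sq_def N_def[symmetric] s_def[symmetric] m_def[symmetric]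
        by (simp add: ennreal_mult[symmetric])
    qed
    also have "\<dots> = (\<integral>\<^sup>+w. G (ball_involution z w) \<partial>nu t)"
      by (rule nn_integral_nu_involution[OF t z, symmetric]) measurable
    also have "\<dots> = (\<integral>\<^sup>+w. ennreal (s powr (- c)) * ennreal (cmod (1 - hprod w z) powr (c - N)) \<partial>nu t)"
    proof (intro nn_integral_cong)
      fix w :: "complex^'n" assume "w \<in> space (nu t)"
      then have w: "norm w < 1" by simp
      have m: "cmod (1 - hprod w z) > 0" using cmod_one_minus_hprod_pos[OF w z] .
      have "1 - hprod z z = complex_of_real s" by (simp add: hprod_self s_def)
      then have "cmod (1 - hprod (ball_involution z w) z) = s / cmod (1 - hprod w z)"
        using hprod_ball_involution_self[OF z, of w] m s by (simp add: norm_divide)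
      then have "cmod (1 - hprod (ball_involution z w) z) powr (N - c) * s powr (-N)
         = s powr (- c) * cmod (1 - hprod w z) powr (c - N)"
        using s m by (simp add: powr_divide powr_minus_divide powr_diff)
      then show "G (ball_involution z w) = ennreal (s powr (- c)) * ennreal (cmod (1 - hprod w z) powr (c - N))"
        unfolding G_def by (simp add: ennreal_mult[symmetric])
    qed
    also have "\<dots> = ennreal (s powr (- c)) * (\<integral>\<^sup>+w. ennreal (cmod (1 - hprod w z) powr (c - N)) \<partial>nu t)"
      by (rule nn_integral_cmult, rule measurable_nu_borel) measurable
    also have "\<dots> \<le> ennreal (s powr (- c)) * ennreal C" by (intro mult_left_mono C(2)[OF z]) simp
    finally show ?thesis using C(1) by (simp add: ennreal_mult s_def mult.commute)
  qed
  then show ?thesis using C(1) unfolding N_def by blast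
qed

text \<open>K is split as sqrt(K h) times sqrt(K / h) and Cauchy-Schwarz is applied in z; the first
  condition bounds one factor, Tonelli and the second condition bound the other. Nonnegative
  integrands in \<open>ennreal\<close> make the estimate available before any convergence is
  known.\<close>

lemma schur_test:
  fixes K :: "'a \<Rightarrow> 'a \<Rightarrow> real" and h :: "'a \<Rightarrow> real" and f :: "'a \<Rightarrow> ennreal"
  assumes M: "sigma_finite_measure M"
    and K[measurable]: "(\<lambda>(w, z). K w z) \<in> borel_measurable (M \<Otimes>\<^sub>M M)" "\<And>w z. 0 \<le> K w z"
    and h[measurable]: "h \<in> borel_measurable M" "\<And>z. z \<in> space M \<Longrightarrow> 0 < h z"
    and C: "C \<ge> 0"
    and 1: "\<And>w. w \<in> space M \<Longrightarrow> (\<integral>\<^sup>+z. ennreal (K w z * h z) \<partial>M) \<le> ennreal (C * h w)"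
    and 2: "\<And>z. z \<in> space M \<Longrightarrow> (\<integral>\<^sup>+w. ennreal (K w z * h w) \<partial>M) \<le> ennreal (C * h z)"
    and f[measurable]: "f \<in> borel_measurable M"
  shows "(\<integral>\<^sup>+w. (\<integral>\<^sup>+z. ennreal (K w z) * f z \<partial>M)\<^sup>2 \<partial>M) \<le> ennreal (C\<^sup>2) * (\<integral>\<^sup>+z. (f z)\<^sup>2 \<partial>M)"
proof -
  interpret sigma_finite_measure M by (rule M)
  interpret P: pair_sigma_finite M M ..
  have [measurable]: "(\<lambda>p. K (fst p) (snd p)) \<in> borel_measurable (M \<Otimes>\<^sub>M M)"
    using K(1) by (simp add: case_prod_beta')
  have K'[measurable]: "(\<lambda>z. K w z) \<in> borel_measurable M" "(\<lambda>w. K w z) \<in> borel_measurable M"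
     if "w \<in> space M" "z \<in> space M" for w z
    using measurable_Pair2[OF K(1) that(1)] measurable_Pair1[OF K(1) that(2)] by simp_all
  have "(\<integral>\<^sup>+w. (\<integral>\<^sup>+z. ennreal (K w z) * f z \<partial>M)\<^sup>2 \<partial>M)
    \<le> (\<integral>\<^sup>+w. (\<integral>\<^sup>+z. ennreal (C * h w) * (ennreal (K w z / h z) * (f z)\<^sup>2) \<partial>M) \<partial>M)"
  proof (intro nn_integral_mono)
    fix w assume w: "w \<in> space M"
    note [measurable] = K'(1)[OF w w]
    have "(\<integral>\<^sup>+z. ennreal (K w z) * f z \<partial>M) =
      (\<integral>\<^sup>+z. ennreal (sqrt (K w z * h z)) * (ennreal (sqrt (K w z / h z)) * f z) \<partial>M)"
    proof (intro nn_integral_cong)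
      fix z assume z: "z \<in> space M"
      have "K w z = sqrt (K w z * h z) * sqrt (K w z / h z)"
        using h(2)[OF z] K(2) by (simp add: real_sqrt_mult[symmetric])
      then have "ennreal (K w z) = ennreal (sqrt (K w z * h z)) * ennreal (sqrt (K w z / h z))"
        using h(2)[OF z] K(2) by (simp add: ennreal_mult[symmetric])
      then show "ennreal (K w z) * f z = ennreal (sqrt (K w z * h z)) * (ennreal (sqrt (K w z / h z)) * f z)"
        by (simp add: mult.assoc)
    qed
    then have "(\<integral>\<^sup>+z. ennreal (K w z) * f z \<partial>M)\<^sup>2 \<le>
      (\<integral>\<^sup>+z. (ennreal (sqrt (K w z * h z)))\<^sup>2 \<partial>M) * (\<integral>\<^sup>+z. (ennreal (sqrt (K w z / h z)) * f z)\<^sup>2 \<partial>M)"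
      by (simp only:) (rule Cauchy_Schwarz_nn_integral; measurable)
    also have "(\<integral>\<^sup>+z. (ennreal (sqrt (K w z * h z)))\<^sup>2 \<partial>M) = (\<integral>\<^sup>+z. ennreal (K w z * h z) \<partial>M)"
      using h(2) K(2) by (intro nn_integral_cong) (simp add: ennreal_power less_imp_le)
    also have "(\<integral>\<^sup>+z. (ennreal (sqrt (K w z / h z)) * f z)\<^sup>2 \<partial>M) = (\<integral>\<^sup>+z. ennreal (K w z / h z) * (f z)\<^sup>2 \<partial>M)"
      using h(2) K(2) by (intro nn_integral_cong) (simp add: power_mult_distrib ennreal_power less_imp_le)
    also have "(\<integral>\<^sup>+z. ennreal (K w z * h z) \<partial>M) * (\<integral>\<^sup>+z. ennreal (K w z / h z) * (f z)\<^sup>2 \<partial>M)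
      \<le> ennreal (C * h w) * (\<integral>\<^sup>+z. ennreal (K w z / h z) * (f z)\<^sup>2 \<partial>M)"
      by (intro mult_right_mono 1 w) simp
    also have "\<dots> = (\<integral>\<^sup>+z. ennreal (C * h w) * (ennreal (K w z / h z) * (f z)\<^sup>2) \<partial>M)"
      by (rule nn_integral_cmult[symmetric]) measurable
    finally show "(\<integral>\<^sup>+z. ennreal (K w z) * f z \<partial>M)\<^sup>2
      \<le> (\<integral>\<^sup>+z. ennreal (C * h w) * (ennreal (K w z / h z) * (f z)\<^sup>2) \<partial>M)" .
  qed
  also have "\<dots> = (\<integral>\<^sup>+z. (\<integral>\<^sup>+w. ennreal (C * h w) * (ennreal (K w z / h z) * (f z)\<^sup>2) \<partial>M) \<partial>M)"
    by (rule P.Fubini') measurable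
  also have "\<dots> \<le> (\<integral>\<^sup>+z. ennreal (C\<^sup>2) * (f z)\<^sup>2 \<partial>M)"
  proof (intro nn_integral_mono)
    fix z assume z: "z \<in> space M"
    note [measurable] = K'(2)[OF z z]
    have "(\<integral>\<^sup>+w. ennreal (C * h w) * (ennreal (K w z / h z) * (f z)\<^sup>2) \<partial>M)
      = (\<integral>\<^sup>+w. (ennreal (C / h z) * (f z)\<^sup>2) * ennreal (K w z * h w) \<partial>M)"
    proof (intro nn_integral_cong)
      fix w assume w: "w \<in> space M"
      have "ennreal (C * h w) * ennreal (K w z / h z) = ennreal (C / h z) * ennreal (K w z * h w)"
        using h(2)[OF w] h(2)[OF z] C K(2) by (simp add: ennreal_mult[symmetric] less_imp_le mult_ac)
      then show "ennreal (C * h w) * (ennreal (K w z / h z) * (f z)\<^sup>2)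
        = (ennreal (C / h z) * (f z)\<^sup>2) * ennreal (K w z * h w)" by (simp add: mult_ac) (metis mult.assoc mult.commute)
    qed
    also have "\<dots> = (ennreal (C / h z) * (f z)\<^sup>2) * (\<integral>\<^sup>+w. ennreal (K w z * h w) \<partial>M)"
      by (rule nn_integral_cmult) measurable
    also have "\<dots> \<le> (ennreal (C / h z) * (f z)\<^sup>2) * ennreal (C * h z)"
      by (intro mult_left_mono 2 z) simp
    also have "\<dots> = (ennreal (C / h z) * ennreal (C * h z)) * (f z)\<^sup>2"
      by (simp only: mult_ac)
    also have "ennreal (C / h z) * ennreal (C * h z) = ennreal (C\<^sup>2)"
      using C h(2)[OF z] by (simp add: ennreal_mult[symmetric] less_imp_le power2_eq_square)
    finally show "(\<integral>\<^sup>+w. ennreal (C * h w) * (ennreal (K w z / h z) * (f z)\<^sup>2) \<partial>M) \<le> ennreal (C\<^sup>2) * (f z)\<^sup>2" .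
  qed
  also have "\<dots> = ennreal (C\<^sup>2) * (\<integral>\<^sup>+z. (f z)\<^sup>2 \<partial>M)"
    by (rule nn_integral_cmult) measurable
  finally show ?thesis .
qed

text \<open>By \<open>Qker_alt\<close> this is |K_z(w)| times the power -d of 1 - |phi_z(w)|^2,
  which is symmetric in w and z. It majorises the integral of |K_z K_w| up to a constant, and d
  measures how much decay away from the diagonal has been given up.\<close>

definition Qker :: "real \<Rightarrow> real \<Rightarrow> complex^'n::finite \<Rightarrow> complex^'n \<Rightarrow> real"
  where "Qker \<alpha> d w z = cmod (1 - hprod w z) powr (2 * d - kernel_exp TYPE('n) \<alpha>)
     * ((1 - (norm w)\<^sup>2) * (1 - (norm z)\<^sup>2)) powr (- d)"

lemma Qker_nonneg [simp]: "0 \<le> Qker \<alpha> d w z" by (simp add: Qker_def)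

lemma Qker_swap: "Qker \<alpha> d w z = Qker \<alpha> d z w"
  by (simp add: Qker_def cmod_one_minus_hprod_swap mult.commute)

lemma measurable_Qker [measurable (raw)]:
  assumes [measurable]: "f \<in> borel_measurable M" "g \<in> borel_measurable M"
  shows "(\<lambda>x. Qker \<alpha> d (f x) (g x)) \<in> borel_measurable M"
  unfolding Qker_def by measurable

lemma kernel_exp_diff: "kernel_exp TYPE('n::finite) (t - s) = kernel_exp TYPE('n) t - s"
  by (simp add: kernel_exp_def)

text \<open>The Schur weight is (1-|w|^2)^(-2d). Together with the power -d in \<open>Qker\<close>
  it leads to the measure with weight \<alpha> - 3d, whose kernel exponent is N - 3d. As 2d - N = -d
  - (N - 3d), the Forelli-Rudin bound with c = d applies; it yields (1-|z|^2)^(-d), which the factor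
  from \<open>Qker\<close> completes to the power -2d. The conditions on d are those of this
  application.\<close>

lemma Qker_schur:
  assumes d: "0 < d" "\<alpha> - 3 * d > -1" "d \<le> kernel_exp TYPE('n::finite) \<alpha> - 3 * d"
  shows "\<exists>C\<ge>0. \<forall>z::complex^'n. norm z < 1 \<longrightarrow>
    (\<integral>\<^sup>+w. ennreal (Qker \<alpha> d w z * (1 - (norm w)\<^sup>2) powr (- (2 * d))) \<partial>nu \<alpha>)
      \<le> ennreal (C * (1 - (norm z)\<^sup>2) powr (- (2 * d)))"
proof -
  define t where "t = \<alpha> - 3 * d"
  define N where "N = kernel_exp TYPE('n) \<alpha>"
  have t: "t > -1" and \<alpha>: "\<alpha> > -1" using d by (auto simp: t_def)
  have Nt: "kernel_exp TYPE('n) t = N - 3 * d" by (simp add: t_def N_def kernel_exp_diff)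
  obtain C where C: "C \<ge> 0" "\<And>z::complex^'n. norm z < 1 \<Longrightarrow>
    (\<integral>\<^sup>+w. ennreal (cmod (1 - hprod w z) powr (- d - (N - 3 * d))) \<partial>nu t) \<le> ennreal (C * (1 - (norm z)\<^sup>2) powr (- d))"
    using forelli_rudin[OF t, of d, where 'n='n] d unfolding Nt N_def by blast
  define R where "R = weight_const TYPE('n) \<alpha> / weight_const TYPE('n) t"
  have R: "R > 0" unfolding R_def using weight_const_pos \<alpha> t by (metis divide_pos_pos)
  have "(\<integral>\<^sup>+w. ennreal (Qker \<alpha> d w z * (1 - (norm w)\<^sup>2) powr (- (2 * d))) \<partial>nu \<alpha>)
      \<le> ennreal (R * C * (1 - (norm z)\<^sup>2) powr (- (2 * d)))" if z: "norm (z::complex^'n) < 1" for z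
  proof -
    define s where "s = 1 - (norm z)\<^sup>2"
    have s: "s > 0" unfolding s_def by (rule one_minus_norm_sq_pos[OF z])
    have "(\<integral>\<^sup>+w. ennreal (Qker \<alpha> d w z * (1 - (norm w)\<^sup>2) powr (- (2 * d))) \<partial>nu \<alpha>)
      = (\<integral>\<^sup>+w. ennreal (R * (1 - (norm w)\<^sup>2) powr (\<alpha> - t)) *
           ennreal (Qker \<alpha> d w z * (1 - (norm w)\<^sup>2) powr (- (2 * d))) \<partial>nu t)"
      unfolding R_def
      by (rule nn_integral_nu_change[OF t \<alpha>], rule measurable_nu_borel) measurable
    also have "\<dots> = (\<integral>\<^sup>+w. ennreal (R * s powr (- d)) * ennreal (cmod (1 - hprod w z) powr (- d - (N - 3 * d))) \<partial>nu t)"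
    proof (intro nn_integral_cong)
      fix w :: "complex^'n" assume "w \<in> space (nu t)"
      then have pw: "1 - (norm w)\<^sup>2 > 0" using one_minus_norm_sq_pos by simp
      define r where "r = 1 - (norm w)\<^sup>2"
      have "r powr (\<alpha> - t) * (r powr (- d) * r powr (- (2 * d))) = 1"
        using pw by (simp add: powr_add[symmetric] t_def r_def)
      then have "R * r powr (\<alpha> - t) * (cmod (1 - hprod w z) powr (2 * d - N) * (r powr (-d) * s powr (-d)) * r powr (- (2 * d)))
         = R * s powr (- d) * cmod (1 - hprod w z) powr (- d - (N - 3 * d))"
        by (simp add: mult_ac) 
      then show "ennreal (R * (1 - (norm w)\<^sup>2) powr (\<alpha> - t)) *
           ennreal (Qker \<alpha> d w z * (1 - (norm w)\<^sup>2) powr (- (2 * d)))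
         = ennreal (R * s powr (- d)) * ennreal (cmod (1 - hprod w z) powr (- d - (N - 3 * d)))"
        using R pw s unfolding Qker_def N_def[symmetric] r_def[symmetric] s_def[symmetric]
        by (simp add: ennreal_mult[symmetric] powr_mult)
    qed
    also have "\<dots> = ennreal (R * s powr (- d)) * (\<integral>\<^sup>+w. ennreal (cmod (1 - hprod w z) powr (- d - (N - 3 * d))) \<partial>nu t)"
      by (rule nn_integral_cmult, rule measurable_nu_borel) measurable
    also have "\<dots> \<le> ennreal (R * s powr (- d)) * ennreal (C * s powr (- d))"
      unfolding s_def by (intro mult_left_mono C(2)[OF z]) simp
    also have "\<dots> = ennreal (R * C * s powr (- (2 * d)))"
      using R C(1) s by (simp add: ennreal_mult[symmetric] mult_ac powr_add[symmetric])
    finally show ?thesis by (simp add: s_def)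
  qed
  then show ?thesis using R C(1) by (intro exI[of _ "R * C"]) simp
qed

lemma Qker_bounded:
  assumes d: "0 < d" "\<alpha> - 3 * d > -1" "d \<le> kernel_exp TYPE('n::finite) \<alpha> - 3 * d"
  shows "\<exists>C\<ge>0. \<forall>f \<in> borel_measurable (nu \<alpha> :: (complex^'n) measure).
    (\<integral>\<^sup>+w. (\<integral>\<^sup>+z. ennreal (Qker \<alpha> d w z) * f z \<partial>nu \<alpha>)\<^sup>2 \<partial>nu \<alpha>) \<le> ennreal (C\<^sup>2) * (\<integral>\<^sup>+z. (f z)\<^sup>2 \<partial>nu \<alpha>)"
proof -
  have \<alpha>: "\<alpha> > -1" using d by simp
  let ?N = "nu \<alpha> :: (complex^'n) measure"
  interpret finite_measure ?N by (rule finite_measure_nu[OF \<alpha>])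
  obtain C where C: "C \<ge> 0" "\<And>z::complex^'n. norm z < 1 \<Longrightarrow>
    (\<integral>\<^sup>+w. ennreal (Qker \<alpha> d w z * (1 - (norm w)\<^sup>2) powr (- (2 * d))) \<partial>nu \<alpha>)
      \<le> ennreal (C * (1 - (norm z)\<^sup>2) powr (- (2 * d)))"
    using Qker_schur[OF d] by blast
  note measurable_nu_id[measurable]
  have "(\<integral>\<^sup>+w. (\<integral>\<^sup>+z. ennreal (Qker \<alpha> d w z) * f z \<partial>nu \<alpha>)\<^sup>2 \<partial>nu \<alpha>) \<le> ennreal (C\<^sup>2) * (\<integral>\<^sup>+z. (f z)\<^sup>2 \<partial>nu \<alpha>)"
    if f: "f \<in> borel_measurable ?N" for f
  proof (rule schur_test[where h = "\<lambda>w. (1 - (norm w)\<^sup>2) powr (- (2 * d))"])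
    show "sigma_finite_measure ?N" ..
    show "(\<lambda>(w, z). Qker \<alpha> d w z) \<in> borel_measurable (?N \<Otimes>\<^sub>M ?N)"
      by measurable
    show "(\<lambda>w. (1 - (norm w)\<^sup>2) powr (- (2 * d))) \<in> borel_measurable ?N"
      by (rule measurable_nu_borel) measurable
    show "w \<in> space ?N \<Longrightarrow> 0 < (1 - (norm w)\<^sup>2) powr (- (2 * d))" for w
      using one_minus_norm_sq_pos[of w] by simp
    show "w \<in> space ?N \<Longrightarrow> (\<integral>\<^sup>+z. ennreal (Qker \<alpha> d w z * (1 - (norm z)\<^sup>2) powr (- (2 * d))) \<partial>nu \<alpha>)
      \<le> ennreal (C * (1 - (norm w)\<^sup>2) powr (- (2 * d)))" for w
      using C(2)[of w] by (subst Qker_swap) simp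
  qed (use C f in auto)
  then show ?thesis using C(1) by blast
qed

text \<open>The involution phi_z turns the integrand into |1-<w,z>|^(-N) |1-<u,w'>|^(-N) with w' =
  phi_z(w). The exponent -N is the borderline at which the integral grows logarithmically, so the
  power -d of |1-<u,w'>| is given up for 2^d (1-|w'|^2)^(-d); the remaining exponent d - N has a
  bounded integral.\<close>

lemma kernel_product_bound:
  assumes \<alpha>: "\<alpha> > -1" and d: "0 < d" "d \<le> kernel_exp TYPE('n::finite) \<alpha>"
  shows "\<exists>C\<ge>0. \<forall>w z :: complex^'n. norm w < 1 \<and> norm z < 1 \<longrightarrow>
    (\<integral>\<^sup>+u. ennreal (cmod (1 - hprod u z) powr (- kernel_exp TYPE('n) \<alpha>)
      * cmod (1 - hprod u w) powr (- kernel_exp TYPE('n) \<alpha>)) \<partial>nu \<alpha>) \<le> ennreal (C * Qker \<alpha> d w z)"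
proof -
  define N where "N = kernel_exp TYPE('n) \<alpha>"
  obtain C where C: "C \<ge> 0" "\<And>z::complex^'n. norm z < 1 \<Longrightarrow>
    (\<integral>\<^sup>+w. ennreal (cmod (1 - hprod w z) powr (d - N)) \<partial>nu \<alpha>) \<le> ennreal C"
    using forelli_rudin_bounded[OF \<alpha> d] unfolding N_def by blast
  have "(\<integral>\<^sup>+u. ennreal (cmod (1 - hprod u z) powr (- N) * cmod (1 - hprod u w) powr (- N)) \<partial>nu \<alpha>)
     \<le> ennreal ((2 powr d * C) * Qker \<alpha> d w z)" if w: "norm w < 1" and z: "norm z < 1" for w z :: "complex^'n"
  proof -
    define s where "s = 1 - (norm z)\<^sup>2"
    have s: "s > 0" unfolding s_def by (rule one_minus_norm_sq_pos[OF z])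
    define w' where "w' = ball_involution z w"
    have w': "norm w' < 1" unfolding w'_def by (rule ball_involution_in_ball[OF z w])
    define M where "M = cmod (1 - hprod w z)"
    have M: "M > 0" unfolding M_def by (rule cmod_one_minus_hprod_pos[OF w z])
    have zz: "1 - hprod z z = complex_of_real s" by (simp add: hprod_self s_def)
    define G where "G u = ennreal (cmod (1 - hprod u z) powr N * s powr (-N) * cmod (1 - hprod u w) powr (- N))" for u
    have [measurable]: "G \<in> borel_measurable borel" unfolding G_def by measurable
    have "(\<integral>\<^sup>+u. ennreal (cmod (1 - hprod u z) powr (- N) * cmod (1 - hprod u w) powr (- N)) \<partial>nu \<alpha>)
      = (\<integral>\<^sup>+u. G u * ennreal (kernel_sq \<alpha> z u) \<partial>nu \<alpha>)"
    proof (intro nn_integral_cong)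
      fix u :: "complex^'n" assume "u \<in> space (nu \<alpha>)"
      then have m: "cmod (1 - hprod u z) > 0" using cmod_one_minus_hprod_pos z by simp
      define m where "m = cmod (1 - hprod u z)"
      have "m powr N * s powr (-N) * (s / m\<^sup>2) powr N = m powr (- N)"
      proof -
        have "(m\<^sup>2) powr N = m powr N * m powr N"
          using m by (simp add: m_def power2_eq_square powr_mult)
        then show ?thesis using s m by (simp add: powr_divide powr_minus_divide m_def)
      qed
      then show "ennreal (cmod (1 - hprod u z) powr (- N) * cmod (1 - hprod u w) powr (- N)) = G u * ennreal (kernel_sq \<alpha> z u)"
        unfolding G_def kernel_sq_def N_def[symmetric] s_def[symmetric] m_def[symmetric]
        by (simp add: ennreal_mult[symmetric] mult_ac)
    qed
    also have "\<dots> = (\<integral>\<^sup>+u. G (ball_involution z u) \<partial>nu \<alpha>)"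
      by (rule nn_integral_nu_involution[OF \<alpha> z, symmetric]) measurable
    also have "\<dots> = (\<integral>\<^sup>+u. ennreal (M powr (-N)) * ennreal (cmod (1 - hprod u w') powr (-N)) \<partial>nu \<alpha>)"
    proof (intro nn_integral_cong)
      fix u :: "complex^'n" assume "u \<in> space (nu \<alpha>)"
      then have u: "norm u < 1" by simp
      define m where "m = cmod (1 - hprod u z)"
      have m: "m > 0" unfolding m_def by (rule cmod_one_minus_hprod_pos[OF u z])
      define n where "n = cmod (1 - hprod u w')"
      have n: "n > 0" unfolding n_def by (rule cmod_one_minus_hprod_pos[OF u w'])
      have nz: "1 - hprod u z \<noteq> 0" "1 - hprod w z \<noteq> 0" "1 - hprod w' z \<noteq> 0"
        using one_minus_hprod_nz z w w' u by (meson less_imp_le)+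
      have ww: "w = ball_involution z w'" 
        unfolding w'_def using ball_involution_involution[OF z nz(2)] by simp
      have a: "cmod (1 - hprod (ball_involution z u) z) = s / m"
        using hprod_ball_involution_self[OF z nz(1)] s zz by (simp add: norm_divide m_def)
      have "cmod (1 - hprod w' z) = s / M"
        unfolding w'_def using hprod_ball_involution_self[OF z nz(2)] s zz by (simp add: norm_divide M_def)
      then have "cmod (1 - hprod z w') = s / M" by (simp only: cmod_one_minus_hprod_swap)
      then have b: "cmod (1 - hprod (ball_involution z u) w) = n * M / m"
        using hprod_ball_involution[OF z nz(1) nz(3)] s M zz unfolding ww[symmetric]
        by (simp add: norm_divide norm_mult m_def n_def)
      have "(s / m) powr N * s powr (-N) * (n * M / m) powr (-N) = M powr (-N) * n powr (-N)"
        using s m n M by (simp add: powr_divide powr_mult powr_minus_divide)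
      then show "G (ball_involution z u) = ennreal (M powr (-N)) * ennreal (cmod (1 - hprod u w') powr (-N))"
        unfolding G_def a b n_def[symmetric] by (simp add: ennreal_mult[symmetric])
    qed
    also have "\<dots> \<le> (\<integral>\<^sup>+u. ennreal (M powr (-N) * (2 powr d * (1 - (norm w')\<^sup>2) powr (-d))) * ennreal (cmod (1 - hprod u w') powr (d - N)) \<partial>nu \<alpha>)"
    proof (intro nn_integral_mono)
      fix u :: "complex^'n" assume "u \<in> space (nu \<alpha>)"
      then have u: "norm u < 1" by simp
      define n where "n = cmod (1 - hprod u w')"
      have n: "n > 0" unfolding n_def by (rule cmod_one_minus_hprod_pos[OF u w'])
      have "(1 - (norm w')\<^sup>2) / 2 \<le> n"
        using one_minus_norm_sq_le_cmod[OF w' u] by (simp add: n_def cmod_one_minus_hprod_swap)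
      then have "n powr (- d) \<le> ((1 - (norm w')\<^sup>2) / 2) powr (- d)"
        using d one_minus_norm_sq_pos[OF w'] by (intro powr_mono2') auto
      also have "\<dots> = 2 powr d * (1 - (norm w')\<^sup>2) powr (-d)"
        using one_minus_norm_sq_pos[OF w'] by (simp add: powr_divide powr_minus_divide)
      finally have "n powr (- d) * n powr (d - N) \<le> (2 powr d * (1 - (norm w')\<^sup>2) powr (-d)) * n powr (d - N)"
        by (intro mult_right_mono) auto
      moreover have "n powr (- d) * n powr (d - N) = n powr (- N)" by (simp add: powr_add[symmetric])
      ultimately have "M powr (-N) * n powr (- N) \<le> M powr (-N) * (2 powr d * (1 - (norm w')\<^sup>2) powr (-d)) * n powr (d - N)"
        by (simp add: mult_left_mono mult.assoc)
      then show "ennreal (M powr (-N)) * ennreal (cmod (1 - hprod u w') powr (-N))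
         \<le> ennreal (M powr (-N) * (2 powr d * (1 - (norm w')\<^sup>2) powr (-d))) * ennreal (cmod (1 - hprod u w') powr (d - N))"
        unfolding n_def[symmetric] by (simp add: ennreal_mult[symmetric] ennreal_leI)
    qed
    also have "\<dots> = ennreal (M powr (-N) * (2 powr d * (1 - (norm w')\<^sup>2) powr (-d))) *
        (\<integral>\<^sup>+u. ennreal (cmod (1 - hprod u w') powr (d - N)) \<partial>nu \<alpha>)"
      by (rule nn_integral_cmult, rule measurable_nu_borel) measurable
    also have "\<dots> \<le> ennreal (M powr (-N) * (2 powr d * (1 - (norm w')\<^sup>2) powr (-d))) * ennreal C"
      by (intro mult_left_mono C(2)[OF w']) simp
    also have "\<dots> = ennreal ((2 powr d * C) * (M powr (-N) * (1 - (norm w')\<^sup>2) powr (-d)))"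
      using C(1) by (simp add: ennreal_mult[symmetric] mult_ac)
    also have "M powr (-N) * (1 - (norm w')\<^sup>2) powr (-d) = Qker \<alpha> d w z"
    proof -
      have "1 - (norm w')\<^sup>2 = ((1 - (norm w)\<^sup>2) * (1 - (norm z)\<^sup>2)) / M\<^sup>2"
        unfolding w'_def M_def ball_involution_norm[OF z w] by (simp add: mult.commute)
      then have "(1 - (norm w')\<^sup>2) powr (-d) = ((1 - (norm w)\<^sup>2) * (1 - (norm z)\<^sup>2)) powr (-d) * M powr (2 * d)"
        using M one_minus_norm_sq_pos[OF w] one_minus_norm_sq_pos[OF z]
        by (simp add: powr_divide powr_minus_divide powr_powr[symmetric] powr_numeral)
      then show ?thesis using M
        by (simp add: Qker_def M_def[symmetric] N_def[symmetric] powr_diff powr_minus_divide)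
    qed
    finally show ?thesis .
  qed
  then show ?thesis using C(1) unfolding N_def by (intro exI[of _ "2 powr d * C"]) auto
qed

section \<open>The Bergman kernel and the reproducing formula\<close>

lemma cmod_bergman_kernel:
  "cmod (bergman_kernel \<alpha> z w) = cmod (1 - hprod w z) powr (- kernel_exp TYPE('n) \<alpha>)"
  for z w :: "complex^'n::finite"
  unfolding bergman_kernel_def kernel_exp_def by (rule cmod_powr_of_real)

lemma cmod_bergman_kernel_swap: "cmod (bergman_kernel \<alpha> z w) = cmod (bergman_kernel \<alpha> w z)"
  by (simp add: cmod_bergman_kernel cmod_one_minus_hprod_swap)

lemma cnj_bergman_kernel:
  assumes "norm z < 1" "norm w < 1"
  shows "cnj (bergman_kernel \<alpha> z w) = bergman_kernel \<alpha> w z"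
proof -
  have "cnj ((1 - hprod w z) powr s) = cnj (1 - hprod w z) powr cnj s" for s
    using one_minus_hprod_Re_pos[of w z] assms by (intro cnj_powr) auto
  then show ?thesis by (simp add: bergman_kernel_def cnj_hprod)
qed

lemma scalar_holo_bergman_kernel: "norm z < 1 \<Longrightarrow> scalar_holo (bergman_kernel \<alpha> z)"
  unfolding bergman_kernel_def by (rule scalar_holo_kernel)

lemma normalized_kernel_eq:
  "normalized_kernel \<alpha> z w =
     complex_of_real ((1 - (norm z)\<^sup>2) powr (kernel_exp TYPE('n) \<alpha> / 2)) * bergman_kernel \<alpha> z w"
  for z w :: "complex^'n::finite"
  by (simp add: normalized_kernel_def bergman_kernel_def kernel_exp_def)

lemma kernel_sq_eq:
  fixes z w :: "complex^'n::finite"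
  assumes "norm z < 1" "norm w < 1"
  shows "kernel_sq \<alpha> z w = (1 - (norm z)\<^sup>2) powr kernel_exp TYPE('n) \<alpha> * (cmod (bergman_kernel \<alpha> z w))\<^sup>2"
    and "(cmod (normalized_kernel \<alpha> z w))\<^sup>2 = kernel_sq \<alpha> z w"
proof -
  define N where "N = kernel_exp TYPE('n) \<alpha>"
  define m where "m = cmod (1 - hprod w z)"
  have m: "m > 0" unfolding m_def using cmod_one_minus_hprod_pos assms by blast
  have "(m\<^sup>2) powr N = m powr N * m powr N"
    using m by (simp add: m_def power2_eq_square powr_mult)
  then show 1: "kernel_sq \<alpha> z w = (1 - (norm z)\<^sup>2) powr kernel_exp TYPE('n) \<alpha> * (cmod (bergman_kernel \<alpha> z w))\<^sup>2"
    using one_minus_norm_sq_pos[OF assms(1)] m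
    unfolding kernel_sq_def cmod_bergman_kernel N_def[symmetric] m_def[symmetric]
    by (simp add: powr_divide powr_minus_divide power2_eq_square)
  have "((1 - (norm z)\<^sup>2) powr (N / 2))\<^sup>2 = (1 - (norm z)\<^sup>2) powr N"
    using one_minus_norm_sq_pos[OF assms(1)] by (simp add: power2_eq_square powr_add[symmetric])
  then show "(cmod (normalized_kernel \<alpha> z w))\<^sup>2 = kernel_sq \<alpha> z w"
    unfolding 1 normalized_kernel_eq N_def[symmetric] by (simp add: norm_mult power_mult_distrib)
qed

lemma bergman_kernel_L2:
  fixes z :: "complex^'n::finite"
  assumes \<alpha>: "\<alpha> > -1" and z: "norm z < 1"
  shows "(\<integral>\<^sup>+w. (ennreal (cmod (bergman_kernel \<alpha> z w)))\<^sup>2 \<partial>nu \<alpha>) = ennreal ((1 - (norm z)\<^sup>2) powr (- kernel_exp TYPE('n) \<alpha>))"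
proof -
  define s where "s = (1 - (norm z)\<^sup>2) powr (kernel_exp TYPE('n) \<alpha>)"
  have s: "s > 0" using one_minus_norm_sq_pos[OF z] by (simp add: s_def)
  have [measurable]: "bergman_kernel \<alpha> z \<in> borel_measurable (nu \<alpha>)"
    by (rule scalar_holo_measurable[OF scalar_holo_bergman_kernel[OF z]])
  have "1 = (\<integral>\<^sup>+w. ennreal (kernel_sq \<alpha> z w) \<partial>nu \<alpha>)" by (rule kernel_sq_integral[OF \<alpha> z, symmetric])
  also have "\<dots> = (\<integral>\<^sup>+w. ennreal s * (ennreal (cmod (bergman_kernel \<alpha> z w)))\<^sup>2 \<partial>nu \<alpha>)"
    using s z by (intro nn_integral_cong) (simp add: kernel_sq_eq(1) s_def ennreal_mult ennreal_power)
  also have "\<dots> = ennreal s * (\<integral>\<^sup>+w. (ennreal (cmod (bergman_kernel \<alpha> z w)))\<^sup>2 \<partial>nu \<alpha>)"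
    by (rule nn_integral_cmult) measurable
  finally have "ennreal (1 / s) * 1 = ennreal (1 / s) * (ennreal s * (\<integral>\<^sup>+w. (ennreal (cmod (bergman_kernel \<alpha> z w)))\<^sup>2 \<partial>nu \<alpha>))"
    by simp
  also have "\<dots> = (\<integral>\<^sup>+w. (ennreal (cmod (bergman_kernel \<alpha> z w)))\<^sup>2 \<partial>nu \<alpha>)"
    using s by (simp add: mult.assoc[symmetric] ennreal_mult[symmetric])
  finally show ?thesis using one_minus_norm_sq_pos[OF z] by (simp add: s_def powr_minus_divide)
qed

lemma integral_nu_involution:
  fixes P :: "complex^'n::finite \<Rightarrow> complex"
  assumes t: "t > -1" and a: "norm a < 1" and P[measurable]: "P \<in> borel_measurable borel"
  shows "(LINT x|nu t. P (ball_involution a x)) = (LINT x|nu t. kernel_sq t a x *\<^sub>R P x)"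
proof -
  note measurable_nu_id[measurable] measurable_ball_involution[OF a, measurable]
  have mi: "ball_involution a \<in> measurable (nu t) borel" by (rule measurable_nu_borel) measurable
  have mk: "kernel_sq t a \<in> borel_measurable (nu t)" by (rule measurable_nu_borel) measurable
  have mP: "P \<in> borel_measurable (nu t)" by (rule measurable_nu_borel) measurable
  have mid: "(\<lambda>x. x) \<in> measurable (density (nu t) (\<lambda>x. ennreal (kernel_sq t a x))) (borel :: (complex^'n) measure)"
    by (simp add: measurable_nu_id)
  have "distr (nu t) borel (ball_involution a) = distr (density (nu t) (kernel_sq t a)) borel (\<lambda>x. x)"
  proof (rule measure_eqI)
    fix A assume "A \<in> sets (distr (nu t) borel (ball_involution a))"
    then have A[measurable]: "A \<in> sets borel" by simp
    have mA: "(indicator A :: complex^'n \<Rightarrow> ennreal) \<in> borel_measurable (nu t)"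
      by (rule measurable_nu_borel) measurable
    have "emeasure (distr (nu t) borel (ball_involution a)) A = (\<integral>\<^sup>+x. indicator A x \<partial>distr (nu t) borel (ball_involution a))"
      by (rule nn_integral_indicator[symmetric]) simp
    also have "\<dots> = (\<integral>\<^sup>+x. indicator A (ball_involution a x) \<partial>nu t)"
      by (rule nn_integral_distr[OF mi]) simp
    also have "\<dots> = (\<integral>\<^sup>+x. indicator A x * ennreal (kernel_sq t a x) \<partial>nu t)"
      by (rule nn_integral_nu_involution[OF t a]) measurable
    also have "\<dots> = (\<integral>\<^sup>+x. indicator A x \<partial>density (nu t) (kernel_sq t a))"
      using mk mA by (subst nn_integral_density) (auto simp: mult.commute)
    also have "\<dots> = (\<integral>\<^sup>+x. indicator A x \<partial>distr (density (nu t) (kernel_sq t a)) borel (\<lambda>x. x))"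
      by (rule nn_integral_distr[OF mid, symmetric]) simp
    also have "\<dots> = emeasure (distr (density (nu t) (kernel_sq t a)) borel (\<lambda>x. x)) A"
      by (rule nn_integral_indicator) simp
    finally show "emeasure (distr (nu t) borel (ball_involution a)) A = emeasure (distr (density (nu t) (kernel_sq t a)) borel (\<lambda>x. x)) A" .
  qed simp
  then have "(LINT x|distr (nu t) borel (ball_involution a). P x)
     = (LINT x|distr (density (nu t) (kernel_sq t a)) borel (\<lambda>x. x). P x)" by simp
  also have "(LINT x|distr (nu t) borel (ball_involution a). P x) = (LINT x|nu t. P (ball_involution a x))"
    by (rule integral_distr[OF mi P])
  also have "(LINT x|distr (density (nu t) (kernel_sq t a)) borel (\<lambda>x. x). P x) = (LINT x|density (nu t) (kernel_sq t a). P x)"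
    by (rule integral_distr[OF mid P])
  also have "\<dots> = (LINT x|nu t. kernel_sq t a x *\<^sub>R P x)"
    by (rule integral_density[OF mP mk]) simp
  finally show ?thesis .
qed

lemma nn_integral_L2_imp_L1:
  assumes M: "emeasure M (space M) \<le> 1" and f: "f \<in> borel_measurable M"
  shows "(\<integral>\<^sup>+x. f x \<partial>M)\<^sup>2 \<le> (\<integral>\<^sup>+x. (f x)\<^sup>2 \<partial>M)"
proof -
  have "(\<integral>\<^sup>+x. f x * 1 \<partial>M)\<^sup>2 \<le> (\<integral>\<^sup>+x. (f x)\<^sup>2 \<partial>M) * (\<integral>\<^sup>+x. 1\<^sup>2 \<partial>M)"
    using f by (intro Cauchy_Schwarz_nn_integral) auto
  also have "\<dots> \<le> (\<integral>\<^sup>+x. (f x)\<^sup>2 \<partial>M) * 1" using M by (intro mult_left_mono) auto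
  finally show ?thesis by simp
qed

lemma measurable_cnj [measurable (raw)]:
  assumes "f \<in> borel_measurable M" shows "(\<lambda>x. cnj (f x)) \<in> borel_measurable M"
  by (rule measurable_compose[OF assms borel_measurable_continuous_onI]) (intro continuous_intros)

text \<open>The mean value property of the product of G with (1-<.,u>)^N, composed with phi_u. After
  the change of variables the extra factor meets the density |k_u|^2 and cancels its holomorphic
  half, so that the conjugate kernel remains; at 0 the composite has the value
  G(u)(1-|u|^2)^N.\<close>

lemma reproducing_formula:
  fixes G :: "complex^'n::finite \<Rightarrow> complex"
  assumes \<alpha>: "\<alpha> > -1" and G: "scalar_holo G" and u: "norm u < 1"
    and L2: "(\<integral>\<^sup>+z. (ennreal (cmod (G z)))\<^sup>2 \<partial>nu \<alpha>) < \<infinity>"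
  shows "integrable (nu \<alpha>) (\<lambda>z. cnj (bergman_kernel \<alpha> u z) * G z)"
    and "G u = (LINT z|nu \<alpha>. cnj (bergman_kernel \<alpha> u z) * G z)"
proof -
  define N where "N = kernel_exp TYPE('n) \<alpha>"
  define s where "s = 1 - (norm u)\<^sup>2"
  have s: "s > 0" unfolding s_def by (rule one_minus_norm_sq_pos[OF u])
  have [measurable]: "G \<in> borel_measurable (nu \<alpha>)" by (rule scalar_holo_measurable[OF G])
  have Km[measurable]: "bergman_kernel \<alpha> u \<in> borel_measurable (nu \<alpha>)"
    by (rule scalar_holo_measurable[OF scalar_holo_bergman_kernel[OF u]])
  have "(\<integral>\<^sup>+z. ennreal (cmod (bergman_kernel \<alpha> u z)) * ennreal (cmod (G z)) \<partial>nu \<alpha>)\<^sup>2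
      \<le> (\<integral>\<^sup>+z. (ennreal (cmod (bergman_kernel \<alpha> u z)))\<^sup>2 \<partial>nu \<alpha>) * (\<integral>\<^sup>+z. (ennreal (cmod (G z)))\<^sup>2 \<partial>nu \<alpha>)"
    by (rule Cauchy_Schwarz_nn_integral) measurable
  also have "\<dots> < \<infinity>" using L2 by (simp add: bergman_kernel_L2[OF \<alpha> u] ennreal_mult_less_top)
  finally have fin: "(\<integral>\<^sup>+z. ennreal (cmod (bergman_kernel \<alpha> u z)) * ennreal (cmod (G z)) \<partial>nu \<alpha>) < \<infinity>"
    by (simp add: power2_eq_square ennreal_mult_less_top) (auto simp: less_top[symmetric])
  then show int: "integrable (nu \<alpha>) (\<lambda>z. cnj (bergman_kernel \<alpha> u z) * G z)"
    by (intro integrableI_bounded) (auto simp: norm_mult ennreal_mult)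
  define Pr where "Pr z = G z * (1 - hprod z u) powr N" for z
  have Pr: "scalar_holo Pr" unfolding Pr_def by (intro scalar_holo_mult G scalar_holo_kernel u)
  define H where "H z = Pr (ball_involution u z)" for z
  have H: "scalar_holo H" unfolding H_def by (rule scalar_holo_involution[OF Pr u])
  define P' where "P' x = indicator (ball 0 1) x *\<^sub>R Pr x" for x
  have [measurable]: "P' \<in> borel_measurable borel"
    unfolding P'_def by (rule scalar_holo_cut_measurable[OF Pr])
  have key: "kernel_sq \<alpha> u z *\<^sub>R P' z = of_real (s powr N) * (cnj (bergman_kernel \<alpha> u z) * G z)"
    if z: "norm z < 1" for z
  proof -
    define x where "x = 1 - hprod z u"
    have x: "x \<noteq> 0" using one_minus_hprod_nz[of z u] z u by (simp add: x_def)
    have "bergman_kernel \<alpha> u z * x powr N = 1"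
    proof -
      have "bergman_kernel \<alpha> u z = x powr (- complex_of_real N)"
        by (simp add: bergman_kernel_def N_def kernel_exp_def x_def)
      then show ?thesis using x by (simp add: powr_minus)
    qed
    then have "cnj (bergman_kernel \<alpha> u z) * (bergman_kernel \<alpha> u z * x powr N) = cnj (bergman_kernel \<alpha> u z)"
      by simp
    moreover have "complex_of_real ((cmod (bergman_kernel \<alpha> u z))\<^sup>2) = bergman_kernel \<alpha> u z * cnj (bergman_kernel \<alpha> u z)"
      by (rule complex_norm_square)
    ultimately have "complex_of_real ((cmod (bergman_kernel \<alpha> u z))\<^sup>2) * x powr N = cnj (bergman_kernel \<alpha> u z)"
      by (simp add: mult_ac)
    then show ?thesis using z
      unfolding kernel_sq_eq(1)[OF u z] P'_def Pr_def x_def[symmetric] N_def[symmetric] s_def[symmetric]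
      by (simp add: scaleR_conv_of_real mult_ac)
  qed
  have "(\<integral>\<^sup>+x. ennreal (cmod (H x)) \<partial>nu \<alpha>) = (\<integral>\<^sup>+x. ennreal (cmod (P' (ball_involution u x))) \<partial>nu \<alpha>)"
    using ball_involution_in_ball[OF u] by (intro nn_integral_cong) (simp add: H_def P'_def)
  also have "\<dots> = (\<integral>\<^sup>+x. ennreal (cmod (P' x)) * ennreal (kernel_sq \<alpha> u x) \<partial>nu \<alpha>)"
    by (rule nn_integral_nu_involution[OF \<alpha> u]) measurable
  also have "\<dots> = (\<integral>\<^sup>+x. ennreal (s powr N) * (ennreal (cmod (bergman_kernel \<alpha> u x)) * ennreal (cmod (G x))) \<partial>nu \<alpha>)"
  proof (intro nn_integral_cong)
    fix x :: "complex^'n" assume "x \<in> space (nu \<alpha>)"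
    then have "cmod (kernel_sq \<alpha> u x *\<^sub>R P' x) = cmod (of_real (s powr N) * (cnj (bergman_kernel \<alpha> u x) * G x))"
      using key by simp
    then show "ennreal (cmod (P' x)) * ennreal (kernel_sq \<alpha> u x)
       = ennreal (s powr N) * (ennreal (cmod (bergman_kernel \<alpha> u x)) * ennreal (cmod (G x)))"
      by (simp add: norm_mult ennreal_mult[symmetric] mult_ac)
  qed
  also have "\<dots> = ennreal (s powr N) * (\<integral>\<^sup>+x. ennreal (cmod (bergman_kernel \<alpha> u x)) * ennreal (cmod (G x)) \<partial>nu \<alpha>)"
    by (rule nn_integral_cmult) measurable
  also have "\<dots> < \<infinity>" using fin by (simp add: ennreal_mult_less_top)
  finally have iH: "integrable (nu \<alpha>) H"
    using scalar_holo_measurable[OF H] by (intro integrableI_bounded) auto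
  have "of_real (s powr N) * G u = H 0"
  proof -
    have "1 - hprod u u = complex_of_real s" by (simp add: hprod_self s_def)
    then show ?thesis using s u by (simp add: H_def Pr_def powr_of_real mult.commute)
  qed
  also have "\<dots> = (LINT x|nu \<alpha>. H x)" by (rule mean_value_property[OF \<alpha> H iH])
  also have "\<dots> = (LINT x|nu \<alpha>. P' (ball_involution u x))"
    using ball_involution_in_ball[OF u] by (intro Bochner_Integration.integral_cong) (simp_all add: H_def P'_def)
  also have "\<dots> = (LINT x|nu \<alpha>. kernel_sq \<alpha> u x *\<^sub>R P' x)"
    by (rule integral_nu_involution[OF \<alpha> u]) measurable
  also have "\<dots> = (LINT x|nu \<alpha>. of_real (s powr N) * (cnj (bergman_kernel \<alpha> u x) * G x))"
    using key by (intro Bochner_Integration.integral_cong) simp_all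
  also have "\<dots> = of_real (s powr N) * (LINT x|nu \<alpha>. cnj (bergman_kernel \<alpha> u x) * G x)" by simp
  finally show "G u = (LINT z|nu \<alpha>. cnj (bergman_kernel \<alpha> u z) * G z)" using s by simp
qed

section \<open>Vector-valued functions and strong measurability\<close>

lemma scaleC_one [simp]: "1 *\<^sub>C (x :: 'a::complex_normed_space) = x"
  using scaleC_of_real[of 1 x] by simp

lemma scaleC_zero_left [simp]: "0 *\<^sub>C (x :: 'a::complex_normed_space) = 0"
  using scaleC_of_real[of 0 x] by simp

lemma scaleC_zero_right [simp]: "c *\<^sub>C (0 :: 'a::complex_normed_space) = 0"
  using norm_scaleC[of c "0::'a"] by simp

lemma scaleC_diff_left: "(a - b) *\<^sub>C x = a *\<^sub>C x - b *\<^sub>C (x :: 'a::complex_normed_space)"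
  by (metis add_diff_cancel_right' diff_add_cancel scaleC_add_left)

lemma bounded_bilinear_scaleC: "bounded_bilinear (\<lambda>c (x :: 'a::complex_normed_space). c *\<^sub>C x)"
proof
  show "\<exists>K. \<forall>a (b::'a). norm (a *\<^sub>C b) \<le> norm a * norm b * K"
    by (intro exI[of _ 1]) (simp add: norm_scaleC)
  show "(r *\<^sub>R a) *\<^sub>C (b::'a) = r *\<^sub>R a *\<^sub>C b" for r a b
    by (simp add: scaleC_of_real[symmetric] scaleC_scaleC scaleR_conv_of_real)
  show "a *\<^sub>C r *\<^sub>R (b::'a) = r *\<^sub>R a *\<^sub>C b" for r a b
    by (simp add: scaleC_of_real[symmetric] scaleC_scaleC mult.commute)
qed (simp_all add: scaleC_add_left scaleC_add_right)

lemma cinner_add_right: "cinner z (x + y) = cinner z x + cinner z y"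
  by (metis cinner_add_left cinner_commute complex_cnj_add)

lemma cinner_scaleC_right: "cinner y (c *\<^sub>C x) = cnj c * cinner y x"
  by (metis cinner_scaleC_left cinner_commute complex_cnj_mult)

lemma bounded_bilinear_cinner: "bounded_bilinear cinner"
proof
  show "\<exists>K. \<forall>a b. norm (cinner a b) \<le> norm a * norm b * K"
    by (intro exI[of _ 1]) (simp add: cinner_norm_le)
  show "cinner (r *\<^sub>R a) b = r *\<^sub>R cinner a b" for r a b
    by (simp add: scaleC_of_real[symmetric] cinner_scaleC_left scaleR_conv_of_real)
  show "cinner a (r *\<^sub>R b) = r *\<^sub>R cinner a b" for r a b
    by (simp add: scaleC_of_real[symmetric] cinner_scaleC_right scaleR_conv_of_real)
qed (simp_all add: cinner_add_left cinner_add_right)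

lemma cinner_self_norm: "cinner x x = complex_of_real ((norm x)\<^sup>2)"
  by (simp add: cinner_self norm_ell2_eq suminf_nonneg[OF coord_sq_summable])

lemma cinner_ext: "(\<And>y. cinner x y = cinner x' y) \<Longrightarrow> x = x'"
  by (metis cinner_unit_vec coord_inject ext)

lemma norm_unit_vec [simp]: "norm (unit_vec j) = 1"
proof -
  have "complex_of_real ((norm (unit_vec j))\<^sup>2) = 1"
    using cinner_self_norm[of "unit_vec j"] by (simp add: cinner_unit_vec coord_unit_vec)
  then have "(norm (unit_vec j))\<^sup>2 = 1" by (simp only: of_real_eq_1_iff)
  then show ?thesis by (simp add: power2_eq_1_iff) (metis norm_ge_zero not_one_le_zero neg_0_le_iff_le)
qed

text \<open>Finite combinations of the unit vectors with coefficients in a countable dense set of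
  complex numbers are dense; balls of radius 1/(m+1) around them form a countable basis. With this
  instance \<open>integrable\<close> and \<open>LINT\<close> apply to ell2-valued functions, while
  operator-valued functions enter through norms or after application to a vector.\<close>

instance ell2 :: second_countable_topology
proof
  obtain Q :: "complex set" where Q: "countable Q" "\<And>X. open X \<Longrightarrow> X \<noteq> {} \<Longrightarrow> \<exists>d\<in>Q. d \<in> X"
    using countable_dense_exists by blast
  define p where "p xs = (\<Sum>i<length xs. (xs ! i) *\<^sub>C unit_vec i)" for xs :: "complex list"
  define B where "B = (\<lambda>(xs, m). ball (p xs) (1 / real (Suc m))) ` (lists Q \<times> (UNIV :: nat set))"
  have dense: "\<exists>xs\<in>lists Q. dist (p xs) x < e" if e: "e > 0" for x e
  proof -
    have "(\<lambda>n. \<Sum>i<n. coord x i *\<^sub>C unit_vec i) \<longlonglongrightarrow> x"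
      using orthonormal_basis_unit_vec by (simp add: orthonormal_basis_def sums_def cinner_unit_vec)
    then obtain n where n: "dist (\<Sum>i<n. coord x i *\<^sub>C unit_vec i) x < e / 2"
      using e by (meson half_gt_zero metric_LIMSEQ_D order_refl)
    define d where "d = e / (2 * (real n + 1))"
    have d: "d > 0" using e by (simp add: d_def)
    have "\<exists>c\<in>Q. dist (coord x i) c < d" for i
      using Q(2)[of "ball (coord x i) d"] d by (auto simp: ball_eq_empty)
    then obtain c where c: "\<And>i. c i \<in> Q" "\<And>i. dist (coord x i) (c i) < d" by metis
    define xs where "xs = map c [0..<n]"
    have "norm (p xs - (\<Sum>i<n. coord x i *\<^sub>C unit_vec i)) = norm (\<Sum>i<n. (c i - coord x i) *\<^sub>C unit_vec i)"
      by (simp add: p_def xs_def sum_subtractf scaleC_diff_left)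
    also have "\<dots> \<le> (\<Sum>i<n. norm ((c i - coord x i) *\<^sub>C unit_vec i))" by (rule norm_sum)
    also have "\<dots> \<le> (\<Sum>i<n. d)"
      using c(2) by (intro sum_mono) (simp add: norm_scaleC dist_norm norm_minus_commute less_imp_le)
    also have "\<dots> < e / 2" using e by (simp add: d_def field_simps)
    finally have "dist (p xs) (\<Sum>i<n. coord x i *\<^sub>C unit_vec i) < e / 2" by (simp add: dist_norm)
    then have "dist (p xs) x < e"
      using n dist_triangle[of "p xs" x "\<Sum>i<n. coord x i *\<^sub>C unit_vec i"] by linarith
    moreover have "xs \<in> lists Q" using c(1) by (auto simp: xs_def)
    ultimately show ?thesis by blast
  qed
  have "topological_basis B"
  proof (rule topological_basisI)
    show "open b" if "b \<in> B" for b using that by (auto simp: B_def)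
    fix U :: "ell2 set" and x assume U: "open U" "x \<in> U"
    then obtain e where e: "e > 0" "ball x e \<subseteq> U" by (meson open_contains_ball)
    obtain m where m: "1 / real (Suc m) < e / 2" using e by (metis half_gt_zero nat_approx_posE)
    obtain xs where xs: "xs \<in> lists Q" "dist (p xs) x < 1 / real (Suc m)"
      using dense[of "1 / real (Suc m)" x] by auto
    have "ball (p xs) (1 / real (Suc m)) \<subseteq> ball x e"
    proof
      fix y assume "y \<in> ball (p xs) (1 / real (Suc m))"
      then show "y \<in> ball x e" using xs(2) m dist_triangle[of x y "p xs"] by (simp add: dist_commute)
    qed
    then show "\<exists>b\<in>B. x \<in> b \<and> b \<subseteq> U"
      using e xs unfolding B_def by (intro bexI[of _ "ball (p xs) (1 / real (Suc m))"]) auto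
  qed
  moreover have "countable B" unfolding B_def
    by (intro countable_image countable_SIGMA countable_lists Q(1)) auto
  ultimately show "\<exists>B :: ell2 set set. countable B \<and> open = generate_topology B"
    using topological_basis_imp_subbasis by blast
qed

lemma borel_measurable_AE_eq:
  assumes M: "complete_measure M" and g: "g \<in> measurable M borel"
    and ae: "AE x in M. f x = g x"
  shows "f \<in> measurable M borel"
proof (rule measurableI)
  interpret complete_measure M by (rule M)
  fix A :: "'b set" assume A: "A \<in> sets borel"
  obtain N where N: "N \<in> null_sets M" "{x \<in> space M. f x \<noteq> g x} \<subseteq> N"
    using ae by (auto elim!: AE_E)
  have "f -` A \<inter> space M = ((g -` A \<inter> space M) - N) \<union> (f -` A \<inter> space M \<inter> N)"
    using N(2) by auto
  moreover have "f -` A \<inter> space M \<inter> N \<in> sets M" using complete[of _ N] N(1) by blast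
  ultimately show "f -` A \<inter> space M \<in> sets M"
    using measurable_sets[OF g A] N(1) by (metis null_setsD2 sets.Diff sets.Un)
qed simp

lemma borel_measurable_AE_limit:
  fixes f :: "'a \<Rightarrow> 'b::metric_space"
  assumes M: "complete_measure M" and s: "\<And>i. s i \<in> borel_measurable M"
    and lim: "AE x in M. (\<lambda>i. s i x) \<longlonglongrightarrow> f x"
  shows "f \<in> borel_measurable M"
proof -
  obtain N where N: "N \<in> null_sets M" "{x \<in> space M. \<not> (\<lambda>i. s i x) \<longlonglongrightarrow> f x} \<subseteq> N"
    using lim by (auto elim!: AE_E)
  define g where "g x = (if x \<in> N then undefined else f x)" for x
  have [measurable]: "N \<in> sets M" using N by auto
  have "g \<in> borel_measurable M"
  proof (rule borel_measurable_LIMSEQ_metric)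
    show "(\<lambda>x. if x \<in> N then undefined else s i x) \<in> borel_measurable M" for i
      using s[of i] by measurable
    show "(\<lambda>i. if x \<in> N then undefined else s i x) \<longlonglongrightarrow> g x" if "x \<in> space M" for x
      using N(2) that by (auto simp: g_def)
  qed
  moreover have "AE x in M. f x = g x"
    using AE_not_in[OF N(1)] by eventually_elim (auto simp: g_def)
  ultimately show ?thesis by (rule borel_measurable_AE_eq[OF M])
qed

text \<open>A continuous map sends simple approximants to simple functions that still converge
  almost everywhere. In this way the norm of a symbol, of its difference with a constant and of its
  product with a fixed operator become measurable, although the space of operators is not
  separable.\<close>

lemma strongly_measurable_compose:
  fixes h :: "'b::real_normed_vector \<Rightarrow> 'c::metric_space"
  assumes M: "complete_measure M" and f: "strongly_measurable M f" and h: "continuous_on UNIV h"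
  shows "(\<lambda>x. h (f x)) \<in> borel_measurable M"
proof -
  obtain s where s: "\<And>i::nat. simple_function M (s i)" "AE x in M. (\<lambda>i. s i x) \<longlonglongrightarrow> f x"
    using f unfolding strongly_measurable_def by blast
  show ?thesis
  proof (rule borel_measurable_AE_limit[OF M])
    show "(\<lambda>x. h (s i x)) \<in> borel_measurable M" for i
      by (intro borel_measurable_simple_function simple_function_compose1[OF s(1)])
    show "AE x in M. (\<lambda>i. h (s i x)) \<longlonglongrightarrow> h (f x)"
      using s(2) by eventually_elim (rule continuous_on_tendsto_compose[OF h], auto)
  qed
qed

lemma strongly_measurable_iff_borel:
  fixes f :: "'a \<Rightarrow> 'b::{real_normed_vector, second_countable_topology}"
  assumes M: "complete_measure M"
  shows "strongly_measurable M f \<longleftrightarrow> f \<in> borel_measurable M"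
proof
  assume "f \<in> borel_measurable M"
  from borel_measurable_implies_sequence_metric[OF this, of 0]
  show "strongly_measurable M f" unfolding strongly_measurable_def
    by (meson AE_I2)
qed (use strongly_measurable_compose[OF M, of f "\<lambda>x. x"] in simp)

lemma strongly_measurable_blinfun_apply:
  fixes b :: "'a \<Rightarrow> ell2 \<Rightarrow>\<^sub>L ell2"
  assumes M: "complete_measure M" and b: "strongly_measurable M b" and f: "f \<in> borel_measurable M"
  shows "(\<lambda>x. blinfun_apply (b x) (f x)) \<in> borel_measurable M"
proof -
  obtain s where s: "\<And>i::nat. simple_function M (s i)" "AE x in M. (\<lambda>i. s i x) \<longlonglongrightarrow> b x"
    using b unfolding strongly_measurable_def by blast
  obtain u where u: "\<And>i::nat. simple_function M (u i)" "AE x in M. (\<lambda>i. u i x) \<longlonglongrightarrow> f x"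
    using f strongly_measurable_iff_borel[OF M, of f] unfolding strongly_measurable_def by blast
  show ?thesis
  proof (rule borel_measurable_AE_limit[OF M])
    show "(\<lambda>x. blinfun_apply (s i x) (u i x)) \<in> borel_measurable M" for i
      by (intro borel_measurable_simple_function simple_function_compose2[OF s(1) u(1)])
    show "AE x in M. (\<lambda>i. blinfun_apply (s i x) (u i x)) \<longlonglongrightarrow> blinfun_apply (b x) (f x)"
      using s(2) u(2) by eventually_elim (rule blinfun.tendsto)
  qed
qed

text \<open>For separable values strong and Borel measurability agree over a complete measure, so
  the two notions of Bochner integral have the same instances; uniqueness of the integral then
  settles the definite description.\<close>

lemma bochner_int_eq_integral:
  fixes f :: "'a \<Rightarrow> 'b::{banach, second_countable_topology}"
  assumes M: "complete_measure M" and f: "integrable M f"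
  shows "bochner_int M f = integral\<^sup>L M f"
proof -
  have eq: "has_bochner_int M f I \<longleftrightarrow> has_bochner_integral M f I" for I
    unfolding has_bochner_int_def has_bochner_integral.simps strongly_measurable_iff_borel[OF M]
    by blast
  have "has_bochner_integral M f (integral\<^sup>L M f)" by (rule has_bochner_integral_integrable[OF f])
  then show ?thesis unfolding bochner_int_def eq
    by (intro the_equality) (auto dest: has_bochner_integral_eq)
qed

lemma measurable_scaleC [measurable (raw)]:
  fixes g :: "'a \<Rightarrow> ell2"
  assumes "f \<in> borel_measurable M" "g \<in> borel_measurable M"
  shows "(\<lambda>x. f x *\<^sub>C g x) \<in> borel_measurable M"
  using assms by (rule borel_measurable_continuous_Pair)
    (intro bounded_bilinear.continuous_on[OF bounded_bilinear_scaleC] continuous_intros)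

lemma measurable_cinner [measurable (raw)]:
  assumes "f \<in> borel_measurable M" "g \<in> borel_measurable M"
  shows "(\<lambda>x. cinner (f x) (g x)) \<in> borel_measurable M"
  using assms by (rule borel_measurable_continuous_Pair)
    (intro bounded_bilinear.continuous_on[OF bounded_bilinear_cinner] continuous_intros)

section \<open>Square norms and the Bergman space of ell2-valued functions\<close>

definition L2_sq :: "real \<Rightarrow> (complex^'n::finite \<Rightarrow> 'e::real_normed_vector) \<Rightarrow> ennreal"
  where "L2_sq \<alpha> f = (\<integral>\<^sup>+z. (ennreal (norm (f z)))\<^sup>2 \<partial>nu \<alpha>)"

text \<open>\<open>L2_sq\<close> is the squared norm as a bare integral in \<open>ennreal\<close>:
  Tonelli and monotonicity apply to it directly and infinite values cause no case distinction. This
  lemma and \<open>Lp_norm_2_le\<close> lead back to the norms of the definitions.\<close>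

lemma Lp_norm_2:
  "Lp_norm \<alpha> 2 f = (if L2_sq \<alpha> f = \<infinity> then \<infinity> else ennreal (sqrt (enn2real (L2_sq \<alpha> f))))"
proof -
  have "ennreal (norm (f z) powr 2) = (ennreal (norm (f z)))\<^sup>2" for z
    by (cases "f z = 0") (simp_all add: powr_numeral ennreal_power)
  then have eq: "(\<integral>\<^sup>+z. ennreal (norm (f z) powr 2) \<partial>nu \<alpha>) = L2_sq \<alpha> f" by (simp add: L2_sq_def)
  have "x powr (1 / 2) = sqrt x" if "x \<ge> 0" for x :: real
    using that by (simp add: powr_half_sqrt)
  then show ?thesis unfolding Lp_norm_def eq Let_def by simp
qed

lemma Lp_norm_2_le: 
  assumes "c \<ge> 0" shows "Lp_norm \<alpha> 2 f \<le> ennreal c \<longleftrightarrow> L2_sq \<alpha> f \<le> ennreal (c\<^sup>2)"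
proof (cases "L2_sq \<alpha> f")
  case (real r)
  then have "sqrt r \<le> c \<longleftrightarrow> r \<le> c\<^sup>2" using assms by (metis real_sqrt_le_iff real_sqrt_abs abs_of_nonneg)
  then show ?thesis using real assms by (simp add: Lp_norm_2 ennreal_le_iff)
qed (simp add: Lp_norm_2 top_unique)

lemma Lp_norm_2_finite: "Lp_norm \<alpha> 2 f < \<infinity> \<longleftrightarrow> L2_sq \<alpha> f < \<infinity>"
  by (simp add: Lp_norm_2 less_top[symmetric])

lemma Lp_norm_1: "Lp_norm \<alpha> 1 f = (\<integral>\<^sup>+z. ennreal (norm (f z)) \<partial>nu \<alpha>)"
  by (cases "(\<integral>\<^sup>+z. ennreal (norm (f z)) \<partial>nu \<alpha>)") (simp_all add: Lp_norm_def)

lemma holomorphic_ball_continuous: "holomorphic_ball f \<Longrightarrow> continuous_on (ball 0 1) f"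
  unfolding holomorphic_ball_def by (meson continuous_at_imp_continuous_on has_derivative_continuous)

lemma continuous_on_ball_measurable:
  fixes f :: "complex^'n::finite \<Rightarrow> 'e::{real_normed_vector, second_countable_topology}"
  assumes "continuous_on (ball 0 1) f"
  shows "f \<in> borel_measurable (nu \<alpha>)"
proof -
  have "(\<lambda>x. indicator (ball 0 1) x *\<^sub>R f x) \<in> borel_measurable borel"
    using borel_measurable_continuous_on_indicator[OF _ assms] by simp
  then have "(\<lambda>x. indicator (ball 0 1) x *\<^sub>R f x) \<in> borel_measurable (nu \<alpha>)" by (rule measurable_nu_borel)
  then show ?thesis by (rule measurable_cong[THEN iffD1, rotated]) auto
qed

lemma Ap_space_2_iff:
  fixes f :: "complex^'n::finite \<Rightarrow> ell2"
  assumes "\<alpha> > -1"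
  shows "f \<in> Ap_space \<alpha> 2 \<longleftrightarrow> holomorphic_ball f \<and> L2_sq \<alpha> f < \<infinity>"
  using continuous_on_ball_measurable[OF holomorphic_ball_continuous, of f \<alpha>] 
  unfolding Ap_space_def Lp_space_def
  by (auto simp: Lp_norm_2_finite[unfolded infinity_ennreal_def] strongly_measurable_iff_borel[OF complete_nu[OF assms]])

lemma scalar_holo_cinner:
  assumes "holomorphic_ball f" shows "scalar_holo (\<lambda>z. cinner (f z) y)"
  unfolding scalar_holo_def
proof
  fix z :: "complex^'a" assume "z \<in> ball 0 1"
  then obtain D where D: "(f has_derivative D) (at z)" "\<And>c v. D (c *s v) = c *\<^sub>C D v"
    using assms unfolding holomorphic_ball_def by blast
  show "\<exists>D. ((\<lambda>z. cinner (f z) y) has_derivative D) (at z) \<and> (\<forall>c v. D (c *s v) = c * D v)"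
    using bounded_linear.has_derivative[OF bounded_linear_cinner_left D(1)]
    by (intro exI[of _ "\<lambda>v. cinner (D v) y"]) (simp add: D(2) cinner_scaleC_left)
qed

text \<open>The half plane Re x >= r is convex, and on it the second derivative c (c-1) x^(c-2) has
  modulus at most c (c-1) r^(c-2), because c < 0. The bound is independent of the point, as
  differentiation under the integral demands.\<close>

lemma powr_taylor2:
  fixes c :: real and x h :: complex
  assumes c: "c < 0" and r: "r > 0" and x: "Re x \<ge> r" and xh: "Re (x + h) \<ge> r"
  shows "cmod ((x + h) powr c - x powr c - complex_of_real c * x powr (c - 1) * h)
     \<le> c * (c - 1) * r powr (c - 2) * (cmod h)\<^sup>2"
proof -
  define S where "S = {x. Re x \<ge> r}"
  define f :: "nat \<Rightarrow> complex \<Rightarrow> complex"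
    where "f i = (case i of 0 \<Rightarrow> (\<lambda>x. x powr complex_of_real c)
      | Suc 0 \<Rightarrow> (\<lambda>x. complex_of_real c * x powr complex_of_real (c - 1))
      | Suc (Suc _) \<Rightarrow> (\<lambda>x. complex_of_real c * (complex_of_real (c - 1) * x powr complex_of_real (c - 2))))"
    for i
  have slit: "x \<notin> \<real>\<^sub>\<le>\<^sub>0" if "x \<in> S" for x using that r by (auto simp: S_def complex_nonpos_Reals_iff)
  have "cmod (f 0 (x + h) - (\<Sum>i\<le>1. f i x * ((x + h) - x) ^ i / fact i))
     \<le> (c * (c - 1) * r powr (c - 2)) * cmod ((x + h) - x) ^ Suc 1 / fact 1"
  proof (rule complex_Taylor[where S = S])
    show "convex S" unfolding S_def by (rule convex_halfspace_Re_ge)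
    show "(f i has_field_derivative f (Suc i) x) (at x within S)" if "x \<in> S" "i \<le> 1" for i x
    proof -
      have d: "((\<lambda>x. x powr complex_of_real s) has_field_derivative complex_of_real s * x powr (s - 1)) (at x within S)" for s :: real
        using has_field_derivative_powr[OF slit[OF that(1)], of "complex_of_real s"]
        by (simp add: has_field_derivative_at_within)
      show ?thesis
      proof (cases i)
        case 0
        then show ?thesis using d[of c] by (simp add: f_def)
      next
        case (Suc j)
        then have "i = 1" using that by simp
        then show ?thesis using DERIV_cmult[OF d[of "c - 1"], of "complex_of_real c"] by (simp add: f_def)
      qed
    qed
    show "cmod (f (Suc 1) x) \<le> c * (c - 1) * r powr (c - 2)" if "x \<in> S" for x
    proof -
      have "r \<le> cmod x" using that complex_Re_le_cmod[of x] by (simp add: S_def)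
      then have p: "cmod x powr (c - 2) \<le> r powr (c - 2)" using r c by (intro powr_mono2') auto
      have "cmod (x powr complex_of_real (c - 2)) = cmod x powr (c - 2)" by (rule cmod_powr_of_real)
      moreover have "cmod (complex_of_real c * (complex_of_real c - 1)) = c * (c - 1)"
      proof -
        have "complex_of_real c - 1 = complex_of_real (c - 1)" by simp
        then show ?thesis using c by (simp only: norm_mult norm_of_real)
      qed
      ultimately have "cmod (f (Suc 1) x) = c * (c - 1) * cmod x powr (c - 2)"
        by (simp add: f_def norm_mult mult.assoc)
      also have "\<dots> \<le> c * (c - 1) * r powr (c - 2)"
        using p c by (intro mult_left_mono) (auto simp: mult_nonpos_nonpos)
      finally show ?thesis .
    qed
  qed (use x xh in \<open>auto simp: S_def\<close>)
  then show ?thesis by (simp add: f_def power2_eq_square algebra_simps)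
qed

text \<open>Differentiation under the integral: the Taylor remainder of the kernel is at most a
  constant times |y - z|^2 uniformly in w, so only integrability of G enters. It shows that Bergman
  projections are holomorphic and, through the reproducing formula, that L2 limits of holomorphic
  functions are.\<close>

lemma kernel_integral_holomorphic:
  fixes G :: "complex^'n::finite \<Rightarrow> ell2"
  assumes \<alpha>: "\<alpha> > -1" and G: "integrable (nu \<alpha>) G"
    and F: "\<And>z. norm z < 1 \<Longrightarrow> F z = (LINT w|nu \<alpha>. cnj (bergman_kernel \<alpha> z w) *\<^sub>C G w)"
  shows "holomorphic_ball F"
  unfolding holomorphic_ball_def
proof
  let ?M = "nu \<alpha> :: (complex^'n) measure"
  fix z :: "complex^'n" assume "z \<in> ball 0 1"
  then have z: "norm z < 1" by simp
  define c where "c = - kernel_exp TYPE('n) \<alpha>"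
  have c: "c < 0" using kernel_exp_pos[OF \<alpha>, where 'n='n] by (simp add: c_def)
  \<comment> \<open>Half the distance from z to the sphere: for |y - z| < r both 1 - <z,w> and 1 -
    <y,w> have real part at least r, as the Taylor estimate requires.\<close>
  define r where "r = (1 - norm z) / 2"
  have r: "r > 0" using z by (simp add: r_def)
  have [measurable]: "G \<in> borel_measurable ?M" using G by auto
  note measurable_nu_id[measurable]
  have hm: "(\<lambda>w. hprod a w) \<in> borel_measurable ?M" for a
    by (rule measurable_nu_borel) measurable
  have pm: "(\<lambda>w. (1 - hprod a w) powr complex_of_real s) \<in> borel_measurable ?M" if "norm a < 1" for a s
  proof -
    have "(\<lambda>w. cnj ((1 - hprod w a) powr complex_of_real s)) \<in> borel_measurable ?M"
      using scalar_holo_measurable[OF scalar_holo_kernel[OF that]] by measurable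
    moreover have "cnj ((1 - hprod w a) powr complex_of_real s) = (1 - hprod a w) powr complex_of_real s"
      if "w \<in> space ?M" for w
      using one_minus_hprod_Re_pos[of w a] \<open>norm a < 1\<close> that
      by (subst cnj_powr) (auto simp: cnj_hprod)
    ultimately show ?thesis by (rule measurable_cong[THEN iffD1, rotated])
  qed
  define G1 where "G1 = (LINT w|?M. norm (G w))"
  have G1: "G1 \<ge> 0" by (simp add: G1_def)
  have bint: "integrable ?M (\<lambda>w. p w *\<^sub>C G w)"
    "norm (LINT w|?M. p w *\<^sub>C G w) \<le> B * G1"
    if [measurable]: "p \<in> borel_measurable ?M" and b: "\<And>w. norm w < 1 \<Longrightarrow> cmod (p w) \<le> B" for p B
  proof -
    have B: "B \<ge> 0" using order_trans[OF norm_ge_zero b[of 0]] by simp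
    show i: "integrable ?M (\<lambda>w. p w *\<^sub>C G w)"
    proof (rule Bochner_Integration.integrable_bound[of _ "\<lambda>w. B * norm (G w)"])
      show "AE w in ?M. norm (p w *\<^sub>C G w) \<le> norm (B * norm (G w))"
        using b B by (intro AE_I2) (simp add: norm_scaleC mult_right_mono)
    qed (use G in auto)
    have "norm (LINT w|?M. p w *\<^sub>C G w) \<le> (LINT w|?M. norm (p w *\<^sub>C G w))" by (rule integral_norm_bound)
    also have "\<dots> \<le> (LINT w|?M. B * norm (G w))"
      using integrable_norm[OF i] G b by (intro integral_mono) (auto simp: norm_scaleC mult_right_mono)
    finally show "norm (LINT w|?M. p w *\<^sub>C G w) \<le> B * G1" by (simp add: G1_def)
  qed
  have Re_ge: "Re (1 - hprod a w) \<ge> 1 - norm a" if "norm w < 1" for a w :: "complex^'n"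
  proof -
    have "Re (hprod a w) \<le> cmod (hprod a w)" by (rule complex_Re_le_cmod)
    also have "\<dots> \<le> norm a * norm w" by (rule hprod_norm_le)
    also have "\<dots> \<le> norm a" using that by (simp add: mult_left_le)
    finally show ?thesis by simp
  qed
  have K: "cnj (bergman_kernel \<alpha> a w) = (1 - hprod a w) powr complex_of_real c" if "norm a < 1" "norm w < 1" for a w :: "complex^'n"
    using cnj_bergman_kernel[OF that, of \<alpha>] by (simp add: bergman_kernel_def c_def kernel_exp_def)
  have cb: "cmod ((1 - hprod a w) powr complex_of_real s) \<le> (1 - norm a) powr s" if "norm a < 1" "norm w < 1" "s < 0" for a w :: "complex^'n" and s
  proof -
    have "1 - norm a \<le> cmod (1 - hprod a w)" using Re_ge[OF that(2)] complex_Re_le_cmod order_trans by blast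
    then show ?thesis unfolding cmod_powr_of_real using that by (intro powr_mono2') auto
  qed
  define p where "p v w = - complex_of_real c * (1 - hprod z w) powr complex_of_real (c - 1) * hprod v w" for v w
  have pm': "p v \<in> borel_measurable ?M" for v unfolding p_def
    using pm[OF z, of "c - 1"] hm[of v] by measurable
  have pb: "cmod (p v w) \<le> (- c * (1 - norm z) powr (c - 1)) * norm v" if "norm w < 1" for v w
  proof -
    have "cmod (hprod v w) \<le> norm v * norm w" by (rule hprod_norm_le)
    also have "\<dots> \<le> norm v" using that by (simp add: mult_left_le)
    finally have "cmod (p v w) \<le> - c * (1 - norm z) powr (c - 1) * norm v"
      unfolding p_def norm_mult using c cb[OF z that, of "c - 1"]
      by (intro mult_mono) (auto simp: mult_nonpos_nonneg)
    then show ?thesis .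
  qed
  define D where "D v = (LINT w|?M. p v w *\<^sub>C G w)" for v
  have pint: "integrable ?M (\<lambda>w. p v w *\<^sub>C G w)" for v by (rule bint(1)[OF pm' pb])
  have Dscale: "D (s *s v) = s *\<^sub>C D v" for s v
  proof -
    have "bounded_linear (\<lambda>x :: ell2. s *\<^sub>C x)"
      by (rule bounded_bilinear.bounded_linear_right[OF bounded_bilinear_scaleC])
    from integral_bounded_linear[OF this pint]
    have "(LINT w|?M. s *\<^sub>C (p v w *\<^sub>C G w)) = s *\<^sub>C D v" unfolding D_def .
    then show ?thesis unfolding D_def p_def by (simp add: hprod_scale_left scaleC_scaleC mult_ac)
  qed
  have "bounded_linear D"
  proof (rule bounded_linear_intro)
    show "D (x + y) = D x + D y" for x y
      unfolding D_def Bochner_Integration.integral_add[OF pint pint, symmetric]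
      by (simp add: p_def hprod_add_left scaleC_add_left[symmetric] algebra_simps)
    show "D (s *\<^sub>R x) = s *\<^sub>R D x" for s x
      by (simp add: scaleR_vec_eq Dscale scaleC_of_real)
    show "norm (D v) \<le> norm v * ((- c * (1 - norm z) powr (c - 1)) * G1)" for v
      unfolding D_def using bint(2)[OF pm' pb, of v] by (simp add: mult_ac)
  qed
  moreover
  define B where "B = c * (c - 1) * r powr (c - 2)"
  have B: "B \<ge> 0" using c by (simp add: B_def mult_nonpos_nonpos)
  have est: "norm (F y - F z - D (y - z)) \<le> B * (norm (y - z))\<^sup>2 * G1" if y: "norm (y - z) < r" for y
  proof -
    have "norm y \<le> norm z + norm (y - z)" by (metis add.commute diff_add_cancel norm_triangle_ineq)
    then have ny: "norm y < 1 - r" using y by (simp add: r_def field_simps)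
    then have y1: "norm y < 1" using r by simp
    have "F y - F z - D (y - z) = (LINT w|?M. ((1 - hprod y w) powr complex_of_real c - (1 - hprod z w) powr complex_of_real c - p (y - z) w) *\<^sub>C G w)"
    proof -
      have iK: "integrable ?M (\<lambda>w. (1 - hprod a w) powr complex_of_real c *\<^sub>C G w)" if "norm a < 1" for a
        by (rule bint(1)[OF pm cb[OF that _ c]]) (use that in auto)
      have FK: "F a = (LINT w|?M. (1 - hprod a w) powr complex_of_real c *\<^sub>C G w)" if "norm a < 1" for a
        unfolding F[OF that] using K[OF that] by (intro Bochner_Integration.integral_cong) auto
      have "F y - F z - D (y - z) = (LINT w|?M. (1 - hprod y w) powr complex_of_real c *\<^sub>C G w
          - (1 - hprod z w) powr complex_of_real c *\<^sub>C G w - p (y - z) w *\<^sub>C G w)"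
        unfolding FK[OF y1] FK[OF z] D_def
        by (simp add: iK[OF y1] iK[OF z] pint)
      then show ?thesis by (simp add: scaleC_diff_left)
    qed
    also have "norm \<dots> \<le> B * (norm (y - z))\<^sup>2 * G1"
    proof (rule bint(2))
      show "(\<lambda>w. (1 - hprod y w) powr complex_of_real c - (1 - hprod z w) powr complex_of_real c - p (y - z) w) \<in> borel_measurable ?M"
        using pm[OF y1, of c] pm[OF z, of c] pm'[of "y - z"] by measurable
      fix w :: "complex^'n" assume w: "norm w < 1"
      define h where "h = - hprod (y - z) w"
      have "cmod h \<le> norm (y - z) * norm w" unfolding h_def norm_minus_cancel by (rule hprod_norm_le)
      also have "\<dots> \<le> norm (y - z)" using w by (simp add: mult_left_le)
      finally have h: "(cmod h)\<^sup>2 \<le> (norm (y - z))\<^sup>2" by (intro power_mono) auto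
      have xh: "1 - hprod y w = 1 - hprod z w + h" by (simp add: h_def hprod_diff_left)
      have "cmod ((1 - hprod z w + h) powr c - (1 - hprod z w) powr c - complex_of_real c * (1 - hprod z w) powr (c - 1) * h)
         \<le> c * (c - 1) * r powr (c - 2) * (cmod h)\<^sup>2"
      proof (rule powr_taylor2[OF c r])
        show "r \<le> Re (1 - hprod z w)" using Re_ge[OF w, of z] z by (simp add: r_def)
        show "r \<le> Re (1 - hprod z w + h)" unfolding xh[symmetric] using Re_ge[OF w, of y] ny by simp
      qed
      also have "complex_of_real c * (1 - hprod z w) powr (c - 1) * h = p (y - z) w" by (simp add: p_def h_def)
      also have "c * (c - 1) * r powr (c - 2) * (cmod h)\<^sup>2 \<le> B * (norm (y - z))\<^sup>2"
        unfolding B_def[symmetric] by (rule mult_left_mono[OF h B])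
      finally show "cmod ((1 - hprod y w) powr complex_of_real c - (1 - hprod z w) powr complex_of_real c - p (y - z) w) \<le> B * (norm (y - z))\<^sup>2"
        unfolding xh .
    qed
    finally show ?thesis .
  qed
  have "\<exists>d>0. \<forall>y. norm (y - z) < d \<longrightarrow> norm (F y - F z - D (y - z)) \<le> e * norm (y - z)" if e: "e > 0" for e
  proof (intro exI[of _ "min r (e / (B * G1 + 1))"] conjI allI impI)
    have pos: "B * G1 + 1 > 0" using B G1 by (simp add: add_nonneg_pos)
    then show "0 < min r (e / (B * G1 + 1))" using r e by simp
    fix y assume y: "norm (y - z) < min r (e / (B * G1 + 1))"
    then have "norm (y - z) * (B * G1 + 1) \<le> e" using pos by (simp add: pos_less_divide_eq less_imp_le)
    then have "norm (y - z) * (B * G1) \<le> e" using norm_ge_zero[of "y - z"]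
      unfolding distrib_left mult_1_right by linarith
    then have "(norm (y - z) * (B * G1)) * norm (y - z) \<le> e * norm (y - z)" by (intro mult_right_mono) auto
    then show "norm (F y - F z - D (y - z)) \<le> e * norm (y - z)"
      using est[of y] y by (simp add: power2_eq_square mult_ac)
  qed
  ultimately have "(F has_derivative D) (at z)" unfolding has_derivative_at_alt by blast
  then show "\<exists>D. (F has_derivative D) (at z) \<and> (\<forall>c v. D (c *s v) = c *\<^sub>C D v)" using Dscale by blast
qed

text \<open>Tested against every vector y: the scalar function <f(.),y> is holomorphic and square
  integrable, and the integral commutes with the bounded functional.\<close>

lemma vector_reproducing:
  fixes f :: "complex^'n::finite \<Rightarrow> ell2"
  assumes \<alpha>: "\<alpha> > -1" and f: "f \<in> Ap_space \<alpha> 2" and u: "norm u < 1"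
  shows "integrable (nu \<alpha>) (\<lambda>z. cnj (bergman_kernel \<alpha> u z) *\<^sub>C f z)"
    and "f u = (LINT z|nu \<alpha>. cnj (bergman_kernel \<alpha> u z) *\<^sub>C f z)"
    and "ennreal (norm (f u)) \<le> (\<integral>\<^sup>+z. ennreal (cmod (bergman_kernel \<alpha> u z)) * ennreal (norm (f z)) \<partial>nu \<alpha>)"
proof -
  have hol: "holomorphic_ball f" and fin: "L2_sq \<alpha> f < \<infinity>" using f Ap_space_2_iff[OF \<alpha>] by auto
  have fm[measurable]: "f \<in> borel_measurable (nu \<alpha>)"
    by (rule continuous_on_ball_measurable[OF holomorphic_ball_continuous[OF hol]])
  have Km[measurable]: "bergman_kernel \<alpha> u \<in> borel_measurable (nu \<alpha>)"
    by (rule scalar_holo_measurable[OF scalar_holo_bergman_kernel[OF u]])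
  have "(\<integral>\<^sup>+z. ennreal (cmod (bergman_kernel \<alpha> u z)) * ennreal (norm (f z)) \<partial>nu \<alpha>)\<^sup>2
      \<le> (\<integral>\<^sup>+z. (ennreal (cmod (bergman_kernel \<alpha> u z)))\<^sup>2 \<partial>nu \<alpha>) * L2_sq \<alpha> f"
    unfolding L2_sq_def by (rule Cauchy_Schwarz_nn_integral) measurable
  also have "\<dots> < \<infinity>" using fin by (simp add: bergman_kernel_L2[OF \<alpha> u] ennreal_mult_less_top)
  finally have "(\<integral>\<^sup>+z. ennreal (cmod (bergman_kernel \<alpha> u z)) * ennreal (norm (f z)) \<partial>nu \<alpha>) < \<infinity>"
    by (simp add: power2_eq_square ennreal_mult_less_top) (auto simp: less_top[symmetric])
  then show int: "integrable (nu \<alpha>) (\<lambda>z. cnj (bergman_kernel \<alpha> u z) *\<^sub>C f z)"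
    by (intro integrableI_bounded) (auto simp: norm_scaleC ennreal_mult)
  show eq: "f u = (LINT z|nu \<alpha>. cnj (bergman_kernel \<alpha> u z) *\<^sub>C f z)"
  proof (rule cinner_ext)
    fix y
    have "(\<integral>\<^sup>+z. (ennreal (cmod (cinner (f z) y)))\<^sup>2 \<partial>nu \<alpha>) \<le> (\<integral>\<^sup>+z. ennreal ((norm y)\<^sup>2) * (ennreal (norm (f z)))\<^sup>2 \<partial>nu \<alpha>)"
    proof (intro nn_integral_mono)
      fix z
      have "(cmod (cinner (f z) y))\<^sup>2 \<le> (norm (f z) * norm y)\<^sup>2" by (intro power_mono cinner_norm_le) simp
      then show "(ennreal (cmod (cinner (f z) y)))\<^sup>2 \<le> ennreal ((norm y)\<^sup>2) * (ennreal (norm (f z)))\<^sup>2"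
        by (simp add: ennreal_power ennreal_mult[symmetric] ennreal_leI power_mult_distrib mult.commute)
    qed
    also have "\<dots> = ennreal ((norm y)\<^sup>2) * L2_sq \<alpha> f" unfolding L2_sq_def by (rule nn_integral_cmult) measurable
    also have "\<dots> < \<infinity>" using fin by (simp add: ennreal_mult_less_top)
    finally have l2: "(\<integral>\<^sup>+z. (ennreal (cmod (cinner (f z) y)))\<^sup>2 \<partial>nu \<alpha>) < \<infinity>" .
    have "cinner (f u) y = (LINT z|nu \<alpha>. cnj (bergman_kernel \<alpha> u z) * cinner (f z) y)"
      by (rule reproducing_formula(2)[OF \<alpha> scalar_holo_cinner[OF hol] u l2])
    also have "\<dots> = (LINT z|nu \<alpha>. cinner (cnj (bergman_kernel \<alpha> u z) *\<^sub>C f z) y)"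
      by (simp add: cinner_scaleC_left)
    also have "\<dots> = cinner (LINT z|nu \<alpha>. cnj (bergman_kernel \<alpha> u z) *\<^sub>C f z) y"
      by (rule integral_bounded_linear[OF bounded_linear_cinner_left int])
    finally show "cinner (f u) y = cinner (LINT z|nu \<alpha>. cnj (bergman_kernel \<alpha> u z) *\<^sub>C f z) y" .
  qed
  have "ennreal (norm (f u)) \<le> (\<integral>\<^sup>+z. norm (cnj (bergman_kernel \<alpha> u z) *\<^sub>C f z) \<partial>nu \<alpha>)"
    unfolding eq by (rule integral_norm_bound_ennreal[OF int])
  then show "ennreal (norm (f u)) \<le> (\<integral>\<^sup>+z. ennreal (cmod (bergman_kernel \<alpha> u z)) * ennreal (norm (f z)) \<partial>nu \<alpha>)"
    by (simp add: norm_scaleC ennreal_mult)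
qed

section \<open>Carleson weights\<close>

text \<open>The integral is the Berezin transform of \<beta> at z. A bound almost everywhere matches
  the essential suprema in the hypotheses and suffices because it is only ever integrated over z. B
  is carried explicitly since operator norms must come out proportional to it.\<close>

definition carleson_weight :: "real \<Rightarrow> (complex^'n::finite \<Rightarrow> real) \<Rightarrow> real \<Rightarrow> bool"
  where "carleson_weight \<alpha> \<beta> B \<longleftrightarrow> \<beta> \<in> borel_measurable (nu \<alpha>) \<and> (\<forall>u. 0 \<le> \<beta> u) \<and> 0 \<le> B \<and>
    (AE z in nu \<alpha>. (\<integral>\<^sup>+u. ennreal (\<beta> u) * ennreal (kernel_sq \<alpha> z u) \<partial>nu \<alpha>) \<le> ennreal B)"

lemma measurable_nu_fst [measurable]: "fst \<in> borel_measurable (nu \<alpha> \<Otimes>\<^sub>M M)"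
  by (rule measurable_compose[OF measurable_fst measurable_nu_id])

lemma measurable_nu_snd [measurable]: "snd \<in> borel_measurable (M \<Otimes>\<^sub>M nu \<alpha>)"
  by (rule measurable_compose[OF measurable_snd measurable_nu_id])

text \<open>The assumption bounds g by an average of itself against |k_z(u)|^2. Integrating against
  \<beta>(u) and exchanging the integrals leaves the Berezin transform of \<beta> at z as inner
  integral, which is at most B almost everywhere.\<close>

lemma carleson_transfer:
  fixes \<beta> :: "complex^'n::finite \<Rightarrow> real"
  assumes \<alpha>: "\<alpha> > -1" and \<beta>: "carleson_weight \<alpha> \<beta> B"
    and g[measurable]: "g \<in> borel_measurable (nu \<alpha>)" and C: "C \<ge> 0"
    and le: "\<And>u. norm u < 1 \<Longrightarrow> g u \<le> ennreal C * (\<integral>\<^sup>+z. g z * ennreal (kernel_sq \<alpha> z u) \<partial>nu \<alpha>)"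
  shows "(\<integral>\<^sup>+u. ennreal (\<beta> u) * g u \<partial>nu \<alpha>) \<le> ennreal (C * B) * (\<integral>\<^sup>+z. g z \<partial>nu \<alpha>)"
proof -
  let ?M = "nu \<alpha> :: (complex^'n) measure"
  interpret N: finite_measure ?M by (rule finite_measure_nu[OF \<alpha>])
  interpret P: pair_sigma_finite ?M ?M ..
  have [measurable]: "\<beta> \<in> borel_measurable ?M" and B: "B \<ge> 0"
    and ae: "AE z in ?M. (\<integral>\<^sup>+u. ennreal (\<beta> u) * ennreal (kernel_sq \<alpha> z u) \<partial>nu \<alpha>) \<le> ennreal B"
    using \<beta> by (auto simp: carleson_weight_def)
  have [measurable]: "(\<lambda>u. kernel_sq \<alpha> z u) \<in> borel_measurable ?M" "(\<lambda>z. kernel_sq \<alpha> z u) \<in> borel_measurable ?M" for u z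
    by (rule measurable_nu_borel, measurable)+
  have "(\<integral>\<^sup>+u. ennreal (\<beta> u) * g u \<partial>?M)
     \<le> (\<integral>\<^sup>+u. (\<integral>\<^sup>+z. ennreal C * (ennreal (\<beta> u) * (g z * ennreal (kernel_sq \<alpha> z u))) \<partial>?M) \<partial>?M)"
  proof (intro nn_integral_mono)
    fix u assume "u \<in> space ?M"
    then have "ennreal (\<beta> u) * g u \<le> ennreal (\<beta> u) * (ennreal C * (\<integral>\<^sup>+z. g z * ennreal (kernel_sq \<alpha> z u) \<partial>nu \<alpha>))"
      using le by (intro mult_left_mono) auto
    also have "\<dots> = (\<integral>\<^sup>+z. ennreal C * (ennreal (\<beta> u) * (g z * ennreal (kernel_sq \<alpha> z u))) \<partial>?M)"
      by (simp add: nn_integral_cmult) (simp only: mult.left_commute)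
    finally show "ennreal (\<beta> u) * g u \<le> (\<integral>\<^sup>+z. ennreal C * (ennreal (\<beta> u) * (g z * ennreal (kernel_sq \<alpha> z u))) \<partial>?M)" .
  qed
  also have "\<dots> = (\<integral>\<^sup>+z. (\<integral>\<^sup>+u. ennreal C * (ennreal (\<beta> u) * (g z * ennreal (kernel_sq \<alpha> z u))) \<partial>?M) \<partial>?M)"
    by (rule P.Fubini') measurable
  also have "\<dots> = (\<integral>\<^sup>+z. (ennreal C * g z) * (\<integral>\<^sup>+u. ennreal (\<beta> u) * ennreal (kernel_sq \<alpha> z u) \<partial>?M) \<partial>?M)"
    by (intro nn_integral_cong) (subst nn_integral_cmult[symmetric]; auto simp: mult_ac intro!: nn_integral_cong)
  also have "\<dots> \<le> (\<integral>\<^sup>+z. (ennreal C * g z) * ennreal B \<partial>?M)"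
    using ae by (intro nn_integral_mono_AE) (auto elim!: eventually_mono intro: mult_left_mono)
  also have "\<dots> = (\<integral>\<^sup>+z. ennreal (C * B) * g z \<partial>?M)"
    using C B by (intro nn_integral_cong) (simp add: ennreal_mult mult_ac)
  also have "\<dots> = ennreal (C * B) * (\<integral>\<^sup>+z. g z \<partial>nu \<alpha>)"
    by (rule nn_integral_cmult) measurable
  finally show ?thesis .
qed

lemma carleson_scalar:
  assumes \<alpha>: "\<alpha> > -1"
  shows "\<exists>C\<ge>0. \<forall>(\<beta> :: complex^'n::finite \<Rightarrow> real) B F. carleson_weight \<alpha> \<beta> B \<and> scalar_holo F \<longrightarrow>
    (\<integral>\<^sup>+u. ennreal (\<beta> u) * ennreal (cmod (F u)) \<partial>nu \<alpha>) \<le> ennreal (C * B) * (\<integral>\<^sup>+z. ennreal (cmod (F z)) \<partial>nu \<alpha>)"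
proof -
  obtain C where C: "C > 0" "\<And>F u. scalar_holo F \<Longrightarrow> norm (u :: complex^'n) < 1 \<Longrightarrow>
    ennreal (cmod (F u)) \<le> ennreal C * (\<integral>\<^sup>+z. ennreal (cmod (F z)) * ennreal (kernel_sq \<alpha> z u) \<partial>nu \<alpha>)"
    using holo_bound[OF \<alpha>] by blast
  show ?thesis
  proof (intro exI[of _ C] conjI allI impI)
    fix \<beta> :: "complex^'n \<Rightarrow> real" and B and F :: "complex^'n \<Rightarrow> complex" assume as: "carleson_weight \<alpha> \<beta> B \<and> scalar_holo F"
    then have [measurable]: "F \<in> borel_measurable (nu \<alpha>)" by (simp add: scalar_holo_measurable)
    show "(\<integral>\<^sup>+u. ennreal (\<beta> u) * ennreal (cmod (F u)) \<partial>nu \<alpha>) \<le> ennreal (C * B) * (\<integral>\<^sup>+z. ennreal (cmod (F z)) \<partial>nu \<alpha>)"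
      using as C by (intro carleson_transfer[OF \<alpha>]) auto
  qed (use C in auto)
qed

text \<open>For vector-valued f the bound \<open>holo_bound\<close> is applied to the scalar
  holomorphic function <f,y>^2 with y the direction of f(u): its modulus equals |f(u)|^2 at u and is
  at most |f|^2 elsewhere.\<close>

lemma carleson_vector:
  assumes \<alpha>: "\<alpha> > -1"
  shows "\<exists>C\<ge>0. \<forall>(\<beta> :: complex^'n::finite \<Rightarrow> real) B f. carleson_weight \<alpha> \<beta> B \<and> f \<in> (Ap_space \<alpha> 2 :: (_ \<Rightarrow> ell2) set) \<longrightarrow>
    (\<integral>\<^sup>+u. ennreal (\<beta> u) * (ennreal (norm (f u)))\<^sup>2 \<partial>nu \<alpha>) \<le> ennreal (C * B) * L2_sq \<alpha> f"
proof -
  obtain C where C: "C > 0" "\<And>F u. scalar_holo F \<Longrightarrow> norm (u :: complex^'n) < 1 \<Longrightarrow>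
    ennreal (cmod (F u)) \<le> ennreal C * (\<integral>\<^sup>+z. ennreal (cmod (F z)) * ennreal (kernel_sq \<alpha> z u) \<partial>nu \<alpha>)"
    using holo_bound[OF \<alpha>] by blast
  show ?thesis
  proof (intro exI[of _ C] conjI allI impI)
    fix \<beta> :: "complex^'n \<Rightarrow> real" and B and f :: "complex^'n \<Rightarrow> ell2"
    assume as: "carleson_weight \<alpha> \<beta> B \<and> f \<in> Ap_space \<alpha> 2"
    then have hol: "holomorphic_ball f" using Ap_space_2_iff[OF \<alpha>] by auto
    have [measurable]: "f \<in> borel_measurable (nu \<alpha>)"
      by (rule continuous_on_ball_measurable[OF holomorphic_ball_continuous[OF hol]])
    show "(\<integral>\<^sup>+u. ennreal (\<beta> u) * (ennreal (norm (f u)))\<^sup>2 \<partial>nu \<alpha>) \<le> ennreal (C * B) * L2_sq \<alpha> f"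
      unfolding L2_sq_def
    proof (intro carleson_transfer[OF \<alpha>])
      fix u :: "complex^'n" assume u: "norm u < 1"
      define y where "y = sgn (f u)"
      have y: "norm y \<le> 1" by (simp add: y_def norm_sgn)
      have "complex_of_real (norm (f u)) = cinner (f u) y"
      proof (cases "f u = 0")
        case False
        have "cinner (f u) y = complex_of_real (inverse (norm (f u))) * complex_of_real ((norm (f u))\<^sup>2)"
          by (simp add: y_def sgn_div_norm scaleC_of_real[symmetric] cinner_scaleC_right cinner_self_norm)
        then show ?thesis using False by (simp add: power2_eq_square)
      qed (simp add: cinner_def zero_ell2.rep_eq)
      then have "norm (f u) = cmod (cinner (f u) y)" by (metis abs_norm_cancel norm_of_real)
      then have "(norm (f u))\<^sup>2 = cmod (cinner (f u) y * cinner (f u) y)"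
        by (simp add: norm_mult power2_eq_square)
      then have "(ennreal (norm (f u)))\<^sup>2 = ennreal (cmod (cinner (f u) y * cinner (f u) y))"
        by (simp add: ennreal_power)
      also have "\<dots> \<le> ennreal C * (\<integral>\<^sup>+z. ennreal (cmod (cinner (f z) y * cinner (f z) y)) * ennreal (kernel_sq \<alpha> z u) \<partial>nu \<alpha>)"
        by (intro C(2) scalar_holo_mult scalar_holo_cinner hol u)
      also have "\<dots> \<le> ennreal C * (\<integral>\<^sup>+z. (ennreal (norm (f z)))\<^sup>2 * ennreal (kernel_sq \<alpha> z u) \<partial>nu \<alpha>)"
      proof (intro mult_left_mono nn_integral_mono mult_right_mono)
        fix z
        have "cmod (cinner (f z) y) \<le> norm (f z) * norm y" by (rule cinner_norm_le)
        also have "\<dots> \<le> norm (f z)" using y by (simp add: mult_left_le)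
        finally have "(cmod (cinner (f z) y))\<^sup>2 \<le> (norm (f z))\<^sup>2" by (intro power_mono) auto
        then show "ennreal (cmod (cinner (f z) y * cinner (f z) y)) \<le> (ennreal (norm (f z)))\<^sup>2"
          by (simp add: norm_mult power2_eq_square ennreal_mult[symmetric] ennreal_leI)
      qed auto
      finally show "(ennreal (norm (f u)))\<^sup>2 \<le> ennreal C * (\<integral>\<^sup>+z. (ennreal (norm (f z)))\<^sup>2 * ennreal (kernel_sq \<alpha> z u) \<partial>nu \<alpha>)" .
    qed (use as C in auto)
  qed (use C in auto)
qed

text \<open>K_z K_w is holomorphic in u, so \<open>carleson_scalar\<close> trades the weight for its
  bound B, which leaves the unweighted integral of |K_z K_w|.\<close>

lemma carleson_kernel:
  assumes \<alpha>: "\<alpha> > -1" and d: "0 < d" "d \<le> kernel_exp TYPE('n::finite) \<alpha>"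
  shows "\<exists>C\<ge>0. \<forall>(\<beta> :: complex^'n \<Rightarrow> real) B w z. carleson_weight \<alpha> \<beta> B \<and> norm w < 1 \<and> norm z < 1 \<longrightarrow>
    (\<integral>\<^sup>+u. ennreal (\<beta> u) * ennreal (cmod (bergman_kernel \<alpha> z u) * cmod (bergman_kernel \<alpha> w u)) \<partial>nu \<alpha>)
      \<le> ennreal (C * B * Qker \<alpha> d w z)"
proof -
  obtain C1 where C1: "C1 \<ge> 0" "\<And>(\<beta> :: complex^'n \<Rightarrow> real) B F. carleson_weight \<alpha> \<beta> B \<Longrightarrow> scalar_holo F \<Longrightarrow>
    (\<integral>\<^sup>+u. ennreal (\<beta> u) * ennreal (cmod (F u)) \<partial>nu \<alpha>) \<le> ennreal (C1 * B) * (\<integral>\<^sup>+z. ennreal (cmod (F z)) \<partial>nu \<alpha>)"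
    using carleson_scalar[OF \<alpha>, where 'n='n] by blast
  obtain C2 where C2: "C2 \<ge> 0" "\<And>w z :: complex^'n. norm w < 1 \<Longrightarrow> norm z < 1 \<Longrightarrow>
    (\<integral>\<^sup>+u. ennreal (cmod (1 - hprod u z) powr (- kernel_exp TYPE('n) \<alpha>)
      * cmod (1 - hprod u w) powr (- kernel_exp TYPE('n) \<alpha>)) \<partial>nu \<alpha>) \<le> ennreal (C2 * Qker \<alpha> d w z)"
    using kernel_product_bound[OF \<alpha> d] by blast
  show ?thesis
  proof (intro exI[of _ "C1 * C2"] conjI allI impI)
    fix \<beta> :: "complex^'n \<Rightarrow> real" and B and w z :: "complex^'n"
    assume as: "carleson_weight \<alpha> \<beta> B \<and> norm w < 1 \<and> norm z < 1"
    then have B: "B \<ge> 0" by (simp add: carleson_weight_def)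
    have "(\<integral>\<^sup>+u. ennreal (\<beta> u) * ennreal (cmod (bergman_kernel \<alpha> z u * bergman_kernel \<alpha> w u)) \<partial>nu \<alpha>)
       \<le> ennreal (C1 * B) * (\<integral>\<^sup>+u. ennreal (cmod (bergman_kernel \<alpha> z u * bergman_kernel \<alpha> w u)) \<partial>nu \<alpha>)"
      using as by (intro C1(2) scalar_holo_mult scalar_holo_bergman_kernel) auto
    also have "\<dots> \<le> ennreal (C1 * B) * ennreal (C2 * Qker \<alpha> d w z)"
      using C2(2)[of w z] as by (intro mult_left_mono) (auto simp: norm_mult cmod_bergman_kernel)
    finally show "(\<integral>\<^sup>+u. ennreal (\<beta> u) * ennreal (cmod (bergman_kernel \<alpha> z u) * cmod (bergman_kernel \<alpha> w u)) \<partial>nu \<alpha>)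
      \<le> ennreal (C1 * C2 * B * Qker \<alpha> d w z)"
      using C1(1) C2(1) B by (simp add: norm_mult ennreal_mult[symmetric] mult_ac)
  qed (use C1 C2 in auto)
qed

text \<open>With d = (\<alpha>+1)/4 one has \<alpha> - 3d = d - 1 > -1 and 4d = \<alpha> + 1 <= N,
  so a single exponent meets the conditions of the Schur test and of the kernel product
  bound.\<close>

definition schur_exp :: "real \<Rightarrow> real" where "schur_exp \<alpha> = (\<alpha> + 1) / 4"

lemma schur_exp:
  assumes "\<alpha> > -1"
  shows "0 < schur_exp \<alpha>" "\<alpha> - 3 * schur_exp \<alpha> > -1"
    "schur_exp \<alpha> \<le> kernel_exp TYPE('n::finite) \<alpha> - 3 * schur_exp \<alpha>"
    "schur_exp \<alpha> \<le> kernel_exp TYPE('n) \<alpha>"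
  using assms by (auto simp: schur_exp_def kernel_exp_def field_simps)

lemma measurable_bergman_pair:
  "(\<lambda>p. cmod (bergman_kernel \<alpha> (fst p) (snd p))) \<in> borel_measurable (nu \<alpha> \<Otimes>\<^sub>M nu \<alpha>)"
  unfolding cmod_bergman_kernel by measurable

text \<open>The reproducing bound for |f(u)| is inserted and the integrals are exchanged: the weight
  then meets only |K_w K_z|, whose weighted integral is at most a multiple of B times
  \<open>Qker\<close>, and the Schur test concludes. The norm bound is linear in B, hence the square
  of C B here.\<close>

lemma carleson_majorant:
  assumes \<alpha>: "\<alpha> > -1"
  shows "\<exists>C\<ge>0. \<forall>(\<beta> :: complex^'n::finite \<Rightarrow> real) B f. carleson_weight \<alpha> \<beta> B \<and> f \<in> (Ap_space \<alpha> 2 :: (_ \<Rightarrow> ell2) set) \<longrightarrow>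
    (\<integral>\<^sup>+w. (\<integral>\<^sup>+u. ennreal (\<beta> u) * (ennreal (cmod (bergman_kernel \<alpha> w u)) * ennreal (norm (f u))) \<partial>nu \<alpha>)\<^sup>2 \<partial>nu \<alpha>)
      \<le> ennreal ((C * B)\<^sup>2) * L2_sq \<alpha> f"
proof -
  let ?M = "nu \<alpha> :: (complex^'n) measure"
  interpret N: finite_measure ?M by (rule finite_measure_nu[OF \<alpha>])
  interpret P: pair_sigma_finite ?M ?M ..
  define d where "d = schur_exp \<alpha>"
  obtain C1 where C1: "C1 \<ge> 0" "\<And>(\<beta> :: complex^'n \<Rightarrow> real) B w z. carleson_weight \<alpha> \<beta> B \<Longrightarrow> norm w < 1 \<Longrightarrow> norm z < 1 \<Longrightarrow>
    (\<integral>\<^sup>+u. ennreal (\<beta> u) * ennreal (cmod (bergman_kernel \<alpha> z u) * cmod (bergman_kernel \<alpha> w u)) \<partial>nu \<alpha>)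
      \<le> ennreal (C1 * B * Qker \<alpha> d w z)"
    using carleson_kernel[OF \<alpha> schur_exp(1)[OF \<alpha>] schur_exp(4)[OF \<alpha>, where 'n='n]] unfolding d_def by blast
  obtain C2 where C2: "C2 \<ge> 0" "\<And>f. f \<in> borel_measurable ?M \<Longrightarrow>
    (\<integral>\<^sup>+w. (\<integral>\<^sup>+z. ennreal (Qker \<alpha> d w z) * f z \<partial>nu \<alpha>)\<^sup>2 \<partial>nu \<alpha>) \<le> ennreal (C2\<^sup>2) * (\<integral>\<^sup>+z. (f z)\<^sup>2 \<partial>nu \<alpha>)"
    using Qker_bounded[OF schur_exp(1,2)[OF \<alpha>] schur_exp(3)[OF \<alpha>, where 'n='n]] unfolding d_def by blast
  show ?thesis
  proof (intro exI[of _ "C1 * C2"] conjI allI impI)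
    fix \<beta> :: "complex^'n \<Rightarrow> real" and B and f :: "complex^'n \<Rightarrow> ell2"
    assume as: "carleson_weight \<alpha> \<beta> B \<and> f \<in> Ap_space \<alpha> 2"
    then have B: "B \<ge> 0" and [measurable]: "\<beta> \<in> borel_measurable ?M" and \<beta>: "\<And>u. \<beta> u \<ge> 0"
       and hol: "holomorphic_ball f"
      using Ap_space_2_iff[OF \<alpha>] by (auto simp: carleson_weight_def)
    have [measurable]: "f \<in> borel_measurable ?M"
      by (rule continuous_on_ball_measurable[OF holomorphic_ball_continuous[OF hol]])
    note measurable_bergman_pair[measurable]
    have Km[measurable]: "(\<lambda>u. cmod (bergman_kernel \<alpha> w u)) \<in> borel_measurable ?M"
       "(\<lambda>u. cmod (bergman_kernel \<alpha> u w)) \<in> borel_measurable ?M" for w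
      unfolding cmod_bergman_kernel by (rule measurable_nu_borel, measurable)+
    have [measurable]: "(\<lambda>p. cmod (bergman_kernel \<alpha> (snd p) (fst p))) \<in> borel_measurable (?M \<Otimes>\<^sub>M ?M)"
      unfolding cmod_bergman_kernel by measurable
    have [measurable]: "(\<lambda>z. Qker \<alpha> d w z) \<in> borel_measurable ?M" for w
      by (rule measurable_nu_borel) measurable
    have inner: "(\<integral>\<^sup>+u. ennreal (\<beta> u) * (ennreal (cmod (bergman_kernel \<alpha> w u)) * ennreal (norm (f u))) \<partial>?M)
       \<le> ennreal (C1 * B) * (\<integral>\<^sup>+z. ennreal (Qker \<alpha> d w z) * ennreal (norm (f z)) \<partial>?M)" if w: "norm w < 1" for w
    proof -
      have "(\<integral>\<^sup>+u. ennreal (\<beta> u) * (ennreal (cmod (bergman_kernel \<alpha> w u)) * ennreal (norm (f u))) \<partial>?M)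
        \<le> (\<integral>\<^sup>+u. (\<integral>\<^sup>+z. ennreal (\<beta> u) * (ennreal (cmod (bergman_kernel \<alpha> w u)) * (ennreal (cmod (bergman_kernel \<alpha> u z)) * ennreal (norm (f z)))) \<partial>?M) \<partial>?M)"
      proof (intro nn_integral_mono)
        fix u assume "u \<in> space ?M"
        then have u: "norm u < 1" by simp
        have "ennreal (\<beta> u) * (ennreal (cmod (bergman_kernel \<alpha> w u)) * ennreal (norm (f u)))
          \<le> ennreal (\<beta> u) * (ennreal (cmod (bergman_kernel \<alpha> w u)) * (\<integral>\<^sup>+z. ennreal (cmod (bergman_kernel \<alpha> u z)) * ennreal (norm (f z)) \<partial>nu \<alpha>))"
          using as vector_reproducing(3)[OF \<alpha> _ u] by (intro mult_left_mono) auto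
        also have "\<dots> = (\<integral>\<^sup>+z. ennreal (\<beta> u) * (ennreal (cmod (bergman_kernel \<alpha> w u)) * (ennreal (cmod (bergman_kernel \<alpha> u z)) * ennreal (norm (f z)))) \<partial>?M)"
          by (simp add: nn_integral_cmult)
        finally show "ennreal (\<beta> u) * (ennreal (cmod (bergman_kernel \<alpha> w u)) * ennreal (norm (f u)))
          \<le> (\<integral>\<^sup>+z. ennreal (\<beta> u) * (ennreal (cmod (bergman_kernel \<alpha> w u)) * (ennreal (cmod (bergman_kernel \<alpha> u z)) * ennreal (norm (f z)))) \<partial>?M)" .
      qed
      also have "\<dots> = (\<integral>\<^sup>+z. (\<integral>\<^sup>+u. ennreal (\<beta> u) * (ennreal (cmod (bergman_kernel \<alpha> w u)) * (ennreal (cmod (bergman_kernel \<alpha> u z)) * ennreal (norm (f z)))) \<partial>?M) \<partial>?M)"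
        by (rule P.Fubini') measurable
      also have "\<dots> \<le> (\<integral>\<^sup>+z. ennreal (C1 * B) * (ennreal (Qker \<alpha> d w z) * ennreal (norm (f z))) \<partial>?M)"
      proof (intro nn_integral_mono)
        fix z assume "z \<in> space ?M"
        then have z: "norm z < 1" by simp
        have "(\<integral>\<^sup>+u. ennreal (\<beta> u) * (ennreal (cmod (bergman_kernel \<alpha> w u)) * (ennreal (cmod (bergman_kernel \<alpha> u z)) * ennreal (norm (f z)))) \<partial>?M)
          = (\<integral>\<^sup>+u. ennreal (norm (f z)) * (ennreal (\<beta> u) * ennreal (cmod (bergman_kernel \<alpha> z u) * cmod (bergman_kernel \<alpha> w u))) \<partial>?M)"
          by (intro nn_integral_cong) (simp add: ennreal_mult cmod_bergman_kernel_swap[of \<alpha> z] mult_ac)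
        also have "\<dots> = ennreal (norm (f z)) * (\<integral>\<^sup>+u. ennreal (\<beta> u) * ennreal (cmod (bergman_kernel \<alpha> z u) * cmod (bergman_kernel \<alpha> w u)) \<partial>?M)"
          by (rule nn_integral_cmult) measurable
        also have "\<dots> \<le> ennreal (norm (f z)) * ennreal (C1 * B * Qker \<alpha> d w z)"
          using as by (intro mult_left_mono C1(2) w z) auto
        also have "\<dots> = ennreal (C1 * B) * (ennreal (Qker \<alpha> d w z) * ennreal (norm (f z)))"
          using C1(1) B by (simp add: ennreal_mult mult_ac)
        finally show "(\<integral>\<^sup>+u. ennreal (\<beta> u) * (ennreal (cmod (bergman_kernel \<alpha> w u)) * (ennreal (cmod (bergman_kernel \<alpha> u z)) * ennreal (norm (f z)))) \<partial>?M)
          \<le> ennreal (C1 * B) * (ennreal (Qker \<alpha> d w z) * ennreal (norm (f z)))" .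
      qed
      also have "\<dots> = ennreal (C1 * B) * (\<integral>\<^sup>+z. ennreal (Qker \<alpha> d w z) * ennreal (norm (f z)) \<partial>?M)"
        by (rule nn_integral_cmult) measurable
      finally show ?thesis .
    qed
    have Qm: "(\<lambda>w. \<integral>\<^sup>+z. ennreal (Qker \<alpha> d w z) * ennreal (norm (f z)) \<partial>?M) \<in> borel_measurable ?M"
      by measurable
    have "(\<integral>\<^sup>+w. (\<integral>\<^sup>+u. ennreal (\<beta> u) * (ennreal (cmod (bergman_kernel \<alpha> w u)) * ennreal (norm (f u))) \<partial>?M)\<^sup>2 \<partial>?M)
      \<le> (\<integral>\<^sup>+w. ennreal ((C1 * B)\<^sup>2) * (\<integral>\<^sup>+z. ennreal (Qker \<alpha> d w z) * ennreal (norm (f z)) \<partial>?M)\<^sup>2 \<partial>?M)"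
    proof (intro nn_integral_mono)
      fix w assume "w \<in> space ?M"
      then have "(\<integral>\<^sup>+u. ennreal (\<beta> u) * (ennreal (cmod (bergman_kernel \<alpha> w u)) * ennreal (norm (f u))) \<partial>?M)\<^sup>2
        \<le> (ennreal (C1 * B) * (\<integral>\<^sup>+z. ennreal (Qker \<alpha> d w z) * ennreal (norm (f z)) \<partial>?M))\<^sup>2"
        by (intro power_mono inner) auto
      then show "(\<integral>\<^sup>+u. ennreal (\<beta> u) * (ennreal (cmod (bergman_kernel \<alpha> w u)) * ennreal (norm (f u))) \<partial>?M)\<^sup>2
        \<le> ennreal ((C1 * B)\<^sup>2) * (\<integral>\<^sup>+z. ennreal (Qker \<alpha> d w z) * ennreal (norm (f z)) \<partial>?M)\<^sup>2"
        using C1(1) B by (simp add: power_mult_distrib ennreal_power[symmetric] ennreal_mult)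
    qed
    also have "\<dots> = ennreal ((C1 * B)\<^sup>2) * (\<integral>\<^sup>+w. (\<integral>\<^sup>+z. ennreal (Qker \<alpha> d w z) * ennreal (norm (f z)) \<partial>?M)\<^sup>2 \<partial>?M)"
      using Qm by (intro nn_integral_cmult) measurable
    also have "\<dots> \<le> ennreal ((C1 * B)\<^sup>2) * (ennreal (C2\<^sup>2) * L2_sq \<alpha> f)"
      unfolding L2_sq_def by (intro mult_left_mono C2(2)) auto
    also have "\<dots> = ennreal ((C1 * C2 * B)\<^sup>2) * L2_sq \<alpha> f"
    proof -
      have "(C1 * C2 * B)\<^sup>2 = (C1 * B)\<^sup>2 * C2\<^sup>2" by (simp add: power_mult_distrib mult_ac)
      then show ?thesis by (simp only: ennreal_mult[OF zero_le_power2 zero_le_power2] mult.assoc)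
    qed
    finally show "(\<integral>\<^sup>+w. (\<integral>\<^sup>+u. ennreal (\<beta> u) * (ennreal (cmod (bergman_kernel \<alpha> w u)) * ennreal (norm (f u))) \<partial>?M)\<^sup>2 \<partial>?M)
      \<le> ennreal ((C1 * C2 * B)\<^sup>2) * L2_sq \<alpha> f" .
  qed (use C1 C2 in auto)
qed

text \<open>Symbols are measurable only for the completed measure. Such a G agrees with a Borel
  function off a Borel null set, and the preimage of that set under phi_a is null by the Borel
  formula applied to its indicator.\<close>

lemma nn_integral_nu_involution_nu:
  fixes a :: "complex^'n::finite" and G :: "complex^'n \<Rightarrow> ennreal"
  assumes t: "t > -1" and a: "norm a < 1" and G: "G \<in> borel_measurable (nu t)"
  shows "(\<lambda>x. G (ball_involution a x)) \<in> borel_measurable (nu t)"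
    and "(\<integral>\<^sup>+x. G (ball_involution a x) \<partial>nu t) = (\<integral>\<^sup>+x. G x * ennreal (kernel_sq t a x) \<partial>nu t)"
proof -
  note measurable_ball_involution[OF a, measurable]
  let ?b = "ball (0 :: complex^'n) 1"
  have "G \<in> borel_measurable (lebesgue_on ?b)" using G unfolding measurable_cong_sets[OF sets_nu refl] .
  then have "(\<lambda>x. if x \<in> ?b then G x else 0) \<in> borel_measurable lebesgue"
    by (subst (asm) measurable_restrict_space_iff[where c = 0]) auto
  then obtain G' where G': "G' \<in> borel_measurable lborel" "AE x in lborel. (if x \<in> ?b then G x else 0) = G' x"
    using completion_ex_borel_measurable by blast
  have G'm[measurable]: "G' \<in> borel_measurable borel" using G'(1) by simp
  obtain N where N: "{x. (if x \<in> ?b then G x else 0) \<noteq> G' x} \<subseteq> N" "emeasure lborel N = 0" "N \<in> sets lborel"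
    using G'(2) by (auto elim!: AE_E)
  have [measurable]: "N \<in> sets borel" using N(3) by simp
  have eqN: "G x = G' x" if "norm x < 1" "x \<notin> N" for x
  proof -
    have "(if x \<in> ?b then G x else 0) = G' x" using that(2) N(1) by blast
    then show ?thesis using that(1) by simp
  qed
  have "AE x in lebesgue. x \<notin> N"
    using N(2,3) by (intro AE_completion AE_not_in) (auto simp: null_sets_def)
  then have "AE x in lebesgue_on ?b. x \<notin> N" by (subst AE_restrict_space_iff) auto
  then have aeN: "AE x in nu t. x \<notin> N" by (simp add: AE_nu_iff[OF t])
  have "(\<integral>\<^sup>+x. indicator N (ball_involution a x) \<partial>nu t) = (\<integral>\<^sup>+x. indicator N x * ennreal (kernel_sq t a x) \<partial>nu t)"
    by (rule nn_integral_nu_involution[OF t a]) measurable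
  also have "\<dots> = (\<integral>\<^sup>+x. 0 \<partial>(nu t :: (complex^'n) measure))"
    using aeN by (intro nn_integral_cong_AE) (auto elim!: eventually_mono)
  finally have z: "(\<integral>\<^sup>+x. indicator N (ball_involution a x) \<partial>nu t) = 0" by simp
  have mi: "(\<lambda>x. indicator N (ball_involution a x) :: ennreal) \<in> borel_measurable (nu t)"
    by (intro measurable_nu_borel) measurable
  have "AE x in nu t. indicator N (ball_involution a x) = (0::ennreal)"
    using z nn_integral_0_iff_AE[OF mi] by simp
  then have aep: "AE x in nu t. ball_involution a x \<notin> N"
    by eventually_elim (auto simp: indicator_def split: if_splits)
  have ae: "AE x in nu t. G (ball_involution a x) = G' (ball_involution a x)"
    using aep AE_space by eventually_elim (auto intro!: eqN ball_involution_in_ball[OF a])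
  have ae2: "AE x in nu t. G x = G' x"
    using aeN AE_space by eventually_elim (auto intro!: eqN)
  have "(\<lambda>x. G' (ball_involution a x)) \<in> borel_measurable (nu t)"
    by (intro measurable_nu_borel) measurable
  then show "(\<lambda>x. G (ball_involution a x)) \<in> borel_measurable (nu t)"
    by (rule borel_measurable_AE_eq[OF complete_nu[OF t] _ ae])
  have "(\<integral>\<^sup>+x. G (ball_involution a x) \<partial>nu t) = (\<integral>\<^sup>+x. G' (ball_involution a x) \<partial>nu t)"
    by (rule nn_integral_cong_AE[OF ae])
  also have "\<dots> = (\<integral>\<^sup>+x. G' x * ennreal (kernel_sq t a x) \<partial>nu t)"
    by (rule nn_integral_nu_involution[OF t a]) measurable
  also have "\<dots> = (\<integral>\<^sup>+x. G x * ennreal (kernel_sq t a x) \<partial>nu t)"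
    using ae2 by (intro nn_integral_cong_AE) (auto elim!: eventually_mono)
  finally show "(\<integral>\<^sup>+x. G (ball_involution a x) \<partial>nu t) = (\<integral>\<^sup>+x. G x * ennreal (kernel_sq t a x) \<partial>nu t)" .
qed

text \<open>By the change of variables the Berezin transform of |b| at z is the integral of |b o
  phi_z|, at most that of |b o phi_z - b~(z)| plus |b~(z)|. The first is bounded by the BMO norm at
  every z, the second by the essential supremum at almost every z.\<close>

lemma carleson_weight_BMO:
  fixes b :: "complex^'n::finite \<Rightarrow> 'e::real_normed_vector"
  assumes \<alpha>: "\<alpha> > -1" and b: "b \<in> BMO1_space \<alpha>" and bb: "berezin \<alpha> b \<in> Linf_space \<alpha>"
  shows "\<exists>B. carleson_weight \<alpha> (\<lambda>u. norm (b u)) B"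
proof -
  let ?M = "nu \<alpha> :: (complex^'n) measure"
  have sm: "strongly_measurable ?M b" and fin: "BMO1_norm \<alpha> b < \<infinity>"
    using b by (auto simp: BMO1_space_def Lp_space_def)
  obtain M1 where M1: "M1 \<ge> 0" "BMO1_norm \<alpha> b = ennreal M1" using fin by (cases "BMO1_norm \<alpha> b") auto
  have "Linf_norm \<alpha> (berezin \<alpha> b) < \<infinity>" using bb by (simp add: Linf_space_def)
  then obtain M2 where M2: "M2 \<ge> 0" "Linf_norm \<alpha> (berezin \<alpha> b) = ennreal M2"
    by (cases "Linf_norm \<alpha> (berezin \<alpha> b)") auto
  have ae: "AE z in ?M. ennreal (norm (berezin \<alpha> b z)) \<le> ennreal M2"
    using esssup_AE[of "\<lambda>z. ennreal (norm (berezin \<alpha> b z))" ?M] M2(2) by (simp add: Linf_norm_def)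
  have cm: "(\<lambda>x. norm (b x - c)) \<in> borel_measurable ?M" for c
    by (rule strongly_measurable_compose[OF complete_nu[OF \<alpha>] sm]) (intro continuous_intros)
  have nm: "(\<lambda>x. norm (b x)) \<in> borel_measurable ?M" using cm[of 0] by simp
  have *: "(\<integral>\<^sup>+u. ennreal (norm (b u)) * ennreal (kernel_sq \<alpha> z u) \<partial>?M) \<le> ennreal (M1 + M2)"
    if z: "norm z < 1" and bz: "ennreal (norm (berezin \<alpha> b z)) \<le> ennreal M2" for z
  proof -
    define c where "c = berezin \<alpha> b z"
    have m1: "(\<lambda>x. ennreal (norm (b x - c))) \<in> borel_measurable ?M" using cm[of c] by measurable
    have m2: "(\<lambda>x. ennreal (norm (b x))) \<in> borel_measurable ?M" using nm by measurable
    have "(\<integral>\<^sup>+u. ennreal (norm (b u)) * ennreal (kernel_sq \<alpha> z u) \<partial>?M) = (\<integral>\<^sup>+u. ennreal (norm (b (ball_involution z u))) \<partial>?M)"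
      by (rule nn_integral_nu_involution_nu(2)[OF \<alpha> z m2, symmetric])
    also have "\<dots> \<le> (\<integral>\<^sup>+u. ennreal (norm (b (ball_involution z u) - c)) + ennreal (norm c) \<partial>?M)"
    proof (intro nn_integral_mono)
      fix u
      have "norm (b (ball_involution z u)) \<le> norm (b (ball_involution z u) - c) + norm c"
        by (metis diff_add_cancel norm_triangle_ineq)
      then show "ennreal (norm (b (ball_involution z u))) \<le> ennreal (norm (b (ball_involution z u) - c)) + ennreal (norm c)"
        by (simp add: ennreal_plus[symmetric] ennreal_leI del: ennreal_plus)
    qed
    also have "\<dots> = (\<integral>\<^sup>+u. ennreal (norm (b (ball_involution z u) - c)) \<partial>?M) + (\<integral>\<^sup>+u. ennreal (norm c) \<partial>?M)"
      by (rule nn_integral_add[OF nn_integral_nu_involution_nu(1)[OF \<alpha> z m1]]) simp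
    also have "(\<integral>\<^sup>+u. ennreal (norm c) \<partial>?M) = ennreal (norm c)"
      using emeasure_nu_space[OF \<alpha>, where 'n='n] by simp
    also have "(\<integral>\<^sup>+u. ennreal (norm (b (ball_involution z u) - c)) \<partial>?M) + ennreal (norm c)
        \<le> BMO1_norm \<alpha> b + ennreal M2"
    proof (rule add_mono)
      show "(\<integral>\<^sup>+u. ennreal (norm (b (ball_involution z u) - c)) \<partial>?M) \<le> BMO1_norm \<alpha> b"
        unfolding BMO1_norm_def Lp_norm_1 c_def using z by (intro SUP_upper) simp
    qed (use bz in \<open>simp add: c_def\<close>)
    also have "\<dots> = ennreal (M1 + M2)" using M1 M2 by simp
    finally show ?thesis .
  qed
  have "AE z in ?M. (\<integral>\<^sup>+u. ennreal (norm (b u)) * ennreal (kernel_sq \<alpha> z u) \<partial>?M) \<le> ennreal (M1 + M2)"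
    using ae AE_space by eventually_elim (use * in simp)
  then have "carleson_weight \<alpha> (\<lambda>u. norm (b u)) (M1 + M2)"
    using nm M1 M2 by (auto simp: carleson_weight_def)
  then show ?thesis by blast
qed

lemma kernel_sq_bound:
  fixes z u :: "complex^'n::finite"
  assumes "\<alpha> > -1" "norm z < 1" "norm u < 1"
  shows "kernel_sq \<alpha> z u \<le> ((1 - (norm z)\<^sup>2) / (1 - norm z)\<^sup>2) powr kernel_exp TYPE('n) \<alpha>"
proof -
  have "1 - norm z \<le> cmod (1 - hprod u z)"
    using one_minus_norm_le_cmod[OF assms(2,3)] by (simp add: cmod_one_minus_hprod_swap)
  then have "(1 - norm z)\<^sup>2 \<le> (cmod (1 - hprod u z))\<^sup>2" using assms by (intro power_mono) auto
  then show ?thesis unfolding kernel_sq_def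
    using assms one_minus_norm_sq_pos[OF assms(2)] kernel_exp_pos[OF assms(1), where 'n='n]
    by (intro powr_mono2 divide_left_mono) (auto intro!: mult_pos_pos)
qed

text \<open>\<open>berezin\<close> is a Bochner integral given by a definite description, so
  integrability comes first: for fixed z the kernel is bounded on the ball, and integrability of
  \<tau> is enough. The value is then real and nonnegative, and its modulus is the integral in the
  Carleson condition.\<close>

lemma carleson_weight_Linf:
  fixes \<tau> :: "complex^'n::finite \<Rightarrow> real"
  assumes \<alpha>: "\<alpha> > -1" and m: "\<tau> \<in> borel_measurable (nu \<alpha>)" and nn: "\<And>u. \<tau> u \<ge> 0"
    and int: "(\<integral>\<^sup>+u. ennreal (\<tau> u) \<partial>nu \<alpha>) < \<infinity>"
    and B: "B \<ge> 0" "Linf_norm \<alpha> (berezin \<alpha> (\<lambda>w. complex_of_real (\<tau> w))) \<le> ennreal B"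
  shows "carleson_weight \<alpha> \<tau> B"
proof -
  let ?M = "nu \<alpha> :: (complex^'n) measure"
  have i: "integrable ?M \<tau>" using m nn int by (intro integrableI_bounded) auto
  have eq: "(\<integral>\<^sup>+u. ennreal (\<tau> u) * ennreal (kernel_sq \<alpha> z u) \<partial>?M) = ennreal (cmod (berezin \<alpha> (\<lambda>w. complex_of_real (\<tau> w)) z))"
    if z: "norm z < 1" for z
  proof -
    have [measurable]: "(\<lambda>u. kernel_sq \<alpha> z u) \<in> borel_measurable ?M"
      by (rule measurable_nu_borel) measurable
    define k where "k = ((1 - (norm z)\<^sup>2) / (1 - norm z)\<^sup>2) powr kernel_exp TYPE('n) \<alpha>"
    have ik: "integrable ?M (\<lambda>u. kernel_sq \<alpha> z u * \<tau> u)"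
    proof (rule Bochner_Integration.integrable_bound[of _ "\<lambda>u. k * \<tau> u"])
      show "AE u in ?M. norm (kernel_sq \<alpha> z u * \<tau> u) \<le> norm (k * \<tau> u)"
        using nn kernel_sq_bound[OF \<alpha> z] by (intro AE_I2) (auto simp: k_def abs_mult intro!: mult_right_mono)
    qed (use i m in auto)
    then have ic: "integrable ?M (\<lambda>u. complex_of_real (kernel_sq \<alpha> z u * \<tau> u))"
      by (rule integrable_of_real)
    have e: "(cmod (normalized_kernel \<alpha> z w))\<^sup>2 *\<^sub>R complex_of_real (\<tau> w) = complex_of_real (kernel_sq \<alpha> z w * \<tau> w)"
      if "w \<in> space ?M" for w
      using that z by (simp add: kernel_sq_eq(2) scaleR_conv_of_real)
    have "integrable ?M (\<lambda>w. (cmod (normalized_kernel \<alpha> z w))\<^sup>2 *\<^sub>R complex_of_real (\<tau> w))"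
      using ic by (rule Bochner_Integration.integrable_cong[THEN iffD2, rotated -1]) (use e in auto)
    then have "berezin \<alpha> (\<lambda>w. complex_of_real (\<tau> w)) z = (LINT w|?M. (cmod (normalized_kernel \<alpha> z w))\<^sup>2 *\<^sub>R complex_of_real (\<tau> w))"
      unfolding berezin_def by (rule bochner_int_eq_integral[OF complete_nu[OF \<alpha>]])
    also have "\<dots> = (LINT w|?M. complex_of_real (kernel_sq \<alpha> z w * \<tau> w))"
      by (rule Bochner_Integration.integral_cong) (use e in auto)
    also have "\<dots> = complex_of_real (LINT w|?M. kernel_sq \<alpha> z w * \<tau> w)" by (rule integral_complex_of_real)
    finally have "cmod (berezin \<alpha> (\<lambda>w. complex_of_real (\<tau> w)) z) = (LINT w|?M. kernel_sq \<alpha> z w * \<tau> w)"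
      using nn by (simp add: integral_nonneg_AE)
    moreover have "(\<integral>\<^sup>+u. ennreal (kernel_sq \<alpha> z u * \<tau> u) \<partial>?M) = ennreal (LINT w|?M. kernel_sq \<alpha> z w * \<tau> w)"
      using ik nn by (intro nn_integral_eq_integral) auto
    ultimately show ?thesis using nn by (simp add: ennreal_mult mult.commute)
  qed
  have "AE z in ?M. ennreal (norm (berezin \<alpha> (\<lambda>w. complex_of_real (\<tau> w)) z)) \<le> Linf_norm \<alpha> (berezin \<alpha> (\<lambda>w. complex_of_real (\<tau> w)))"
    unfolding Linf_norm_def by (rule esssup_AE)
  then have "AE z in ?M. (\<integral>\<^sup>+u. ennreal (\<tau> u) * ennreal (kernel_sq \<alpha> z u) \<partial>?M) \<le> ennreal B"
    using AE_space by eventually_elim (use B(2) in \<open>auto simp: eq\<close>)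
  then show ?thesis using m nn B(1) by (simp add: carleson_weight_def)
qed

lemma carleson_weight_add:
  assumes "carleson_weight \<alpha> \<beta> B" "carleson_weight \<alpha> \<gamma> C"
  shows "carleson_weight \<alpha> (\<lambda>u. \<beta> u + \<gamma> u) (B + C)"
proof -
  have [measurable]: "\<beta> \<in> borel_measurable (nu \<alpha>)" "\<gamma> \<in> borel_measurable (nu \<alpha>)"
    using assms by (auto simp: carleson_weight_def)
  have [measurable]: "(\<lambda>u. kernel_sq \<alpha> z u) \<in> borel_measurable (nu \<alpha>)" for z
    by (rule measurable_nu_borel) measurable
  have nn: "\<beta> u \<ge> 0" "\<gamma> u \<ge> 0" "B \<ge> 0" "C \<ge> 0" for u using assms by (auto simp: carleson_weight_def)
  have "(\<integral>\<^sup>+u. ennreal (\<beta> u + \<gamma> u) * ennreal (kernel_sq \<alpha> z u) \<partial>nu \<alpha>)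
     = (\<integral>\<^sup>+u. ennreal (\<beta> u) * ennreal (kernel_sq \<alpha> z u) \<partial>nu \<alpha>) + (\<integral>\<^sup>+u. ennreal (\<gamma> u) * ennreal (kernel_sq \<alpha> z u) \<partial>nu \<alpha>)" for z
    using nn by (subst nn_integral_add[symmetric]) (auto simp: distrib_right)
  moreover have "AE z in nu \<alpha>. (\<integral>\<^sup>+u. ennreal (\<beta> u) * ennreal (kernel_sq \<alpha> z u) \<partial>nu \<alpha>)
     + (\<integral>\<^sup>+u. ennreal (\<gamma> u) * ennreal (kernel_sq \<alpha> z u) \<partial>nu \<alpha>) \<le> ennreal (B + C)"
    using assms nn unfolding carleson_weight_def
    by (auto elim!: eventually_elim2 intro: add_mono)
  ultimately show ?thesis using nn by (simp add: carleson_weight_def)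
qed

lemma carleson_weight_mono:
  fixes \<beta> :: "complex^'n::finite \<Rightarrow> real"
  assumes b: "carleson_weight \<alpha> \<beta> B" and m: "\<gamma> \<in> borel_measurable (nu \<alpha>)" "\<And>u. 0 \<le> \<gamma> u"
    and le: "\<And>u. norm u < 1 \<Longrightarrow> \<gamma> u \<le> \<beta> u"
  shows "carleson_weight \<alpha> \<gamma> B"
proof -
  have "(\<integral>\<^sup>+u. ennreal (\<gamma> u) * ennreal (kernel_sq \<alpha> z u) \<partial>nu \<alpha>) \<le> (\<integral>\<^sup>+u. ennreal (\<beta> u) * ennreal (kernel_sq \<alpha> z u) \<partial>nu \<alpha>)" for z :: "complex^'n"
    using le by (intro nn_integral_mono mult_right_mono ennreal_leI) auto
  then show ?thesis using b m unfolding carleson_weight_def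
    by (auto elim!: eventually_mono intro: order_trans)
qed

section \<open>Toeplitz operators as Bergman projections of majorised functions\<close>

definition bergman_proj :: "real \<Rightarrow> (complex^'n::finite \<Rightarrow> ell2) \<Rightarrow> complex^'n \<Rightarrow> ell2"
  where "bergman_proj \<alpha> G z = (LINT w|nu \<alpha>. cnj (bergman_kernel \<alpha> z w) *\<^sub>C G w)"

lemma bergman_kernel_bound:
  fixes z w :: "complex^'n::finite"
  assumes "\<alpha> > -1" "norm z < 1" "norm w < 1"
  shows "cmod (bergman_kernel \<alpha> z w) \<le> (1 - norm z) powr (- kernel_exp TYPE('n) \<alpha>)"
  unfolding cmod_bergman_kernel cmod_one_minus_hprod_swap[of w]
  using one_minus_norm_le_cmod[OF assms(2,3)] kernel_exp_pos[OF assms(1), where 'n='n] assms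
  by (intro powr_mono2') auto

lemma integrable_kernel_mult:
  fixes G :: "complex^'n::finite \<Rightarrow> ell2"
  assumes \<alpha>: "\<alpha> > -1" and z: "norm z < 1" and G: "integrable (nu \<alpha>) G"
  shows "integrable (nu \<alpha>) (\<lambda>w. cnj (bergman_kernel \<alpha> z w) *\<^sub>C G w)"
proof (rule Bochner_Integration.integrable_bound[of _ "\<lambda>w. (1 - norm z) powr (- kernel_exp TYPE('n) \<alpha>) * norm (G w)"])
  show "(\<lambda>w. cnj (bergman_kernel \<alpha> z w) *\<^sub>C G w) \<in> borel_measurable (nu \<alpha>)"
    using scalar_holo_measurable[OF scalar_holo_bergman_kernel[OF z]] G by measurable
  show "AE w in nu \<alpha>. norm (cnj (bergman_kernel \<alpha> z w) *\<^sub>C G w) \<le> norm ((1 - norm z) powr (- kernel_exp TYPE('n) \<alpha>) * norm (G w))"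
    using bergman_kernel_bound[OF \<alpha> z] by (intro AE_I2) (auto simp: norm_scaleC mult_right_mono)
qed (use G in auto)

text \<open>Stated for any G with |G| <= \<beta> |f| so that it serves three functions: the symbol
  applied to f, the remainder of a compression with its small weight, and the single matrix entries.
  Holomorphy comes from \<open>kernel_integral_holomorphic\<close>, the norm from the
  majorant.\<close>

lemma bergman_proj_bound:
  assumes \<alpha>: "\<alpha> > -1"
  shows "\<exists>C\<ge>0. \<forall>(\<beta> :: complex^'n::finite \<Rightarrow> real) B f G. carleson_weight \<alpha> \<beta> B \<and> f \<in> Ap_space \<alpha> 2 \<and> G \<in> borel_measurable (nu \<alpha>)
      \<and> (\<forall>w\<in>ball 0 1. norm (G w) \<le> \<beta> w * norm (f w :: ell2)) \<longrightarrow>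
      integrable (nu \<alpha>) G \<and> bergman_proj \<alpha> G \<in> Ap_space \<alpha> 2 \<and> L2_sq \<alpha> (bergman_proj \<alpha> G) \<le> ennreal ((C * B)\<^sup>2) * L2_sq \<alpha> f"
proof -
  let ?M = "nu \<alpha> :: (complex^'n) measure"
  obtain C where C: "C \<ge> 0" "\<And>(\<beta> :: complex^'n \<Rightarrow> real) B f. carleson_weight \<alpha> \<beta> B \<Longrightarrow> f \<in> (Ap_space \<alpha> 2 :: (_ \<Rightarrow> ell2) set) \<Longrightarrow>
    (\<integral>\<^sup>+w. (\<integral>\<^sup>+u. ennreal (\<beta> u) * (ennreal (cmod (bergman_kernel \<alpha> w u)) * ennreal (norm (f u))) \<partial>nu \<alpha>)\<^sup>2 \<partial>nu \<alpha>)
      \<le> ennreal ((C * B)\<^sup>2) * L2_sq \<alpha> f"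
    using carleson_majorant[OF \<alpha>, where 'n='n] by blast
  obtain C1 where C1: "C1 \<ge> 0" "\<And>(\<beta> :: complex^'n \<Rightarrow> real) B F. carleson_weight \<alpha> \<beta> B \<Longrightarrow> scalar_holo F \<Longrightarrow>
    (\<integral>\<^sup>+u. ennreal (\<beta> u) * ennreal (cmod (F u)) \<partial>nu \<alpha>) \<le> ennreal (C1 * B) * (\<integral>\<^sup>+z. ennreal (cmod (F z)) \<partial>nu \<alpha>)"
    using carleson_scalar[OF \<alpha>, where 'n='n] by blast
  obtain C2 where C2: "C2 \<ge> 0" "\<And>(\<beta> :: complex^'n \<Rightarrow> real) B f. carleson_weight \<alpha> \<beta> B \<Longrightarrow> f \<in> (Ap_space \<alpha> 2 :: (_ \<Rightarrow> ell2) set) \<Longrightarrow>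
    (\<integral>\<^sup>+u. ennreal (\<beta> u) * (ennreal (norm (f u)))\<^sup>2 \<partial>nu \<alpha>) \<le> ennreal (C2 * B) * L2_sq \<alpha> f"
    using carleson_vector[OF \<alpha>, where 'n='n] by blast
  show ?thesis
  proof (intro exI[of _ C] conjI[of "C \<ge> 0"] allI impI)
    fix \<beta> :: "complex^'n \<Rightarrow> real" and B and f G :: "complex^'n \<Rightarrow> ell2"
    assume as: "carleson_weight \<alpha> \<beta> B \<and> f \<in> Ap_space \<alpha> 2 \<and> G \<in> borel_measurable (nu \<alpha>)
      \<and> (\<forall>w\<in>ball 0 1. norm (G w) \<le> \<beta> w * norm (f w))"
    then have [measurable]: "G \<in> borel_measurable ?M" "\<beta> \<in> borel_measurable ?M" and \<beta>: "\<And>u. \<beta> u \<ge> 0"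
      and cw: "carleson_weight \<alpha> \<beta> B" and fA: "f \<in> Ap_space \<alpha> 2"
      and G: "\<And>w. norm w < 1 \<Longrightarrow> norm (G w) \<le> \<beta> w * norm (f w)"
      by (auto simp: carleson_weight_def)
    have hol: "holomorphic_ball f" and L2: "L2_sq \<alpha> f < \<infinity>" using fA Ap_space_2_iff[OF \<alpha>] by auto
    have [measurable]: "f \<in> borel_measurable ?M"
      by (rule continuous_on_ball_measurable[OF holomorphic_ball_continuous[OF hol]])
    have "(\<integral>\<^sup>+w. ennreal (norm (G w)) \<partial>?M) \<le> (\<integral>\<^sup>+w. ennreal (\<beta> w) * ennreal (cmod 1) + ennreal (\<beta> w) * (ennreal (norm (f w)))\<^sup>2 \<partial>?M)"
    proof (intro nn_integral_mono)
      fix w assume "w \<in> space ?M"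
      then have "norm (G w) \<le> \<beta> w * norm (f w)" using G by simp
      \<comment> \<open>The Carleson property controls the integrals of \<beta>, through the
        constant function 1, and of \<beta> |f|^2; together they dominate \<beta> |f|.\<close>
      also have "\<dots> \<le> \<beta> w * (1 + (norm (f w))\<^sup>2)"
      proof (intro mult_left_mono \<beta>)
        have "2 * norm (f w) \<le> 1 + (norm (f w))\<^sup>2" using sum_squares_bound[of 1 "norm (f w)"] by simp
        then show "norm (f w) \<le> 1 + (norm (f w))\<^sup>2" using norm_ge_zero[of "f w"] by linarith
      qed
      finally have "ennreal (norm (G w)) \<le> ennreal (\<beta> w * (1 + (norm (f w))\<^sup>2))" by (rule ennreal_leI)
      then show "ennreal (norm (G w)) \<le> ennreal (\<beta> w) * ennreal (cmod 1) + ennreal (\<beta> w) * (ennreal (norm (f w)))\<^sup>2"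
        using \<beta> by (simp add: distrib_left ennreal_mult ennreal_power)
    qed
    also have "\<dots> = (\<integral>\<^sup>+w. ennreal (\<beta> w) * ennreal (cmod 1) \<partial>?M) + (\<integral>\<^sup>+w. ennreal (\<beta> w) * (ennreal (norm (f w)))\<^sup>2 \<partial>?M)"
      by (rule nn_integral_add) measurable
    also have "\<dots> \<le> ennreal (C1 * B) * (\<integral>\<^sup>+z. ennreal (cmod 1) \<partial>?M) + ennreal (C2 * B) * L2_sq \<alpha> f"
      by (intro add_mono C1(2)[OF cw] C2(2)[OF cw fA]) auto
    also have "\<dots> < \<infinity>"
      using L2 emeasure_nu_space[OF \<alpha>, where 'n='n] by (simp add: ennreal_mult_less_top)
    finally have iG: "integrable ?M G" by (intro integrableI_bounded) auto
    have holP: "holomorphic_ball (bergman_proj \<alpha> G)"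
      by (rule kernel_integral_holomorphic[OF \<alpha> iG]) (simp add: bergman_proj_def)
    have "L2_sq \<alpha> (bergman_proj \<alpha> G) \<le> (\<integral>\<^sup>+w. (\<integral>\<^sup>+u. ennreal (\<beta> u) * (ennreal (cmod (bergman_kernel \<alpha> w u)) * ennreal (norm (f u))) \<partial>nu \<alpha>)\<^sup>2 \<partial>?M)"
      unfolding L2_sq_def
    proof (intro nn_integral_mono power_mono)
      fix w assume "w \<in> space ?M"
      then have w: "norm w < 1" by simp
      have "ennreal (norm (bergman_proj \<alpha> G w)) \<le> (\<integral>\<^sup>+u. norm (cnj (bergman_kernel \<alpha> w u) *\<^sub>C G u) \<partial>?M)"
        unfolding bergman_proj_def by (rule integral_norm_bound_ennreal[OF integrable_kernel_mult[OF \<alpha> w iG]])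
      also have "\<dots> \<le> (\<integral>\<^sup>+u. ennreal (\<beta> u) * (ennreal (cmod (bergman_kernel \<alpha> w u)) * ennreal (norm (f u))) \<partial>nu \<alpha>)"
      proof (intro nn_integral_mono)
        fix u assume "u \<in> space ?M"
        then have "cmod (bergman_kernel \<alpha> w u) * norm (G u) \<le> cmod (bergman_kernel \<alpha> w u) * (\<beta> u * norm (f u))"
          using G by (intro mult_left_mono) auto
        then show "ennreal (norm (cnj (bergman_kernel \<alpha> w u) *\<^sub>C G u)) \<le> ennreal (\<beta> u) * (ennreal (cmod (bergman_kernel \<alpha> w u)) * ennreal (norm (f u)))"
          using \<beta> by (simp add: norm_scaleC ennreal_mult[symmetric] ennreal_leI mult_ac)
      qed
      finally show "ennreal (norm (bergman_proj \<alpha> G w)) \<le> (\<integral>\<^sup>+u. ennreal (\<beta> u) * (ennreal (cmod (bergman_kernel \<alpha> w u)) * ennreal (norm (f u))) \<partial>nu \<alpha>)" .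
    qed simp
    also have "\<dots> \<le> ennreal ((C * B)\<^sup>2) * L2_sq \<alpha> f" by (rule C(2)[OF cw fA])
    finally have bound: "L2_sq \<alpha> (bergman_proj \<alpha> G) \<le> ennreal ((C * B)\<^sup>2) * L2_sq \<alpha> f" .
    also have "\<dots> < \<infinity>" using L2 by (simp add: ennreal_mult_less_top)
    finally have "bergman_proj \<alpha> G \<in> Ap_space \<alpha> 2" using holP Ap_space_2_iff[OF \<alpha>] by blast
    then show "integrable (nu \<alpha>) G \<and> bergman_proj \<alpha> G \<in> Ap_space \<alpha> 2 \<and> L2_sq \<alpha> (bergman_proj \<alpha> G) \<le> ennreal ((C * B)\<^sup>2) * L2_sq \<alpha> f"
      using iG bound by blast
  qed (use C in auto)
qed

lemma toeplitz_eq_bergman_proj: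
  assumes \<alpha>: "\<alpha> > -1" and z: "norm z < 1" and G: "integrable (nu \<alpha>) (\<lambda>w. blinfun_apply (b w) (f w))"
  shows "toeplitz \<alpha> b f z = bergman_proj \<alpha> (\<lambda>w. blinfun_apply (b w) (f w) :: ell2) z"
  unfolding toeplitz_def bergman_proj_def
  by (rule bochner_int_eq_integral[OF complete_nu[OF \<alpha>] integrable_kernel_mult[OF \<alpha> z G]])

lemma bounded_linear_scaleC_right: "bounded_linear (\<lambda>x :: 'a::complex_normed_space. c *\<^sub>C x)"
  by (rule bounded_bilinear.bounded_linear_right[OF bounded_bilinear_scaleC])

lemma holomorphic_ball_cong:
  assumes "holomorphic_ball f" "\<And>z. norm z < 1 \<Longrightarrow> g z = f z" shows "holomorphic_ball g"
  unfolding holomorphic_ball_def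
proof
  fix z :: "complex^'a" assume z: "z \<in> ball 0 1"
  then obtain D where D: "(f has_derivative D) (at z)" "\<forall>c v. D (c *s v) = c *\<^sub>C D v"
    using assms(1) unfolding holomorphic_ball_def by blast
  have "(g has_derivative D) (at z)"
    by (rule has_derivative_transform_within_open[OF D(1) open_ball z]) (use assms(2) in auto)
  then show "\<exists>D. (g has_derivative D) (at z) \<and> (\<forall>c v. D (c *s v) = c *\<^sub>C D v)" using D(2) by blast
qed

lemma L2_sq_cong:
  fixes f :: "complex^'n::finite \<Rightarrow> 'e::real_normed_vector"
  shows "(\<And>z. norm z < 1 \<Longrightarrow> norm (f z) = norm (g z)) \<Longrightarrow> L2_sq \<alpha> f = L2_sq \<alpha> g"
  unfolding L2_sq_def by (intro nn_integral_cong) simp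

text \<open>The integral defining \<open>toeplitz\<close> converges for every f in the Bergman
  space, because b f is integrable and the kernel is bounded for fixed z. The same formula therefore
  gives the bounded operator on the whole space, and its agreement on bounded holomorphic functions
  is immediate.\<close>

lemma toeplitz_extension_self:
  fixes b :: "complex^'n::finite \<Rightarrow> ell2 \<Rightarrow>\<^sub>L ell2"
  assumes \<alpha>: "\<alpha> > -1" and sm: "strongly_measurable (nu \<alpha>) b"
    and lin: "\<forall>w\<in>ball 0 1. b w \<in> bounded_clinear_ops"
    and cw: "carleson_weight \<alpha> (\<lambda>u. norm (b u)) B"
  shows "toeplitz_extension \<alpha> b (toeplitz \<alpha> b)"
    and "\<And>f. f \<in> Ap_space \<alpha> 2 \<Longrightarrow> integrable (nu \<alpha>) (\<lambda>w. blinfun_apply (b w) (f w))"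
proof -
  let ?M = "nu \<alpha> :: (complex^'n) measure"
  let ?G = "\<lambda>f w. blinfun_apply (b w) (f w)"
  obtain C where C: "C \<ge> 0" "\<And>(\<beta> :: complex^'n \<Rightarrow> real) B f G. carleson_weight \<alpha> \<beta> B \<and> f \<in> Ap_space \<alpha> 2 \<and> G \<in> borel_measurable (nu \<alpha>)
      \<and> (\<forall>w\<in>ball 0 1. norm (G w) \<le> \<beta> w * norm (f w :: ell2)) \<Longrightarrow>
      integrable (nu \<alpha>) G \<and> bergman_proj \<alpha> G \<in> Ap_space \<alpha> 2 \<and> L2_sq \<alpha> (bergman_proj \<alpha> G) \<le> ennreal ((C * B)\<^sup>2) * L2_sq \<alpha> f"
    using bergman_proj_bound[OF \<alpha>, where 'n='n] by blast
  have P: "integrable ?M (?G f)" "bergman_proj \<alpha> (?G f) \<in> Ap_space \<alpha> 2"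
      "L2_sq \<alpha> (bergman_proj \<alpha> (?G f)) \<le> ennreal ((C * B)\<^sup>2) * L2_sq \<alpha> f"
      "\<And>z. norm z < 1 \<Longrightarrow> toeplitz \<alpha> b f z = bergman_proj \<alpha> (?G f) z"
    if f: "f \<in> Ap_space \<alpha> 2" for f
  proof -
    have "f \<in> borel_measurable ?M"
      using f Ap_space_2_iff[OF \<alpha>] by (auto intro: continuous_on_ball_measurable holomorphic_ball_continuous)
    then have "?G f \<in> borel_measurable ?M"
      by (rule strongly_measurable_blinfun_apply[OF complete_nu[OF \<alpha>] sm])
    then have *: "integrable ?M (?G f) \<and> bergman_proj \<alpha> (?G f) \<in> Ap_space \<alpha> 2 \<and>
      L2_sq \<alpha> (bergman_proj \<alpha> (?G f)) \<le> ennreal ((C * B)\<^sup>2) * L2_sq \<alpha> f"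
      using cw f by (intro C(2)) (auto intro: norm_blinfun)
    then show "integrable ?M (?G f)" "bergman_proj \<alpha> (?G f) \<in> Ap_space \<alpha> 2"
      "L2_sq \<alpha> (bergman_proj \<alpha> (?G f)) \<le> ennreal ((C * B)\<^sup>2) * L2_sq \<alpha> f" by auto
    then show "toeplitz \<alpha> b f z = bergman_proj \<alpha> (?G f) z" if "norm z < 1" for z
      by (intro toeplitz_eq_bergman_proj[OF \<alpha> that])
  qed
  show "\<And>f. f \<in> Ap_space \<alpha> 2 \<Longrightarrow> integrable (nu \<alpha>) (?G f)" by (rule P(1))
  have L2T: "L2_sq \<alpha> (toeplitz \<alpha> b f) = L2_sq \<alpha> (bergman_proj \<alpha> (?G f))" if "f \<in> Ap_space \<alpha> 2" for f
    using P(4)[OF that] by (intro L2_sq_cong) simp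
  have B: "B \<ge> 0" using cw by (simp add: carleson_weight_def)
  have "bounded_operator_A2 \<alpha> (toeplitz \<alpha> b)" unfolding bounded_operator_A2_def
  proof (intro conjI ballI allI)
    fix f :: "complex^'n \<Rightarrow> ell2" assume f: "f \<in> Ap_space \<alpha> 2"
    show "toeplitz \<alpha> b f \<in> Ap_space \<alpha> 2"
      using P(2)[OF f] holomorphic_ball_cong[OF _ P(4)[OF f]] L2T[OF f] by (auto simp: Ap_space_2_iff[OF \<alpha>])
    fix z :: "complex^'n" assume "z \<in> ball 0 1"
    then have z: "norm z < 1" by simp
    show "toeplitz \<alpha> b (\<lambda>w. f w + g w) z = toeplitz \<alpha> b f z + toeplitz \<alpha> b g z" if g: "g \<in> Ap_space \<alpha> 2" for g
    proof -
      have "integrable ?M (\<lambda>w. blinfun_apply (b w) (f w + g w))"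
        using Bochner_Integration.integrable_add[OF P(1)[OF f] P(1)[OF g]] by (simp add: blinfun.add_right)
      then have "toeplitz \<alpha> b (\<lambda>w. f w + g w) z = bergman_proj \<alpha> (\<lambda>w. blinfun_apply (b w) (f w + g w)) z"
        by (rule toeplitz_eq_bergman_proj[OF \<alpha> z])
      also have "\<dots> = bergman_proj \<alpha> (?G f) z + bergman_proj \<alpha> (?G g) z"
        unfolding bergman_proj_def
        by (simp add: blinfun.add_right scaleC_add_right integrable_kernel_mult[OF \<alpha> z P(1)[OF f]] integrable_kernel_mult[OF \<alpha> z P(1)[OF g]])
      finally show ?thesis by (simp add: P(4)[OF f z] P(4)[OF g z])
    qed
    show "toeplitz \<alpha> b (\<lambda>w. c *\<^sub>C f w) z = c *\<^sub>C toeplitz \<alpha> b f z" for c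
    proof -
      have e: "blinfun_apply (b w) (c *\<^sub>C f w) = c *\<^sub>C ?G f w" if "w \<in> space ?M" for w
        using lin that by (simp add: bounded_clinear_ops_def)
      have "integrable ?M (\<lambda>w. c *\<^sub>C ?G f w)"
        by (rule integrable_bounded_linear[OF bounded_linear_scaleC_right P(1)[OF f]])
      then have "integrable ?M (\<lambda>w. blinfun_apply (b w) (c *\<^sub>C f w))"
        by (rule Bochner_Integration.integrable_cong[THEN iffD2, rotated -1]) (use e in auto)
      then have "toeplitz \<alpha> b (\<lambda>w. c *\<^sub>C f w) z = bergman_proj \<alpha> (\<lambda>w. blinfun_apply (b w) (c *\<^sub>C f w)) z"
        by (rule toeplitz_eq_bergman_proj[OF \<alpha> z])
      also have "\<dots> = (LINT w|?M. c *\<^sub>C (cnj (bergman_kernel \<alpha> z w) *\<^sub>C ?G f w))"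
        unfolding bergman_proj_def using e
        by (intro Bochner_Integration.integral_cong) (auto simp: scaleC_scaleC mult.commute)
      also have "\<dots> = c *\<^sub>C bergman_proj \<alpha> (?G f) z"
        unfolding bergman_proj_def
        by (rule integral_bounded_linear[OF bounded_linear_scaleC_right integrable_kernel_mult[OF \<alpha> z P(1)[OF f]]])
      finally show ?thesis by (simp add: P(4)[OF f z])
    qed
  next
    show "\<exists>K::real. \<forall>f\<in>Ap_space \<alpha> 2. Lp_norm \<alpha> 2 (toeplitz \<alpha> b f) \<le> ennreal K * Lp_norm \<alpha> 2 f"
    proof (intro exI[of _ "C * B"] ballI)
      fix f :: "complex^'n \<Rightarrow> ell2" assume f: "f \<in> Ap_space \<alpha> 2"
      then have "L2_sq \<alpha> f < \<infinity>" using Ap_space_2_iff[OF \<alpha>] by blast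
      then obtain r where r: "r \<ge> 0" "L2_sq \<alpha> f = ennreal r" by (cases "L2_sq \<alpha> f") auto
      have "L2_sq \<alpha> (toeplitz \<alpha> b f) \<le> ennreal ((C * B)\<^sup>2) * ennreal r"
        using P(3)[OF f] L2T[OF f] r by simp
      also have "\<dots> = ennreal ((C * B * sqrt r)\<^sup>2)" using r by (simp add: ennreal_mult[symmetric] power_mult_distrib)
      finally have "Lp_norm \<alpha> 2 (toeplitz \<alpha> b f) \<le> ennreal (C * B * sqrt r)"
        using C(1) B r by (subst Lp_norm_2_le) auto
      then show "Lp_norm \<alpha> 2 (toeplitz \<alpha> b f) \<le> ennreal (C * B) * Lp_norm \<alpha> 2 f"
        using C(1) B r by (simp add: Lp_norm_2 ennreal_mult)
    qed
  qed
  then show "toeplitz_extension \<alpha> b (toeplitz \<alpha> b)" by (simp add: toeplitz_extension_def)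
qed

lemma cinner_diff_left: "cinner (x - y) z = cinner x z - cinner y z"
  by (metis add_diff_cancel_right' cinner_add_left diff_add_cancel)

lemma cinner_diff_right: "cinner z (x - y) = cinner z x - cinner z y"
  by (metis add_diff_cancel_right' cinner_add_right diff_add_cancel)

lemma cinner_sum_left: "cinner (\<Sum>i\<in>I. f i) y = (\<Sum>i\<in>I. cinner (f i) y)"
  by (rule linear_sum[OF bounded_linear.linear[OF bounded_linear_cinner_left]])

lemma cinner_sum_right: "cinner y (\<Sum>i\<in>I. f i) = (\<Sum>i\<in>I. cinner y (f i))"
  by (rule linear_sum[OF bounded_linear.linear[OF bounded_bilinear.bounded_linear_right[OF bounded_bilinear_cinner]]])

lemma norm_sq_cinner: "(norm x)\<^sup>2 = cmod (cinner x x)"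
  by (simp only: cinner_self_norm norm_of_real) simp

lemma selfadjoint_idempotent_norm:
  assumes "\<And>x y. cinner (S x) y = cinner x (S y)" "\<And>x. S (S x) = S x"
  shows "norm (S x) \<le> norm x"
proof -
  have "(norm (S x))\<^sup>2 = cmod (cinner x (S x))" unfolding norm_sq_cinner by (simp add: assms)
  also have "\<dots> \<le> norm x * norm (S x)" by (rule cinner_norm_le)
  finally have "norm (S x) * norm (S x) \<le> norm x * norm (S x)" by (simp add: power2_eq_square)
  then show ?thesis by (cases "norm (S x) = 0") (auto simp: mult_le_cancel_right)
qed

section \<open>Compressions of operators on the sequence space\<close>

text \<open>The orthogonal projection that annihilates the first d basis vectors. Composition with
  it on the right turns b into b_(d); on the left it gives the adjoint of the truncation of
  b^star.\<close>

definition tail_proj :: "(nat \<Rightarrow> ell2) \<Rightarrow> nat \<Rightarrow> ell2 \<Rightarrow>\<^sub>L ell2"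
  where "tail_proj e d = Blinfun (\<lambda>x. x - (\<Sum>i<d. cinner x (e i) *\<^sub>C e i))"

lemma tail_proj_clinear:
  shows "tail_proj e d \<in> bounded_clinear_ops"
    and tail_proj_apply: "blinfun_apply (tail_proj e d) x = x - (\<Sum>i<d. cinner x (e i) *\<^sub>C e i)"
proof -
  have lin: "bounded_linear (\<lambda>x. x - (\<Sum>i<d. cinner x (e i) *\<^sub>C e i))"
    by (intro bounded_linear_sub bounded_linear_sum bounded_linear_ident
        bounded_linear_compose[OF bounded_linear_scaleC_left bounded_linear_cinner_left])
  have "c *\<^sub>C x - (\<Sum>i<d. cinner (c *\<^sub>C x) (e i) *\<^sub>C e i) = c *\<^sub>C (x - (\<Sum>i<d. cinner x (e i) *\<^sub>C e i))" for c x
    by (simp add: cinner_scaleC_left scaleC_scaleC scaleC_sum_right scaleC_diff_right)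
  from bounded_clinear_opsI[OF lin this]
  show "tail_proj e d \<in> bounded_clinear_ops" "blinfun_apply (tail_proj e d) x = x - (\<Sum>i<d. cinner x (e i) *\<^sub>C e i)"
    by (auto simp: tail_proj_def)
qed

context
  fixes e :: "nat \<Rightarrow> ell2" assumes e: "orthonormal_basis e"
begin

lemma e_inner: "cinner (e i) (e j) = (if i = j then 1 else 0)"
  using e by (simp add: orthonormal_basis_def)

lemma norm_e: "norm (e i) = 1"
proof -
  have "(norm (e i))\<^sup>2 = 1" unfolding norm_sq_cinner by (simp add: e_inner)
  then show ?thesis by (simp add: power2_eq_1_iff) (metis norm_ge_zero not_one_le_zero neg_0_le_iff_le)
qed

lemma tail_proj_basis: "blinfun_apply (tail_proj e d) (e i) = (if i < d then 0 else e i)"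
proof -
  have "(\<Sum>k<d. cinner (e i) (e k) *\<^sub>C e k) = (\<Sum>k<d. if k = i then e i else 0)"
    by (intro sum.cong) (auto simp: e_inner)
  then show ?thesis by (simp add: tail_proj_apply)
qed

lemma tail_proj_selfadjoint:
  "cinner (blinfun_apply (tail_proj e d) x) y = cinner x (blinfun_apply (tail_proj e d) y)"
proof -
  have "(\<Sum>i<d. cinner x (e i) * cinner (e i) y) = (\<Sum>i<d. cnj (cinner y (e i)) * cinner x (e i))"
    by (intro sum.cong refl) (metis cinner_commute mult.commute)
  then show ?thesis
    by (simp add: tail_proj_apply cinner_diff_left cinner_diff_right cinner_sum_left cinner_sum_right
      cinner_scaleC_left cinner_scaleC_right)
qed

lemma tail_proj_idem: "blinfun_apply (tail_proj e d) (blinfun_apply (tail_proj e d) x) = blinfun_apply (tail_proj e d) x"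
proof -
  have "blinfun_apply (tail_proj e d) (cinner x (e i) *\<^sub>C e i) = 0" if "i < d" for i
    using tail_proj_clinear(1)[of e d] tail_proj_basis[of d i] that by (simp add: bounded_clinear_ops_def)
  then have "blinfun_apply (tail_proj e d) (\<Sum>i<d. cinner x (e i) *\<^sub>C e i) = 0"
    by (simp add: blinfun.sum_right)
  then have "blinfun_apply (tail_proj e d) (x - (\<Sum>i<d. cinner x (e i) *\<^sub>C e i)) = blinfun_apply (tail_proj e d) x"
    by (simp add: blinfun.diff_right)
  then show ?thesis by (simp only: tail_proj_apply[of e d x])
qed

lemma norm_tail_proj: "norm (tail_proj e d) \<le> 1"
  using selfadjoint_idempotent_norm[OF tail_proj_selfadjoint tail_proj_idem]
  by (intro norm_blinfun_bound) auto

lemma tail_op_eq: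
  assumes A: "A \<in> bounded_clinear_ops"
  shows "tail_op e d A = A o\<^sub>L tail_proj e d"
  unfolding tail_op_def
proof (rule the1_equality[OF tail_op_unique[OF e A]], intro conjI allI)
  show "A o\<^sub>L tail_proj e d \<in> bounded_clinear_ops"
    using A tail_proj_clinear(1)[of e d] by (simp add: bounded_clinear_ops_def)
  show "blinfun_apply (A o\<^sub>L tail_proj e d) (e i) = (if i < d then 0 else blinfun_apply A (e i))" for i
    by (simp add: tail_proj_basis blinfun.zero_right)
qed

lemma hilbert_adjoint:
  assumes A: "A \<in> bounded_clinear_ops"
  shows "hilbert_adjoint A \<in> bounded_clinear_ops"
    and "cinner (blinfun_apply A x) y = cinner x (blinfun_apply (hilbert_adjoint A) y)"
proof -
  have "hilbert_adjoint A \<in> bounded_clinear_ops \<and>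
      (\<forall>x y. cinner (blinfun_apply A x) y = cinner x (blinfun_apply (hilbert_adjoint A) y))"
    unfolding hilbert_adjoint_def by (rule theI'[OF hilbert_adjoint_unique[OF A]])
  then show "hilbert_adjoint A \<in> bounded_clinear_ops"
    and "cinner (blinfun_apply A x) y = cinner x (blinfun_apply (hilbert_adjoint A) y)" by blast+
qed

lemma norm_adjoint_le:
  assumes "\<And>x y. cinner (blinfun_apply S x) y = cinner x (blinfun_apply S' y)"
  shows "norm S \<le> norm S'"
proof (rule norm_blinfun_bound)
  fix x
  have "(norm (blinfun_apply S x))\<^sup>2 = cmod (cinner x (blinfun_apply S' (blinfun_apply S x)))"
    unfolding norm_sq_cinner by (simp add: assms)
  also have "\<dots> \<le> norm x * norm (blinfun_apply S' (blinfun_apply S x))" by (rule cinner_norm_le)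
  also have "\<dots> \<le> norm x * (norm S' * norm (blinfun_apply S x))" by (intro mult_left_mono norm_blinfun) simp
  finally have "norm (blinfun_apply S x) * norm (blinfun_apply S x) \<le> (norm S' * norm x) * norm (blinfun_apply S x)"
    by (simp add: power2_eq_square mult_ac)
  then show "norm (blinfun_apply S x) \<le> norm S' * norm x"
    by (cases "norm (blinfun_apply S x) = 0") (auto simp: mult_le_cancel_right)
qed simp

text \<open>The truncation of the adjoint is A^star Q with Q the tail projection, and its adjoint Q
  A has the same norm. Thus (iii) controls the part of b that maps into the tail, as (ii) controls
  the part that starts there.\<close>

lemma norm_tail_op_adjoint:
  assumes A: "A \<in> bounded_clinear_ops"
  shows "norm (tail_op e d (hilbert_adjoint A)) = norm (tail_proj e d o\<^sub>L A)"
proof -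
  have 1: "cinner (blinfun_apply (tail_proj e d o\<^sub>L A) x) y
      = cinner x (blinfun_apply (hilbert_adjoint A o\<^sub>L tail_proj e d) y)" for x y
    by (simp add: tail_proj_selfadjoint hilbert_adjoint(2)[OF A])
  have 2: "cinner (blinfun_apply (hilbert_adjoint A o\<^sub>L tail_proj e d) x) y
      = cinner x (blinfun_apply (tail_proj e d o\<^sub>L A) y)" for x y
    using 1[of y x] by (metis cinner_commute)
  show ?thesis unfolding tail_op_eq[OF hilbert_adjoint(1)[OF A]]
    by (intro antisym norm_adjoint_le 1 2)
qed

definition head_proj :: "nat \<Rightarrow> ell2 \<Rightarrow> ell2"
  where "head_proj d x = (\<Sum>i<d. cinner x (e i) *\<^sub>C e i)"

lemma head_proj_eq: "head_proj d x = x - blinfun_apply (tail_proj e d) x"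
  by (simp add: head_proj_def tail_proj_apply)

lemma norm_head_proj: "norm (head_proj d x) \<le> norm x"
  by (rule selfadjoint_idempotent_norm)
    (simp_all add: head_proj_eq cinner_diff_left cinner_diff_right tail_proj_selfadjoint blinfun.diff_right tail_proj_idem)

text \<open>With P = 1 - Q the head projection, A - P A P = A Q + Q A P. As P has norm at most 1,
  the error sees only the two truncations that (ii) and (iii) control.\<close>

lemma compression_error:
  "norm (blinfun_apply A x - head_proj d (blinfun_apply A (head_proj d x)))
    \<le> (norm (A o\<^sub>L tail_proj e d) + norm (tail_proj e d o\<^sub>L A)) * norm x"
proof -
  have "blinfun_apply A x - head_proj d (blinfun_apply A (head_proj d x))
     = blinfun_apply (A o\<^sub>L tail_proj e d) x + blinfun_apply (tail_proj e d o\<^sub>L A) (head_proj d x)"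
    by (simp add: head_proj_eq blinfun.diff_right)
  also have "norm \<dots> \<le> norm (A o\<^sub>L tail_proj e d) * norm x + norm (tail_proj e d o\<^sub>L A) * norm (head_proj d x)"
    by (intro norm_triangle_le add_mono norm_blinfun)
  also have "\<dots> \<le> norm (A o\<^sub>L tail_proj e d) * norm x + norm (tail_proj e d o\<^sub>L A) * norm x"
    by (intro add_mono mult_left_mono norm_head_proj) auto
  finally show ?thesis by (simp add: distrib_right)
qed

lemma head_proj_compress:
  assumes A: "A \<in> bounded_clinear_ops"
  shows "head_proj d (blinfun_apply A (head_proj d x)) =
    (\<Sum>j<d. \<Sum>l<d. (cinner (blinfun_apply A (e l)) (e j) * cinner x (e l)) *\<^sub>C e j)"
proof -
  have "blinfun_apply A (head_proj d x) = (\<Sum>l<d. cinner x (e l) *\<^sub>C blinfun_apply A (e l))"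
    using A by (simp add: head_proj_def blinfun.sum_right bounded_clinear_ops_def)
  then have "cinner (blinfun_apply A (head_proj d x)) (e j) = (\<Sum>l<d. cinner (blinfun_apply A (e l)) (e j) * cinner x (e l))" for j
    by (simp add: cinner_sum_left cinner_scaleC_left mult.commute)
  moreover have "(\<Sum>l<d. g l) *\<^sub>C y = (\<Sum>l<d. g l *\<^sub>C (y::ell2))" for g y
    by (rule linear_sum[OF bounded_linear.linear[OF bounded_linear_scaleC_left]])
  ultimately show ?thesis by (simp add: head_proj_def[of d "blinfun_apply A _"])
qed

lemma compression_apply:
  assumes "l < d"
  shows "blinfun_apply (compression e d A) (c *\<^sub>C unit_vec l) =
    (\<Sum>j<d. (c * cinner (blinfun_apply A (e l)) (e j)) *\<^sub>C unit_vec j)"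
proof -
  have C: "compression e d A \<in> bounded_clinear_ops"
    and k: "\<And>k j. cinner (blinfun_apply (compression e d A) (unit_vec k)) (unit_vec j) =
      (if k < d \<and> j < d then cinner (blinfun_apply A (e k)) (e j) else 0)"
  proof -
    have "compression e d A \<in> bounded_clinear_ops \<and>
      (\<forall>k j. cinner (blinfun_apply (compression e d A) (unit_vec k)) (unit_vec j) =
        (if k < d \<and> j < d then cinner (blinfun_apply A (e k)) (e j) else 0))"
      unfolding compression_def by (rule theI'[OF compression_unique])
    then show "compression e d A \<in> bounded_clinear_ops"
      "\<And>k j. cinner (blinfun_apply (compression e d A) (unit_vec k)) (unit_vec j) =
        (if k < d \<and> j < d then cinner (blinfun_apply A (e k)) (e j) else 0)" by blast+
  qed
  have "coord (blinfun_apply (compression e d A) (c *\<^sub>C unit_vec l)) i = 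
     coord (\<Sum>j<d. (c * cinner (blinfun_apply A (e l)) (e j)) *\<^sub>C unit_vec j) i" for i
    using C k[of l i] assms
    by (simp add: bounded_clinear_ops_def cinner_unit_vec scaleC_ell2.rep_eq coord_sum coord_unit_vec
       if_distrib[of "\<lambda>u. _ * u"] cong: if_cong)
  then show ?thesis by (intro iffD1[OF coord_inject] ext)
qed

end

section \<open>Integral kernels of the scalar entries\<close>

lemma ennreal_norm_integral_le:
  fixes f :: "'a \<Rightarrow> 'b::{banach, second_countable_topology}"
  shows "ennreal (norm (integral\<^sup>L M f)) \<le> (\<integral>\<^sup>+x. ennreal (norm (f x)) \<partial>M)"
  by (cases "integrable M f") (auto simp: integral_norm_bound_ennreal not_integrable_integral_eq)

text \<open>The value at w of the scalar Toeplitz operator T_a applied to K_z. Inserting the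
  reproducing formula for F in T_a F shows that it is also the integral kernel of T_a.\<close>

definition symbol_kernel :: "real \<Rightarrow> (complex^'n::finite \<Rightarrow> complex) \<Rightarrow> complex^'n \<Rightarrow> complex^'n \<Rightarrow> complex"
  where "symbol_kernel \<alpha> a w z = (LINT u|nu \<alpha>. cnj (bergman_kernel \<alpha> w u) * (bergman_kernel \<alpha> z u * a u))"

lemma scalar_holo_pointwise:
  fixes G :: "complex^'n::finite \<Rightarrow> complex"
  assumes \<alpha>: "\<alpha> > -1" and G: "scalar_holo G" and u: "norm u < 1"
    and L2: "L2_sq \<alpha> G < \<infinity>"
  shows "(ennreal (cmod (G u)))\<^sup>2 \<le> ennreal ((1 - (norm u)\<^sup>2) powr (- kernel_exp TYPE('n) \<alpha>)) * L2_sq \<alpha> G"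
proof -
  have [measurable]: "G \<in> borel_measurable (nu \<alpha>)" "bergman_kernel \<alpha> u \<in> borel_measurable (nu \<alpha>)"
    by (rule scalar_holo_measurable, rule G, rule scalar_holo_measurable, rule scalar_holo_bergman_kernel, rule u)
  have "ennreal (cmod (G u)) \<le> (\<integral>\<^sup>+z. ennreal (cmod (cnj (bergman_kernel \<alpha> u z) * G z)) \<partial>nu \<alpha>)"
    unfolding reproducing_formula(2)[OF \<alpha> G u L2[unfolded L2_sq_def]] by (rule ennreal_norm_integral_le)
  also have "\<dots> = (\<integral>\<^sup>+z. ennreal (cmod (bergman_kernel \<alpha> u z)) * ennreal (cmod (G z)) \<partial>nu \<alpha>)"
    by (simp add: norm_mult ennreal_mult)
  finally have "(ennreal (cmod (G u)))\<^sup>2 \<le> (\<integral>\<^sup>+z. ennreal (cmod (bergman_kernel \<alpha> u z)) * ennreal (cmod (G z)) \<partial>nu \<alpha>)\<^sup>2"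
    by (intro power_mono) auto
  also have "\<dots> \<le> (\<integral>\<^sup>+z. (ennreal (cmod (bergman_kernel \<alpha> u z)))\<^sup>2 \<partial>nu \<alpha>) * (\<integral>\<^sup>+z. (ennreal (cmod (G z)))\<^sup>2 \<partial>nu \<alpha>)"
    by (rule Cauchy_Schwarz_nn_integral) measurable
  finally show ?thesis by (simp add: bergman_kernel_L2[OF \<alpha> u] L2_sq_def)
qed

lemma integrable_bergman_times:
  fixes a :: "complex^'n::finite \<Rightarrow> complex"
  assumes \<alpha>: "\<alpha> > -1" and z: "norm z < 1" and a: "integrable (nu \<alpha>) a"
  shows "integrable (nu \<alpha>) (\<lambda>u. bergman_kernel \<alpha> z u * a u)"
proof (rule Bochner_Integration.integrable_bound[of _ "\<lambda>w. (1 - norm z) powr (- kernel_exp TYPE('n) \<alpha>) * norm (a w)"])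
  show "(\<lambda>u. bergman_kernel \<alpha> z u * a u) \<in> borel_measurable (nu \<alpha>)"
    using scalar_holo_measurable[OF scalar_holo_bergman_kernel[OF z]] a by measurable
  show "AE w in nu \<alpha>. norm (bergman_kernel \<alpha> z w * a w) \<le> norm ((1 - norm z) powr (- kernel_exp TYPE('n) \<alpha>) * norm (a w))"
    using bergman_kernel_bound[OF \<alpha> z] by (intro AE_I2) (auto simp: norm_mult mult_right_mono)
qed (use a in auto)

text \<open>Holomorphy in w is taken from the vector-valued result by placing the integrand along
  one unit vector and reading off that coordinate. Agreement with H on the ball is all that
  pointwise evaluation will use.\<close>

lemma scalar_holo_symbol_kernel:
  fixes a :: "complex^'n::finite \<Rightarrow> complex"
  assumes \<alpha>: "\<alpha> > -1" and z: "norm z < 1" and a: "integrable (nu \<alpha>) a"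
  shows "\<exists>H. scalar_holo H \<and> (\<forall>w\<in>ball 0 1. H w = symbol_kernel \<alpha> a w z)"
proof -
  define G where "G u = (bergman_kernel \<alpha> z u * a u) *\<^sub>C unit_vec 0" for u
  have iG: "integrable (nu \<alpha>) G" unfolding G_def
    by (rule integrable_bounded_linear[OF bounded_linear_scaleC_left integrable_bergman_times[OF assms]])
  have "holomorphic_ball (bergman_proj \<alpha> G)"
    by (rule kernel_integral_holomorphic[OF \<alpha> iG]) (simp add: bergman_proj_def)
  moreover have "cinner (bergman_proj \<alpha> G w) (unit_vec 0) = symbol_kernel \<alpha> a w z" if "norm w < 1" for w
  proof -
    have "cinner (bergman_proj \<alpha> G w) (unit_vec 0) = (LINT u|nu \<alpha>. cinner (cnj (bergman_kernel \<alpha> w u) *\<^sub>C G u) (unit_vec 0))"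
      unfolding bergman_proj_def
      by (rule integral_bounded_linear[OF bounded_linear_cinner_left integrable_kernel_mult[OF \<alpha> that iG], symmetric])
    then show ?thesis by (simp add: symbol_kernel_def G_def cinner_scaleC_left cinner_self_norm)
  qed
  ultimately show ?thesis
    by (intro exI[of _ "\<lambda>w. cinner (bergman_proj \<alpha> G w) (unit_vec 0)"]) (auto intro: scalar_holo_cinner)
qed

text \<open>The quotient is 1 - |phi_z(w)|^2 by \<open>ball_involution_norm\<close>. It lies between
  0 and 1 and is small exactly when w and z are far apart in the invariant metric, so a smaller d
  means a better kernel off the diagonal.\<close>

lemma Qker_alt:
  fixes w z :: "complex^'n::finite"
  assumes "norm w < 1" "norm z < 1"
  shows "Qker \<alpha> d w z = cmod (1 - hprod w z) powr (- kernel_exp TYPE('n) \<alpha>) *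
     ((1 - (norm w)\<^sup>2) * (1 - (norm z)\<^sup>2) / (cmod (1 - hprod w z))\<^sup>2) powr (- d)"
proof -
  have m: "cmod (1 - hprod w z) > 0" by (rule cmod_one_minus_hprod_pos[OF assms])
  then show ?thesis using one_minus_norm_sq_pos[OF assms(1)] one_minus_norm_sq_pos[OF assms(2)]
    unfolding Qker_def
    by (simp add: powr_divide powr_minus_divide powr_diff powr_powr[symmetric] powr_numeral)
qed

text \<open>Off the diagonal the kernel is small because it is dominated by \<open>Qker\<close> with a better exponent;
  near the diagonal it is small because of the smallness of \<open>T_a k_z\<close>.\<close>

lemma symbol_kernel_small:
  fixes a :: "complex^'n::finite \<Rightarrow> complex"
  assumes \<alpha>: "\<alpha> > -1" and a: "integrable (nu \<alpha>) a" and cw: "carleson_weight \<alpha> (\<lambda>u. cmod (a u)) B"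
    and small: "\<And>\<epsilon>. \<epsilon> > 0 \<Longrightarrow> \<exists>\<rho><1. \<forall>z. \<rho> < norm z \<and> norm z < 1 \<longrightarrow>
      ennreal ((1 - (norm z)\<^sup>2) powr kernel_exp TYPE('n) \<alpha>) * L2_sq \<alpha> (\<lambda>w. symbol_kernel \<alpha> a w z) \<le> ennreal \<epsilon>"
    and \<kappa>: "\<kappa> > 0"
  shows "\<exists>\<rho><1. \<forall>w z. norm w < 1 \<and> \<rho> < norm z \<and> norm z < 1 \<longrightarrow>
    cmod (symbol_kernel \<alpha> a w z) \<le> \<kappa> * Qker \<alpha> (schur_exp \<alpha>) w z"
proof -
  define N where "N = kernel_exp TYPE('n) \<alpha>"
  define d where "d = schur_exp \<alpha>"
  have d: "d > 0" "d \<le> N" "d < N / 2"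
    using \<alpha> schur_exp(1)[OF \<alpha>] schur_exp(4)[OF \<alpha>, where 'n='n] unfolding d_def N_def by (auto simp: schur_exp_def kernel_exp_def field_simps)
  obtain C where C: "C \<ge> 0" "\<And>(\<beta> :: complex^'n \<Rightarrow> real) B w z. carleson_weight \<alpha> \<beta> B \<and> norm w < 1 \<and> norm z < 1 \<Longrightarrow>
    (\<integral>\<^sup>+u. ennreal (\<beta> u) * ennreal (cmod (bergman_kernel \<alpha> z u) * cmod (bergman_kernel \<alpha> w u)) \<partial>nu \<alpha>)
      \<le> ennreal (C * B * Qker \<alpha> (d / 2) w z)"
    using carleson_kernel[where 'n='n and d = "d / 2", OF \<alpha>] d unfolding N_def by auto
  have B: "B \<ge> 0" using cw by (simp add: carleson_weight_def)
  \<comment> \<open>The threshold for 1 - |phi_z(w)|^2. Off the diagonal the kernel is dominated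
    with exponent d/2, a gain of p^(d/2) over the exponent d, and this choice makes C B \<eta>^(d/2)
    at most \<kappa>. The added 1 keeps the quotient meaningful when C B = 0.\<close>
  define \<eta> where "\<eta> = (\<kappa> / (C * B + 1)) powr (2 / d)"
  have CB: "C * B + 1 > 0" using C(1) B by (simp add: add_nonneg_pos)
  have \<eta>: "\<eta> > 0" using \<kappa> CB by (simp add: \<eta>_def)
  have \<eta>d: "\<eta> powr (d / 2) = \<kappa> / (C * B + 1)" using \<kappa> CB d by (simp add: \<eta>_def powr_powr)
  \<comment> \<open>Near the diagonal, evaluation at w gives sqrt(\<epsilon>) (sw sz)^(-N/2), which
    is sqrt(\<epsilon>) m^(-N) p^(-N/2). As p > \<eta> and d < N/2, the factor \<eta>^(N/2-d) is
    what turns p^(-N/2) into p^(-d).\<close>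
  define \<epsilon> where "\<epsilon> = (\<kappa> * \<eta> powr (N / 2 - d))\<^sup>2"
  have \<epsilon>: "\<epsilon> > 0" using \<kappa> \<eta> by (simp add: \<epsilon>_def)
  obtain \<rho> where \<rho>: "\<rho> < 1" "\<And>z. \<rho> < norm z \<Longrightarrow> norm z < 1 \<Longrightarrow>
      ennreal ((1 - (norm z)\<^sup>2) powr N) * L2_sq \<alpha> (\<lambda>w. symbol_kernel \<alpha> a w z) \<le> ennreal \<epsilon>"
    using small[OF \<epsilon>] unfolding N_def by blast
  have "cmod (symbol_kernel \<alpha> a w z) \<le> \<kappa> * Qker \<alpha> d w z" if w: "norm w < 1" and z: "\<rho> < norm z" "norm z < 1" for w z
  proof -
    define m where "m = cmod (1 - hprod w z)"
    have m: "m > 0" unfolding m_def by (rule cmod_one_minus_hprod_pos[OF w z(2)])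
    define sw sz where "sw = 1 - (norm w)\<^sup>2" and "sz = 1 - (norm z)\<^sup>2"
    have s: "sw > 0" "sz > 0" unfolding sw_def sz_def using one_minus_norm_sq_pos w z by blast+
    define p where "p = sw * sz / m\<^sup>2"
    have p: "p > 0" using s m by (simp add: p_def)
    have Q: "Qker \<alpha> t w z = m powr (- N) * p powr (- t)" for t
      using Qker_alt[OF w z(2), of \<alpha> t] by (simp add: N_def m_def p_def sw_def sz_def)
    show ?thesis
    proof (cases "p \<le> \<eta>")
      case True
      have "ennreal (cmod (symbol_kernel \<alpha> a w z)) \<le> (\<integral>\<^sup>+u. ennreal (cmod (cnj (bergman_kernel \<alpha> w u) * (bergman_kernel \<alpha> z u * a u))) \<partial>nu \<alpha>)"
        unfolding symbol_kernel_def by (rule ennreal_norm_integral_le)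
      also have "\<dots> = (\<integral>\<^sup>+u. ennreal (cmod (a u)) * ennreal (cmod (bergman_kernel \<alpha> z u) * cmod (bergman_kernel \<alpha> w u)) \<partial>nu \<alpha>)"
        by (intro nn_integral_cong) (simp add: norm_mult ennreal_mult[symmetric] mult_ac)
      also have "\<dots> \<le> ennreal (C * B * Qker \<alpha> (d / 2) w z)" using cw w z by (intro C(2)) auto
      finally have "cmod (symbol_kernel \<alpha> a w z) \<le> C * B * Qker \<alpha> (d / 2) w z"
        using C(1) B by (subst (asm) ennreal_le_iff) auto
      also have "Qker \<alpha> (d / 2) w z = p powr (d / 2) * Qker \<alpha> d w z"
        unfolding Q by (simp add: powr_add[symmetric] mult.left_commute)
      also have "C * B * (p powr (d / 2) * Qker \<alpha> d w z) \<le> C * B * (\<eta> powr (d / 2) * Qker \<alpha> d w z)"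
        using True p d C(1) B by (intro mult_left_mono mult_right_mono powr_mono2) auto
      also have "\<dots> = (C * B / (C * B + 1)) * (\<kappa> * Qker \<alpha> d w z)" unfolding \<eta>d by simp
      also have "\<dots> \<le> 1 * (\<kappa> * Qker \<alpha> d w z)"
        using CB \<kappa> by (intro mult_right_mono) auto
      finally show ?thesis by simp
    next
      case False
      obtain H where H: "scalar_holo H" "\<And>w. norm w < 1 \<Longrightarrow> H w = symbol_kernel \<alpha> a w z"
        using scalar_holo_symbol_kernel[OF \<alpha> z(2) a] by auto
      have L: "L2_sq \<alpha> H = L2_sq \<alpha> (\<lambda>w. symbol_kernel \<alpha> a w z)" by (rule L2_sq_cong) (simp add: H(2))
      have le: "ennreal (sz powr N) * L2_sq \<alpha> H \<le> ennreal \<epsilon>" using \<rho>(2)[OF z] by (simp add: L sz_def)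
      have pos: "sz powr N > 0" using s by simp
      have "L2_sq \<alpha> H < \<infinity>"
      proof (rule ccontr)
        assume "\<not> L2_sq \<alpha> H < \<infinity>"
        then have "L2_sq \<alpha> H = top" by (simp add: less_top[symmetric])
        then show False using le pos by (simp add: ennreal_mult_top top_unique)
      qed
      then obtain r where r: "r \<ge> 0" "L2_sq \<alpha> H = ennreal r" by (cases "L2_sq \<alpha> H") auto
      have r\<epsilon>: "sz powr N * r \<le> \<epsilon>" using le r \<epsilon> by (simp add: ennreal_mult[symmetric])
      have "(ennreal (cmod (H w)))\<^sup>2 \<le> ennreal (sw powr (- N)) * L2_sq \<alpha> H"
        unfolding sw_def N_def using r by (intro scalar_holo_pointwise[OF \<alpha> H(1) w]) auto
      then have "(cmod (H w))\<^sup>2 \<le> sw powr (- N) * r"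
        using r by (simp add: ennreal_power ennreal_mult[symmetric] ennreal_le_iff)
      also have "\<dots> \<le> sw powr (- N) * (\<epsilon> * sz powr (- N))"
        using r\<epsilon> pos by (intro mult_left_mono) (auto simp: powr_minus_divide field_simps)
      also have "\<dots> = (\<kappa> * \<eta> powr (N / 2 - d) * ((sw * sz) powr (- (N / 2))))\<^sup>2"
      proof -
        have "((sw * sz) powr (- (N / 2)))\<^sup>2 = sw powr (-N) * sz powr (-N)"
        proof -
          have "((sw * sz) powr (- (N / 2)))\<^sup>2 = (sw powr (- (N / 2)) * sw powr (- (N / 2))) *
              (sz powr (- (N / 2)) * sz powr (- (N / 2)))"
            using s by (simp add: power2_eq_square powr_mult mult_ac)
          also have "\<dots> = sw powr (-N) * sz powr (-N)" by (simp add: powr_add[symmetric])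
          finally show ?thesis .
        qed
        then show ?thesis by (simp add: \<epsilon>_def power_mult_distrib mult_ac)
      qed
      finally have "(cmod (H w))\<^sup>2 \<le> (\<kappa> * \<eta> powr (N / 2 - d) * ((sw * sz) powr (- (N / 2))))\<^sup>2" .
      then have "cmod (H w) \<le> \<kappa> * \<eta> powr (N / 2 - d) * ((sw * sz) powr (- (N / 2)))"
        by (rule power2_le_imp_le) (use \<kappa> in simp)
      also have "(sw * sz) powr (- (N / 2)) = m powr (-N) * p powr (- (N / 2))"
      proof -
        have "sw * sz = p * m\<^sup>2" using m by (simp add: p_def)
        then have "(sw * sz) powr (- (N / 2)) = p powr (- (N / 2)) * (m\<^sup>2) powr (- (N / 2))"
          using p m by (simp add: powr_mult)
        also have "(m\<^sup>2) powr (- (N / 2)) = m powr (- N)"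
        proof -
          have "m\<^sup>2 = m powr 2" using m by (simp add: powr_numeral)
          then show ?thesis by (simp only: powr_powr) simp
        qed
        finally show ?thesis by simp
      qed
      also have "\<kappa> * \<eta> powr (N / 2 - d) * (m powr (-N) * p powr (- (N / 2)))
         = \<kappa> * (m powr (-N) * (\<eta> powr (N / 2 - d) * p powr (- (N / 2))))" by simp
      also have "\<dots> \<le> \<kappa> * (m powr (-N) * (p powr (N / 2 - d) * p powr (- (N / 2))))"
        using False \<eta> d \<kappa> by (intro mult_left_mono mult_right_mono powr_mono2) auto
      also have "p powr (N / 2 - d) * p powr (- (N / 2)) = p powr (- d)" by (simp add: powr_add[symmetric])
      finally show ?thesis using H(2)[OF w] Q by simp
    qed
  qed
  then show ?thesis using \<rho>(1) unfolding d_def by blast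
qed

text \<open>The principal power cut off to the right half plane, where 1 - <u,z> lies for points of
  the ball. It is Borel on the whole plane, and this gives the joint measurability of the complex
  kernel in both variables that Fubini requires.\<close>

definition cut_powr :: "real \<Rightarrow> complex \<Rightarrow> complex"
  where "cut_powr s x = indicator {x. 0 < Re x} x *\<^sub>R (x powr complex_of_real s)"

lemma measurable_cut_powr [measurable]: "cut_powr s \<in> borel_measurable borel"
proof -
  have o: "open {x :: complex. 0 < Re x}" by (rule open_halfspace_Re_gt)
  have "continuous_on {x :: complex. 0 < Re x} (\<lambda>x. x powr complex_of_real s)"
    by (intro continuous_intros) (auto simp: complex_nonpos_Reals_iff)
  then show ?thesis unfolding cut_powr_def[abs_def]
    using o by (intro borel_measurable_continuous_on_indicator) auto
qed

text \<open>F is replaced by its reproducing integral and the order of integration is exchanged;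
  finiteness of the double integral of moduli is the absolute integrability behind this
  exchange.\<close>

lemma entry_operator_pointwise:
  fixes a F :: "complex^'n::finite \<Rightarrow> complex"
  assumes \<alpha>: "\<alpha> > -1" and a: "integrable (nu \<alpha>) a"
    and F: "scalar_holo F" "L2_sq \<alpha> F < \<infinity>" and w: "norm w < 1"
    and fin: "(\<integral>\<^sup>+z. (\<integral>\<^sup>+u. ennreal (cmod (bergman_kernel \<alpha> w u) * (cmod (a u) * (cmod (bergman_kernel \<alpha> z u) * cmod (F z)))) \<partial>nu \<alpha>) \<partial>nu \<alpha>) < \<infinity>"
  shows "ennreal (cmod (LINT u|nu \<alpha>. cnj (bergman_kernel \<alpha> w u) * (a u * F u)))
    \<le> (\<integral>\<^sup>+z. ennreal (cmod (symbol_kernel \<alpha> a w z)) * ennreal (cmod (F z)) \<partial>nu \<alpha>)"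
proof -
  let ?M = "nu \<alpha> :: (complex^'n) measure"
  interpret N: finite_measure ?M by (rule finite_measure_nu[OF \<alpha>])
  interpret P: pair_sigma_finite ?M ?M ..
  define N where "N = kernel_exp TYPE('n) \<alpha>"
  define k where "k z u = cut_powr (- N) (1 - hprod u z)" for z u :: "complex^'n"
  have k: "k z u = bergman_kernel \<alpha> z u" if "norm z < 1" "norm u < 1" for z u
    using one_minus_hprod_Re_pos[OF that(2,1)]
    by (simp add: k_def cut_powr_def bergman_kernel_def N_def kernel_exp_def)
  define H where "H u z = cnj (bergman_kernel \<alpha> w u) * (a u * (k z u * F z))" for u z
  have [measurable]: "a \<in> borel_measurable ?M" using a by auto
  have [measurable]: "F \<in> borel_measurable ?M" by (rule scalar_holo_measurable[OF F(1)])
  have [measurable]: "bergman_kernel \<alpha> w \<in> borel_measurable ?M" by (rule scalar_holo_measurable[OF scalar_holo_bergman_kernel[OF w]])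
  have km: "(\<lambda>p. k (snd p) (fst p)) \<in> borel_measurable (?M \<Otimes>\<^sub>M ?M)" unfolding k_def by measurable
  then have Hm: "(\<lambda>p. H (fst p) (snd p)) \<in> borel_measurable (?M \<Otimes>\<^sub>M ?M)" unfolding H_def by measurable
  have "(\<integral>\<^sup>+p. ennreal (norm (H (fst p) (snd p))) \<partial>(?M \<Otimes>\<^sub>M ?M)) = (\<integral>\<^sup>+z. \<integral>\<^sup>+u. ennreal (norm (H u z)) \<partial>?M \<partial>?M)"
    using Hm by (subst P.nn_integral_snd[symmetric]) auto
  also have "\<dots> = (\<integral>\<^sup>+z. (\<integral>\<^sup>+u. ennreal (cmod (bergman_kernel \<alpha> w u) * (cmod (a u) * (cmod (bergman_kernel \<alpha> z u) * cmod (F z)))) \<partial>?M) \<partial>?M)"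
    by (intro nn_integral_cong) (simp add: H_def norm_mult k)
  finally have int: "integrable (?M \<Otimes>\<^sub>M ?M) (case_prod H)"
    using Hm fin by (intro integrableI_bounded) (auto simp: case_prod_beta')
  have "(LINT u|?M. cnj (bergman_kernel \<alpha> w u) * (a u * F u)) = (LINT u|?M. LINT z|?M. H u z)"
  proof (rule Bochner_Integration.integral_cong[OF refl])
    fix u assume "u \<in> space ?M"
    then have u: "norm u < 1" by simp
    have "(LINT z|?M. H u z) = (LINT z|?M. (cnj (bergman_kernel \<alpha> w u) * a u) * (cnj (bergman_kernel \<alpha> u z) * F z))"
      by (intro Bochner_Integration.integral_cong) (auto simp: H_def k u cnj_bergman_kernel)
    also have "\<dots> = (cnj (bergman_kernel \<alpha> w u) * a u) * F u"
      using reproducing_formula(2)[OF \<alpha> F(1) u F(2)[unfolded L2_sq_def]] by simp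
    finally show "cnj (bergman_kernel \<alpha> w u) * (a u * F u) = (LINT z|?M. H u z)" by simp
  qed
  also have "\<dots> = (LINT z|?M. LINT u|?M. H u z)" by (rule P.Fubini_integral[OF int, symmetric])
  also have "\<dots> = (LINT z|?M. symbol_kernel \<alpha> a w z * F z)"
  proof (rule Bochner_Integration.integral_cong[OF refl])
    fix z assume "z \<in> space ?M"
    then have z: "norm z < 1" by simp
    have "(LINT u|?M. H u z) = (LINT u|?M. (cnj (bergman_kernel \<alpha> w u) * (bergman_kernel \<alpha> z u * a u)) * F z)"
      by (intro Bochner_Integration.integral_cong) (auto simp: H_def k z)
    then show "(LINT u|?M. H u z) = symbol_kernel \<alpha> a w z * F z" by (simp add: symbol_kernel_def)
  qed
  finally have "ennreal (cmod (LINT u|?M. cnj (bergman_kernel \<alpha> w u) * (a u * F u))) \<le> (\<integral>\<^sup>+z. ennreal (cmod (symbol_kernel \<alpha> a w z * F z)) \<partial>?M)"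
    using ennreal_norm_integral_le[of ?M "\<lambda>z. symbol_kernel \<alpha> a w z * F z"] by simp
  then show ?thesis by (simp add: norm_mult ennreal_mult)
qed

text \<open>The factor \<phi> depends on z so that it can be small near the sphere and merely
  bounded inside. The constant comes from the Schur test alone and does not involve B; the Carleson
  bound on a justifies Fubini.\<close>

lemma entry_operator_bound:
  assumes \<alpha>: "\<alpha> > -1"
  shows "\<exists>C\<ge>0. \<forall>(a :: complex^'n::finite \<Rightarrow> complex) B F \<phi>. integrable (nu \<alpha>) a \<and> carleson_weight \<alpha> (\<lambda>u. cmod (a u)) B
     \<and> scalar_holo F \<and> L2_sq \<alpha> F < \<infinity> \<and> \<phi> \<in> borel_measurable borel \<and> (\<forall>z. \<phi> z \<ge> 0)
     \<and> (\<forall>w\<in>ball 0 1. \<forall>z\<in>ball 0 1. cmod (symbol_kernel \<alpha> a w z) \<le> \<phi> z * Qker \<alpha> (schur_exp \<alpha>) w z) \<longrightarrow>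
     L2_sq \<alpha> (\<lambda>w. LINT u|nu \<alpha>. cnj (bergman_kernel \<alpha> w u) * (a u * F u))
       \<le> ennreal (C\<^sup>2) * (\<integral>\<^sup>+z. (ennreal (\<phi> z * cmod (F z)))\<^sup>2 \<partial>nu \<alpha>)"
proof -
  let ?M = "nu \<alpha> :: (complex^'n) measure"
  interpret N: finite_measure ?M by (rule finite_measure_nu[OF \<alpha>])
  define d where "d = schur_exp \<alpha>"
  obtain C1 where C1: "C1 \<ge> 0" "\<And>(\<beta> :: complex^'n \<Rightarrow> real) B w z. carleson_weight \<alpha> \<beta> B \<Longrightarrow> norm w < 1 \<Longrightarrow> norm z < 1 \<Longrightarrow>
    (\<integral>\<^sup>+u. ennreal (\<beta> u) * ennreal (cmod (bergman_kernel \<alpha> z u) * cmod (bergman_kernel \<alpha> w u)) \<partial>nu \<alpha>)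
      \<le> ennreal (C1 * B * Qker \<alpha> d w z)"
    using carleson_kernel[OF \<alpha> schur_exp(1)[OF \<alpha>] schur_exp(4)[OF \<alpha>, where 'n='n]] unfolding d_def by blast
  obtain C where C: "C \<ge> 0" "\<And>f. f \<in> borel_measurable ?M \<Longrightarrow>
    (\<integral>\<^sup>+w. (\<integral>\<^sup>+z. ennreal (Qker \<alpha> d w z) * f z \<partial>nu \<alpha>)\<^sup>2 \<partial>nu \<alpha>) \<le> ennreal (C\<^sup>2) * (\<integral>\<^sup>+z. (f z)\<^sup>2 \<partial>nu \<alpha>)"
    using Qker_bounded[OF schur_exp(1,2)[OF \<alpha>] schur_exp(3)[OF \<alpha>, where 'n='n]] unfolding d_def by blast
  show ?thesis
  proof (intro exI[of _ C] conjI allI impI)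
    fix a F :: "complex^'n \<Rightarrow> complex" and B and \<phi> :: "complex^'n \<Rightarrow> real"
    assume as: "integrable (nu \<alpha>) a \<and> carleson_weight \<alpha> (\<lambda>u. cmod (a u)) B
     \<and> scalar_holo F \<and> L2_sq \<alpha> F < \<infinity> \<and> \<phi> \<in> borel_measurable borel \<and> (\<forall>z. \<phi> z \<ge> 0)
     \<and> (\<forall>w\<in>ball 0 1. \<forall>z\<in>ball 0 1. cmod (symbol_kernel \<alpha> a w z) \<le> \<phi> z * Qker \<alpha> (schur_exp \<alpha>) w z)"
    then have B: "B \<ge> 0" by (simp add: carleson_weight_def)
    have [measurable]: "F \<in> borel_measurable ?M" using as scalar_holo_measurable by blast
    have \<phi>m[measurable]: "\<phi> \<in> borel_measurable ?M" using as by (intro measurable_nu_borel) simp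
    have [measurable]: "a \<in> borel_measurable ?M" using as by auto
    have [measurable]: "(\<lambda>z. Qker \<alpha> d w z) \<in> borel_measurable ?M" for w
      by (rule measurable_nu_borel) measurable
    have Km[measurable]: "(\<lambda>u. cmod (bergman_kernel \<alpha> w u)) \<in> borel_measurable ?M" for w
      unfolding cmod_bergman_kernel by (rule measurable_nu_borel, measurable)
    let ?X = "\<lambda>w. \<integral>\<^sup>+z. ennreal (Qker \<alpha> d w z) * ennreal (cmod (F z)) \<partial>?M"
    have Xm: "?X \<in> borel_measurable ?M" by measurable
    have "(\<integral>\<^sup>+w. (?X w)\<^sup>2 \<partial>?M) \<le> ennreal (C\<^sup>2) * (\<integral>\<^sup>+z. (ennreal (cmod (F z)))\<^sup>2 \<partial>nu \<alpha>)"
      by (rule C(2)) measurable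
    also have "\<dots> < \<infinity>" using as by (simp add: L2_sq_def ennreal_mult_less_top)
    finally have "(\<integral>\<^sup>+w. (?X w)\<^sup>2 \<partial>?M) \<noteq> \<infinity>" by auto
    then have "AE w in ?M. (?X w)\<^sup>2 \<noteq> \<infinity>" using Xm by (intro nn_integral_PInf_AE) auto
    \<comment> \<open>Absolute integrability is obtained for almost every w only: it follows from
      square integrability of the \<open>Qker\<close> integral of |F|.\<close>
    then have aefin: "AE w in ?M. ?X w < \<infinity>"
      by eventually_elim (auto simp: less_top[symmetric] power2_eq_square ennreal_mult_eq_top_iff)
    have main: "AE w in ?M. ennreal (cmod (LINT u|?M. cnj (bergman_kernel \<alpha> w u) * (a u * F u)))
       \<le> (\<integral>\<^sup>+z. ennreal (Qker \<alpha> d w z) * ennreal (\<phi> z * cmod (F z)) \<partial>?M)"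
      using aefin AE_space
    proof eventually_elim
      case (elim w)
      then have w: "norm w < 1" by simp
      have "(\<integral>\<^sup>+z. (\<integral>\<^sup>+u. ennreal (cmod (bergman_kernel \<alpha> w u) * (cmod (a u) * (cmod (bergman_kernel \<alpha> z u) * cmod (F z)))) \<partial>?M) \<partial>?M)
        \<le> (\<integral>\<^sup>+z. ennreal (C1 * B) * (ennreal (Qker \<alpha> d w z) * ennreal (cmod (F z))) \<partial>?M)"
      proof (intro nn_integral_mono)
        fix z assume "z \<in> space ?M"
        then have z: "norm z < 1" by simp
        have "(\<integral>\<^sup>+u. ennreal (cmod (bergman_kernel \<alpha> w u) * (cmod (a u) * (cmod (bergman_kernel \<alpha> z u) * cmod (F z)))) \<partial>?M)
          = (\<integral>\<^sup>+u. ennreal (cmod (F z)) * (ennreal (cmod (a u)) * ennreal (cmod (bergman_kernel \<alpha> z u) * cmod (bergman_kernel \<alpha> w u))) \<partial>?M)"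
          by (intro nn_integral_cong) (simp add: ennreal_mult[symmetric] mult_ac)
        also have "\<dots> = ennreal (cmod (F z)) * (\<integral>\<^sup>+u. ennreal (cmod (a u)) * ennreal (cmod (bergman_kernel \<alpha> z u) * cmod (bergman_kernel \<alpha> w u)) \<partial>?M)"
          by (rule nn_integral_cmult) measurable
        also have "\<dots> \<le> ennreal (cmod (F z)) * ennreal (C1 * B * Qker \<alpha> d w z)"
          using as by (intro mult_left_mono C1(2) w z) auto
        also have "\<dots> = ennreal (C1 * B) * (ennreal (Qker \<alpha> d w z) * ennreal (cmod (F z)))"
          using C1(1) B by (simp add: ennreal_mult[symmetric] mult_ac)
        finally show "(\<integral>\<^sup>+u. ennreal (cmod (bergman_kernel \<alpha> w u) * (cmod (a u) * (cmod (bergman_kernel \<alpha> z u) * cmod (F z)))) \<partial>?M)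
          \<le> ennreal (C1 * B) * (ennreal (Qker \<alpha> d w z) * ennreal (cmod (F z)))" .
      qed
      also have "\<dots> = ennreal (C1 * B) * ?X w" by (rule nn_integral_cmult) measurable
      also have "\<dots> < \<infinity>" using elim(1) by (simp add: ennreal_mult_less_top)
      finally have "ennreal (cmod (LINT u|?M. cnj (bergman_kernel \<alpha> w u) * (a u * F u)))
        \<le> (\<integral>\<^sup>+z. ennreal (cmod (symbol_kernel \<alpha> a w z)) * ennreal (cmod (F z)) \<partial>nu \<alpha>)"
        using as by (intro entry_operator_pointwise[OF \<alpha> _ _ _ w]) auto
      also have "\<dots> \<le> (\<integral>\<^sup>+z. ennreal (Qker \<alpha> d w z) * ennreal (\<phi> z * cmod (F z)) \<partial>?M)"
      proof (intro nn_integral_mono)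
        fix z assume "z \<in> space ?M"
        then have "cmod (symbol_kernel \<alpha> a w z) * cmod (F z) \<le> (\<phi> z * Qker \<alpha> d w z) * cmod (F z)"
          using as w by (intro mult_right_mono) (auto simp: d_def)
        then show "ennreal (cmod (symbol_kernel \<alpha> a w z)) * ennreal (cmod (F z)) \<le> ennreal (Qker \<alpha> d w z) * ennreal (\<phi> z * cmod (F z))"
          using as by (simp add: ennreal_mult[symmetric] ennreal_leI mult_ac)
      qed
      finally show ?case .
    qed
    have "L2_sq \<alpha> (\<lambda>w. LINT u|?M. cnj (bergman_kernel \<alpha> w u) * (a u * F u))
      \<le> (\<integral>\<^sup>+w. (\<integral>\<^sup>+z. ennreal (Qker \<alpha> d w z) * ennreal (\<phi> z * cmod (F z)) \<partial>?M)\<^sup>2 \<partial>?M)"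
      unfolding L2_sq_def using main by (intro nn_integral_mono_AE) (auto elim!: eventually_mono intro: power_mono)
    also have "\<dots> \<le> ennreal (C\<^sup>2) * (\<integral>\<^sup>+z. (ennreal (\<phi> z * cmod (F z)))\<^sup>2 \<partial>nu \<alpha>)"
      by (rule C(2)) measurable
    finally show "L2_sq \<alpha> (\<lambda>w. LINT u|nu \<alpha>. cnj (bergman_kernel \<alpha> w u) * (a u * F u))
       \<le> ennreal (C\<^sup>2) * (\<integral>\<^sup>+z. (ennreal (\<phi> z * cmod (F z)))\<^sup>2 \<partial>nu \<alpha>)" .
  qed (use C in auto)
qed

section \<open>Completeness, equicontinuity and subsequences in the Bergman space\<close>

lemma L2_sq_add_le:
  fixes f g :: "complex^'n::finite \<Rightarrow> 'e::{real_normed_vector, second_countable_topology}"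
  assumes [measurable]: "f \<in> borel_measurable (nu \<alpha>)" "g \<in> borel_measurable (nu \<alpha>)"
    and le: "\<And>z. norm z < 1 \<Longrightarrow> norm (h z) \<le> norm (f z) + norm (g z)"
  shows "L2_sq \<alpha> h \<le> 2 * L2_sq \<alpha> f + 2 * L2_sq \<alpha> g"
proof -
  have "L2_sq \<alpha> h \<le> (\<integral>\<^sup>+z. 2 * (ennreal (norm (f z)))\<^sup>2 + 2 * (ennreal (norm (g z)))\<^sup>2 \<partial>nu \<alpha>)"
    unfolding L2_sq_def
  proof (intro nn_integral_mono)
    fix z :: "complex^'n" assume "z \<in> space (nu \<alpha>)"
    then have "(norm (h z))\<^sup>2 \<le> (norm (f z) + norm (g z))\<^sup>2" using le by (intro power_mono) auto
    also have "\<dots> \<le> 2 * (norm (f z))\<^sup>2 + 2 * (norm (g z))\<^sup>2"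
      using sum_squares_bound[of "norm (f z)" "norm (g z)"] by (simp add: power2_sum)
    finally have "ennreal ((norm (h z))\<^sup>2) \<le> ennreal (2 * (norm (f z))\<^sup>2 + 2 * (norm (g z))\<^sup>2)" by (rule ennreal_leI)
    then show "(ennreal (norm (h z)))\<^sup>2 \<le> 2 * (ennreal (norm (f z)))\<^sup>2 + 2 * (ennreal (norm (g z)))\<^sup>2"
      by (simp add: ennreal_power ennreal_mult)
  qed
  also have "\<dots> = 2 * L2_sq \<alpha> f + 2 * L2_sq \<alpha> g"
    unfolding L2_sq_def by (subst nn_integral_add) (auto simp: nn_integral_cmult)
  finally show ?thesis .
qed

lemma Ap_measurable:
  fixes f :: "complex^'n::finite \<Rightarrow> ell2"
  assumes "\<alpha> > -1" "f \<in> Ap_space \<alpha> 2" shows "f \<in> borel_measurable (nu \<alpha>)"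
  using assms Ap_space_2_iff[OF assms(1)] by (auto intro: continuous_on_ball_measurable holomorphic_ball_continuous)

lemma Ap_diff:
  fixes f g :: "complex^'n::finite \<Rightarrow> ell2"
  assumes \<alpha>: "\<alpha> > -1" and f: "f \<in> Ap_space \<alpha> 2" and g: "g \<in> Ap_space \<alpha> 2"
  shows "(\<lambda>z. f z - g z) \<in> Ap_space \<alpha> 2"
    and "L2_sq \<alpha> (\<lambda>z. f z - g z) \<le> 2 * L2_sq \<alpha> f + 2 * L2_sq \<alpha> g"
proof -
  show le: "L2_sq \<alpha> (\<lambda>z. f z - g z) \<le> 2 * L2_sq \<alpha> f + 2 * L2_sq \<alpha> g"
    by (rule L2_sq_add_le[OF Ap_measurable[OF \<alpha> f] Ap_measurable[OF \<alpha> g]]) (rule norm_triangle_ineq4)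
  have hf: "holomorphic_ball f" "holomorphic_ball g" and l: "L2_sq \<alpha> f < \<infinity>" "L2_sq \<alpha> g < \<infinity>"
    using f g Ap_space_2_iff[OF \<alpha>] by auto
  have "holomorphic_ball (\<lambda>z. f z - g z)" unfolding holomorphic_ball_def
  proof
    fix z :: "complex^'n" assume z: "z \<in> ball 0 1"
    obtain D where D: "(f has_derivative D) (at z)" "\<And>c v. D (c *s v) = c *\<^sub>C D v"
      using hf(1) z unfolding holomorphic_ball_def by blast
    obtain E where E: "(g has_derivative E) (at z)" "\<And>c v. E (c *s v) = c *\<^sub>C E v"
      using hf(2) z unfolding holomorphic_ball_def by blast
    show "\<exists>D. ((\<lambda>z. f z - g z) has_derivative D) (at z) \<and> (\<forall>c v. D (c *s v) = c *\<^sub>C D v)"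
      by (intro exI[of _ "\<lambda>v. D v - E v"] conjI has_derivative_diff D(1) E(1)) (simp add: D(2) E(2) scaleC_diff_right)
  qed
  moreover have "L2_sq \<alpha> (\<lambda>z. f z - g z) < \<infinity>"
    using le l by (auto simp: ennreal_mult_less_top elim!: le_less_trans)
  ultimately show "(\<lambda>z. f z - g z) \<in> Ap_space \<alpha> 2" using Ap_space_2_iff[OF \<alpha>] by blast
qed

lemma Ap_pointwise:
  fixes f :: "complex^'n::finite \<Rightarrow> ell2"
  assumes \<alpha>: "\<alpha> > -1" and f: "f \<in> Ap_space \<alpha> 2" and u: "norm u < 1"
  shows "(ennreal (norm (f u)))\<^sup>2 \<le> ennreal ((1 - (norm u)\<^sup>2) powr (- kernel_exp TYPE('n) \<alpha>)) * L2_sq \<alpha> f"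
proof -
  have [measurable]: "f \<in> borel_measurable (nu \<alpha>)" "bergman_kernel \<alpha> u \<in> borel_measurable (nu \<alpha>)"
    using Ap_measurable[OF \<alpha> f] scalar_holo_measurable[OF scalar_holo_bergman_kernel[OF u]] by auto
  have "(ennreal (norm (f u)))\<^sup>2 \<le> (\<integral>\<^sup>+z. ennreal (cmod (bergman_kernel \<alpha> u z)) * ennreal (norm (f z)) \<partial>nu \<alpha>)\<^sup>2"
    by (intro power_mono vector_reproducing(3)[OF \<alpha> f u]) simp
  also have "\<dots> \<le> (\<integral>\<^sup>+z. (ennreal (cmod (bergman_kernel \<alpha> u z)))\<^sup>2 \<partial>nu \<alpha>) * L2_sq \<alpha> f"
    unfolding L2_sq_def by (rule Cauchy_Schwarz_nn_integral) measurable
  finally show ?thesis by (simp add: bergman_kernel_L2[OF \<alpha> u])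
qed

lemma L2_integrable:
  fixes f :: "complex^'n::finite \<Rightarrow> ell2"
  assumes \<alpha>: "\<alpha> > -1" and f[measurable]: "f \<in> borel_measurable (nu \<alpha>)" and L: "L2_sq \<alpha> f < \<infinity>"
  shows "integrable (nu \<alpha>) f" and "(\<integral>\<^sup>+z. ennreal (norm (f z)) \<partial>nu \<alpha>)\<^sup>2 \<le> L2_sq \<alpha> f"
proof -
  show le: "(\<integral>\<^sup>+z. ennreal (norm (f z)) \<partial>nu \<alpha>)\<^sup>2 \<le> L2_sq \<alpha> f"
    unfolding L2_sq_def
    by (rule nn_integral_L2_imp_L1) (simp_all add: emeasure_nu_space[OF \<alpha>])
  then have "(\<integral>\<^sup>+z. ennreal (norm (f z)) \<partial>nu \<alpha>)\<^sup>2 < \<infinity>" using L by (rule le_less_trans)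
  then have "(\<integral>\<^sup>+z. ennreal (norm (f z)) \<partial>nu \<alpha>) < \<infinity>"
    by (simp add: power2_eq_square ennreal_mult_less_top) (auto simp: less_top[symmetric])
  then show "integrable (nu \<alpha>) f" by (intro integrableI_bounded) auto
qed

text \<open>Point evaluations are bounded, so the sequence converges at every point of the ball, and
  Fatou's lemma upgrades this to convergence in L2. The limit is holomorphic because the reproducing
  formula passes to it and kernel integrals are holomorphic.\<close>

lemma Ap_complete:
  fixes h :: "nat \<Rightarrow> complex^'n::finite \<Rightarrow> ell2"
  assumes \<alpha>: "\<alpha> > -1" and h: "\<And>k. h k \<in> Ap_space \<alpha> 2"
    and cauchy: "\<And>\<epsilon>. \<epsilon> > 0 \<Longrightarrow> \<exists>K. \<forall>k\<ge>K. \<forall>m\<ge>K. L2_sq \<alpha> (\<lambda>z. h k z - h m z) \<le> ennreal \<epsilon>"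
  shows "\<exists>g\<in>Ap_space \<alpha> 2. (\<lambda>k. L2_sq \<alpha> (\<lambda>z. h k z - g z)) \<longlonglongrightarrow> 0"
proof -
  have conv: "convergent (\<lambda>k. h k z)" if z: "norm z < 1" for z
  proof -
    define s where "s = (1 - (norm z)\<^sup>2) powr (- kernel_exp TYPE('n) \<alpha>)"
    have s: "s > 0" using one_minus_norm_sq_pos[OF z] by (simp add: s_def)
    have "Cauchy (\<lambda>k. h k z)"
    proof (rule metric_CauchyI)
      fix e :: real assume e: "e > 0"
      then obtain K where K: "\<And>k m. k \<ge> K \<Longrightarrow> m \<ge> K \<Longrightarrow> L2_sq \<alpha> (\<lambda>z. h k z - h m z) \<le> ennreal ((e/2)\<^sup>2 / s)"
        using cauchy[of "(e/2)\<^sup>2 / s"] s by (metis divide_pos_pos half_gt_zero zero_less_power)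
      show "\<exists>M. \<forall>m\<ge>M. \<forall>n\<ge>M. dist (h m z) (h n z) < e"
      proof (intro exI[of _ K] allI impI)
        fix k m assume km: "k \<ge> K" "m \<ge> K"
        have "(ennreal (norm (h k z - h m z)))\<^sup>2 \<le> ennreal s * L2_sq \<alpha> (\<lambda>z. h k z - h m z)"
          unfolding s_def by (rule Ap_pointwise[OF \<alpha> Ap_diff(1)[OF \<alpha> h h] z])
        also have "\<dots> \<le> ennreal s * ennreal ((e/2)\<^sup>2 / s)" by (intro mult_left_mono K km) simp
        also have "\<dots> = ennreal ((e/2)\<^sup>2)" using s by (simp add: ennreal_mult[symmetric])
        finally have "(norm (h k z - h m z))\<^sup>2 \<le> (e/2)\<^sup>2" by (simp add: ennreal_power)
        then have "norm (h k z - h m z) \<le> e/2" by (rule power2_le_imp_le) (use e in simp)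
        then show "dist (h k z) (h m z) < e" using e by (simp add: dist_norm)
      qed
    qed
    then show ?thesis by (rule Cauchy_convergent)
  qed
  define g where "g z = (if norm z < 1 then lim (\<lambda>k. h k z) else 0)" for z
  have g: "(\<lambda>k. h k z) \<longlonglongrightarrow> g z" if "norm z < 1" for z
    using conv[OF that] that by (simp add: g_def convergent_LIMSEQ_iff)
  have hm[measurable]: "h k \<in> borel_measurable (nu \<alpha>)" for k by (rule Ap_measurable[OF \<alpha> h])
  have gm[measurable]: "g \<in> borel_measurable (nu \<alpha>)"
    by (rule borel_measurable_LIMSEQ_metric[of h]) (use hm g in auto)
  have fatou: "L2_sq \<alpha> (\<lambda>z. h k z - g z) \<le> ennreal \<epsilon>"
    if K: "\<And>m. m \<ge> K \<Longrightarrow> L2_sq \<alpha> (\<lambda>z. h k z - h m z) \<le> ennreal \<epsilon>" for k K \<epsilon>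
  proof -
    have "L2_sq \<alpha> (\<lambda>z. h k z - g z) = (\<integral>\<^sup>+z. liminf (\<lambda>m. (ennreal (norm (h k z - h m z)))\<^sup>2) \<partial>nu \<alpha>)"
      unfolding L2_sq_def
    proof (intro nn_integral_cong)
      fix z :: "complex^'n" assume "z \<in> space (nu \<alpha>)"
      then have "(\<lambda>m. norm (h k z - h m z)) \<longlonglongrightarrow> norm (h k z - g z)" by (intro tendsto_intros g) simp
      then have "(\<lambda>m. (norm (h k z - h m z))\<^sup>2) \<longlonglongrightarrow> (norm (h k z - g z))\<^sup>2" by (intro tendsto_power)
      then have "(\<lambda>m. ennreal ((norm (h k z - h m z))\<^sup>2)) \<longlonglongrightarrow> ennreal ((norm (h k z - g z))\<^sup>2)" by (rule tendsto_ennrealI)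
      then have "(\<lambda>m. (ennreal (norm (h k z - h m z)))\<^sup>2) \<longlonglongrightarrow> (ennreal (norm (h k z - g z)))\<^sup>2" by (simp add: ennreal_power)
      then show "(ennreal (norm (h k z - g z)))\<^sup>2 = liminf (\<lambda>m. (ennreal (norm (h k z - h m z)))\<^sup>2)"
        by (rule lim_imp_Liminf[OF sequentially_bot, symmetric])
    qed
    also have "\<dots> \<le> liminf (\<lambda>m. \<integral>\<^sup>+z. (ennreal (norm (h k z - h m z)))\<^sup>2 \<partial>nu \<alpha>)"
      by (rule nn_integral_liminf) measurable
    also have "\<dots> \<le> limsup (\<lambda>m. L2_sq \<alpha> (\<lambda>z. h k z - h m z))"
      unfolding L2_sq_def by (rule Liminf_le_Limsup) simp
    also have "\<dots> \<le> ennreal \<epsilon>"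
      by (rule Limsup_bounded) (use K in \<open>auto simp: eventually_sequentially\<close>)
    finally show ?thesis .
  qed
  have lim: "(\<lambda>k. L2_sq \<alpha> (\<lambda>z. h k z - g z)) \<longlonglongrightarrow> 0"
  proof (rule order_tendstoI)
    fix a :: ennreal assume "0 < a"
    then obtain \<epsilon> where \<epsilon>: "0 < ennreal \<epsilon>" "ennreal \<epsilon> < a"
      by (metis dense ennreal_cases less_top top.extremum_strict not_less_iff_gr_or_eq)
    then have "\<epsilon> > 0" by simp
    then obtain K where "\<And>k m. k \<ge> K \<Longrightarrow> m \<ge> K \<Longrightarrow> L2_sq \<alpha> (\<lambda>z. h k z - h m z) \<le> ennreal \<epsilon>"
      using cauchy by blast
    then have "L2_sq \<alpha> (\<lambda>z. h k z - g z) \<le> ennreal \<epsilon>" if "k \<ge> K" for k using fatou[of K k] that by blast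
    then show "\<forall>\<^sub>F k in sequentially. L2_sq \<alpha> (\<lambda>z. h k z - g z) < a"
      using \<epsilon>(2) unfolding eventually_sequentially by (meson le_less_trans)
  qed simp
  obtain K where K: "L2_sq \<alpha> (\<lambda>z. h K z - g z) < 1"
    using order_tendstoD(2)[OF lim, of 1] by (auto simp: eventually_sequentially)
  have "L2_sq \<alpha> g \<le> 2 * L2_sq \<alpha> (h K) + 2 * L2_sq \<alpha> (\<lambda>z. h K z - g z)"
  proof (rule L2_sq_add_le)
    show "norm (g z) \<le> norm (h K z) + norm (h K z - g z)" for z
      by (metis add_diff_cancel_left' add.commute diff_add_cancel norm_triangle_ineq4)
  qed measurable
  also have "\<dots> < \<infinity>"
  proof -
    have "L2_sq \<alpha> (h K) < \<infinity>" using h[of K] Ap_space_2_iff[OF \<alpha>] by blast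
    moreover have "L2_sq \<alpha> (\<lambda>z. h K z - g z) < \<infinity>" using K by (rule less_trans) simp
    ultimately show ?thesis by (simp add: ennreal_mult_less_top)
  qed
  finally have gL: "L2_sq \<alpha> g < \<infinity>" .
  have ig: "integrable (nu \<alpha>) g" by (rule L2_integrable(1)[OF \<alpha> gm gL])
  have "holomorphic_ball g"
  proof (rule kernel_integral_holomorphic[OF \<alpha> ig])
    fix z :: "complex^'n" assume z: "norm z < 1"
    let ?P = "\<lambda>f. LINT w|nu \<alpha>. cnj (bergman_kernel \<alpha> z w) *\<^sub>C (f w :: ell2)"
    define s where "s = (1 - (norm z)\<^sup>2) powr (- kernel_exp TYPE('n) \<alpha>)"
    have [measurable]: "bergman_kernel \<alpha> z \<in> borel_measurable (nu \<alpha>)"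
      by (rule scalar_holo_measurable[OF scalar_holo_bergman_kernel[OF z]])
    have b: "(ennreal (norm (h k z - ?P g)))\<^sup>2 \<le> ennreal s * L2_sq \<alpha> (\<lambda>z. h k z - g z)" for k
    proof -
      have eq: "h k z - ?P g = (LINT w|nu \<alpha>. cnj (bergman_kernel \<alpha> z w) *\<^sub>C (h k w - g w))"
        using vector_reproducing(1,2)[OF \<alpha> h z] integrable_kernel_mult[OF \<alpha> z ig]
        by (simp add: scaleC_diff_right)
      have "ennreal (norm (h k z - ?P g)) \<le> (\<integral>\<^sup>+w. ennreal (norm (cnj (bergman_kernel \<alpha> z w) *\<^sub>C (h k w - g w))) \<partial>nu \<alpha>)"
        unfolding eq by (rule ennreal_norm_integral_le)
      then have "(ennreal (norm (h k z - ?P g)))\<^sup>2 \<le> (\<integral>\<^sup>+w. ennreal (cmod (bergman_kernel \<alpha> z w)) * ennreal (norm (h k w - g w)) \<partial>nu \<alpha>)\<^sup>2"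
        by (intro power_mono) (simp_all add: norm_scaleC ennreal_mult)
      also have "\<dots> \<le> (\<integral>\<^sup>+w. (ennreal (cmod (bergman_kernel \<alpha> z w)))\<^sup>2 \<partial>nu \<alpha>) * L2_sq \<alpha> (\<lambda>z. h k z - g z)"
        unfolding L2_sq_def by (rule Cauchy_Schwarz_nn_integral) measurable
      finally show ?thesis by (simp add: bergman_kernel_L2[OF \<alpha> z] s_def)
    qed
    have "(\<lambda>k. ennreal s * L2_sq \<alpha> (\<lambda>z. h k z - g z)) \<longlonglongrightarrow> ennreal s * 0"
      by (intro ennreal_tendsto_cmult lim) simp
    then have lim0: "(\<lambda>k. ennreal s * L2_sq \<alpha> (\<lambda>z. h k z - g z)) \<longlonglongrightarrow> 0" by simp
    have "(\<lambda>k. ennreal ((norm (h k z - ?P g))\<^sup>2)) \<longlonglongrightarrow> 0"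
    proof (rule tendsto_sandwich[OF _ _ tendsto_const lim0])
      show "\<forall>\<^sub>F k in sequentially. ennreal ((norm (h k z - ?P g))\<^sup>2) \<le> ennreal s * L2_sq \<alpha> (\<lambda>z. h k z - g z)"
        by (intro always_eventually allI b[unfolded ennreal_power[OF norm_ge_zero]])
    qed simp
    then have "(\<lambda>k. (norm (h k z - ?P g))\<^sup>2) \<longlonglongrightarrow> 0"
      by (subst (asm) ennreal_tendsto_0_iff) auto
    then have "(\<lambda>k. sqrt ((norm (h k z - ?P g))\<^sup>2)) \<longlonglongrightarrow> sqrt 0" by (rule tendsto_real_sqrt)
    then have "(\<lambda>k. norm (h k z - ?P g)) \<longlonglongrightarrow> 0" by simp
    then have "(\<lambda>k. h k z) \<longlonglongrightarrow> ?P g" by (simp add: LIM_zero_iff tendsto_norm_zero_iff)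
    then show "g z = ?P g" using g[OF z] LIMSEQ_unique by blast
  qed
  then have "g \<in> Ap_space \<alpha> 2" using gL Ap_space_2_iff[OF \<alpha>] by blast
  then show ?thesis using lim by blast
qed

lemma power2_le_ennreal_sqrt:
  assumes "(X :: ennreal)\<^sup>2 \<le> ennreal C" "C \<ge> 0" shows "X \<le> ennreal (sqrt C)"
proof (cases X)
  case (real x)
  then have "x\<^sup>2 \<le> C" using assms by (simp add: ennreal_power)
  then have "x \<le> sqrt C" by (rule real_le_rsqrt)
  then show ?thesis using real by (simp add: ennreal_leI)
next
  case top
  then show ?thesis using assms by (simp add: power2_eq_square ennreal_top_mult top_unique)
qed

text \<open>Taylor's formula on the half plane Re x >= r: the first-order coefficient is bounded
  there, and the quadratic remainder is linear in |q - z| once |h| <= 1. The Lipschitz constant does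
  not depend on w.\<close>

lemma bergman_kernel_equicontinuous:
  fixes z :: "complex^'n::finite"
  assumes \<alpha>: "\<alpha> > -1" and z: "norm z < 1"
  shows "\<exists>A\<ge>0. \<exists>r>0. \<forall>q. norm (q - z) < r \<longrightarrow> norm q < 1 \<and>
    (\<forall>w. norm w < 1 \<longrightarrow> cmod (cnj (bergman_kernel \<alpha> q w) - cnj (bergman_kernel \<alpha> z w)) \<le> A * norm (q - z))"
proof -
  define c where "c = - kernel_exp TYPE('n) \<alpha>"
  have c: "c < 0" using kernel_exp_pos[OF \<alpha>, where 'n='n] by (simp add: c_def)
  define r where "r = (1 - norm z) / 2"
  have r: "r > 0" unfolding r_def using z by simp
  have "r + r = 1 - norm z" unfolding r_def by (rule field_sum_of_halves)
  then have nz: "norm z = 1 - 2 * r" by linarith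
  have r1: "r \<le> 1" using nz norm_ge_zero[of z] r by linarith
  note r = r r1
  define A where "A = - c * r powr (c - 1) + c * (c - 1) * r powr (c - 2)"
  have A1: "0 \<le> - c * r powr (c - 1)" using c by (intro mult_nonneg_nonneg) auto
  have A2: "0 \<le> c * (c - 1) * r powr (c - 2)"
    using c by (intro mult_nonneg_nonneg[of "c * (c - 1)"] mult_nonpos_nonpos) auto
  have K: "cnj (bergman_kernel \<alpha> a w) = (1 - hprod a w) powr complex_of_real c" if "norm a < 1" "norm w < 1" for a w :: "complex^'n"
    using cnj_bergman_kernel[OF that, of \<alpha>] by (simp add: bergman_kernel_def c_def kernel_exp_def)
  have main: "norm q < 1 \<and> (\<forall>w. norm w < 1 \<longrightarrow>
      cmod (cnj (bergman_kernel \<alpha> q w) - cnj (bergman_kernel \<alpha> z w)) \<le> A * norm (q - z))"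
    if q: "norm (q - z) < r" for q
  proof (intro conjI allI impI)
    have "norm q \<le> norm z + norm (q - z)" by (metis add.commute diff_add_cancel norm_triangle_ineq)
    then have nq: "norm q \<le> 1 - r" using q nz by linarith
    then show q1: "norm q < 1" using r by simp
    fix w :: "complex^'n" assume w: "norm w < 1"
    have Re: "Re (1 - hprod a w) \<ge> 1 - norm a" for a
    proof -
      have "Re (hprod a w) \<le> cmod (hprod a w)" by (rule complex_Re_le_cmod)
      also have "\<dots> \<le> norm a * norm w" by (rule hprod_norm_le)
      also have "\<dots> \<le> norm a" using w by (simp add: mult_left_le)
      finally show ?thesis by simp
    qed
    define x h where "x = 1 - hprod z w" and "h = - hprod (q - z) w"
    have xh: "1 - hprod q w = x + h" by (simp add: x_def h_def hprod_diff_left)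
    have xr: "r \<le> Re x" using Re[of z] nz r(1) unfolding x_def by linarith
    have xhr: "r \<le> Re (x + h)" unfolding xh[symmetric] using Re[of q] nq by linarith
    have "cmod h \<le> norm (q - z) * norm w" unfolding h_def norm_minus_cancel by (rule hprod_norm_le)
    also have "\<dots> \<le> norm (q - z)" using w by (simp add: mult_left_le)
    finally have h: "cmod h \<le> norm (q - z)" .
    have h1: "cmod h \<le> 1" using h q r by linarith
    have "(cmod h)\<^sup>2 \<le> cmod h * 1" unfolding power2_eq_square by (rule mult_left_mono[OF h1]) simp
    then have h2: "(cmod h)\<^sup>2 \<le> norm (q - z)" using h by linarith
    have rx: "r \<le> cmod x" using xr complex_Re_le_cmod[of x] by linarith
    have "cmod (complex_of_real c * x powr complex_of_real (c - 1) * h) = - c * cmod x powr (c - 1) * cmod h"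
      unfolding norm_mult cmod_powr_of_real using c by simp
    also have "\<dots> \<le> - c * r powr (c - 1) * norm (q - z)"
      using rx r c h by (intro mult_mono mult_left_mono powr_mono2') (auto simp: mult_nonpos_nonneg)
    finally have b1: "cmod (complex_of_real c * x powr complex_of_real (c - 1) * h) \<le> - c * r powr (c - 1) * norm (q - z)" .
    have t: "cmod ((x + h) powr c - x powr c - complex_of_real c * x powr (c - 1) * h) \<le> c * (c - 1) * r powr (c - 2) * (cmod h)\<^sup>2"
      by (rule powr_taylor2[OF c r(1) xr xhr])
    have b2: "c * (c - 1) * r powr (c - 2) * (cmod h)\<^sup>2 \<le> c * (c - 1) * r powr (c - 2) * norm (q - z)"
      by (rule mult_left_mono[OF h2 A2])
    have "cmod ((x + h) powr c - x powr c) \<le> cmod ((x + h) powr c - x powr c - complex_of_real c * x powr (c - 1) * h)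
        + cmod (complex_of_real c * x powr (c - 1) * h)"
      by (metis diff_add_cancel norm_triangle_ineq)
    also have "\<dots> \<le> A * norm (q - z)"
      using t b1 b2 unfolding A_def distrib_right by linarith
    finally show "cmod (cnj (bergman_kernel \<alpha> q w) - cnj (bergman_kernel \<alpha> z w)) \<le> A * norm (q - z)"
      unfolding K[OF q1 w] K[OF z w] xh x_def[symmetric] .
  qed
  show ?thesis
    by (rule exI[of _ A], rule conjI, use A1 A2 in \<open>simp add: A_def\<close>, rule exI[of _ r], rule conjI, rule r(1), use main in blast)
qed

text \<open>f(q) - f(z) is the integral of f against a difference of kernels. The measure has mass
  1, so the L1 norm of f is at most its L2 norm, which gives the factor sqrt C.\<close>

lemma Ap_equicontinuous:
  fixes z :: "complex^'n::finite"
  assumes \<alpha>: "\<alpha> > -1" and z: "norm z < 1"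
  shows "\<exists>A\<ge>0. \<exists>r>0. \<forall>q f C. norm (q - z) < r \<and> f \<in> Ap_space \<alpha> 2 \<and> 0 \<le> C \<and> L2_sq \<alpha> f \<le> ennreal C \<longrightarrow>
    norm q < 1 \<and> norm (f q - f z :: ell2) \<le> A * sqrt C * norm (q - z)"
proof -
  obtain A r where A: "A \<ge> 0" "r > 0" and Ar: "\<And>q. norm (q - z) < r \<Longrightarrow> norm q < 1 \<and>
    (\<forall>w. norm w < 1 \<longrightarrow> cmod (cnj (bergman_kernel \<alpha> q w) - cnj (bergman_kernel \<alpha> z w)) \<le> A * norm (q - z))"
    using bergman_kernel_equicontinuous[OF \<alpha> z] by blast
  have main: "norm q < 1 \<and> norm (f q - f z) \<le> A * sqrt C * norm (q - z)"
    if as: "norm (q - z) < r" "f \<in> Ap_space \<alpha> 2" "0 \<le> C" "L2_sq \<alpha> f \<le> ennreal C" for q C and f :: "complex^'n \<Rightarrow> ell2"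
  proof
    show q: "norm q < 1" using Ar[OF as(1)] by blast
    have kb: "\<And>w. norm w < 1 \<Longrightarrow> cmod (cnj (bergman_kernel \<alpha> q w) - cnj (bergman_kernel \<alpha> z w)) \<le> A * norm (q - z)"
      using Ar[OF as(1)] by blast
    have [measurable]: "f \<in> borel_measurable (nu \<alpha>)" by (rule Ap_measurable[OF \<alpha> as(2)])
    have L: "L2_sq \<alpha> f < \<infinity>" using as(4) by (rule le_less_trans) simp
    have "(\<integral>\<^sup>+w. ennreal (norm (f w)) \<partial>nu \<alpha>)\<^sup>2 \<le> ennreal C"
      using L2_integrable(2)[OF \<alpha> Ap_measurable[OF \<alpha> as(2)] L] as(4) by (rule order_trans)
    then have L1: "(\<integral>\<^sup>+w. ennreal (norm (f w)) \<partial>nu \<alpha>) \<le> ennreal (sqrt C)" using as(3) by (rule power2_le_ennreal_sqrt)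
    have eq: "f q - f z = (LINT w|nu \<alpha>. (cnj (bergman_kernel \<alpha> q w) - cnj (bergman_kernel \<alpha> z w)) *\<^sub>C f w)"
      using vector_reproducing(1,2)[OF \<alpha> as(2) q] vector_reproducing(1,2)[OF \<alpha> as(2) z]
      by (simp add: scaleC_diff_left)
    have "ennreal (norm (f q - f z)) \<le> (\<integral>\<^sup>+w. ennreal (norm ((cnj (bergman_kernel \<alpha> q w) - cnj (bergman_kernel \<alpha> z w)) *\<^sub>C f w)) \<partial>nu \<alpha>)"
      unfolding eq by (rule ennreal_norm_integral_le)
    also have "\<dots> \<le> (\<integral>\<^sup>+w. ennreal (A * norm (q - z)) * ennreal (norm (f w)) \<partial>nu \<alpha>)"
    proof (intro nn_integral_mono)
      fix w :: "complex^'n" assume "w \<in> space (nu \<alpha>)"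
      then have "norm ((cnj (bergman_kernel \<alpha> q w) - cnj (bergman_kernel \<alpha> z w)) *\<^sub>C f w) \<le> (A * norm (q - z)) * norm (f w)"
        unfolding norm_scaleC by (intro mult_right_mono kb) auto
      then show "ennreal (norm ((cnj (bergman_kernel \<alpha> q w) - cnj (bergman_kernel \<alpha> z w)) *\<^sub>C f w)) \<le> ennreal (A * norm (q - z)) * ennreal (norm (f w))"
        using A(1) by (subst ennreal_mult[symmetric]) (auto intro: ennreal_leI)
    qed
    also have "\<dots> = ennreal (A * norm (q - z)) * (\<integral>\<^sup>+w. ennreal (norm (f w)) \<partial>nu \<alpha>)" by (rule nn_integral_cmult) measurable
    also have "\<dots> \<le> ennreal (A * norm (q - z)) * ennreal (sqrt C)" by (intro mult_left_mono L1) simp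
    also have "\<dots> = ennreal (A * norm (q - z) * sqrt C)" using A(1) as(3) by (subst ennreal_mult) auto
    finally have "norm (f q - f z) \<le> A * norm (q - z) * sqrt C"
      using A(1) as(3) by (subst (asm) ennreal_le_iff) auto
    then show "norm (f q - f z) \<le> A * sqrt C * norm (q - z)" by (simp add: mult_ac)
  qed
  show ?thesis
    by (rule exI[of _ A], rule conjI, rule A(1), rule exI[of _ r], rule conjI, rule A(2), use main in blast)
qed

text \<open>Diagonal selection over the countable set of dense points and vector indices, extended
  to all points of the ball by equicontinuity. Scalar coordinates are used because boundedness in
  the sequence space yields no convergent subsequence in norm.\<close>

lemma Ap_subsequence:
  fixes f :: "nat \<Rightarrow> complex^'n::finite \<Rightarrow> ell2"
  assumes \<alpha>: "\<alpha> > -1" and f: "\<And>k. f k \<in> Ap_space \<alpha> 2" and C: "C \<ge> 0" "\<And>k. L2_sq \<alpha> (f k) \<le> ennreal C"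
    and e: "\<And>l::nat. norm (e l) = 1"
  shows "\<exists>r. strict_mono (r :: nat \<Rightarrow> nat) \<and> (\<forall>z l. norm z < 1 \<longrightarrow> convergent (\<lambda>k. cinner (f (r k) z) (e l)))"
proof -
  obtain D :: "(complex^'n) set" where D: "countable D" "\<And>X. open X \<Longrightarrow> X \<noteq> {} \<Longrightarrow> \<exists>d\<in>D. d \<in> X"
    using countable_dense_exists by blast
  define S where "S = (D \<inter> ball 0 1) \<times> (UNIV :: nat set)"
  define N where "N = kernel_exp TYPE('n) \<alpha>"
  \<comment> \<open>The factor (1-|q|^2)^(N/2) balances the growth of point evaluations; it makes
    all these sequences bounded by the one constant sqrt C, as the selection lemma asks, and is
    divided out afterwards.\<close>
  define \<phi> where "\<phi> k p = complex_of_real ((1 - (norm (fst p))\<^sup>2) powr (N / 2)) * cinner (f k (fst p)) (e (snd p))" for k p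
  have "countable S" unfolding S_def using D(1) by (intro countable_SIGMA) auto
  moreover have "norm (\<phi> k p) \<le> sqrt C" if "p \<in> S" for k p
  proof -
    obtain q l where p: "p = (q, l)" by (cases p)
    have q: "norm q < 1" using that by (auto simp: S_def p)
    define s where "s = 1 - (norm q)\<^sup>2"
    have s: "s > 0" unfolding s_def by (rule one_minus_norm_sq_pos[OF q])
    have "(ennreal (norm (f k q)))\<^sup>2 \<le> ennreal (s powr (- N)) * L2_sq \<alpha> (f k)"
      unfolding s_def N_def by (rule Ap_pointwise[OF \<alpha> f q])
    also have "\<dots> \<le> ennreal (s powr (- N)) * ennreal C" by (intro mult_left_mono C(2)) simp
    also have "\<dots> = ennreal (s powr (- N) * C)" using C(1) by (subst ennreal_mult) auto
    finally have "(norm (f k q))\<^sup>2 \<le> s powr (- N) * C" using C(1) by (simp add: ennreal_power)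
    then have "s powr N * (norm (f k q))\<^sup>2 \<le> s powr N * (s powr (- N) * C)" by (intro mult_left_mono) auto
    also have "\<dots> = C" using s by (simp add: powr_minus_divide)
    also have "s powr N = (s powr (N / 2))\<^sup>2" using s by (simp add: power2_eq_square powr_add[symmetric])
    finally have "(s powr (N / 2) * norm (f k q))\<^sup>2 \<le> C" by (simp add: power_mult_distrib)
    then have 1: "s powr (N / 2) * norm (f k q) \<le> sqrt C" by (rule real_le_rsqrt)
    have "cmod (cinner (f k q) (e l)) \<le> norm (f k q)" using cinner_norm_le[of "f k q" "e l"] e[of l] by simp
    then have "norm (\<phi> k p) \<le> s powr (N / 2) * norm (f k q)"
      unfolding \<phi>_def p norm_mult by (simp add: s_def mult_left_mono)
    then show ?thesis using 1 by linarith
  qed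
  ultimately obtain r where r: "strict_mono (r :: nat \<Rightarrow> nat)" "\<And>p. p \<in> S \<Longrightarrow> \<exists>l. (\<lambda>n. \<phi> (r n) p) \<longlonglongrightarrow> l"
    using function_convergent_subsequence[of S \<phi> "sqrt C"] by blast
  have cD: "Cauchy (\<lambda>k. cinner (f (r k) q) (e l))" if q: "q \<in> D" "norm q < 1" for q l
  proof -
    define t where "t = complex_of_real ((1 - (norm q)\<^sup>2) powr (N / 2))"
    have t: "t \<noteq> 0" using one_minus_norm_sq_pos[OF q(2)] by (simp add: t_def)
    have "(q, l) \<in> S" using q by (simp add: S_def)
    then obtain L where "(\<lambda>n. \<phi> (r n) (q, l)) \<longlonglongrightarrow> L" using r(2) by blast
    then have "(\<lambda>n. (1 / t) * \<phi> (r n) (q, l)) \<longlonglongrightarrow> (1 / t) * L" by (rule tendsto_mult_left)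
    then have "(\<lambda>k. cinner (f (r k) q) (e l)) \<longlonglongrightarrow> (1 / t) * L" using t by (simp add: \<phi>_def t_def[symmetric])
    then show ?thesis by (rule LIMSEQ_imp_Cauchy)
  qed
  have "convergent (\<lambda>k. cinner (f (r k) z) (e l))" if z: "norm z < 1" for z l
  proof -
    obtain A \<rho> where A: "A \<ge> 0" "\<rho> > 0" and Ar: "\<And>q f C. norm (q - z) < \<rho> \<Longrightarrow> f \<in> Ap_space \<alpha> 2 \<Longrightarrow> 0 \<le> C \<Longrightarrow> L2_sq \<alpha> f \<le> ennreal C \<Longrightarrow>
        norm q < 1 \<and> norm (f q - f z :: ell2) \<le> A * sqrt C * norm (q - z)"
      using Ap_equicontinuous[OF \<alpha> z] by blast
    have "Cauchy (\<lambda>k. cinner (f (r k) z) (e l))"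
    proof (rule metric_CauchyI)
      fix \<epsilon> :: real assume \<epsilon>: "\<epsilon> > 0"
      define \<delta> where "\<delta> = min \<rho> (\<epsilon> / (4 * (A * sqrt C + 1)))"
      have AC: "A * sqrt C \<ge> 0" using A C by simp
      then have \<delta>: "\<delta> > 0" using A(2) \<epsilon> by (simp add: \<delta>_def)
      obtain q where q: "q \<in> D" "q \<in> ball z \<delta>"
        using D(2)[of "ball z \<delta>"] \<delta> by (auto simp: ball_eq_empty)
      have qz: "norm (q - z) < \<delta>" using q(2) by (simp add: dist_norm norm_minus_commute)
      then have q\<rho>: "norm (q - z) < \<rho>" by (simp add: \<delta>_def)
      have q1: "norm q < 1" using Ar[OF q\<rho> f C(1) C(2)] by blast
      have close: "cmod (cinner (f k q) (e l) - cinner (f k z) (e l)) \<le> \<epsilon> / 4" for k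
      proof -
        have "cmod (cinner (f k q) (e l) - cinner (f k z) (e l)) \<le> norm (f k q - f k z)"
          using cinner_norm_le[of "f k q - f k z" "e l"] e[of l] by (simp add: cinner_diff_left)
        also have "\<dots> \<le> A * sqrt C * norm (q - z)" using Ar[OF q\<rho> f C(1) C(2)] by blast
        also have "\<dots> \<le> (A * sqrt C + 1) * (\<epsilon> / (4 * (A * sqrt C + 1)))"
          using qz AC by (intro mult_mono) (auto simp: \<delta>_def)
        also have "\<dots> = \<epsilon> / 4"
        proof -
          have "c1 * (\<epsilon> / (4 * c1)) = \<epsilon> / 4" if "c1 \<noteq> 0" for c1 :: real using that by simp
          moreover have "A * sqrt C + 1 \<noteq> 0" using AC by linarith
          ultimately show ?thesis by blast
        qed
        finally show ?thesis .
      qed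
      obtain K where K: "\<And>k m. k \<ge> K \<Longrightarrow> m \<ge> K \<Longrightarrow> dist (cinner (f (r k) q) (e l)) (cinner (f (r m) q) (e l)) < \<epsilon> / 4"
        using metric_CauchyD[OF cD[OF q(1) q1, of l], of "\<epsilon> / 4"] \<epsilon> by auto
      show "\<exists>M. \<forall>m\<ge>M. \<forall>n\<ge>M. dist (cinner (f (r m) z) (e l)) (cinner (f (r n) z) (e l)) < \<epsilon>"
      proof (intro exI[of _ K] allI impI)
        fix k m assume km: "k \<ge> K" "m \<ge> K"
        let ?a = "\<lambda>k z. cinner (f (r k) z) (e l)"
        have "dist (?a k z) (?a m z) \<le> dist (?a k z) (?a k q) + dist (?a k q) (?a m q) + dist (?a m q) (?a m z)"
          by (meson add_mono dist_triangle order_refl order_trans)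
        moreover have "dist (?a k z) (?a k q) \<le> \<epsilon> / 4" using close[of "r k"] by (simp add: dist_norm norm_minus_commute)
        moreover have "dist (?a m q) (?a m z) \<le> \<epsilon> / 4" using close[of "r m"] by (simp add: dist_norm)
        ultimately show "dist (?a k z) (?a m z) < \<epsilon>" using K[OF km] \<epsilon> by linarith
      qed
    qed
    then show ?thesis by (rule Cauchy_convergent)
  qed
  then show ?thesis using r(1) by blast
qed

text \<open>On |z| <= \<rho> point evaluations are uniformly bounded, so dominated convergence
  applies to the coordinate functions; both indices are then compared with the pointwise limit
  g.\<close>

lemma local_cauchy:
  fixes h :: "nat \<Rightarrow> complex^'n::finite \<Rightarrow> ell2"
  assumes \<alpha>: "\<alpha> > -1" and h: "\<And>k. h k \<in> Ap_space \<alpha> 2" and C: "C \<ge> 0" "\<And>k. L2_sq \<alpha> (h k) \<le> ennreal C"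
    and y: "norm y = 1" and conv: "\<And>z. norm z < 1 \<Longrightarrow> convergent (\<lambda>k. cinner (h k z) y)"
    and \<rho>: "\<rho> < 1" and \<delta>: "\<delta> > 0"
  shows "\<exists>K. \<forall>k\<ge>K. \<forall>m\<ge>K. (\<integral>\<^sup>+z. indicator {z. norm z \<le> \<rho>} z * (ennreal (cmod (cinner (h k z - h m z) y)))\<^sup>2 \<partial>nu \<alpha>) \<le> ennreal \<delta>"
proof -
  let ?M = "nu \<alpha> :: (complex^'n) measure"
  define N where "N = kernel_exp TYPE('n) \<alpha>"
  define g where "g z = (if norm z < 1 then lim (\<lambda>k. cinner (h k z) y) else 0)" for z
  have g: "(\<lambda>k. cinner (h k z) y) \<longlonglongrightarrow> g z" if "norm z < 1" for z
    using conv[OF that] that by (simp add: g_def convergent_LIMSEQ_iff)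
  have hm[measurable]: "h k \<in> borel_measurable ?M" for k by (rule Ap_measurable[OF \<alpha> h])
  have gm[measurable]: "g \<in> borel_measurable ?M"
    by (rule borel_measurable_LIMSEQ_metric[of "\<lambda>k z. cinner (h k z) y"]) (use g in auto)
  have im[measurable]: "(\<lambda>z. indicator {z. norm z \<le> \<rho>} z :: ennreal) \<in> borel_measurable ?M"
    by (rule measurable_nu_borel) measurable
  define B where "B = ((1 - \<rho>\<^sup>2) powr (- N)) * C"
  have bnd: "cmod (cinner (h k z) y) \<le> sqrt B" if z: "norm z \<le> \<rho>" for k z
  proof -
    have z1: "norm z < 1" using z \<rho> by simp
    have "(norm z)\<^sup>2 \<le> \<rho>\<^sup>2" using z by (intro power_mono) auto
    moreover have "0 \<le> \<rho>" using z norm_ge_zero[of z] by linarith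
    then have "\<rho>\<^sup>2 < 1" using \<rho> by (simp add: abs_square_less_1)
    ultimately have "(1 - (norm z)\<^sup>2) powr (- N) \<le> (1 - \<rho>\<^sup>2) powr (- N)"
      using kernel_exp_pos[OF \<alpha>, where 'n='n] by (intro powr_mono2') (auto simp: N_def)
    have "(ennreal (norm (h k z)))\<^sup>2 \<le> ennreal ((1 - (norm z)\<^sup>2) powr (- N)) * L2_sq \<alpha> (h k)"
      unfolding N_def by (rule Ap_pointwise[OF \<alpha> h z1])
    also have "\<dots> \<le> ennreal ((1 - \<rho>\<^sup>2) powr (- N)) * ennreal C"
      by (intro mult_mono C(2) ennreal_leI) (use \<open>(1 - (norm z)\<^sup>2) powr (- N) \<le> (1 - \<rho>\<^sup>2) powr (- N)\<close> in auto)
    also have "\<dots> = ennreal B" unfolding B_def using C(1) by (subst ennreal_mult) auto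
    finally have "(norm (h k z))\<^sup>2 \<le> B" using C(1) by (simp add: ennreal_power B_def)
    then have "norm (h k z) \<le> sqrt B" by (rule real_le_rsqrt)
    then show ?thesis using cinner_norm_le[of "h k z" y] y by simp
  qed
  have gb: "cmod (g z) \<le> sqrt B" if z: "norm z \<le> \<rho>" for z
  proof (rule LIMSEQ_le_const2[OF tendsto_norm[OF g]])
    show "norm z < 1" using z \<rho> by simp
    show "\<exists>N. \<forall>n\<ge>N. cmod (cinner (h n z) y) \<le> sqrt B" using bnd[OF z] by blast
  qed
  define X where "X k = (\<integral>\<^sup>+z. indicator {z. norm z \<le> \<rho>} z * (ennreal (cmod (cinner (h k z) y - g z)))\<^sup>2 \<partial>?M)" for k
  have "X \<longlonglongrightarrow> (\<integral>\<^sup>+z. 0 \<partial>?M)" unfolding X_def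
  proof (rule nn_integral_dominated_convergence[where w = "\<lambda>z. ennreal ((2 * sqrt B)\<^sup>2)"])
    show "AE z in ?M. indicator {z. norm z \<le> \<rho>} z * (ennreal (cmod (cinner (h j z) y - g z)))\<^sup>2 \<le> ennreal ((2 * sqrt B)\<^sup>2)" for j
    proof (intro AE_I2)
      fix z :: "complex^'n"
      show "indicator {z. norm z \<le> \<rho>} z * (ennreal (cmod (cinner (h j z) y - g z)))\<^sup>2 \<le> ennreal ((2 * sqrt B)\<^sup>2)"
      proof (cases "norm z \<le> \<rho>")
        case True
        have "cmod (cinner (h j z) y - g z) \<le> 2 * sqrt B"
          using norm_triangle_ineq4[of "cinner (h j z) y" "g z"] bnd[OF True, of j] gb[OF True] by linarith
        then have "(cmod (cinner (h j z) y - g z))\<^sup>2 \<le> (2 * sqrt B)\<^sup>2" by (intro power_mono) auto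
        then show ?thesis using True by (simp only: ennreal_power[OF norm_ge_zero] indicator_simps mem_Collect_eq mult_1 ennreal_leI if_True indicator_def)
          (simp add: ennreal_leI)
      qed (simp add: indicator_def)
    qed
    show "(\<integral>\<^sup>+z. ennreal ((2 * sqrt B)\<^sup>2) \<partial>?M) < \<infinity>"
      by (simp add: emeasure_nu_space[OF \<alpha>])
    show "AE z in ?M. (\<lambda>j. indicator {z. norm z \<le> \<rho>} z * (ennreal (cmod (cinner (h j z) y - g z)))\<^sup>2) \<longlonglongrightarrow> 0"
    proof (intro AE_I2)
      fix z :: "complex^'n" assume "z \<in> space ?M"
      then have "(\<lambda>j. cinner (h j z) y - g z) \<longlonglongrightarrow> 0" using g by (intro LIM_zero) simp
      then have "(\<lambda>j. (cmod (cinner (h j z) y - g z))\<^sup>2) \<longlonglongrightarrow> 0\<^sup>2" by (intro tendsto_power tendsto_norm_zero)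
      then have "(\<lambda>j. ennreal ((cmod (cinner (h j z) y - g z))\<^sup>2)) \<longlonglongrightarrow> ennreal (0\<^sup>2)" by (rule tendsto_ennrealI)
      then have "(\<lambda>j. indicator {z. norm z \<le> \<rho>} z * ennreal ((cmod (cinner (h j z) y - g z))\<^sup>2)) \<longlonglongrightarrow> indicator {z. norm z \<le> \<rho>} z * ennreal (0\<^sup>2)"
        by (intro ennreal_tendsto_cmult) (auto simp: indicator_def)
      then show "(\<lambda>j. indicator {z. norm z \<le> \<rho>} z * (ennreal (cmod (cinner (h j z) y - g z)))\<^sup>2) \<longlonglongrightarrow> 0"
        by (simp add: ennreal_power)
    qed
  qed measurable
  then have X0: "X \<longlonglongrightarrow> 0" by simp
  have "ennreal (\<delta> / 4) > 0" using \<delta> by simp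
  then obtain K where K: "\<And>k. k \<ge> K \<Longrightarrow> X k < ennreal (\<delta> / 4)"
    using order_tendstoD(2)[OF X0] unfolding eventually_sequentially by blast
  show ?thesis
  proof (intro exI[of _ K] allI impI)
    fix k m assume km: "k \<ge> K" "m \<ge> K"
    have "(\<integral>\<^sup>+z. indicator {z. norm z \<le> \<rho>} z * (ennreal (cmod (cinner (h k z - h m z) y)))\<^sup>2 \<partial>?M)
      \<le> (\<integral>\<^sup>+z. 2 * (indicator {z. norm z \<le> \<rho>} z * (ennreal (cmod (cinner (h k z) y - g z)))\<^sup>2)
           + 2 * (indicator {z. norm z \<le> \<rho>} z * (ennreal (cmod (cinner (h m z) y - g z)))\<^sup>2) \<partial>?M)"
    proof (intro nn_integral_mono)
      fix z
      define p q where "p = cinner (h k z) y - g z" and "q = cinner (h m z) y - g z"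
      have "cinner (h k z - h m z) y = p - q" by (simp add: p_def q_def cinner_diff_left)
      then have "(cmod (cinner (h k z - h m z) y))\<^sup>2 \<le> (cmod p + cmod q)\<^sup>2"
        by (simp add: norm_triangle_ineq4 power_mono)
      also have "\<dots> \<le> 2 * (cmod p)\<^sup>2 + 2 * (cmod q)\<^sup>2"
        using sum_squares_bound[of "cmod p" "cmod q"] by (simp add: power2_sum)
      finally have "ennreal ((cmod (cinner (h k z - h m z) y))\<^sup>2) \<le> ennreal (2 * (cmod p)\<^sup>2 + 2 * (cmod q)\<^sup>2)" by (rule ennreal_leI)
      then have "(ennreal (cmod (cinner (h k z - h m z) y)))\<^sup>2 \<le> 2 * (ennreal (cmod p))\<^sup>2 + 2 * (ennreal (cmod q))\<^sup>2"
        by (simp add: ennreal_power ennreal_mult)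
      then show "indicator {z. norm z \<le> \<rho>} z * (ennreal (cmod (cinner (h k z - h m z) y)))\<^sup>2
        \<le> 2 * (indicator {z. norm z \<le> \<rho>} z * (ennreal (cmod (cinner (h k z) y - g z)))\<^sup>2)
           + 2 * (indicator {z. norm z \<le> \<rho>} z * (ennreal (cmod (cinner (h m z) y - g z)))\<^sup>2)"
        unfolding p_def[symmetric] q_def[symmetric] by (cases "norm z \<le> \<rho>") (simp_all add: indicator_def)
    qed
    also have "\<dots> = 2 * X k + 2 * X m"
      unfolding X_def by (subst nn_integral_add) (simp_all add: nn_integral_cmult)
    also have "\<dots> \<le> 2 * ennreal (\<delta> / 4) + 2 * ennreal (\<delta> / 4)"
      using K[OF km(1)] K[OF km(2)] by (intro add_mono mult_left_mono) (auto intro: less_imp_le)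
    also have "\<dots> = ennreal (2 * (\<delta> / 4) + 2 * (\<delta> / 4))"
    proof -
      have g: "2 * ennreal (\<delta> / 4) = ennreal (2 * (\<delta> / 4))" by (subst ennreal_mult') simp_all
      show ?thesis unfolding g by (rule ennreal_plus[symmetric]) (use \<delta> in auto)
    qed
    also have "2 * (\<delta> / 4) + 2 * (\<delta> / 4) = \<delta>" by simp
    finally show "(\<integral>\<^sup>+z. indicator {z. norm z \<le> \<rho>} z * (ennreal (cmod (cinner (h k z - h m z) y)))\<^sup>2 \<partial>nu \<alpha>) \<le> ennreal \<delta>" .
  qed
qed

lemma L2_sq_sum:
  fixes y :: "'i \<Rightarrow> complex^'n::finite \<Rightarrow> 'e::{real_normed_vector, second_countable_topology}"
  assumes m[measurable]: "\<And>i. i \<in> I \<Longrightarrow> y i \<in> borel_measurable (nu \<alpha>)"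
  shows "L2_sq \<alpha> (\<lambda>z. \<Sum>i\<in>I. y i z) \<le> ennreal (real (card I)) * (\<Sum>i\<in>I. L2_sq \<alpha> (y i))"
proof -
  have "L2_sq \<alpha> (\<lambda>z. \<Sum>i\<in>I. y i z) \<le> (\<integral>\<^sup>+z. ennreal (real (card I)) * (\<Sum>i\<in>I. (ennreal (norm (y i z)))\<^sup>2) \<partial>nu \<alpha>)"
    unfolding L2_sq_def
  proof (intro nn_integral_mono)
    fix z
    have "(norm (\<Sum>i\<in>I. y i z))\<^sup>2 \<le> (\<Sum>i\<in>I. norm (y i z))\<^sup>2" by (intro power_mono norm_sum) simp
    also have "\<dots> \<le> (\<Sum>i\<in>I. (norm (y i z))\<^sup>2) * card I" by (rule sum_squared_le_sum_of_squares)
    finally have "ennreal ((norm (\<Sum>i\<in>I. y i z))\<^sup>2) \<le> ennreal (real (card I) * (\<Sum>i\<in>I. (norm (y i z))\<^sup>2))"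
      by (intro ennreal_leI) (simp add: mult.commute)
    also have "\<dots> = ennreal (real (card I)) * ennreal (\<Sum>i\<in>I. (norm (y i z))\<^sup>2)"
      by (rule ennreal_mult) (auto intro: sum_nonneg)
    also have "ennreal (\<Sum>i\<in>I. (norm (y i z))\<^sup>2) = (\<Sum>i\<in>I. ennreal ((norm (y i z))\<^sup>2))"
      by (rule sum_ennreal[symmetric]) simp
    finally show "(ennreal (norm (\<Sum>i\<in>I. y i z)))\<^sup>2 \<le> ennreal (real (card I)) * (\<Sum>i\<in>I. (ennreal (norm (y i z)))\<^sup>2)"
      by (simp only: ennreal_power[OF norm_ge_zero])
  qed
  also have "\<dots> = ennreal (real (card I)) * (\<integral>\<^sup>+z. (\<Sum>i\<in>I. (ennreal (norm (y i z)))\<^sup>2) \<partial>nu \<alpha>)"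
    by (rule nn_integral_cmult) measurable
  also have "(\<integral>\<^sup>+z. (\<Sum>i\<in>I. (ennreal (norm (y i z)))\<^sup>2) \<partial>nu \<alpha>) = (\<Sum>i\<in>I. L2_sq \<alpha> (y i))"
    unfolding L2_sq_def by (rule nn_integral_sum) measurable
  finally show ?thesis .
qed

section \<open>Small tails, and entries that vanish at the sphere\<close>

lemma tail_weight_small:
  fixes b :: "complex^'n::finite \<Rightarrow> ell2 \<Rightarrow>\<^sub>L ell2"
  assumes \<alpha>: "\<alpha> > -1" and e: "orthonormal_basis e" and lin: "\<forall>w\<in>ball 0 1. b w \<in> bounded_clinear_ops"
    and b: "b \<in> Lp_space \<alpha> 1"
    and ii: "(\<lambda>d. Linf_norm \<alpha> (berezin \<alpha> (\<lambda>w. complex_of_real (norm (tail_op e d (b w)))))) \<longlonglongrightarrow> 0"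
    and iii: "(\<lambda>d. Linf_norm \<alpha> (berezin \<alpha> (\<lambda>w. complex_of_real (norm (tail_op e d (hilbert_adjoint (b w))))))) \<longlonglongrightarrow> 0"
    and \<kappa>: "\<kappa> > 0"
  shows "\<exists>d\<ge>1. carleson_weight \<alpha> (\<lambda>w. norm (b w o\<^sub>L tail_proj e d) + norm (tail_proj e d o\<^sub>L b w)) \<kappa>"
proof -
  have \<kappa>2: "(0::ennreal) < ennreal (\<kappa> / 2)" using \<kappa> by simp
  \<comment> \<open>The limits in (ii) and (iii) each supply half of \<kappa>. Positivity of d is
    asked for because (iv) speaks of positive dimensions.\<close>
  obtain d where d: "Linf_norm \<alpha> (berezin \<alpha> (\<lambda>w. complex_of_real (norm (tail_op e d (b w))))) < ennreal (\<kappa> / 2)"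
     "Linf_norm \<alpha> (berezin \<alpha> (\<lambda>w. complex_of_real (norm (tail_op e d (hilbert_adjoint (b w)))))) < ennreal (\<kappa> / 2)" "d \<ge> 1"
    using eventually_happens'[OF sequentially_bot eventually_conj[OF order_tendstoD(2)[OF ii \<kappa>2]
      eventually_conj[OF order_tendstoD(2)[OF iii \<kappa>2] eventually_ge_at_top[of 1]]]] by blast
  let ?P = "tail_proj e d"
  have sm: "strongly_measurable (nu \<alpha>) b" using b by (simp add: Lp_space_def)
  have m1: "(\<lambda>w. norm (b w o\<^sub>L ?P)) \<in> borel_measurable (nu \<alpha>)"
    by (rule strongly_measurable_compose[OF complete_nu[OF \<alpha>] sm])
      (intro continuous_on_norm bounded_bilinear.continuous_on[OF bounded_bilinear_blinfun_compose] continuous_on_id continuous_on_const)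
  have m2: "(\<lambda>w. norm (?P o\<^sub>L b w)) \<in> borel_measurable (nu \<alpha>)"
    by (rule strongly_measurable_compose[OF complete_nu[OF \<alpha>] sm])
      (intro continuous_on_norm bounded_bilinear.continuous_on[OF bounded_bilinear_blinfun_compose] continuous_on_id continuous_on_const)
  have e1: "norm (tail_op e d (b w)) = norm (b w o\<^sub>L ?P)"
    and e2: "norm (tail_op e d (hilbert_adjoint (b w))) = norm (?P o\<^sub>L b w)" if "norm w < 1" for w
    using lin that by (simp_all add: tail_op_eq[OF e] norm_tail_op_adjoint[OF e])
  have b1: "norm (b w o\<^sub>L ?P) \<le> norm (b w)" and b2: "norm (?P o\<^sub>L b w) \<le> norm (b w)" for w
    by (rule order_trans[OF norm_blinfun_compose mult_left_le[OF norm_tail_proj[OF e] norm_ge_zero]])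
      (rule order_trans[OF norm_blinfun_compose mult_left_le_one_le[OF norm_ge_zero norm_ge_zero norm_tail_proj[OF e]]])
  have fin: "(\<integral>\<^sup>+u. ennreal (norm (b u)) \<partial>nu \<alpha>) < \<infinity>" using b by (simp add: Lp_space_def Lp_norm_1)
  have w1: "carleson_weight \<alpha> (\<lambda>w. norm (tail_op e d (b w))) (\<kappa> / 2)"
  proof (rule carleson_weight_Linf[OF \<alpha> _ norm_ge_zero _ _ less_imp_le[OF d(1)]])
    show "(\<lambda>w. norm (tail_op e d (b w))) \<in> borel_measurable (nu \<alpha>)"
      by (rule measurable_cong[THEN iffD1, OF _ m1]) (simp add: e1)
    show "(\<integral>\<^sup>+u. ennreal (norm (tail_op e d (b u))) \<partial>nu \<alpha>) < \<infinity>"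
      by (rule le_less_trans[OF nn_integral_mono fin]) (simp add: e1 b1 ennreal_leI)
  qed (use \<kappa> in simp)
  have w2: "carleson_weight \<alpha> (\<lambda>w. norm (tail_op e d (hilbert_adjoint (b w)))) (\<kappa> / 2)"
  proof (rule carleson_weight_Linf[OF \<alpha> _ norm_ge_zero _ _ less_imp_le[OF d(2)]])
    show "(\<lambda>w. norm (tail_op e d (hilbert_adjoint (b w)))) \<in> borel_measurable (nu \<alpha>)"
      by (rule measurable_cong[THEN iffD1, OF _ m2]) (simp add: e2)
    show "(\<integral>\<^sup>+u. ennreal (norm (tail_op e d (hilbert_adjoint (b u)))) \<partial>nu \<alpha>) < \<infinity>"
      by (rule le_less_trans[OF nn_integral_mono fin]) (simp add: e2 b2 ennreal_leI)
  qed (use \<kappa> in simp)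
  \<comment> \<open>On the ball the two truncated norms are those of the hypotheses. Off the ball,
    where b need not be complex linear, they may differ, which the Carleson integrals do not
    see.\<close>
  have "carleson_weight \<alpha> (\<lambda>w. norm (b w o\<^sub>L ?P) + norm (?P o\<^sub>L b w)) (\<kappa> / 2 + \<kappa> / 2)"
    by (rule carleson_weight_mono[OF carleson_weight_add[OF w1 w2] borel_measurable_add[OF m1 m2]])
      (simp_all add: e1 e2)
  then show ?thesis using d(3) by auto
qed

text \<open>The j-th coordinate of the compressed operator applied to k_z times
  \<open>unit_vec l\<close> is (1-|z|^2)^(N/2) T_a K_z with a the matrix entry for l and j, and a
  coordinate is at most the norm. Squaring the factor gives the power N.\<close>

lemma symbol_kernel_le_L2_toeplitz:
  fixes b :: "complex^'n::finite \<Rightarrow> ell2 \<Rightarrow>\<^sub>L ell2"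
  assumes \<alpha>: "\<alpha> > -1" and e: "orthonormal_basis e" and z: "norm z < 1" and lj: "l < d" "j < d"
    and int: "\<And>l j. integrable (nu \<alpha>) (\<lambda>u. cinner (b u (e l)) (e j))"
  shows "ennreal ((1 - (norm z)\<^sup>2) powr kernel_exp TYPE('n) \<alpha>) * L2_sq \<alpha> (\<lambda>w. symbol_kernel \<alpha> (\<lambda>u. cinner (b u (e l)) (e j)) w z)
    \<le> L2_sq \<alpha> (toeplitz \<alpha> (\<lambda>w. compression e d (b w)) (\<lambda>w. normalized_kernel \<alpha> z w *\<^sub>C unit_vec l))"
proof -
  define a where "a i u = cinner (b u (e l)) (e i)" for i u
  define c where "c = (1 - (norm z)\<^sup>2) powr (kernel_exp TYPE('n) \<alpha> / 2)"
  have c2: "(1 - (norm z)\<^sup>2) powr kernel_exp TYPE('n) \<alpha> = c\<^sup>2"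
    using one_minus_norm_sq_pos[OF z] by (simp add: c_def power2_eq_square powr_add[symmetric])
  have c0: "c \<ge> 0" by (simp add: c_def)
  have ia: "integrable (nu \<alpha>) (\<lambda>u. bergman_kernel \<alpha> z u * a i u)" for i
    unfolding a_def by (rule integrable_bergman_times[OF \<alpha> z int])
  define G where "G u = (\<Sum>i<d. (normalized_kernel \<alpha> z u * a i u) *\<^sub>C unit_vec i)" for u
  have iG: "integrable (nu \<alpha>) G" unfolding G_def
  proof (intro Bochner_Integration.integrable_sum integrable_bounded_linear[OF bounded_linear_scaleC_left])
    fix i show "integrable (nu \<alpha>) (\<lambda>u. normalized_kernel \<alpha> z u * a i u)"
      using integrable_mult_right[OF ia, of "complex_of_real c" i] by (simp add: normalized_kernel_eq c_def mult.assoc)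
  qed
  have eqG: "(\<lambda>w. blinfun_apply (compression e d (b w)) (normalized_kernel \<alpha> z w *\<^sub>C unit_vec l)) = G"
    by (simp add: fun_eq_iff G_def a_def compression_apply[OF e lj(1)])
  obtain H where H: "scalar_holo H" "\<And>w. w \<in> ball 0 1 \<Longrightarrow> H w = symbol_kernel \<alpha> (a j) w z"
    using scalar_holo_symbol_kernel[OF \<alpha> z int[of l j]] unfolding a_def by blast
  have m[measurable]: "(\<lambda>w. symbol_kernel \<alpha> (a j) w z) \<in> borel_measurable (nu \<alpha>)"
    by (rule measurable_cong[THEN iffD1, OF _ scalar_holo_measurable[OF H(1)]]) (simp add: H(2))
  have le: "c * cmod (symbol_kernel \<alpha> (a j) w z) \<le> norm (toeplitz \<alpha> (\<lambda>w. compression e d (b w)) (\<lambda>w. normalized_kernel \<alpha> z w *\<^sub>C unit_vec l) w)"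
    if w: "norm w < 1" for w
  proof -
    have T: "toeplitz \<alpha> (\<lambda>w. compression e d (b w)) (\<lambda>w. normalized_kernel \<alpha> z w *\<^sub>C unit_vec l) w = bergman_proj \<alpha> G w"
      using toeplitz_eq_bergman_proj[OF \<alpha> w, of "\<lambda>w. compression e d (b w)" "\<lambda>w. normalized_kernel \<alpha> z w *\<^sub>C unit_vec l"]
      unfolding eqG using iG by blast
    have Gj: "cinner (cnj (bergman_kernel \<alpha> w u) *\<^sub>C G u) (unit_vec j)
        = complex_of_real c * (cnj (bergman_kernel \<alpha> w u) * (bergman_kernel \<alpha> z u * a j u))" for u
    proof -
      have "cinner (G u) (unit_vec j) = (\<Sum>i<d. if i = j then normalized_kernel \<alpha> z u * a i u else 0)"
        unfolding G_def cinner_sum_left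
        by (intro sum.cong refl) (simp add: cinner_scaleC_left cinner_unit_vec coord_unit_vec scaleC_ell2.rep_eq)
      then show ?thesis using lj(2) by (simp add: cinner_scaleC_left normalized_kernel_eq c_def mult_ac)
    qed
    have "cinner (bergman_proj \<alpha> G w) (unit_vec j) = (LINT u|nu \<alpha>. cinner (cnj (bergman_kernel \<alpha> w u) *\<^sub>C G u) (unit_vec j))"
      unfolding bergman_proj_def
      by (rule integral_bounded_linear[OF bounded_linear_cinner_left integrable_kernel_mult[OF \<alpha> w iG], symmetric])
    also have "\<dots> = complex_of_real c * symbol_kernel \<alpha> (a j) w z"
      unfolding Gj symbol_kernel_def by simp
    finally have "cmod (complex_of_real c * symbol_kernel \<alpha> (a j) w z) \<le> norm (bergman_proj \<alpha> G w)"
      using cinner_norm_le[of "bergman_proj \<alpha> G w" "unit_vec j"] by simp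
    then show ?thesis using c0 by (simp add: T norm_mult)
  qed
  have "ennreal (c\<^sup>2) * L2_sq \<alpha> (\<lambda>w. symbol_kernel \<alpha> (a j) w z)
      = (\<integral>\<^sup>+w. ennreal (c\<^sup>2) * (ennreal (cmod (symbol_kernel \<alpha> (a j) w z)))\<^sup>2 \<partial>nu \<alpha>)"
    unfolding L2_sq_def by (rule nn_integral_cmult[symmetric]) measurable
  also have "\<dots> \<le> L2_sq \<alpha> (toeplitz \<alpha> (\<lambda>w. compression e d (b w)) (\<lambda>w. normalized_kernel \<alpha> z w *\<^sub>C unit_vec l))"
    unfolding L2_sq_def
  proof (rule nn_integral_mono)
    fix w :: "complex^'n" assume "w \<in> space (nu \<alpha>)"
    then have "ennreal (c * cmod (symbol_kernel \<alpha> (a j) w z)) \<le> ennreal (norm (toeplitz \<alpha> (\<lambda>w. compression e d (b w)) (\<lambda>w. normalized_kernel \<alpha> z w *\<^sub>C unit_vec l) w))"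
      by (intro ennreal_leI le) simp
    from power_mono[OF this, of 2]
    show "ennreal (c\<^sup>2) * (ennreal (cmod (symbol_kernel \<alpha> (a j) w z)))\<^sup>2 \<le> (ennreal (norm (toeplitz \<alpha> (\<lambda>w. compression e d (b w)) (\<lambda>w. normalized_kernel \<alpha> z w *\<^sub>C unit_vec l) w)))\<^sup>2"
      using c0 by (simp add: ennreal_mult power_mult_distrib ennreal_power)
  qed
  finally show ?thesis unfolding c2 a_def[abs_def] by simp
qed

text \<open>A supremum of nonnegative limits that equals 0 forces each limit to be 0; the vector
  used is \<open>unit_vec l\<close>. The filter \<open>to_sphere\<close> only looks at the norm, so
  it unfolds into a radius \<rho> that works for all z beyond it.\<close>

lemma entry_vanishes_at_sphere:
  fixes b :: "complex^'n::finite \<Rightarrow> ell2 \<Rightarrow>\<^sub>L ell2"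
  assumes \<alpha>: "\<alpha> > -1" and e: "orthonormal_basis e" and lj: "l < d" "j < d"
    and int: "\<And>l j. integrable (nu \<alpha>) (\<lambda>u. cinner (b u (e l)) (e j))"
    and iv: "\<exists>L :: ell2 \<Rightarrow> ennreal.
        (\<forall>x\<in>{x \<in> complex_space d. norm x = 1}.
          ((\<lambda>z. Lp_norm \<alpha> 2 (toeplitz \<alpha> (\<lambda>w. compression e d (b w)) (\<lambda>w. normalized_kernel \<alpha> z w *\<^sub>C x))) \<longlongrightarrow> L x) to_sphere) \<and>
        (SUP x\<in>{x \<in> complex_space d. norm x = 1}. L x) = 0"
    and \<epsilon>: "\<epsilon> > 0"
  shows "\<exists>\<rho><1. \<forall>z. \<rho> < norm z \<and> norm z < 1 \<longrightarrow>
      ennreal ((1 - (norm z)\<^sup>2) powr kernel_exp TYPE('n) \<alpha>) * L2_sq \<alpha> (\<lambda>w. symbol_kernel \<alpha> (\<lambda>u. cinner (b u (e l)) (e j)) w z) \<le> ennreal \<epsilon>"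
proof -
  obtain L :: "ell2 \<Rightarrow> ennreal" where L: "\<forall>x\<in>{x \<in> complex_space d. norm x = 1}.
          ((\<lambda>z. Lp_norm \<alpha> 2 (toeplitz \<alpha> (\<lambda>w. compression e d (b w)) (\<lambda>w. normalized_kernel \<alpha> z w *\<^sub>C x))) \<longlongrightarrow> L x) to_sphere"
     "(SUP x\<in>{x \<in> complex_space d. norm x = 1}. L x) = 0" using iv by blast
  have x: "unit_vec l \<in> {x \<in> complex_space d. norm x = 1}"
    using lj(1) by (simp add: complex_space_def coord_unit_vec)
  have L0: "L (unit_vec l) = 0" using SUP_upper[OF x, of L] unfolding L(2) by simp
  have "(0::ennreal) < ennreal (sqrt \<epsilon>)" using \<epsilon> by simp
  from order_tendstoD(2)[OF bspec[OF L(1) x, unfolded L0] this]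
  obtain Q where Q: "eventually Q (at_left (1 :: real))" "\<And>z. Q (norm z) \<Longrightarrow>
      Lp_norm \<alpha> 2 (toeplitz \<alpha> (\<lambda>w. compression e d (b w)) (\<lambda>w. normalized_kernel \<alpha> z w *\<^sub>C unit_vec l)) < ennreal (sqrt \<epsilon>)"
    unfolding to_sphere_def eventually_filtercomap by blast
  obtain \<rho> where \<rho>: "\<rho> < 1" "\<And>y. \<rho> < y \<Longrightarrow> y < 1 \<Longrightarrow> Q y"
    using Q(1) unfolding eventually_at_left_field by blast
  have "L2_sq \<alpha> (toeplitz \<alpha> (\<lambda>w. compression e d (b w)) (\<lambda>w. normalized_kernel \<alpha> z w *\<^sub>C unit_vec l)) \<le> ennreal \<epsilon>"
    if "\<rho> < norm z" "norm z < 1" for z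
  proof -
    have "Lp_norm \<alpha> 2 (toeplitz \<alpha> (\<lambda>w. compression e d (b w)) (\<lambda>w. normalized_kernel \<alpha> z w *\<^sub>C unit_vec l)) \<le> ennreal (sqrt \<epsilon>)"
      by (rule less_imp_le[OF Q(2)[OF \<rho>(2)[OF that]]])
    then show ?thesis using \<epsilon> by (subst (asm) Lp_norm_2_le) auto
  qed
  then show ?thesis
    by (intro exI[of _ \<rho>] conjI allI impI \<rho>(1) order_trans[OF symbol_kernel_le_L2_toeplitz[OF \<alpha> e _ lj int]]) auto
qed

text \<open>This bound holds on the whole ball and serves for z in an inner ball, while
  \<open>symbol_kernel_small\<close> takes over near the sphere.\<close>

lemma symbol_kernel_bound:
  assumes \<alpha>: "\<alpha> > -1"
  shows "\<exists>C\<ge>0. \<forall>(a :: complex^'n::finite \<Rightarrow> complex) B w z. carleson_weight \<alpha> (\<lambda>u. cmod (a u)) B \<and> norm w < 1 \<and> norm z < 1 \<longrightarrow>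
     cmod (symbol_kernel \<alpha> a w z) \<le> C * B * Qker \<alpha> (schur_exp \<alpha>) w z"
proof -
  obtain C where C: "C \<ge> 0" "\<And>(\<beta> :: complex^'n \<Rightarrow> real) B w z. carleson_weight \<alpha> \<beta> B \<and> norm w < 1 \<and> norm z < 1 \<Longrightarrow>
    (\<integral>\<^sup>+u. ennreal (\<beta> u) * ennreal (cmod (bergman_kernel \<alpha> z u) * cmod (bergman_kernel \<alpha> w u)) \<partial>nu \<alpha>)
      \<le> ennreal (C * B * Qker \<alpha> (schur_exp \<alpha>) w z)"
    using carleson_kernel[OF \<alpha> schur_exp(1)[OF \<alpha>] schur_exp(4)[OF \<alpha>]] by blast
  have "cmod (symbol_kernel \<alpha> a w z) \<le> C * B * Qker \<alpha> (schur_exp \<alpha>) w z"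
    if h: "carleson_weight \<alpha> (\<lambda>u. cmod (a u)) B \<and> norm w < 1 \<and> norm z < 1" for a :: "complex^'n \<Rightarrow> complex" and B w z
  proof -
    have "ennreal (cmod (symbol_kernel \<alpha> a w z)) \<le> (\<integral>\<^sup>+u. ennreal (cmod (cnj (bergman_kernel \<alpha> w u) * (bergman_kernel \<alpha> z u * a u))) \<partial>nu \<alpha>)"
      unfolding symbol_kernel_def by (rule ennreal_norm_integral_le)
    also have "\<dots> = (\<integral>\<^sup>+u. ennreal (cmod (a u)) * ennreal (cmod (bergman_kernel \<alpha> z u) * cmod (bergman_kernel \<alpha> w u)) \<partial>nu \<alpha>)"
      by (intro nn_integral_cong) (simp add: norm_mult ennreal_mult[symmetric] mult_ac)
    also have "\<dots> \<le> ennreal (C * B * Qker \<alpha> (schur_exp \<alpha>) w z)" by (rule C(2)[OF h])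
    finally show ?thesis using C(1) h by (subst (asm) ennreal_le_iff) (auto simp: carleson_weight_def)
  qed
  then show ?thesis using C(1) by blast
qed

lemma small_factor: "c \<ge> 0 \<Longrightarrow> t > 0 \<Longrightarrow> \<exists>\<delta>>0. c * \<delta> \<le> (t::real)"
  by (intro exI[of _ "t / (c + 1)"]) (auto simp: field_simps)

text \<open>The kernel constant \<phi> is A for |z| <= \<rho> and sqrt t outside. The outer part is
  small because the norms of the differences are bounded, the inner part because the coordinate
  functions are Cauchy in L2 of the inner ball.\<close>

lemma entry_operator_cauchy:
  fixes h :: "nat \<Rightarrow> complex^'n::finite \<Rightarrow> ell2" and a :: "complex^'n \<Rightarrow> complex"
  assumes \<alpha>: "\<alpha> > -1" and a: "integrable (nu \<alpha>) a" and cw: "carleson_weight \<alpha> (\<lambda>u. cmod (a u)) B"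
    and small: "\<And>\<epsilon>. \<epsilon> > 0 \<Longrightarrow> \<exists>\<rho><1. \<forall>z. \<rho> < norm z \<and> norm z < 1 \<longrightarrow>
      ennreal ((1 - (norm z)\<^sup>2) powr kernel_exp TYPE('n) \<alpha>) * L2_sq \<alpha> (\<lambda>w. symbol_kernel \<alpha> a w z) \<le> ennreal \<epsilon>"
    and h: "\<And>k. h k \<in> Ap_space \<alpha> 2" and C: "C \<ge> 0" "\<And>k. L2_sq \<alpha> (h k) \<le> ennreal C"
    and y: "norm y = 1" and conv: "\<And>z. norm z < 1 \<Longrightarrow> convergent (\<lambda>k. cinner (h k z) y)"
    and \<epsilon>: "\<epsilon> > 0"
  shows "\<exists>K. \<forall>k\<ge>K. \<forall>m\<ge>K. L2_sq \<alpha> (\<lambda>w. LINT u|nu \<alpha>. cnj (bergman_kernel \<alpha> w u) * (a u * cinner (h k u - h m u) y)) \<le> ennreal \<epsilon>"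
proof -
  obtain C1 where C1: "C1 \<ge> 0" "\<And>w z. norm w < 1 \<Longrightarrow> norm z < 1 \<Longrightarrow> cmod (symbol_kernel \<alpha> a w z) \<le> C1 * B * Qker \<alpha> (schur_exp \<alpha>) w z"
  proof -
    obtain C1 where "C1 \<ge> 0" "\<And>(a :: complex^'n \<Rightarrow> complex) B w z. carleson_weight \<alpha> (\<lambda>u. cmod (a u)) B \<and> norm w < 1 \<and> norm z < 1 \<Longrightarrow>
      cmod (symbol_kernel \<alpha> a w z) \<le> C1 * B * Qker \<alpha> (schur_exp \<alpha>) w z"
      using symbol_kernel_bound[OF \<alpha>, where 'n='n] by blast
    then show ?thesis using cw by (intro that[of C1]) auto
  qed
  obtain E where E: "E \<ge> 0" "\<And>(a :: complex^'n \<Rightarrow> complex) B F \<phi>. integrable (nu \<alpha>) a \<and> carleson_weight \<alpha> (\<lambda>u. cmod (a u)) B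
     \<and> scalar_holo F \<and> L2_sq \<alpha> F < \<infinity> \<and> \<phi> \<in> borel_measurable borel \<and> (\<forall>z. \<phi> z \<ge> 0)
     \<and> (\<forall>w\<in>ball 0 1. \<forall>z\<in>ball 0 1. cmod (symbol_kernel \<alpha> a w z) \<le> \<phi> z * Qker \<alpha> (schur_exp \<alpha>) w z) \<Longrightarrow>
     L2_sq \<alpha> (\<lambda>w. LINT u|nu \<alpha>. cnj (bergman_kernel \<alpha> w u) * (a u * F u))
       \<le> ennreal (E\<^sup>2) * (\<integral>\<^sup>+z. (ennreal (\<phi> z * cmod (F z)))\<^sup>2 \<partial>nu \<alpha>)"
    using entry_operator_bound[OF \<alpha>, where 'n='n] by blast
  define A where "A = C1 * B"
  have A: "A \<ge> 0" using C1(1) cw by (simp add: A_def carleson_weight_def)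
  \<comment> \<open>Each of the two contributions gets \<epsilon>/2. The number 4C bounds the
    squared norm of a difference of two members of the sequence, and t is the square of the kernel
    constant used outside.\<close>
  obtain t where t: "t > 0" "E\<^sup>2 * (4 * C) * t \<le> \<epsilon> / 2"
    using small_factor[of "E\<^sup>2 * (4 * C)" "\<epsilon> / 2"] C(1) \<epsilon> by auto
  obtain \<delta> where \<delta>: "\<delta> > 0" "E\<^sup>2 * A\<^sup>2 * \<delta> \<le> \<epsilon> / 2"
    using small_factor[of "E\<^sup>2 * A\<^sup>2" "\<epsilon> / 2"] \<epsilon> by auto
  have st: "sqrt t > 0" using t by simp
  obtain \<rho> where \<rho>: "\<rho> < 1" "\<And>w z. norm w < 1 \<Longrightarrow> \<rho> < norm z \<Longrightarrow> norm z < 1 \<Longrightarrow>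
      cmod (symbol_kernel \<alpha> a w z) \<le> sqrt t * Qker \<alpha> (schur_exp \<alpha>) w z"
    using symbol_kernel_small[OF \<alpha> a cw small st] by blast
  obtain K where K: "\<And>k m. k \<ge> K \<Longrightarrow> m \<ge> K \<Longrightarrow>
     (\<integral>\<^sup>+z. indicator {z. norm z \<le> \<rho>} z * (ennreal (cmod (cinner (h k z - h m z) y)))\<^sup>2 \<partial>nu \<alpha>) \<le> ennreal \<delta>"
    using local_cauchy[OF \<alpha> h C y conv \<rho>(1) \<delta>(1)] by blast
  define \<phi> where "\<phi> z = (if norm z \<le> \<rho> then A else sqrt t)" for z :: "complex^'n"
  have \<phi>m: "\<phi> \<in> borel_measurable borel" unfolding \<phi>_def by measurable
  have "L2_sq \<alpha> (\<lambda>w. LINT u|nu \<alpha>. cnj (bergman_kernel \<alpha> w u) * (a u * cinner (h k u - h m u) y)) \<le> ennreal \<epsilon>"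
    if km: "k \<ge> K" "m \<ge> K" for k m
  proof -
    define F where "F z = cinner (h k z - h m z) y" for z
    have D: "(\<lambda>z. h k z - h m z) \<in> Ap_space \<alpha> 2" by (rule Ap_diff(1)[OF \<alpha> h h])
    have Fh: "scalar_holo F" unfolding F_def
      using D by (intro scalar_holo_cinner) (simp add: Ap_space_def)
    have Fm[measurable]: "F \<in> borel_measurable (nu \<alpha>)" by (rule scalar_holo_measurable[OF Fh])
    have Fle: "cmod (F z) \<le> norm (h k z - h m z)" for z
      using cinner_norm_le[of "h k z - h m z" y] y by (simp add: F_def)
    have "L2_sq \<alpha> F \<le> L2_sq \<alpha> (\<lambda>z. h k z - h m z)"
      unfolding L2_sq_def by (intro nn_integral_mono power_mono ennreal_leI Fle) simp
    also have "\<dots> \<le> 2 * L2_sq \<alpha> (h k) + 2 * L2_sq \<alpha> (h m)" by (rule Ap_diff(2)[OF \<alpha> h h])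
    also have "\<dots> \<le> 2 * ennreal C + 2 * ennreal C" by (intro add_mono mult_left_mono C) auto
    also have "\<dots> = ennreal 4 * ennreal C" using distrib_right[of 2 2 "ennreal C"] by simp
    also have "\<dots> = ennreal (4 * C)" by (rule ennreal_mult[symmetric]) (use C in auto)
    finally have FL: "L2_sq \<alpha> F \<le> ennreal (4 * C)" .
    have "(\<integral>\<^sup>+z. (ennreal (\<phi> z * cmod (F z)))\<^sup>2 \<partial>nu \<alpha>)
       \<le> (\<integral>\<^sup>+z. ennreal (A\<^sup>2) * (indicator {z. norm z \<le> \<rho>} z * (ennreal (cmod (F z)))\<^sup>2) + ennreal t * (ennreal (cmod (F z)))\<^sup>2 \<partial>nu \<alpha>)"
    proof (rule nn_integral_mono)
      fix z :: "complex^'n"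
      have "(ennreal (\<phi> z * cmod (F z)))\<^sup>2 = ennreal ((\<phi> z)\<^sup>2) * (ennreal (cmod (F z)))\<^sup>2"
        using A t(1) by (simp add: \<phi>_def ennreal_mult power_mult_distrib ennreal_power)
      then show "(ennreal (\<phi> z * cmod (F z)))\<^sup>2 \<le> ennreal (A\<^sup>2) * (indicator {z. norm z \<le> \<rho>} z * (ennreal (cmod (F z)))\<^sup>2) + ennreal t * (ennreal (cmod (F z)))\<^sup>2"
        using t(1) by (cases "norm z \<le> \<rho>") (auto simp: \<phi>_def indicator_def intro: add_increasing2)
    qed
    also have "\<dots> = ennreal (A\<^sup>2) * (\<integral>\<^sup>+z. indicator {z. norm z \<le> \<rho>} z * (ennreal (cmod (F z)))\<^sup>2 \<partial>nu \<alpha>) + ennreal t * L2_sq \<alpha> F"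
    proof -
      have [measurable]: "(\<lambda>z. indicator {z. norm z \<le> \<rho>} z :: ennreal) \<in> borel_measurable (nu \<alpha> :: (complex^'n) measure)"
        by (rule measurable_nu_borel) measurable
      have i1: "(\<integral>\<^sup>+z. ennreal (A\<^sup>2) * (indicator {z. norm z \<le> \<rho>} z * (ennreal (cmod (F z)))\<^sup>2) \<partial>nu \<alpha>)
          = ennreal (A\<^sup>2) * (\<integral>\<^sup>+z. indicator {z. norm z \<le> \<rho>} z * (ennreal (cmod (F z)))\<^sup>2 \<partial>nu \<alpha>)"
        by (rule nn_integral_cmult) measurable
      have i2: "(\<integral>\<^sup>+z. ennreal t * (ennreal (cmod (F z)))\<^sup>2 \<partial>nu \<alpha>) = ennreal t * (\<integral>\<^sup>+z. (ennreal (cmod (F z)))\<^sup>2 \<partial>nu \<alpha>)"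
        by (rule nn_integral_cmult) measurable
      show ?thesis unfolding L2_sq_def i1[symmetric] i2[symmetric] by (rule nn_integral_add) measurable
    qed
    also have "\<dots> \<le> ennreal (A\<^sup>2) * ennreal \<delta> + ennreal t * ennreal (4 * C)"
      using K[OF km] FL by (intro add_mono mult_left_mono) (auto simp: F_def)
    also have "\<dots> = ennreal (A\<^sup>2 * \<delta> + t * (4 * C))"
      by (subst ennreal_plus) (use A \<delta>(1) t(1) C(1) in \<open>simp_all add: ennreal_mult'\<close>)
    finally have I: "(\<integral>\<^sup>+z. (ennreal (\<phi> z * cmod (F z)))\<^sup>2 \<partial>nu \<alpha>) \<le> ennreal (A\<^sup>2 * \<delta> + t * (4 * C))" .
    have "L2_sq \<alpha> (\<lambda>w. LINT u|nu \<alpha>. cnj (bergman_kernel \<alpha> w u) * (a u * F u)) \<le> ennreal (E\<^sup>2) * (\<integral>\<^sup>+z. (ennreal (\<phi> z * cmod (F z)))\<^sup>2 \<partial>nu \<alpha>)"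
    proof (rule E(2)[of a B F \<phi>], intro conjI a cw Fh \<phi>m)
      show "L2_sq \<alpha> F < \<infinity>" using FL by (rule le_less_trans) simp
      show "\<forall>z. \<phi> z \<ge> 0" using A st by (simp add: \<phi>_def)
      show "\<forall>w\<in>ball 0 1. \<forall>z\<in>ball 0 1. cmod (symbol_kernel \<alpha> a w z) \<le> \<phi> z * Qker \<alpha> (schur_exp \<alpha>) w z"
        using C1(2) \<rho>(2) by (auto simp: \<phi>_def A_def)
    qed
    also have "\<dots> \<le> ennreal (E\<^sup>2) * ennreal (A\<^sup>2 * \<delta> + t * (4 * C))" by (intro mult_left_mono I) auto
    also have "\<dots> = ennreal (E\<^sup>2 * (A\<^sup>2 * \<delta> + t * (4 * C)))"
      by (rule ennreal_mult[symmetric]) (use A \<delta>(1) t(1) C(1) in auto)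
    also have "\<dots> \<le> ennreal \<epsilon>"
    proof (rule ennreal_leI)
      have "E\<^sup>2 * (A\<^sup>2 * \<delta> + t * (4 * C)) = E\<^sup>2 * A\<^sup>2 * \<delta> + E\<^sup>2 * (4 * C) * t" by (simp add: algebra_simps)
      then show "E\<^sup>2 * (A\<^sup>2 * \<delta> + t * (4 * C)) \<le> \<epsilon>" using \<delta>(2) t(2) by linarith
    qed
    finally show ?thesis by (simp add: F_def)
  qed
  then show ?thesis by blast
qed

lemma bergman_proj_diff:
  assumes \<alpha>: "\<alpha> > -1" and z: "norm z < 1" and "integrable (nu \<alpha>) G" "integrable (nu \<alpha>) H"
  shows "bergman_proj \<alpha> (\<lambda>u. G u - H u) z = bergman_proj \<alpha> G z - bergman_proj \<alpha> H z"
  unfolding bergman_proj_def bounded_bilinear.diff_right[OF bounded_bilinear_scaleC]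
  by (rule Bochner_Integration.integral_diff[OF integrable_kernel_mult[OF \<alpha> z assms(3)] integrable_kernel_mult[OF \<alpha> z assms(4)]])

lemma bergman_proj_sum:
  assumes \<alpha>: "\<alpha> > -1" and z: "norm z < 1" and "\<And>i. i \<in> I \<Longrightarrow> integrable (nu \<alpha>) (G i)"
  shows "bergman_proj \<alpha> (\<lambda>u. \<Sum>i\<in>I. G i u) z = (\<Sum>i\<in>I. bergman_proj \<alpha> (G i) z)"
  unfolding bergman_proj_def bounded_bilinear.sum_right[OF bounded_bilinear_scaleC]
  by (rule Bochner_Integration.integral_sum) (rule integrable_kernel_mult[OF \<alpha> z assms(3)])

section \<open>Compactness\<close>

text \<open>The symbol applied to F = h k - h m splits into the d * d matrix entries G i and the
  remainder R of a compression. R is dominated by the tail weight times |F|, so its projection is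
  small because norms are linear in the bound of the weight; the entries are handled by
  \<open>entry_operator_cauchy\<close>.\<close>

lemma toeplitz_image_cauchy:
  fixes b :: "complex^'n::finite \<Rightarrow> ell2 \<Rightarrow>\<^sub>L ell2" and h :: "nat \<Rightarrow> complex^'n \<Rightarrow> ell2"
  assumes \<alpha>: "\<alpha> > -1" and e: "orthonormal_basis e" and lin: "\<forall>w\<in>ball 0 1. b w \<in> bounded_clinear_ops"
    and b: "b \<in> Lp_space \<alpha> 1" and cw: "carleson_weight \<alpha> (\<lambda>u. norm (b u)) B"
    and ii: "(\<lambda>d. Linf_norm \<alpha> (berezin \<alpha> (\<lambda>w. complex_of_real (norm (tail_op e d (b w)))))) \<longlonglongrightarrow> 0"
    and iii: "(\<lambda>d. Linf_norm \<alpha> (berezin \<alpha> (\<lambda>w. complex_of_real (norm (tail_op e d (hilbert_adjoint (b w))))))) \<longlonglongrightarrow> 0"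
    and iv: "\<forall>d\<ge>1. \<exists>L :: ell2 \<Rightarrow> ennreal.
        (\<forall>x\<in>{x \<in> complex_space d. norm x = 1}.
          ((\<lambda>z. Lp_norm \<alpha> 2 (toeplitz \<alpha> (\<lambda>w. compression e d (b w)) (\<lambda>w. normalized_kernel \<alpha> z w *\<^sub>C x))) \<longlongrightarrow> L x) to_sphere) \<and>
        (SUP x\<in>{x \<in> complex_space d. norm x = 1}. L x) = 0"
    and h: "\<And>k. h k \<in> Ap_space \<alpha> 2" and C: "C \<ge> 0" "\<And>k. L2_sq \<alpha> (h k) \<le> ennreal C"
    and conv: "\<And>z l. norm z < 1 \<Longrightarrow> convergent (\<lambda>k. cinner (h k z) (e l))"
    and \<epsilon>: "\<epsilon> > 0"
  shows "\<exists>K. \<forall>k\<ge>K. \<forall>m\<ge>K. L2_sq \<alpha> (\<lambda>z. toeplitz \<alpha> b (h k) z - toeplitz \<alpha> b (h m) z) \<le> ennreal \<epsilon>"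
proof -
  have sm: "strongly_measurable (nu \<alpha>) b" using b by (simp add: Lp_space_def)
  note M = strongly_measurable_blinfun_apply[OF complete_nu[OF \<alpha>] sm]
  have fin: "(\<integral>\<^sup>+u. ennreal (norm (b u)) \<partial>nu \<alpha>) < \<infinity>" using b by (simp add: Lp_space_def Lp_norm_1)
  define a where "a i u = cinner (blinfun_apply (b u) (e (snd i))) (e (fst i))" for i :: "nat \<times> nat" and u
  have am[measurable]: "a i \<in> borel_measurable (nu \<alpha>)" for i
    unfolding a_def[abs_def] by (intro measurable_cinner M borel_measurable_const)
  have ab: "cmod (a i u) \<le> norm (b u)" for i u
  proof -
    have "cmod (a i u) \<le> norm (blinfun_apply (b u) (e (snd i))) * norm (e (fst i))"
      unfolding a_def by (rule cinner_norm_le)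
    also have "\<dots> \<le> norm (b u) * norm (e (snd i)) * norm (e (fst i))"
      by (intro mult_right_mono norm_blinfun) simp
    finally show ?thesis by (simp add: norm_e[OF e])
  qed
  have ia: "integrable (nu \<alpha>) (a i)" for i
  proof (rule integrableI_bounded[OF am])
    show "(\<integral>\<^sup>+u. ennreal (norm (a i u)) \<partial>nu \<alpha>) < \<infinity>"
      by (rule le_less_trans[OF nn_integral_mono fin]) (simp add: ab ennreal_leI)
  qed
  have aw: "carleson_weight \<alpha> (\<lambda>u. cmod (a i u)) B" for i
    by (rule carleson_weight_mono[OF cw measurable_compose[OF am borel_measurable_norm] norm_ge_zero ab])
  obtain P where P: "P \<ge> 0" "\<And>(\<beta> :: complex^'n \<Rightarrow> real) B f G. carleson_weight \<alpha> \<beta> B \<and> f \<in> Ap_space \<alpha> 2 \<and> G \<in> borel_measurable (nu \<alpha>)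
      \<and> (\<forall>w\<in>ball 0 1. norm (G w) \<le> \<beta> w * norm (f w :: ell2)) \<Longrightarrow>
      integrable (nu \<alpha>) G \<and> bergman_proj \<alpha> G \<in> Ap_space \<alpha> 2 \<and> L2_sq \<alpha> (bergman_proj \<alpha> G) \<le> ennreal ((P * B)\<^sup>2) * L2_sq \<alpha> f"
    using bergman_proj_bound[OF \<alpha>, where 'n='n] by blast
  \<comment> \<open>The tail weight will have bound sqrt s, so the squared norm of the projection of
    R is at most P^2 s times 4C; the leading factor 2 comes from
    \<open>L2_sq_add_le\<close>.\<close>
  obtain s where s: "s > 0" "2 * P\<^sup>2 * (4 * C) * s \<le> \<epsilon> / 2"
    using small_factor[of "2 * P\<^sup>2 * (4 * C)" "\<epsilon> / 2"] C(1) \<epsilon> by auto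
  have s': "sqrt s > 0" using s by simp
  obtain d where d: "d \<ge> 1" "carleson_weight \<alpha> (\<lambda>w. norm (b w o\<^sub>L tail_proj e d) + norm (tail_proj e d o\<^sub>L b w)) (sqrt s)"
    using tail_weight_small[OF \<alpha> e lin b ii iii s'] by blast
  define I where "I = {..<d} \<times> {..<d}"
  have fI: "finite I" by (simp add: I_def)
  define D where "D = real (card I)"
  \<comment> \<open>One factor D counts the summands, the other is the loss in
    \<open>L2_sq_sum\<close>; the 2 again comes from \<open>L2_sq_add_le\<close>.\<close>
  obtain \<epsilon>' where \<epsilon>': "\<epsilon>' > 0" "2 * (D * D) * \<epsilon>' \<le> \<epsilon> / 2"
    using small_factor[of "2 * (D * D)" "\<epsilon> / 2"] \<epsilon> by (auto simp: D_def)
  have "\<forall>i\<in>I. \<exists>K. \<forall>k\<ge>K. \<forall>m\<ge>K. L2_sq \<alpha> (\<lambda>w. LINT u|nu \<alpha>. cnj (bergman_kernel \<alpha> w u) * (a i u * cinner (h k u - h m u) (e (snd i)))) \<le> ennreal \<epsilon>'"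
  proof
    fix i assume i: "i \<in> I"
    have int: "integrable (nu \<alpha>) (\<lambda>u. cinner (blinfun_apply (b u) (e l)) (e j))" for l j
      using ia[of "(j, l)"] by (simp add: a_def[abs_def])
    have small: "\<exists>\<rho><1. \<forall>z. \<rho> < norm z \<and> norm z < 1 \<longrightarrow>
      ennreal ((1 - (norm z)\<^sup>2) powr kernel_exp TYPE('n) \<alpha>) * L2_sq \<alpha> (\<lambda>w. symbol_kernel \<alpha> (a i) w z) \<le> ennreal \<eta>" if "\<eta> > 0" for \<eta>
      unfolding a_def[abs_def]
      by (rule entry_vanishes_at_sphere[OF \<alpha> e _ _ int iv[rule_format, OF d(1)] that]) (use i in \<open>auto simp: I_def\<close>)
    show "\<exists>K. \<forall>k\<ge>K. \<forall>m\<ge>K. L2_sq \<alpha> (\<lambda>w. LINT u|nu \<alpha>. cnj (bergman_kernel \<alpha> w u) * (a i u * cinner (h k u - h m u) (e (snd i)))) \<le> ennreal \<epsilon>'"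
      by (rule entry_operator_cauchy[OF \<alpha> ia aw small h C norm_e[OF e] conv \<epsilon>'(1)])
  qed
  from bchoice[OF this] obtain K where K: "\<forall>i\<in>I. \<forall>k\<ge>K i. \<forall>m\<ge>K i. L2_sq \<alpha> (\<lambda>w. LINT u|nu \<alpha>. cnj (bergman_kernel \<alpha> w u) * (a i u * cinner (h k u - h m u) (e (snd i)))) \<le> ennreal \<epsilon>'"
    by blast
  \<comment> \<open>The indices are natural numbers, so their sum bounds each of them and serves as
    a common index.\<close>
  have K0: "K i \<le> sum K I" if "i \<in> I" for i by (rule member_le_sum[OF that _ fI]) simp
  have "L2_sq \<alpha> (\<lambda>z. toeplitz \<alpha> b (h k) z - toeplitz \<alpha> b (h m) z) \<le> ennreal \<epsilon>"
    if k: "k \<ge> sum K I" and m: "m \<ge> sum K I" for k m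
  proof -
    define F where "F u = h k u - h m u" for u
    have FA: "F \<in> Ap_space \<alpha> 2" unfolding F_def[abs_def] by (rule Ap_diff(1)[OF \<alpha> h h])
    have Fm[measurable]: "F \<in> borel_measurable (nu \<alpha>)" by (rule Ap_measurable[OF \<alpha> FA])
    have "L2_sq \<alpha> F \<le> 2 * L2_sq \<alpha> (h k) + 2 * L2_sq \<alpha> (h m)" unfolding F_def[abs_def] by (rule Ap_diff(2)[OF \<alpha> h h])
    also have "\<dots> \<le> 2 * ennreal C + 2 * ennreal C" by (intro add_mono mult_left_mono C) auto
    also have "\<dots> = ennreal 4 * ennreal C" using distrib_right[of 2 2 "ennreal C"] by simp
    also have "\<dots> = ennreal (4 * C)" by (rule ennreal_mult[symmetric]) (use C in auto)
    finally have FL: "L2_sq \<alpha> F \<le> ennreal (4 * C)" .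
    note int = toeplitz_extension_self(2)[OF \<alpha> sm lin cw]
    define G where "G i u = (a i u * cinner (F u) (e (snd i))) *\<^sub>C e (fst i)" for i u
    have Gm[measurable]: "G i \<in> borel_measurable (nu \<alpha>)" for i unfolding G_def[abs_def] by measurable
    have Gb: "norm (G i u) \<le> norm (b u) * norm (F u)" for i u
      using mult_mono[OF ab cinner_norm_le[of "F u" "e (snd i)"] norm_ge_zero norm_ge_zero]
      by (simp add: G_def norm_scaleC norm_mult norm_e[OF e])
    have PG: "integrable (nu \<alpha>) (G i)" "bergman_proj \<alpha> (G i) \<in> Ap_space \<alpha> 2" for i
      using P(2)[of "\<lambda>u. norm (b u)" B F "G i"] cw FA Gm Gb by simp_all
    define R where "R u = blinfun_apply (b u) (F u) - (\<Sum>i\<in>I. G i u)" for u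
    have Rm: "R \<in> borel_measurable (nu \<alpha>)" unfolding R_def[abs_def]
      by (intro borel_measurable_diff M Fm borel_measurable_sum Gm)
    have Rb: "norm (R u) \<le> (norm (b u o\<^sub>L tail_proj e d) + norm (tail_proj e d o\<^sub>L b u)) * norm (F u)" if "u \<in> ball 0 1" for u
    proof -
      have bu: "b u \<in> bounded_clinear_ops" using lin that by blast
      have "(\<Sum>i\<in>I. G i u) = head_proj e d (blinfun_apply (b u) (head_proj e d (F u)))"
        unfolding head_proj_compress[OF e bu] I_def G_def a_def
        by (simp add: sum.cartesian_product split_beta)
      then show ?thesis unfolding R_def using compression_error[OF e, of "b u" "F u" d] by simp
    qed
    have PR: "integrable (nu \<alpha>) R" "bergman_proj \<alpha> R \<in> Ap_space \<alpha> 2"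
      "L2_sq \<alpha> (bergman_proj \<alpha> R) \<le> ennreal ((P * sqrt s)\<^sup>2) * L2_sq \<alpha> F"
      using P(2)[OF conjI[OF d(2) conjI[OF FA conjI[OF Rm ballI[OF Rb]]]]] by simp_all
    have eqT: "toeplitz \<alpha> b (h k) w - toeplitz \<alpha> b (h m) w = bergman_proj \<alpha> R w + (\<Sum>i\<in>I. bergman_proj \<alpha> (G i) w)"
      if w: "norm w < 1" for w
    proof -
      have "bergman_proj \<alpha> R w = bergman_proj \<alpha> (\<lambda>u. blinfun_apply (b u) (F u)) w - bergman_proj \<alpha> (\<lambda>u. \<Sum>i\<in>I. G i u) w"
        unfolding R_def[abs_def]
        by (intro bergman_proj_diff[OF \<alpha> w] int[OF FA] Bochner_Integration.integrable_sum PG(1))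
      moreover have "bergman_proj \<alpha> (\<lambda>u. \<Sum>i\<in>I. G i u) w = (\<Sum>i\<in>I. bergman_proj \<alpha> (G i) w)"
        by (rule bergman_proj_sum[OF \<alpha> w PG(1)])
      moreover have "bergman_proj \<alpha> (\<lambda>u. blinfun_apply (b u) (F u)) w
          = bergman_proj \<alpha> (\<lambda>u. blinfun_apply (b u) (h k u)) w - bergman_proj \<alpha> (\<lambda>u. blinfun_apply (b u) (h m u)) w"
        unfolding F_def blinfun.diff_right by (rule bergman_proj_diff[OF \<alpha> w int[OF h] int[OF h]])
      ultimately show ?thesis
        by (simp add: toeplitz_eq_bergman_proj[OF \<alpha> w int[OF h]])
    qed
    \<comment> \<open>As G i points along the fixed unit vector \<open>e (fst i)\<close>, the norm
      of its projection is the modulus of the scalar entry operator.\<close>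
    have LG: "L2_sq \<alpha> (bergman_proj \<alpha> (G i)) \<le> ennreal \<epsilon>'" if i: "i \<in> I" for i
    proof -
      have "norm (bergman_proj \<alpha> (G i) w) = norm (LINT u|nu \<alpha>. cnj (bergman_kernel \<alpha> w u) * (a i u * cinner (F u) (e (snd i))))"
        if w: "norm w < 1" for w
      proof -
        have intf: "integrable (nu \<alpha>) (\<lambda>u. cnj (bergman_kernel \<alpha> w u) * (a i u * cinner (F u) (e (snd i))))"
          using integrable_bounded_linear[OF bounded_linear_cinner_left[of "e (fst i)"] integrable_kernel_mult[OF \<alpha> w PG(1)[of i]]]
          by (simp add: G_def cinner_scaleC_left e_inner[OF e])
        have "bergman_proj \<alpha> (G i) w = (LINT u|nu \<alpha>. cnj (bergman_kernel \<alpha> w u) * (a i u * cinner (F u) (e (snd i)))) *\<^sub>C e (fst i)"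
          unfolding bergman_proj_def G_def scaleC_scaleC
          by (rule integral_bounded_linear[OF bounded_linear_scaleC_left intf])
        then show ?thesis by (simp add: norm_scaleC norm_e[OF e])
      qed
      from L2_sq_cong[OF this]
      have "L2_sq \<alpha> (bergman_proj \<alpha> (G i)) = L2_sq \<alpha> (\<lambda>w. LINT u|nu \<alpha>. cnj (bergman_kernel \<alpha> w u) * (a i u * cinner (F u) (e (snd i))))" .
      then show ?thesis using K i order_trans[OF K0[OF i] k] order_trans[OF K0[OF i] m] by (simp add: F_def)
    qed
    have PGm: "bergman_proj \<alpha> (G i) \<in> borel_measurable (nu \<alpha>)" for i by (rule Ap_measurable[OF \<alpha> PG(2)])
    have t: "2 * (ennreal x * ennreal y) = ennreal (2 * (x * y))" if "x \<ge> 0" "y \<ge> 0" for x y :: real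
    proof -
      have "ennreal (2 * (x * y)) = ennreal 2 * (ennreal x * ennreal y)"
        using that ennreal_mult[of 2 "x * y"] ennreal_mult[of x y] by simp
      then show ?thesis by simp
    qed
    have "L2_sq \<alpha> (\<lambda>z. toeplitz \<alpha> b (h k) z - toeplitz \<alpha> b (h m) z)
        \<le> 2 * L2_sq \<alpha> (bergman_proj \<alpha> R) + 2 * L2_sq \<alpha> (\<lambda>w. \<Sum>i\<in>I. bergman_proj \<alpha> (G i) w)"
      by (rule L2_sq_add_le[OF Ap_measurable[OF \<alpha> PR(2)] borel_measurable_sum[OF PGm]])
        (simp add: eqT norm_triangle_ineq)
    also have "\<dots> \<le> 2 * (ennreal ((P * sqrt s)\<^sup>2) * ennreal (4 * C)) + 2 * (ennreal D * ennreal (D * \<epsilon>'))"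
    proof (intro add_mono mult_left_mono)
      show "L2_sq \<alpha> (bergman_proj \<alpha> R) \<le> ennreal ((P * sqrt s)\<^sup>2) * ennreal (4 * C)"
        by (rule order_trans[OF PR(3) mult_left_mono[OF FL]]) simp
      have "(\<Sum>i\<in>I. L2_sq \<alpha> (bergman_proj \<alpha> (G i))) \<le> (\<Sum>i\<in>I. ennreal \<epsilon>')" by (rule sum_mono[OF LG])
      also have "\<dots> = ennreal (\<Sum>i\<in>I. \<epsilon>')" by (rule sum_ennreal) (use \<epsilon>'(1) in simp)
      finally have "(\<Sum>i\<in>I. L2_sq \<alpha> (bergman_proj \<alpha> (G i))) \<le> ennreal (D * \<epsilon>')" by (simp add: D_def)
      from mult_left_mono[OF this, of "ennreal D"]
      show "L2_sq \<alpha> (\<lambda>w. \<Sum>i\<in>I. bergman_proj \<alpha> (G i) w) \<le> ennreal D * ennreal (D * \<epsilon>')"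
        unfolding D_def by (intro order_trans[OF L2_sq_sum[OF PGm]]) simp
    qed auto
    also have "\<dots> = ennreal (2 * ((P * sqrt s)\<^sup>2 * (4 * C))) + ennreal (2 * (D * (D * \<epsilon>')))"
      by (subst (1 2) t) (use C(1) \<epsilon>'(1) in \<open>auto simp: D_def\<close>)
    also have "\<dots> = ennreal (2 * ((P * sqrt s)\<^sup>2 * (4 * C)) + 2 * (D * (D * \<epsilon>')))"
      by (rule ennreal_plus[symmetric]) (use C(1) \<epsilon>'(1) in \<open>auto simp: D_def\<close>)
    also have "\<dots> \<le> ennreal \<epsilon>"
    proof (rule ennreal_leI)
      have "2 * ((P * sqrt s)\<^sup>2 * (4 * C)) = 2 * P\<^sup>2 * (4 * C) * s" using s(1) by (simp add: power_mult_distrib)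
      moreover have "2 * (D * (D * \<epsilon>')) = 2 * (D * D) * \<epsilon>'" by simp
      ultimately show "2 * ((P * sqrt s)\<^sup>2 * (4 * C)) + 2 * (D * (D * \<epsilon>')) \<le> \<epsilon>" using s(2) \<epsilon>'(2) by linarith
    qed
    finally show ?thesis .
  qed
  then show ?thesis by blast
qed

lemma Lp_norm_2_tendsto_0:
  assumes "(\<lambda>k. L2_sq \<alpha> (f k)) \<longlonglongrightarrow> 0"
  shows "(\<lambda>k. Lp_norm \<alpha> 2 (f k)) \<longlonglongrightarrow> 0"
proof (rule order_tendstoI)
  fix x :: ennreal assume "0 < x"
  then obtain y where y: "0 < y" "y < x" using dense by blast
  define c where "c = enn2real y"
  have "y < top" by (rule less_le_trans[OF y(2) top_greatest])
  then have c: "y = ennreal c" "c > 0" using y(1) by (simp_all add: c_def enn2real_positive_iff)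
  have "0 < ennreal (c\<^sup>2)" using c(2) by simp
  from order_tendstoD(2)[OF assms this] show "\<forall>\<^sub>F k in sequentially. Lp_norm \<alpha> 2 (f k) < x"
  proof (rule eventually_mono)
    fix k assume "L2_sq \<alpha> (f k) < ennreal (c\<^sup>2)"
    then have "Lp_norm \<alpha> 2 (f k) \<le> ennreal c" using c(2) by (simp add: Lp_norm_2_le less_imp_le)
    then show "Lp_norm \<alpha> 2 (f k) < x" using y(2) c(1) by simp
  qed
qed simp

theorem theorem1p13:
  fixes \<alpha> :: real
    and e :: "nat \<Rightarrow> ell2"
    and b :: "complex ^ 'n::finite \<Rightarrow> ell2 \<Rightarrow>\<^sub>L ell2"
  assumes "\<alpha> > -1"
    and "orthonormal_basis e"
    and "\<forall>w\<in>ball 0 1. b w \<in> bounded_clinear_ops"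
    and "b \<in> Lp_space \<alpha> 1"
    and i: "b \<in> BMO1_space \<alpha>" "berezin \<alpha> b \<in> Linf_space \<alpha>"
    and ii: "(\<lambda>d. Linf_norm \<alpha>
        (berezin \<alpha> (\<lambda>w. complex_of_real (norm (tail_op e d (b w)))))) \<longlonglongrightarrow> 0"
    and iii: "(\<lambda>d. Linf_norm \<alpha>
        (berezin \<alpha> (\<lambda>w. complex_of_real (norm (tail_op e d (hilbert_adjoint (b w))))))) \<longlonglongrightarrow> 0"
    and iv: "\<forall>d\<ge>1. \<exists>L :: ell2 \<Rightarrow> ennreal.
        (\<forall>x\<in>{x \<in> complex_space d. norm x = 1}.
          ((\<lambda>z. Lp_norm \<alpha> 2
              (toeplitz \<alpha> (\<lambda>w. compression e d (b w)) (\<lambda>w. normalized_kernel \<alpha> z w *\<^sub>C x)))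
            \<longlongrightarrow> L x) to_sphere) \<and>
        (SUP x\<in>{x \<in> complex_space d. norm x = 1}. L x) = 0"
  shows "\<exists>T. toeplitz_extension \<alpha> b T \<and> compact_operator_A2 \<alpha> T"
proof -
  note \<alpha> = assms(1) and e = assms(2) and lin = assms(3) and b = assms(4)
  obtain B where cw: "carleson_weight \<alpha> (\<lambda>u. norm (b u)) B" using carleson_weight_BMO[OF \<alpha> i] by blast
  have sm: "strongly_measurable (nu \<alpha>) b" using b by (simp add: Lp_space_def)
  have ext: "toeplitz_extension \<alpha> b (toeplitz \<alpha> b)" by (rule toeplitz_extension_self(1)[OF \<alpha> sm lin cw])
  have bo: "bounded_operator_A2 \<alpha> (toeplitz \<alpha> b)" using ext by (simp add: toeplitz_extension_def)
  have "\<exists>r g. strict_mono r \<and> g \<in> Ap_space \<alpha> 2 \<and> (\<lambda>k. Lp_norm \<alpha> 2 (\<lambda>z. toeplitz \<alpha> b (f (r k)) z - g z)) \<longlonglongrightarrow> 0"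
    if f: "\<And>k. f k \<in> Ap_space \<alpha> 2" and c: "\<And>k. Lp_norm \<alpha> 2 (f k) \<le> ennreal c" for f :: "nat \<Rightarrow> complex^'n \<Rightarrow> ell2" and c
  proof -
    \<comment> \<open>The bound c may be negative, in which case \<open>ennreal c\<close> is 0; the
      maximum with 0 accounts for this before squaring.\<close>
    define C where "C = (max c 0)\<^sup>2"
    have C: "C \<ge> 0" "L2_sq \<alpha> (f k) \<le> ennreal C" for k
    proof -
      have "Lp_norm \<alpha> 2 (f k) \<le> ennreal (max c 0)" using c[of k] by (rule order_trans) (simp add: ennreal_leI)
      then show "L2_sq \<alpha> (f k) \<le> ennreal C" unfolding C_def by (subst (asm) Lp_norm_2_le) auto
    qed (simp add: C_def)
    obtain r :: "nat \<Rightarrow> nat" where r: "strict_mono r" "\<And>z l. norm z < 1 \<Longrightarrow> convergent (\<lambda>k. cinner (f (r k) z) (e l))"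
      using Ap_subsequence[where f = f and e = e, OF \<alpha> f C norm_e[OF e]] by blast
    have TA: "toeplitz \<alpha> b (f (r k)) \<in> Ap_space \<alpha> 2" for k using bo f by (simp add: bounded_operator_A2_def)
    obtain g where g: "g \<in> Ap_space \<alpha> 2" "(\<lambda>k. L2_sq \<alpha> (\<lambda>z. toeplitz \<alpha> b (f (r k)) z - g z)) \<longlonglongrightarrow> 0"
      using Ap_complete[OF \<alpha> TA toeplitz_image_cauchy[OF \<alpha> e lin b cw ii iii iv f C r(2)]] by blast
    show ?thesis using r(1) g(1) Lp_norm_2_tendsto_0[OF g(2)] by blast
  qed
  then have "compact_operator_A2 \<alpha> (toeplitz \<alpha> b)" using bo unfolding compact_operator_A2_def by blast
  then show ?thesis using ext by blast
qed

end
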